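(* Let $\tau$ be a linear anti-symplectic involution on $(\mathbb{R}^{2n},\omega_0)=(\mathbb{R}^n_q\times\mathbb{R}^n_p,dq\wedge dp)$ and let $\Delta\subset\mathbb{R}^n_q$, $\Lambda\subset\mathbb{R}^n_p$ be smooth convex bodies such that $\Delta\times\Lambda$ is $\tau$-invariant. Then there is a $\tau$-brake $(\Delta,\Lambda)$-billiard trajectory $\gamma^\ast$ on $\partial(\Delta\times\Lambda)$ such that $$c_{\rm EHZ,\tau}(\Delta\times\Lambda)=A(\gamma^\ast)=\min\{A(\gamma)>0\,|\,\gamma\text{ is a $\tau$-brake $(\Delta,\Lambda)$-billiard trajectory on }\partial(\Delta\times\Lambda)\}.$$
   Context: $J_0(q,p)=(-p,q)$, $\langle\cdot,\cdot\rangle$ standard; a linear anti-symplectic involution is linear $\tau$ with $\tau^*\omega_0=-\omega_0$, $\tau^2=\mathrm{id}$. Action $A(\gamma)=\frac12\int_0^T\langle-J_0\dot\gamma,\gamma\rangle dt$. Symmetric capacity: for $\tau$-invariant open $U$ meeting ${\rm Fix}(\tau)$, $c_{\rm HZ,\tau}(U)=\sup\{\max H\}$ over $\tau$-invariant smooth $H:U\to[0,\infty)$ vanishing on a nonempty open set meeting ${\rm Fix}(\tau)$, equal to $\max H$ outside a compact subset of $U$, whose Hamiltonian flow ($\omega_0(X_H,\cdot)=-dH$) has no nonconstant $T$-periodic orbit $x$ with $x(T-t)=x(-t)=\tau(x(t))$, $T\in(0,1]$; for a $\tau$-invariant convex body $C$, $c_{\rm EHZ,\tau}(C)=c_{\rm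 HZ,\tau}({\rm Int}C,\omega_0)$. Billiards: for a convex body $K$ with $0$ in its interior, $j_K$ is its Minkowski functional. If $0\in{\rm Int}\Delta$, $0\in{\rm Int}\Lambda$, set $\mathfrak X(q,p)=(-\nabla j_\Lambda(p),0)$ on ${\rm Int}\Delta\times\partial\Lambda$ and $\mathfrak X(q,p)=(0,\nabla j_\Delta(q))$ on $\partial\Delta\times{\rm Int}\Lambda$. A closed $(\Delta,\Lambda)$-billiard trajectory is a continuous piecewise smooth $\gamma=(\gamma_q,\gamma_p):\mathbb{R}/T\mathbb{Z}\to\partial(\Delta\times\Lambda)$ such that for some constant $\kappa>0$, $\dot\gamma=\kappa\mathfrak X(\gamma)$ outside $\mathscr B_\gamma=\gamma^{-1}(\partial\Delta\times\partial\Lambda)$, and at each $t\in\mathscr B_\gamma$ the one-sided derivatives exist and lie in $\{-\lambda(\nabla j_\Lambda(\gamma_p(t)),0)+\mu(0,\nabla j_\Delta(\gamma_q(t)))\,|\,\lambda,\mu\ge0,(\lambda,\mu)\ne(0,0)\}$. For general smooth convex bodies, $\gamma$ is a closed $(\Delta,\Lambda)$-billiard trajectory if for some $\bar q\in{\rm Int}\Delta$, $\bar p\in{\rm Int}\Lambda$, $\gamma-(\bar q,\bar p)$ is one for $(\Delta-\bar q,\Lambda-\bar p)$. It is a $\tau$-brake $(\Delta,\Lambda)$-billiard trajectory if moreover $\gamma(T-t)=\tau(\gamma(t))$ for all $t$. *)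

theory Defs
  imports "HOL-Analysis.Analysis"
begin

type_synonym 'n phase = "(real^'n) \<times> (real^'n)"

definition omega0 :: "'n::finite phase \<Rightarrow> 'n phase \<Rightarrow> real" where
  "omega0 z w = fst z \<bullet> snd w - snd z \<bullet> fst w"

definition J0 :: "'n::finite phase \<Rightarrow> 'n phase" where
  "J0 z = (- snd z, fst z)"

definition lin_antisymp_inv :: "('n::finite phase \<Rightarrow> 'n phase) \<Rightarrow> bool" where
  "lin_antisymp_inv \<tau> \<longleftrightarrow> linear \<tau> \<and>
     (\<forall>z w. omega0 (\<tau> z) (\<tau> w) = - omega0 z w) \<and> (\<forall>z. \<tau> (\<tau> z) = z)"

definition Fix :: "('a \<Rightarrow> 'a) \<Rightarrow> 'a set" where
  "Fix \<tau> = {z. \<tau> z = z}"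

coinductive C_inf :: "'a::euclidean_space set \<Rightarrow> ('a \<Rightarrow> real) \<Rightarrow> bool" for U where
  "(\<forall>x\<in>U. (f has_derivative (\<lambda>v. \<Sum>i\<in>Basis. (v \<bullet> i) * g i x)) (at x))
   \<Longrightarrow> (\<forall>i\<in>Basis. C_inf U (g i)) \<Longrightarrow> C_inf U f"

definition convex_body :: "'a::euclidean_space set \<Rightarrow> bool" where
  "convex_body K \<longleftrightarrow> compact K \<and> convex K \<and> interior K \<noteq> {}"

definition smooth_convex_body :: "'a::euclidean_space set \<Rightarrow> bool" where
  "smooth_convex_body K \<longleftrightarrow> convex_body K \<and>
     (\<forall>x\<in>frontier K. \<exists>U f. open U \<and> x \<in> U \<and> C_inf U f \<and>
        frechet_derivative f (at x) \<noteq> (\<lambda>v. 0) \<and> K \<inter> U = {y\<in>U. f y \<le> 0})"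

definition minkowski :: "'a::real_vector set \<Rightarrow> 'a \<Rightarrow> real" where
  "minkowski K x = Inf {t. t > 0 \<and> x \<in> (\<lambda>y. t *\<^sub>R y) ` K}"

definition grad :: "('a::real_inner \<Rightarrow> real) \<Rightarrow> 'a \<Rightarrow> 'a" where
  "grad f x = (SOME D. GDERIV f x :> D)"

text \<open>The billiard vector field (for 0 in the interiors).\<close>
definition billiard_field :: "(real^'n::finite) set \<Rightarrow> (real^'n) set \<Rightarrow> 'n phase \<Rightarrow> 'n phase" where
  "billiard_field \<Delta> \<Lambda> z =
     (if fst z \<in> interior \<Delta> then (- grad (minkowski \<Lambda>) (snd z), 0)
      else (0, grad (minkowski \<Delta>) (fst z)))"

definition billiard_cone :: "(real^'n::finite) set \<Rightarrow> (real^'n) set \<Rightarrow> 'n phase \<Rightarrow> 'n phase set" where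
  "billiard_cone \<Delta> \<Lambda> z =
     {- (lam *\<^sub>R (grad (minkowski \<Lambda>) (snd z), 0)) + \<mu> *\<^sub>R (0, grad (minkowski \<Delta>) (fst z))
      | lam \<mu>. lam \<ge> 0 \<and> \<mu> \<ge> 0 \<and> (lam, \<mu>) \<noteq> (0, 0)}"

text \<open>Closed (Delta,Lambda)-billiard trajectory gamma : R/TZ -> boundary, for 0 in the interiors.
  gamma is represented as a T-periodic function on R.\<close>
definition billiard0 :: "(real^'n::finite) set \<Rightarrow> (real^'n) set \<Rightarrow> (real \<Rightarrow> 'n phase) \<Rightarrow> real \<Rightarrow> bool" where
  "billiard0 \<Delta> \<Lambda> \<gamma> T \<longleftrightarrow> T > 0 \<and> (\<forall>t. \<gamma> (t + T) = \<gamma> t) \<and> continuous_on UNIV \<gamma> \<and>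
     (\<forall>a b. \<gamma> piecewise_C1_differentiable_on {a..b}) \<and>
     (\<forall>t. \<gamma> t \<in> frontier (\<Delta> \<times> \<Lambda>)) \<and>
     (\<exists>\<kappa>>0.
        (\<forall>t. \<gamma> t \<notin> frontier \<Delta> \<times> frontier \<Lambda> \<longrightarrow>
           (\<gamma> has_vector_derivative (\<kappa> *\<^sub>R billiard_field \<Delta> \<Lambda> (\<gamma> t))) (at t)) \<and>
        (\<forall>t. \<gamma> t \<in> frontier \<Delta> \<times> frontier \<Lambda> \<longrightarrow>
           (\<exists>v. (\<gamma> has_vector_derivative v) (at_left t) \<and> v \<in> billiard_cone \<Delta> \<Lambda> (\<gamma> t)) \<and>
           (\<exists>v. (\<gamma> has_vector_derivative v) (at_right t) \<and> v \<in> billiard_cone \<Delta> \<Lambda> (\<gamma> t))))"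

definition billiard :: "(real^'n::finite) set \<Rightarrow> (real^'n) set \<Rightarrow> (real \<Rightarrow> 'n phase) \<Rightarrow> real \<Rightarrow> bool" where
  "billiard \<Delta> \<Lambda> \<gamma> T \<longleftrightarrow>
     (\<exists>qb\<in>interior \<Delta>. \<exists>pb\<in>interior \<Lambda>.
        billiard0 ((\<lambda>q. q - qb) ` \<Delta>) ((\<lambda>p. p - pb) ` \<Lambda>) (\<lambda>t. \<gamma> t - (qb, pb)) T)"

definition brake_billiard :: "('n::finite phase \<Rightarrow> 'n phase) \<Rightarrow> (real^'n) set \<Rightarrow> (real^'n) set
    \<Rightarrow> (real \<Rightarrow> 'n phase) \<Rightarrow> real \<Rightarrow> bool" where
  "brake_billiard \<tau> \<Delta> \<Lambda> \<gamma> T \<longleftrightarrow> billiard \<Delta> \<Lambda> \<gamma> T \<and> (\<forall>t. \<gamma> (T - t) = \<tau> (\<gamma> t))"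

definition action :: "(real \<Rightarrow> 'n::finite phase) \<Rightarrow> real \<Rightarrow> real" where
  "action \<gamma> T = (1/2) * integral {0..T} (\<lambda>t. (- J0 (vector_derivative \<gamma> (at t))) \<bullet> \<gamma> t)"

definition ham_brake_orbit :: "('n::finite phase \<Rightarrow> 'n phase) \<Rightarrow> 'n phase set \<Rightarrow> ('n phase \<Rightarrow> real)
    \<Rightarrow> (real \<Rightarrow> 'n phase) \<Rightarrow> real \<Rightarrow> bool" where
  "ham_brake_orbit \<tau> U H x T \<longleftrightarrow>
     (\<forall>t. x t \<in> U \<and> (\<exists>x'. (x has_vector_derivative x') (at t) \<and>
          (\<forall>v. omega0 x' v = - frechet_derivative H (at (x t)) v))) \<and>
     (\<forall>t. x (t + T) = x t) \<and> (\<exists>s t. x s \<noteq> x t) \<and>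
     (\<forall>t. x (T - t) = x (- t) \<and> x (- t) = \<tau> (x t))"

definition admissible_sym :: "('n::finite phase \<Rightarrow> 'n phase) \<Rightarrow> 'n phase set \<Rightarrow> ('n phase \<Rightarrow> real) \<Rightarrow> bool" where
  "admissible_sym \<tau> U H \<longleftrightarrow>
     (\<forall>z\<in>U. H (\<tau> z) = H z) \<and> C_inf U H \<and> (\<forall>z\<in>U. H z \<ge> 0) \<and>
     (\<exists>V. open V \<and> V \<noteq> {} \<and> V \<subseteq> U \<and> V \<inter> Fix \<tau> \<noteq> {} \<and> (\<forall>z\<in>V. H z = 0)) \<and>
     (\<exists>m. (\<forall>z\<in>U. H z \<le> m) \<and> (\<exists>z\<in>U. H z = m) \<and>
          (\<exists>K. compact K \<and> K \<subseteq> U \<and> (\<forall>z\<in>U - K. H z = m))) \<and>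
     (\<forall>x T. T \<in> {0<..1} \<longrightarrow> \<not> ham_brake_orbit \<tau> U H x T)"

definition c_HZ_sym :: "('n::finite phase \<Rightarrow> 'n phase) \<Rightarrow> 'n phase set \<Rightarrow> ereal" where
  "c_HZ_sym \<tau> U = (SUP H\<in>{H. admissible_sym \<tau> U H}. ereal (Sup (H ` U)))"

definition c_EHZ_sym :: "('n::finite phase \<Rightarrow> 'n phase) \<Rightarrow> 'n phase set \<Rightarrow> ereal" where
  "c_EHZ_sym \<tau> C = c_HZ_sym \<tau> (interior C)"

end

(* Write w for the symplectic form, L for the Lagrangian Fix tau and C = Delta x Lambda.  A curve
   from L to L, closed up by tau, is approximated by staircases that alternate q-moves and p-moves.
   Caratheodory's theorem bounds the number of steps, so a staircase of maximal area for given
   support-function length exists; its multiplier turns it into a polygon with vertices in C whose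
   edges obey w(zeta, edge) <= w(vertex, edge) for all zeta in C.  Closed up by tau, it is a brake
   billiard trajectory of action c, and maximality is an isoperimetric inequality
   c * area <= length^2 for all curves from L to L.  Applied to another brake billiard trajectory,
   whose area equals its length, the inequality shows that its action is at least c.

   Lower bound for the capacity: H = phi(G) with G a log-sum-exp smoothing of the gauge of C and
   phi' slightly below 2 c s; the isoperimetric inequality excludes brake orbits of period at most 1.
   Upper bound: in symplectic coordinates adapted to tau an admissible H with max H > c is extended
   by a Moreau envelope; a finite-dimensional linking argument over trigonometric loops, with the
   Fejer means of the polygon as linking direction, and a limit by compactness give a brake orbit. *)
theory Submission
  imports Defs "HOL-Complex_Analysis.Complex_Analysis"
begin

text \<open>The product has corners and flat faces, so its characteristic directions form cones and
  a minimiser over all loops could bounce infinitely often. Bounding the number of steps beforehand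
  makes existence a finite-dimensional compactness argument and gives finitely many bounces at once.
  The multiplier of the end condition is normal to \<open>Fix \<tau>\<close>; rotated by
  \<open>J0\<close> it lies in \<open>Fix \<tau>\<close>, which is Lagrangian, and it is exactly the
  translation that puts the vertices into the body.

  The factor 2 c s is a threshold: half of a brake orbit of period T on the level s has area about
  (T/2) phi'(s) s and length area / s. The inequality then forces area >= c s^2, that is T phi'(s)
  >= 2 c s.

  In the upper bound the action is unbounded in both directions. The linking is done in finite
  frequency ranges, with a level and a weight that do not depend on the range; real coefficients
  build the brake symmetry in, and only the limit of almost critical loops solves Hamilton's
  equation.\<close>

section \<open>Zeros of maps on a box: the Poincare-Miranda theorem\<close>

lemma bounded_imp_convergent_subseq_finite:
 fixes u :: "nat \<Rightarrow> 'i \<Rightarrow> 'a::heine_borel"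
 assumes "finite I" "!!i. i \<in> I ==> bounded (range (%k. u k i))"
 shows "\<exists>r l. strict_mono r \<and> (\<forall>i\<in>I. (%k. u (r k) i) \<longlonglongrightarrow> l i)"
 using assms
proof (induction I rule: finite_induct)
 case empty
 have "strict_mono (id::nat\<Rightarrow>nat)" by (simp add: strict_mono_def)
 then show ?case by blast
next
 case (insert i I)
 then obtain r l where r: "strict_mono r" "\<forall>i\<in>I. (%k. u (r k) i) \<longlonglongrightarrow> l i"
  by blast
 have "bounded (range (%k. u (r k) i))"
  using insert.prems[of i] by (rule bounded_subset) auto
 then obtain a s where s: "strict_mono s" "((%k. u (r k) i) \<circ> s) \<longlonglongrightarrow> a"
  using bounded_imp_convergent_subsequence by blast
 have "\<forall>j\<in>insert i I. (%k. u ((r \<circ> s) k) j) \<longlonglongrightarrow> (l(i := a)) j"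
 proof
  fix j assume j: "j \<in> insert i I"
  show "(%k. u ((r \<circ> s) k) j) \<longlonglongrightarrow> (l(i := a)) j"
  proof (cases "j = i")
   case True then show ?thesis using s by (simp add: o_def)
  next
   case False
   then have "(%k. u (r k) j) \<longlonglongrightarrow> l j" using r j by blast
   from LIMSEQ_subseq_LIMSEQ[OF this s(1)] show ?thesis using False by (simp add: o_def)
  qed
 qed
 moreover have "strict_mono (r \<circ> s)" using r s by (simp add: strict_mono_o)
 ultimately show ?case by blast
qed

text \<open>Labelling a grid point in coordinate i by the sign of its i-th value satisfies the
  boundary conditions of Kuhn's lemma, so for every mesh some small cell contains, for each i, a
  point with value <= 0 and a point with value >= 0. The cells shrink to a zero. Continuity is
  assumed along sequences because the points are functions of which only the first n values
  matter.\<close>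

lemma poincare_miranda_nat:
 fixes g :: "(nat \<Rightarrow> real) \<Rightarrow> nat \<Rightarrow> real"
 assumes cont: "!!u l i. [|i < n; !!k j. j < n ==> u k j \<in> {0..1}; !!j. j < n ==> (%k. u k j) \<longlonglongrightarrow> l j|]
   ==> (%k::nat. g (u k) i) \<longlonglongrightarrow> g l i"
  and lo: "!!x i. [|i < n; !!j. j < n ==> x j \<in> {0..1}; x i = 0|] ==> g x i < 0"
  and hi: "!!x i. [|i < n; !!j. j < n ==> x j \<in> {0..1}; x i = 1|] ==> g x i > 0"
 shows "\<exists>x. (\<forall>j<n. x j \<in> {0..1}) \<and> (\<forall>i<n. g x i = 0)"
proof -
 define near where "near p q y \<longleftrightarrow> (\<forall>j<n. y j \<in> {0..1} \<and> \<bar>y j - q j\<bar> <= 1 / real (Suc p))" for p q and y :: "nat \<Rightarrow> real"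
 have ex: "\<exists>q. (\<forall>j<n. q j \<in> {0..1}) \<and> (\<forall>i<n. \<exists>y z. near p q y \<and> near p q z \<and> g y i <= 0 \<and> g z i \<ge> 0)" for p
 proof -
  define P where "P = Suc p"
  define sc where "sc x = (%j. real (x j) / real P)" for x :: "nat \<Rightarrow> nat"
  define label where "label x i = (if g (sc x) i <= 0 then 0 else 1::nat)" for x i
  have P: "0 < P" by (simp add: P_def)
  have sc01: "sc x j \<in> {0..1}" if "\<forall>i<n. x i <= P" "j < n" for x j
   using that P by (auto simp: sc_def divide_simps)
  obtain q where q: "\<forall>i<n. q i < P"
   "\<forall>i<n. \<exists>r s. (\<forall>j<n. q j <= r j \<and> r j <= q j + 1) \<and> (\<forall>j<n. q j <= s j \<and> s j <= q j + 1) \<and> label r i ~= label s i"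
  proof (rule kuhn_lemma[of P n label, OF P])
   show "\<forall>x. (\<forall>i<n. x i <= P) --> (\<forall>i<n. label x i = 0 \<or> label x i = 1)"
    by (auto simp: label_def)
   show "\<forall>x. (\<forall>i<n. x i <= P) --> (\<forall>i<n. x i = 0 --> label x i = 0)"
   proof (intro allI impI)
    fix x i assume a: "\<forall>i<n. x i <= P" "i < n" "x i = (0::nat)"
    have "g (sc x) i < 0" by (rule lo[OF a(2)]) (use sc01 a in \<open>auto simp: sc_def\<close>)
    then show "label x i = 0" by (simp add: label_def)
   qed
   show "\<forall>x. (\<forall>i<n. x i <= P) --> (\<forall>i<n. x i = P --> label x i = 1)"
   proof (intro allI impI)
    fix x i assume a: "\<forall>i<n. x i <= P" "i < n" "x i = P"
    have "g (sc x) i > 0" by (rule hi[OF a(2)]) (use sc01 a P in \<open>auto simp: sc_def\<close>)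
    then show "label x i = 1" by (simp add: label_def)
   qed
  qed auto
  have nr: "near p (sc q) (sc r)" if r: "\<forall>j<n. q j <= r j \<and> r j <= q j + 1" for r
   unfolding near_def
  proof (intro allI impI conjI)
   fix j assume j: "j < n"
   have le: "\<forall>i<n. r i <= P" using r q(1) by (metis Suc_eq_plus1 Suc_leI order_trans)
   show "sc r j \<in> {0..1}" using sc01[OF le j] .
   have "real (q j) <= real (r j)" "real (r j) <= real (q j) + 1" using r j by (auto simp flip: of_nat_Suc)
   then show "\<bar>sc r j - sc q j\<bar> <= 1 / real (Suc p)"
    by (auto simp: sc_def P_def divide_simps abs_if)
  qed
  have "\<exists>y z. near p (sc q) y \<and> near p (sc q) z \<and> g y i <= 0 \<and> g z i \<ge> 0" if i: "i < n" for i
  proof -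
   obtain r s where rs: "\<forall>j<n. q j <= r j \<and> r j <= q j + 1" "\<forall>j<n. q j <= s j \<and> s j <= q j + 1"
    "label r i ~= label s i" using q(2) i by blast
   show ?thesis
   proof (cases "g (sc r) i <= 0")
    case True
    then have "g (sc s) i \<ge> 0" using rs(3) by (auto simp: label_def split: if_splits)
    then show ?thesis using True nr rs by blast
   next
    case False
    then have "g (sc s) i <= 0" "g (sc r) i \<ge> 0" using rs(3) by (auto simp: label_def split: if_splits)
    then show ?thesis using nr rs by blast
   qed
  qed
  moreover have "\<forall>j<n. sc q j \<in> {0..1}" using sc01[of q] q(1) by (auto simp: less_imp_le)
  ultimately show ?thesis by blast
 qed
 obtain q where q: "!!p. \<forall>j<n. q p j \<in> {0..1}"
  "!!p. \<forall>i<n. \<exists>y z. near p (q p) y \<and> near p (q p) z \<and> g y i <= 0 \<and> g z i \<ge> 0"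
  using ex by metis
 obtain y z where yz: "!!p i. i < n ==> near p (q p) (y p i) \<and> near p (q p) (z p i) \<and> g (y p i) i <= 0 \<and> g (z p i) i \<ge> 0"
  using q(2) by metis
 have bd: "bounded (range (%p. q p j))" if "j \<in> {..<n}" for j
  by (rule bounded_subset[of "{0..1}"]) (use q(1) that in auto)
 obtain r l where r: "strict_mono r" and l: "\<forall>j\<in>{..<n}. (%k. q (r k) j) \<longlonglongrightarrow> l j"
  using bounded_imp_convergent_subseq_finite[of "{..<n}" q, OF _ bd] by auto
 have inv: "(%k. 1 / real (Suc (r k))) \<longlonglongrightarrow> 0"
  using LIMSEQ_subseq_LIMSEQ[OF LIMSEQ_inverse_real_of_nat r] by (simp add: o_def inverse_eq_divide)
 have lim: "(%k. w k j) \<longlonglongrightarrow> l j" if w: "!!k. near (r k) (q (r k)) (w k)" and j: "j < n" for w j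
 proof -
  have "(%k. w k j - q (r k) j) \<longlonglongrightarrow> 0"
   by (rule Lim_null_comparison[OF _ inv]) (use w j in \<open>auto simp: near_def\<close>)
  from tendsto_add[OF this] l j show ?thesis by fastforce
 qed
 have "g l i = 0" if i: "i < n" for i
 proof -
  have a: "(%k. g (y (r k) i) i) \<longlonglongrightarrow> g l i"
   using yz[OF i] by (intro cont[OF i] lim) (auto simp: near_def)
  have b: "(%k. g (z (r k) i) i) \<longlonglongrightarrow> g l i"
   using yz[OF i] by (intro cont[OF i] lim) (auto simp: near_def)
  have "g l i <= 0" by (rule LIMSEQ_le_const2[OF a]) (use yz[OF i] in auto)
  moreover have "0 <= g l i" by (rule LIMSEQ_le_const[OF b]) (use yz[OF i] in auto)
  ultimately show ?thesis by simp
 qed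
 moreover have "l j \<in> {0..1}" if j: "j < n" for j
  by (rule closed_sequentially[of _ "%k. q (r k) j"]) (use q(1) l j in auto)
 ultimately show ?thesis by blast
qed

theorem poincare_miranda:
 fixes g :: "('i \<Rightarrow> real) \<Rightarrow> 'i \<Rightarrow> real" and a b :: "'i \<Rightarrow> real"
 assumes I: "finite I" and ab: "!!i. i \<in> I ==> a i < b i"
  and cont: "!!u l i. [|i \<in> I; !!k j. j \<in> I ==> u k j \<in> {a j..b j}; !!j. j \<in> I ==> (%k. u k j) \<longlonglongrightarrow> l j|]
   ==> (%k::nat. g (u k) i) \<longlonglongrightarrow> g l i"
  and lo: "!!x i. [|i \<in> I; !!j. j \<in> I ==> x j \<in> {a j..b j}; x i = a i|] ==> g x i < 0"
  and hi: "!!x i. [|i \<in> I; !!j. j \<in> I ==> x j \<in> {a j..b j}; x i = b i|] ==> g x i > 0"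
 shows "\<exists>x. (\<forall>j\<in>I. x j \<in> {a j..b j}) \<and> (\<forall>i\<in>I. g x i = 0)"
proof -
 obtain h where h: "bij_betw h {..<card I} I"
  using ex_bij_betw_nat_finite[OF I] by (auto simp: atLeast0LessThan)
 define h' where "h' = inv_into {..<card I} h"
 have h': "h' i < card I" "h (h' i) = i" if "i \<in> I" for i
  using that h by (auto simp: h'_def bij_betw_def inv_into_into f_inv_into_f)
    (metis (no_types) bij_betw_def inv_into_into lessThan_iff that)
 have hI: "h j \<in> I" "h' (h j) = j" if "j < card I" for j
  using that h by (auto simp: h'_def bij_betw_def)
 define tr where "tr y = (%i. a i + (b i - a i) * y (h' i))" for y
 have tr: "tr y i \<in> {a i..b i}" if "!!j. j < card I ==> y j \<in> {0..1}" "i \<in> I" for y i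
 proof -
  have "0 <= y (h' i)" "y (h' i) <= 1" using that h' by auto
  then have "0 <= (b i - a i) * y (h' i)" "(b i - a i) * y (h' i) <= (b i - a i) * 1"
   using ab[OF that(2)] by (auto intro!: mult_nonneg_nonneg mult_left_mono)
  then show ?thesis by (auto simp: tr_def)
 qed
 have "\<exists>y. (\<forall>j<card I. y j \<in> {0..1}) \<and> (\<forall>i<card I. g (tr y) (h i) = 0)"
 proof (rule poincare_miranda_nat)
  fix u :: "nat \<Rightarrow> nat \<Rightarrow> real" and l i
  assume u: "i < card I" "!!k j. j < card I ==> u k j \<in> {0..1}" "!!j. j < card I ==> (%k. u k j) \<longlonglongrightarrow> l j"
  show "(%k. g (tr (u k)) (h i)) \<longlonglongrightarrow> g (tr l) (h i)"
  proof (rule cont)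
   show "h i \<in> I" using hI u(1) by auto
   show "tr (u k) j \<in> {a j..b j}" if "j \<in> I" for k j using tr[OF u(2)] that by auto
   show "(%k. tr (u k) j) \<longlonglongrightarrow> tr l j" if "j \<in> I" for j
    unfolding tr_def by (intro tendsto_intros u(3) h'(1) that)
  qed
 next
  fix x :: "nat \<Rightarrow> real" and i assume x: "i < card I" "!!j. j < card I ==> x j \<in> {0..1}"
  { assume "x i = 0" then show "g (tr x) (h i) < 0"
    using x by (intro lo hI(1) tr) (auto simp: tr_def hI) }
  { assume "x i = 1" then show "g (tr x) (h i) > 0"
    using x by (intro hi hI(1) tr) (auto simp: tr_def hI) }
 qed
 then obtain y where y: "\<forall>j<card I. y j \<in> {0..1}" "\<forall>i<card I. g (tr y) (h i) = 0" by blast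
 have "\<forall>j\<in>I. tr y j \<in> {a j..b j}" using tr y by auto
 moreover have "\<forall>i\<in>I. g (tr y) i = 0" using y(2) h' by metis
 ultimately show ?thesis by blast
qed

section \<open>Trigonometric brake loops and their action\<close>

text \<open>With \<open>J0\<close> as multiplication by i this is exp (2 pi i k t) u for a real
  vector u. Real coefficients encode the brake symmetry: every \<open>trig\<close> loop is reflected
  by (q, p) to (q, -p) under t to -t. The map \<open>modeT\<close> is the transpose, see
  \<open>mode_inner\<close>.\<close>

definition mode :: "int \<Rightarrow> real \<Rightarrow> real^'n \<Rightarrow> 'n::finite phase" where
 "mode k t u = (cos (2*pi*k*t) *\<^sub>R u, sin (2*pi*k*t) *\<^sub>R u)"

definition modeT :: "int \<Rightarrow> real \<Rightarrow> 'n::finite phase \<Rightarrow> real^'n" where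
 "modeT k t z = cos (2*pi*k*t) *\<^sub>R fst z + sin (2*pi*k*t) *\<^sub>R snd z"

definition freqs :: "nat \<Rightarrow> int set" where
 "freqs N = {- int N..int N}"

definition trig :: "nat \<Rightarrow> (int \<Rightarrow> real^'n) \<Rightarrow> real \<Rightarrow> 'n::finite phase" where
 "trig N c t = (\<Sum>k\<in>freqs N. mode k t (c k))"

text \<open>Dual to \<open>mode\<close>. Being real, it only sees the part of a loop that is
  symmetric under the joint reflection of time and momentum; a brake loop is nothing but this
  part.\<close>

definition coef :: "(real \<Rightarrow> 'n::finite phase) \<Rightarrow> int \<Rightarrow> real^'n" where
 "coef f k = integral {0..1} (%t. modeT k t (f t))"

definition ip :: "nat \<Rightarrow> (int \<Rightarrow> real^'n) \<Rightarrow> (int \<Rightarrow> real^'n::finite) \<Rightarrow> real" where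
 "ip N c d = (\<Sum>k\<in>freqs N. c k \<bullet> d k)"

lemma finite_freqs [simp]: "finite (freqs N)"
 by (simp add: freqs_def)

lemma mode_linear: "linear (mode k t)"
 by (auto simp: mode_def linear_iff scaleR_add_right)

lemma mode_inner: "mode k t u \<bullet> z = u \<bullet> modeT k t z"
 by (simp add: mode_def modeT_def inner_prod_def inner_add_right)

lemma mode_inner_mode: "mode k t u \<bullet> mode l t v = cos (2*pi*(k - l)*t) * (u \<bullet> v)"
 by (simp add: mode_def inner_prod_def left_diff_distrib right_diff_distrib cos_diff algebra_simps)

lemma norm_mode [simp]: "norm (mode k t u) = norm u"
 by (simp add: norm_eq_sqrt_inner mode_inner_mode)

lemma norm_modeT_le: "norm (modeT k t z) <= 2 * norm z"
proof -
 have "norm (modeT k t z) <= \<bar>cos (2*pi*k*t)\<bar> * norm (fst z) + \<bar>sin (2*pi*k*t)\<bar> * norm (snd z)"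
  unfolding modeT_def by (rule order_trans[OF norm_triangle_ineq]) simp
 also have "\<dots> <= 1 * norm z + 1 * norm z"
  using norm_fst_le[of "fst z" "snd z"] norm_snd_le[of "snd z" "fst z"] by (intro add_mono mult_mono) auto
 finally show ?thesis by simp
qed

lemma modeT_diff: "modeT k t (z - w) = modeT k t z - modeT k t w"
 by (simp add: modeT_def algebra_simps)

lemma continuous_on_modeT [continuous_intros]:
 "continuous_on S f ==> continuous_on S (%t. modeT k t (f t))"
 unfolding modeT_def by (intro continuous_intros)

lemma continuous_on_trig [continuous_intros]: "continuous_on S (trig N c)"
 unfolding trig_def[abs_def] mode_def by (intro continuous_intros)

lemma trig_periodic:
 fixes c :: "int \<Rightarrow> real^'n::finite"
 shows "trig N c (t + 1) = trig N c t"
proof -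
 have "mode k (t + 1) u = mode k t u" for k and u :: "real^'n"
 proof -
  have "2*pi*k*(t + 1) = 2*pi*k*t + of_int k * (2*pi)" by (simp add: algebra_simps)
  then show ?thesis unfolding mode_def using cos.plus_of_int[of "2*pi*k*t" k] sin.plus_of_int[of "2*pi*k*t" k]
   by (simp only: of_real_eq_id id_apply)
 qed
 then show ?thesis by (simp add: trig_def)
qed

lemma trig_reflect: "trig N c (- t) = (fst (trig N c t), - snd (trig N c t))"
 unfolding trig_def prod_eq_iff fst_sum snd_sum by (simp add: mode_def sum_negf fst_sum snd_sum)

lemma trig_add: "trig N (%k. c k + d k) t = trig N c t + trig N d t"
 by (simp add: trig_def linear_add[OF mode_linear] sum.distrib)

lemma trig_scale: "trig N (%k. r *\<^sub>R c k) t = r *\<^sub>R trig N c t"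
 by (simp add: trig_def linear_scale[OF mode_linear] scaleR_sum_right)

lemma trig_minus: "trig N (%k. c k - d k) t = trig N c t - trig N d t"
 using trig_add[of N c "%k. (-1) *\<^sub>R d k" t] trig_scale[of N "-1" d t] by simp

lemma norm_trig_le: "norm (trig N c t) <= (\<Sum>k\<in>freqs N. norm (c k))"
 unfolding trig_def by (rule order_trans[OF norm_sum]) simp

lemma trig_has_vector_derivative:
 "(trig N c has_vector_derivative J0 (trig N (%k. (2*pi*k) *\<^sub>R c k) t)) (at t within S)"
proof -
 have "((%t. mode k t (c k)) has_vector_derivative J0 (mode k t ((2*pi*k) *\<^sub>R c k))) (at t within S)" for k
 proof -
  have "((%t. cos (2*pi*k*t)) has_real_derivative - (sin (2*pi*k*t) * (2*pi*k))) (at t within S)"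
   "((%t. sin (2*pi*k*t)) has_real_derivative cos (2*pi*k*t) * (2*pi*k)) (at t within S)"
   by (auto intro!: derivative_eq_intros)
  from this[THEN has_vector_derivative_scaleR, OF has_vector_derivative_const[of "c k"]]
  show ?thesis unfolding mode_def J0_def
   by (auto intro!: has_vector_derivative_eq_rhs[OF has_vector_derivative_Pair] simp: mult.commute)
 qed
 then have "((%t. \<Sum>k\<in>freqs N. mode k t (c k)) has_vector_derivative
   (\<Sum>k\<in>freqs N. J0 (mode k t ((2*pi*k) *\<^sub>R c k)))) (at t within S)"
  by (intro has_vector_derivative_sum) auto
 moreover have "(\<Sum>k\<in>freqs N. J0 (mode k t ((2*pi*k) *\<^sub>R c k))) = J0 (trig N (%k. (2*pi*k) *\<^sub>R c k) t)"
  by (simp add: trig_def J0_def prod_eq_iff fst_sum snd_sum sum_negf)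
 ultimately show ?thesis by (simp add: trig_def[abs_def])
qed

lemma integral_cos_int: "((%t. cos (2*pi*(k::int)*t)) has_integral (if k = 0 then 1 else 0)) {0..1}"
proof (cases "k = 0")
 case True
 then show ?thesis using has_integral_const_real[of "1::real" 0 1] by simp
next
 case False
 have "((%t. cos (2*pi*k*t)) has_integral (sin (2*pi*k*1) / (2*pi*k) - sin (2*pi*k*0) / (2*pi*k))) {0..1}"
  using False
  by (intro fundamental_theorem_of_calculus)
    (auto intro!: derivative_eq_intros simp: has_real_derivative_iff_has_vector_derivative[symmetric])
 moreover have "sin (2*pi*k) = 0" using sin_int_2pin by (simp add: mult.commute mult.left_commute)
 ultimately show ?thesis using False by simp
qed

lemma trig_inner_coef:
 assumes "continuous_on {0..1} f"
 shows "((%t. trig N c t \<bullet> f t) has_integral (\<Sum>k\<in>freqs N. c k \<bullet> coef f k)) {0..1}"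
proof -
 have "((%t. c k \<bullet> modeT k t (f t)) has_integral c k \<bullet> coef f k) {0..1}" for k
  unfolding coef_def
  by (intro has_integral_linear[OF integrable_integral, unfolded o_def] bounded_linear_inner_right
    integrable_continuous_real continuous_intros assms)
 then have "((%t. \<Sum>k\<in>freqs N. c k \<bullet> modeT k t (f t)) has_integral (\<Sum>k\<in>freqs N. c k \<bullet> coef f k)) {0..1}"
  by (intro has_integral_sum) auto
 then show ?thesis by (simp add: trig_def inner_sum_left mode_inner)
qed

lemma coef_trig: "coef (trig N c) k = (if k \<in> freqs N then c k else 0)"
proof -
 have 1: "modeT k t (mode l t u) = cos (2*pi*(k - l)*t) *\<^sub>R u" for l t u
 proof (rule vector_eq_rdot[THEN iffD1], rule allI)
  fix w show "modeT k t (mode l t u) \<bullet> w = (cos (2*pi*(k - l)*t) *\<^sub>R u) \<bullet> w"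
   using mode_inner_mode[of k t w l u] by (simp add: mode_inner inner_commute)
 qed
 have lin: "linear (modeT k t)" for t by (auto simp: modeT_def linear_iff algebra_simps)
 have "((%t. \<Sum>l\<in>freqs N. cos (2*pi*((k - l)::int)*t) *\<^sub>R c l) has_integral
   (\<Sum>l\<in>freqs N. (if k - l = 0 then 1 else 0) *\<^sub>R c l)) {0..1}"
  by (intro has_integral_sum has_integral_scaleR_left integral_cos_int) auto
 then have "((%t. modeT k t (trig N c t)) has_integral (\<Sum>l\<in>freqs N. (if k - l = 0 then 1 else 0) *\<^sub>R c l)) {0..1}"
  by (simp add: trig_def linear_sum[OF lin] 1)
 moreover have "(\<Sum>l\<in>freqs N. (if k - l = 0 then 1 else 0) *\<^sub>R c l) = (\<Sum>l\<in>freqs N. if l = k then c k else 0)"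
  by (intro sum.cong) auto
 ultimately show ?thesis unfolding coef_def by (simp add: integral_unique)
qed

lemma trig_inner_trig: "((%t. trig N c t \<bullet> trig N d t) has_integral ip N c d) {0..1}"
 using trig_inner_coef[of "trig N d" N c] by (simp add: coef_trig ip_def continuous_on_trig)

lemma bessel:
 assumes "continuous_on {0..1} f"
 shows "ip N (coef f) (coef f) <= integral {0..1} (%t. f t \<bullet> f t)"
proof -
 let ?p = "trig N (coef f)"
 have c: "continuous_on {0..1} (%t. f t \<bullet> f t)" by (intro continuous_intros assms)
 have 1: "((%t. f t \<bullet> f t - (2 * (?p t \<bullet> f t) - ?p t \<bullet> ?p t)) has_integral
   (integral {0..1} (%t. f t \<bullet> f t) - (2 * ip N (coef f) (coef f) - ip N (coef f) (coef f)))) {0..1}"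
  using trig_inner_coef[OF assms, of N "coef f"] trig_inner_trig[of N "coef f" "coef f"]
  by (intro has_integral_diff has_integral_mult_right integrable_integral integrable_continuous_real c)
    (auto simp: ip_def)
 have "0 <= f t \<bullet> f t - (2 * (?p t \<bullet> f t) - ?p t \<bullet> ?p t)" for t
  using inner_ge_zero[of "f t - ?p t"] by (simp add: inner_diff inner_commute)
 from has_integral_nonneg[OF 1 this] show ?thesis by simp
qed

lemma coef_norm_le:
 assumes "continuous_on {0..1} f" "!!t. t \<in> {0..1} ==> norm (f t) <= B"
 shows "norm (coef f k) <= 2 * B"
proof -
 have "norm (coef f k) <= integral {0..1::real} (%t. 2 * B)"
  unfolding coef_def
  by (rule integral_norm_bound_integral)
    (use assms in \<open>auto intro!: integrable_continuous_real continuous_intros order_trans[OF norm_modeT_le]\<close>)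
 then show ?thesis by simp
qed

lemma coef_diff:
 assumes "continuous_on {0..1} f" "continuous_on {0..1} g"
 shows "coef (%t. f t - g t) k = coef f k - coef g k"
 unfolding coef_def modeT_diff
 by (rule integral_diff) (intro integrable_continuous_real continuous_intros assms)+

lemma ip_nonneg: "0 <= ip N c c"
 by (simp add: ip_def sum_nonneg)

text \<open>Half the integral of \<open>omega0\<close> of loop and velocity, by
  \<open>trig_act\<close>. The sign of k splits the loops into a positive and a nonpositive part,
  which is the splitting used in the linking argument.\<close>

definition act :: "nat \<Rightarrow> (int \<Rightarrow> real^'n::finite) \<Rightarrow> real" where
 "act N c = (\<Sum>k\<in>freqs N. pi * k * (c k \<bullet> c k))"

lemma act_ip: "act N c = ip N (%k. (2*pi*k) *\<^sub>R c k) c / 2"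
 by (simp add: act_def ip_def sum_divide_distrib mult.assoc)

lemma act_add: "act N (%k. c k + d k) = act N c + ip N (%k. (2*pi*k) *\<^sub>R c k) d + act N d"
 unfolding act_def ip_def sum.distrib[symmetric]
 by (intro sum.cong refl) (simp add: inner_add_left inner_add_right inner_commute[of "d _" "c _"] algebra_simps)

lemma act_le: "act N d <= pi * N * ip N d d"
 unfolding act_def ip_def sum_distrib_left
 by (intro sum_mono mult_right_mono) (auto simp: freqs_def)

lemma act_scale: "act N (%k. r *\<^sub>R d k) = r\<^sup>2 * act N d"
 unfolding act_def sum_distrib_left by (intro sum.cong refl) (simp add: power2_eq_square)

lemma omega0_J0: "omega0 z (J0 w) = z \<bullet> w"
 by (simp add: omega0_def J0_def inner_prod_def)

lemma trig_act:
 "((%t. omega0 (trig N c t) (J0 (trig N (%k. (2*pi*k) *\<^sub>R c k) t))) has_integral 2 * act N c) {0..1}"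
 using trig_inner_trig[of N c "%k. (2*pi*k) *\<^sub>R c k"]
 by (simp add: omega0_J0 act_ip ip_def inner_commute)

text \<open>The square of the analytic polynomial has the coefficients d m, sums of a k * a (m - k)
  over k and m - k >= 1. Cauchy-Schwarz costs the number of summands, at most m - 1, and m - 1 <= k
  * (m - k) lets the weights of the two factors absorb this number. Summing over m gives a product
  of two weighted sums.\<close>

lemma scalar_L4:
 fixes a :: "int \<Rightarrow> real"
 assumes a0: "!!k. k <= 0 ==> a k = 0"
 shows "((%t. (norm (\<Sum>k\<in>freqs N. of_real (a k) * cis (2*pi*k*t))) ^ 4) has_integral
      integral {0..1} (%t. (norm (\<Sum>k\<in>freqs N. of_real (a k) * cis (2*pi*k*t))) ^ 4)) {0..1}
    \<and> integral {0..1} (%t. (norm (\<Sum>k\<in>freqs N. of_real (a k) * cis (2*pi*k*t))) ^ 4)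
    <= (\<Sum>k\<in>freqs N. k * (a k)\<^sup>2)\<^sup>2"
proof -
 let ?Z = "%t. \<Sum>k\<in>freqs N. of_real (a k) * cis (2*pi*k*t)"
 define P where "P m = {k \<in> freqs N. m - k \<in> freqs N \<and> k \<ge> 1 \<and> m - k \<ge> 1}" for m
 define d where "d m = (\<Sum>k\<in>P m. a k * a (m - k))" for m
 define D :: "int \<Rightarrow> real^1" where "D m = vec (d m)" for m
 have finP [simp]: "finite (P m)" for m by (simp add: P_def)
 have sq: "?Z t * ?Z t = (\<Sum>m\<in>freqs (2*N). of_real (d m) * cis (2*pi*m*t))" for t
 proof -
  have "?Z t * ?Z t = (\<Sum>k\<in>freqs N. \<Sum>l\<in>freqs N. of_real (a k * a l) * cis (2*pi*(k + l)*t))"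
   by (simp add: sum_product algebra_simps cis_mult[symmetric])
  also have "\<dots> = (\<Sum>k\<in>freqs N. \<Sum>m\<in>(%l. k + l) ` freqs N. of_real (a k * a (m - k)) * cis (2*pi*m*t))"
   by (simp add: sum.reindex)
  also have "\<dots> = (\<Sum>k\<in>freqs N. \<Sum>m\<in>freqs (2*N). if k \<in> P m then of_real (a k * a (m - k)) * cis (2*pi*m*t) else 0)"
  proof (rule sum.cong[OF refl], rule sum.mono_neutral_cong)
   fix k m assume k: "k \<in> freqs N" and m: "m \<in> (%l. k + l) ` freqs N \<inter> freqs (2*N)"
   have mk: "m - k \<in> freqs N" using m by auto
   show "complex_of_real (a k * a (m - k)) * cis (2*pi*m*t) = (if k \<in> P m then of_real (a k * a (m - k)) * cis (2*pi*m*t) else 0)"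
    using k mk a0[of k] a0[of "m - k"] by (auto simp: P_def)
  next
   fix k m assume k: "k \<in> freqs N" and "m \<in> freqs (2*N) - (%l. k + l) ` freqs N"
   then have "m - k \<notin> freqs N" by (metis DiffD2 add_diff_cancel_left' diff_add_cancel add.commute image_eqI)
   then show "(if k \<in> P m then complex_of_real (a k * a (m - k)) * cis (2*pi*m*t) else 0) = 0"
    by (simp add: P_def)
  qed (auto simp: freqs_def)
  also have "\<dots> = (\<Sum>m\<in>freqs (2*N). \<Sum>k\<in>freqs N. if k \<in> P m then of_real (a k * a (m - k)) * cis (2*pi*m*t) else 0)"
   by (rule sum.swap)
  also have "\<dots> = (\<Sum>m\<in>freqs (2*N). of_real (d m) * cis (2*pi*m*t))"
  proof (intro sum.cong refl)
   fix m
   have "(\<Sum>k\<in>freqs N. if k \<in> P m then of_real (a k * a (m - k)) * cis (2*pi*m*t) else 0)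
     = (\<Sum>k\<in>P m. of_real (a k * a (m - k)) * cis (2*pi*m*t))"
    by (rule sum.mono_neutral_cong_right) (auto simp: P_def)
   then show "(\<Sum>k\<in>freqs N. if k \<in> P m then of_real (a k * a (m - k)) * cis (2*pi*m*t) else 0)
     = of_real (d m) * cis (2*pi*m*t)" by (simp add: d_def sum_distrib_right)
  qed
  finally show ?thesis .
 qed
 have nrm: "norm (?Z t) ^ 4 = trig (2*N) D t \<bullet> trig (2*N) D t" for t
 proof -
  have "norm (?Z t) ^ 4 = (norm (?Z t * ?Z t))\<^sup>2" by (simp add: norm_mult power4_eq_xxxx power2_eq_square)
  also have "\<dots> = (\<Sum>m\<in>freqs (2*N). d m * cos (2*pi*m*t))\<^sup>2 + (\<Sum>m\<in>freqs (2*N). d m * sin (2*pi*m*t))\<^sup>2"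
   unfolding sq cmod_power2 by (simp add: Re_sum Im_sum)
  also have "\<dots> = trig (2*N) D t \<bullet> trig (2*N) D t"
   unfolding trig_def inner_prod_def fst_sum snd_sum
   by (simp add: mode_def D_def inner_vec_def power2_eq_square mult.commute)
  finally show ?thesis .
 qed
 have bd: "(d m)\<^sup>2 <= (\<Sum>k\<in>P m. real_of_int k * (a k)\<^sup>2 * (real_of_int (m - k) * (a (m - k))\<^sup>2))" for m
 proof -
  have "(d m)\<^sup>2 <= (\<Sum>k\<in>P m. (a k * a (m - k))\<^sup>2) * card (P m)"
   using sum_squared_le_sum_of_squares[of "%k. a k * a (m - k)" "P m"] by (simp add: d_def mult.commute)
  also have "\<dots> = (\<Sum>k\<in>P m. real (card (P m)) * (a k * a (m - k))\<^sup>2)"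
   by (simp add: sum_distrib_left mult.commute)
  also have "\<dots> <= (\<Sum>k\<in>P m. (real_of_int k * real_of_int (m - k)) * (a k * a (m - k))\<^sup>2)"
  proof (intro sum_mono mult_right_mono)
   fix k assume k: "k \<in> P m"
   have "card (P m) <= card {1..m - 1}" by (rule card_mono) (auto simp: P_def)
   then have "int (card (P m)) <= m - 1" using k by (auto simp: P_def)
   also have "\<dots> <= k * (m - k)"
   proof -
    have "0 <= (k - 1) * (m - k - 1)" using k by (auto simp: P_def)
    then show ?thesis by (simp add: algebra_simps)
   qed
   finally have "real_of_int (int (card (P m))) <= real_of_int (k * (m - k))" by (simp only: of_int_le_iff)
   then show "real (card (P m)) <= real_of_int k * real_of_int (m - k)" by simp
  qed simp
  also have "\<dots> = (\<Sum>k\<in>P m. real_of_int k * (a k)\<^sup>2 * (real_of_int (m - k) * (a (m - k))\<^sup>2))"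
   by (intro sum.cong refl) (simp add: power_mult_distrib)
  finally show ?thesis .
 qed
 let ?w = "%k. real_of_int k * (a k)\<^sup>2"
 have w0: "?w k \<ge> 0" for k using a0[of k] by (cases "k <= 0") auto
 have "ip (2*N) D D = (\<Sum>m\<in>freqs (2*N). (d m)\<^sup>2)"
  by (simp add: ip_def D_def inner_vec_def power2_eq_square)
 also have "\<dots> <= (\<Sum>m\<in>freqs (2*N). \<Sum>k\<in>P m. ?w k * ?w (m - k))"
  by (intro sum_mono bd)
 also have "\<dots> = (\<Sum>(m,k)\<in>Sigma (freqs (2*N)) P. ?w k * ?w (m - k))"
  by (rule sum.Sigma) auto
 also have "\<dots> = (\<Sum>(k,l)\<in>(%(m,k). (k, m - k)) ` Sigma (freqs (2*N)) P. ?w k * ?w l)"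
  by (subst sum.reindex) (auto simp: inj_on_def intro!: sum.cong)
 also have "\<dots> <= (\<Sum>(k,l)\<in>freqs N \<times> freqs N. ?w k * ?w l)"
 proof (intro sum_mono2)
  fix x assume "x \<in> freqs N \<times> freqs N - (%(m,k). (k, m - k)) ` Sigma (freqs (2*N)) P"
  show "0 <= (case x of (k,l) \<Rightarrow> ?w k * ?w l)"
   using mult_nonneg_nonneg[OF w0 w0, of "fst x" "snd x"] by (simp add: case_prod_unfold)
 qed (auto simp: P_def)
 also have "\<dots> = (\<Sum>k\<in>freqs N. ?w k)\<^sup>2"
  by (simp add: power2_eq_square sum_product sum.cartesian_product)
 finally have "ip (2*N) D D <= (\<Sum>k\<in>freqs N. ?w k)\<^sup>2" .
 moreover have "((%t. norm (?Z t) ^ 4) has_integral ip (2*N) D D) {0..1}"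
  unfolding nrm by (rule trig_inner_trig)
 ultimately show ?thesis by (simp add: integral_unique)
qed

text \<open>On positive frequencies \<open>trig N c\<close> is analytic, so that its fourth power integral is the
 square integral of a trigonometric polynomial with convolution coefficients. The bound is uniform
 in \<open>N\<close>; it is the embedding of the Sobolev space of order 1/2 into the fourth Lebesgue space.\<close>

lemma trig_L4:
 fixes c :: "int \<Rightarrow> real^'n::finite"
 assumes c0: "!!k. k <= 0 ==> c k = 0"
 shows "integral {0..1} (%t. norm (trig N c t) ^ 4) <= real CARD('n) * (\<Sum>k\<in>freqs N. k * (c k \<bullet> c k))\<^sup>2"
proof -
 let ?Z = "%i t. \<Sum>k\<in>freqs N. complex_of_real (c k $ i) * cis (2*pi*k*t)"
 have eq: "(norm (trig N c t))\<^sup>2 = (\<Sum>i\<in>UNIV. (norm (?Z i t))\<^sup>2)" for t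
 proof -
  have "(norm (trig N c t))\<^sup>2 = (\<Sum>i\<in>UNIV. (fst (trig N c t) $ i)\<^sup>2) + (\<Sum>i\<in>UNIV. (snd (trig N c t) $ i)\<^sup>2)"
   unfolding power2_norm_eq_inner inner_prod_def by (simp add: inner_vec_def power2_eq_square)
  also have "\<dots> = (\<Sum>i\<in>UNIV. (norm (?Z i t))\<^sup>2)"
   unfolding cmod_power2 sum.distrib[symmetric]
   by (intro sum.cong refl) (simp add: trig_def fst_sum snd_sum mode_def sum_component Re_sum Im_sum mult.commute)
  finally show ?thesis .
 qed
 have ci: "(%t. norm (trig N c t) ^ 4) integrable_on {0..1}"
  by (intro integrable_continuous_real continuous_intros)
 have 1: "norm (trig N c t) ^ 4 <= real CARD('n) * (\<Sum>i\<in>UNIV. norm (?Z i t) ^ 4)" for t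
 proof -
  have "norm (trig N c t) ^ 4 = (\<Sum>i\<in>UNIV. (norm (?Z i t))\<^sup>2)\<^sup>2"
   unfolding eq[symmetric] by (simp flip: power_mult)
  also have "\<dots> <= (\<Sum>i\<in>UNIV. ((norm (?Z i t))\<^sup>2)\<^sup>2) * card (UNIV::'n set)"
   using sum_squared_le_sum_of_squares[of "%i. (norm (?Z i t))\<^sup>2" "UNIV::'n set"] by (simp add: mult.commute)
  finally show ?thesis by (simp flip: power_mult add: mult.commute)
 qed
 let ?w = "%i. (\<Sum>k\<in>freqs N. real_of_int k * (c k $ i)\<^sup>2)"
 have hz: "((%t. norm (?Z i t) ^ 4) has_integral integral {0..1} (%t. norm (?Z i t) ^ 4)) {0..1}"
  "integral {0..1} (%t. norm (?Z i t) ^ 4) <= (?w i)\<^sup>2" for i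
  using scalar_L4[of "%k. c k $ i" N] c0 by auto
 have "integral {0..1} (%t. norm (trig N c t) ^ 4)
   <= real CARD('n) * (\<Sum>i\<in>UNIV. integral {0..1} (%t. norm (?Z i t) ^ 4))"
  by (rule has_integral_le[OF integrable_integral[OF ci] has_integral_mult_right[OF has_integral_sum]])
    (use hz 1 in auto)
 also have "\<dots> <= real CARD('n) * (\<Sum>i\<in>UNIV. (?w i)\<^sup>2)"
  by (intro mult_left_mono sum_mono hz) auto
 also have "(\<Sum>i\<in>UNIV. (?w i)\<^sup>2) <= (\<Sum>i\<in>UNIV. ?w i)\<^sup>2"
 proof -
  have w: "?w i \<ge> 0" for i
   using c0 by (intro sum_nonneg) (metis linorder_not_le less_imp_le mult_eq_0_iff mult_nonneg_nonneg of_int_0_le_iff power2_eq_square zero_index zero_le_power2 order_refl)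
  have "(\<Sum>i\<in>UNIV. (f i)\<^sup>2) <= (\<Sum>i\<in>UNIV. f i)\<^sup>2" if f: "!!i. f i \<ge> 0" for f :: "'n \<Rightarrow> real"
  proof -
   have "(\<Sum>i\<in>UNIV. (f i)\<^sup>2) <= (\<Sum>i\<in>UNIV. f i * (\<Sum>j\<in>UNIV. f j))"
    unfolding power2_eq_square using f by (intro sum_mono mult_left_mono member_le_sum) auto
   then show ?thesis by (simp add: sum_distrib_right power2_eq_square)
  qed
  from this[of ?w, OF w] show ?thesis .
 qed
 also have "(\<Sum>i\<in>UNIV. ?w i) = (\<Sum>k\<in>freqs N. k * (c k \<bullet> c k))"
  by (subst sum.swap) (simp add: inner_vec_def sum_distrib_left power2_eq_square)
 finally show ?thesis by (simp add: mult_left_mono)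
qed

section \<open>The action functional in finitely many frequencies and its linking\<close>

lemma uniform_limit_integral_comp:
 fixes y :: "real \<Rightarrow> 'a::euclidean_space" and K :: "'a \<Rightarrow> real"
 assumes cK: "continuous_on UNIV K"
  and u: "uniform_limit {0..1} x y sequentially" and x: "!!j. continuous_on {0..1} (x j)"
 shows "(%j::nat. integral {0..1} (%t. K (x j t))) \<longlonglongrightarrow> integral {0..1} (%t. K (y t))"
proof -
 have y: "continuous_on {0..1} y"
  by (rule uniform_limit_theorem[OF _ u]) (use x in auto)
 obtain B where B: "!!t. t \<in> {0..1} ==> norm (y t) <= B"
  using compact_imp_bounded[OF compact_continuous_image[OF y compact_Icc]] unfolding bounded_iff by blast
 have "uniform_limit {0..1} (%j t. K (x j t)) (%t. K (y t)) sequentially"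
 proof (rule uniform_limit_compose_uniformly_continuous_on[OF u])
  show "uniformly_continuous_on (cball 0 (B + 1)) K"
   by (intro compact_uniformly_continuous continuous_on_subset[OF cK]) auto
  show "\<forall>\<^sub>F j in sequentially. \<forall>t\<in>{0..1}. x j t \<in> cball 0 (B + 1)"
   using uniform_limitD[OF u zero_less_one]
  proof (eventually_elim, intro ballI)
   fix j t assume a: "\<forall>t\<in>{0..1}. dist (x j t) (y t) < 1" "t \<in> {0..1::real}"
   have "norm (x j t) <= norm (y t) + dist (x j t) (y t)"
    by (metis dist_norm norm_triangle_sub)
   then have "norm (x j t) <= B + 1" using a(1)[rule_format, OF a(2)] B[OF a(2)] by linarith
   then show "x j t \<in> cball 0 (B + 1)" by simp
  qed
 qed auto
 then obtain I J where "!!n. ((%t. K (x n t)) has_integral I n) {0..1}"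
   "((%t. K (y t)) has_integral J) {0..1}" "I \<longlonglongrightarrow> J"
  by (rule uniform_limit_integral)
   (auto intro!: continuous_on_compose2[OF cK] x)
 moreover from this have "(%j. integral {0..1} (%t. K (x j t))) = I" by (auto intro!: integral_unique)
 ultimately show ?thesis by (simp add: integral_unique)
qed

text \<open>A gradient that is merely Lipschitz is what a Moreau envelope provides, and it is enough
  for the quadratic estimate \<open>Phi_add_le\<close> of a gradient step.\<close>

locale lipschitz_hamiltonian =
 fixes K :: "'n::finite phase \<Rightarrow> real" and gK :: "'n phase \<Rightarrow> 'n phase" and Lp :: real
 assumes deriv: "!!z. (K has_derivative (%v. v \<bullet> gK z)) (at z)"
  and lip: "!!z w. norm (gK z - gK w) <= Lp * norm (z - w)"
begin

lemma Lp_nonneg: "0 <= Lp"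
proof -
 obtain b :: "'n phase" where "b \<in> Basis" using nonempty_Basis by blast
 then have "norm b = 1" by simp
 then show ?thesis using lip[of b 0] order_trans[OF norm_ge_zero] by fastforce
qed

lemma cont_K: "continuous_on S K"
 by (meson deriv continuous_at_imp_continuous_on has_derivative_continuous)

lemma cont_gK: "continuous_on S gK"
proof (rule continuous_on_subset[OF lipschitz_on_continuous_on])
 show "Lp-lipschitz_on UNIV gK"
  using lip Lp_nonneg by (auto simp: lipschitz_on_def dist_norm)
qed auto

lemma K_lower: "K z + w \<bullet> gK z - Lp * (w \<bullet> w) <= K (z + w)"
proof -
 define f where "f s = K (z + s *\<^sub>R w)" for s :: real
 have f: "(f has_real_derivative (w \<bullet> gK (z + s *\<^sub>R w))) (at s)" for s
 proof -
  have "((%s. z + s *\<^sub>R w) has_derivative (%h. h *\<^sub>R w)) (at s)"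
   by (auto intro!: derivative_eq_intros)
  from has_derivative_compose[OF this deriv]
  show ?thesis unfolding f_def has_field_derivative_def by (simp add: mult_commute_abs)
 qed
 obtain \<xi> where xi: "0 < \<xi>" "\<xi> < 1" "f 1 - f 0 = (1 - 0) * (w \<bullet> gK (z + \<xi> *\<^sub>R w))"
  using MVT2[of 0 1 f "%s. w \<bullet> gK (z + s *\<^sub>R w)"] f by auto
 have "\<bar>w \<bullet> (gK (z + \<xi> *\<^sub>R w) - gK z)\<bar> <= norm w * (Lp * norm (\<xi> *\<^sub>R w))"
 proof -
  have "norm (gK (z + \<xi> *\<^sub>R w) - gK z) <= Lp * norm (\<xi> *\<^sub>R w)" using lip[of "z + \<xi> *\<^sub>R w" z] by simp
  then show ?thesis by (rule order_trans[OF Cauchy_Schwarz_ineq2 mult_left_mono]) simp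
 qed
 also have "\<dots> <= Lp * (w \<bullet> w)"
 proof -
  have "\<xi> * (norm w * norm w) <= 1 * (norm w * norm w)" using xi by (intro mult_right_mono) auto
  then have "Lp * (\<xi> * (norm w * norm w)) <= Lp * (norm w * norm w)"
   using Lp_nonneg by (intro mult_left_mono) auto
  then show ?thesis using xi by (simp add: dot_square_norm power2_eq_square ac_simps)
 qed
 finally show ?thesis using xi(3) by (simp add: f_def inner_diff_right abs_le_iff)
qed

text \<open>Hamilton's action functional on trigonometric brake loops. \<open>gr\<close> is its
  gradient for the product \<open>ip\<close>, so that a zero of \<open>gr\<close> is a Galerkin
  solution of Hamilton's equation.\<close>

definition Phi :: "nat \<Rightarrow> (int \<Rightarrow> real^'n) \<Rightarrow> real" where
 "Phi N c = act N c - integral {0..1} (%t. K (trig N c t))"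

definition gr :: "nat \<Rightarrow> (int \<Rightarrow> real^'n) \<Rightarrow> int \<Rightarrow> real^'n" where
 "gr N c k = (2*pi*k) *\<^sub>R c k - coef (%t. gK (trig N c t)) k"

lemma cont_comp: "continuous_on {0..1} (%t. K (trig N c t))" "continuous_on {0..1} (%t. gK (trig N c t))"
 by (rule continuous_on_compose2[OF cont_K[of UNIV]] continuous_on_compose2[OF cont_gK[of UNIV]];
   auto intro!: continuous_intros)+

lemma Phi_add_le: "Phi N (%k. c k + d k) <= Phi N c + ip N (gr N c) d + (pi * N + Lp) * ip N d d"
proof -
 let ?x = "trig N c" and ?y = "trig N d"
 have "((%t. K (?x t) + ?y t \<bullet> gK (?x t) - Lp * (?y t \<bullet> ?y t)) has_integral
   (integral {0..1} (%t. K (?x t)) + (\<Sum>k\<in>freqs N. d k \<bullet> coef (%t. gK (?x t)) k) - Lp * ip N d d)) {0..1}"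
  by (intro has_integral_add has_integral_diff has_integral_mult_right trig_inner_trig trig_inner_coef
     integrable_integral integrable_continuous_real cont_comp)
 moreover have "((%t. K (trig N (%k. c k + d k) t)) has_integral integral {0..1} (%t. K (trig N (%k. c k + d k) t))) {0..1}"
  by (intro integrable_integral integrable_continuous_real cont_comp)
 ultimately have "integral {0..1} (%t. K (?x t)) + (\<Sum>k\<in>freqs N. d k \<bullet> coef (%t. gK (?x t)) k) - Lp * ip N d d
   <= integral {0..1} (%t. K (trig N (%k. c k + d k) t))"
  by (rule has_integral_le) (simp add: trig_add K_lower)
 moreover have "ip N (gr N c) d = ip N (%k. (2*pi*k) *\<^sub>R c k) d - (\<Sum>k\<in>freqs N. d k \<bullet> coef (%t. gK (?x t)) k)"
  by (simp add: ip_def gr_def inner_diff_left sum_subtractf inner_commute[of "coef _ _"])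
 ultimately show ?thesis using act_le[of N d] act_add[of N c d] by (simp add: Phi_def algebra_simps)
qed

definition ramp :: "real \<Rightarrow> real" where "ramp u = max 0 (min 1 u)"

text \<open>A discrete substitute for the negative gradient flow. The factor \<open>ramp\<close>
  vanishes where \<open>Phi\<close> is nonpositive, so that the boundary of the linking patch stays
  fixed, and is 1 above the level \<alpha>.\<close>

definition stp :: "nat \<Rightarrow> real \<Rightarrow> real \<Rightarrow> (int \<Rightarrow> real^'n) \<Rightarrow> int \<Rightarrow> real^'n" where
 "stp N \<alpha> h c k = c k - (h * ramp (Phi N c / \<alpha>)) *\<^sub>R gr N c k"

text \<open>The bound on h makes the quadratic error in \<open>Phi_add_le\<close> use up at most
  half of the first-order decrease.\<close>

lemma Phi_stp_le:
 assumes "0 < h" "h * (pi * N + Lp) <= 1/2"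
 shows "Phi N (stp N \<alpha> h c) <= Phi N c - h * ramp (Phi N c / \<alpha>) / 2 * ip N (gr N c) (gr N c)"
proof -
 define r where "r = h * ramp (Phi N c / \<alpha>)"
 have r: "0 <= r" "r <= h" using assms(1) by (auto simp: r_def ramp_def mult_le_cancel_left1 mult_le_one)
 let ?G = "ip N (gr N c) (gr N c)" and ?d = "%k. (- r) *\<^sub>R gr N c k"
 have s: "stp N \<alpha> h c = (%k. c k + ?d k)" by (simp add: stp_def r_def fun_eq_iff)
 have i: "ip N (gr N c) ?d = - r * ?G" "ip N ?d ?d = r * r * ?G"
  by (simp_all add: ip_def sum_distrib_left sum_negf mult.assoc)
 have "r * (pi * N + Lp) <= 1/2"
  using mult_right_mono[OF r(2), of "pi * N + Lp"] assms(2) Lp_nonneg by simp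
 then have "(r * (pi * N + Lp)) * (r * ?G) <= 1/2 * (r * ?G)"
  using r(1) ip_nonneg by (intro mult_right_mono mult_nonneg_nonneg) auto
 then show ?thesis using Phi_add_le[of N c ?d] unfolding s i r_def[symmetric] by (simp add: algebra_simps)
qed

lemma stp_id: "Phi N c <= 0 ==> 0 < \<alpha> ==> stp N \<alpha> h c = c"
 by (simp add: stp_def fun_eq_iff ramp_def divide_nonpos_pos)

text \<open>Convergence of the finitely many coefficients that \<open>trig N\<close> sees; the
  coefficients beyond the range are arbitrary, so no topology on the functions themselves is
  suitable.\<close>

definition cv :: "nat \<Rightarrow> (nat \<Rightarrow> int \<Rightarrow> real^'n) \<Rightarrow> (int \<Rightarrow> real^'n) \<Rightarrow> bool" where
 "cv N u l \<longleftrightarrow> (\<forall>k\<in>freqs N. (%j. u j k) \<longlonglongrightarrow> l k)"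

lemma cv_trig:
 assumes "cv N u l"
 shows "uniform_limit S (%j. trig N (u j)) (trig N l) sequentially"
proof (rule uniform_limitI)
 fix e :: real assume e: "0 < e"
 have "(%j. \<Sum>k\<in>freqs N. norm (u j k - l k)) \<longlonglongrightarrow> (\<Sum>k\<in>freqs N. 0)"
  using assms by (intro tendsto_sum tendsto_norm_zero LIM_zero) (auto simp: cv_def)
 then have "\<forall>\<^sub>F j in sequentially. (\<Sum>k\<in>freqs N. norm (u j k - l k)) < e"
  using e by (auto dest: order_tendstoD(2))
 then show "\<forall>\<^sub>F j in sequentially. \<forall>t\<in>S. dist (trig N (u j) t) (trig N l t) < e"
 proof (eventually_elim, intro ballI)
  fix j t assume "(\<Sum>k\<in>freqs N. norm (u j k - l k)) < e"
  then show "dist (trig N (u j) t) (trig N l t) < e"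
   using norm_trig_le[of N "%k. u j k - l k" t] by (simp add: dist_norm trig_minus)
 qed
qed

lemma unif_gK:
 assumes "uniform_limit S x y sequentially"
 shows "uniform_limit S (%j t. gK (x j t)) (%t. gK (y t)) sequentially"
proof (rule uniform_limitI)
 fix e :: real assume e: "0 < e"
 have p: "0 < e / (Lp + 1)" using e Lp_nonneg by simp
 from uniform_limitD[OF assms p]
 show "\<forall>\<^sub>F j in sequentially. \<forall>t\<in>S. dist (gK (x j t)) (gK (y t)) < e"
 proof (eventually_elim, intro ballI)
  fix j t assume "\<forall>t\<in>S. dist (x j t) (y t) < e / (Lp + 1)" "t \<in> S"
  then have "dist (x j t) (y t) * (Lp + 1) < e" using Lp_nonneg by (simp add: pos_less_divide_eq)
  then have "Lp * dist (x j t) (y t) + dist (x j t) (y t) < e" by (simp add: algebra_simps)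
  moreover have "dist (gK (x j t)) (gK (y t)) <= Lp * dist (x j t) (y t)" using lip by (simp add: dist_norm)
  ultimately show "dist (gK (x j t)) (gK (y t)) < e" using zero_le_dist[of "x j t" "y t"] by linarith
 qed
qed

lemma unif_coef:
 assumes u: "uniform_limit {0..1} f g sequentially" and f: "!!j. continuous_on {0..1} (f j)"
 shows "(%j::nat. coef (f j) k) \<longlonglongrightarrow> coef g k"
proof -
 have g: "continuous_on {0..1} g"
  by (rule uniform_limit_theorem[OF _ u]) (use f in auto)
 show ?thesis
 proof (rule LIMSEQ_I)
  fix e :: real assume e: "0 < e"
  then obtain n where n: "!!j t. j \<ge> n ==> t \<in> {0..1} ==> dist (f j t) (g t) < e / 4"
   using uniform_limitD[OF u, of "e/4"] unfolding eventually_sequentially by (metis zero_less_divide_iff zero_less_numeral)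
  have "norm (coef (f j) k - coef g k) < e" if "j \<ge> n" for j
  proof -
   have "norm (coef (%t. f j t - g t) k) <= 2 * (e/4)"
    using n[OF that] by (intro coef_norm_le continuous_intros f g) (auto simp: dist_norm less_imp_le)
   then show ?thesis using e coef_diff[OF f g, of j k] by simp
  qed
  then show "\<exists>no. \<forall>j\<ge>no. norm (coef (f j) k - coef g k) < e" by blast
 qed
qed

lemmas unif_integral_K = uniform_limit_integral_comp[OF cont_K]

lemma cv_Phi:
 assumes "cv N u l" shows "(%j. Phi N (u j)) \<longlonglongrightarrow> Phi N l"
 unfolding Phi_def act_def
 by (intro tendsto_intros unif_integral_K cv_trig assms continuous_on_trig)
  (use assms in \<open>auto simp: cv_def\<close>)

lemma cv_stp:
 assumes "cv N u l" shows "cv N (%j. stp N \<alpha> h (u j)) (stp N \<alpha> h l)"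
 unfolding cv_def
proof
 fix k assume k: "k \<in> freqs N"
 have "(%j. coef (%t. gK (trig N (u j) t)) k) \<longlonglongrightarrow> coef (%t. gK (trig N l t)) k"
  by (intro unif_coef unif_gK cv_trig assms cont_comp)
 then show "(%j. stp N \<alpha> h (u j) k) \<longlonglongrightarrow> stp N \<alpha> h l k"
  unfolding stp_def gr_def ramp_def divide_inverse
  by (intro tendsto_intros cv_Phi assms) (use assms k in \<open>auto simp: cv_def\<close>)
qed

lemma cv_stp_iter: "cv N u l ==> cv N (%j. (stp N \<alpha> h ^^ m) (u j)) ((stp N \<alpha> h ^^ m) l)"
 by (induction m) (auto intro: cv_stp)

text \<open>No step raises \<open>Phi\<close>, so a loop below \<alpha> stays there; above \<alpha>
  the cutoff is 1 and each step gains h / 2 * e. For large m both alternatives end below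
  \<alpha>.\<close>

lemma Phi_iter_le:
 assumes "0 < h" "h * (pi * N + Lp) <= 1/2" "0 < \<alpha>" "0 <= e"
  and big: "!!c. \<alpha> <= Phi N c ==> e <= ip N (gr N c) (gr N c)"
 shows "Phi N ((stp N \<alpha> h ^^ m) c) < \<alpha> \<or> Phi N ((stp N \<alpha> h ^^ m) c) <= Phi N c - m * (h / 2 * e)"
proof (induction m)
 case (Suc m)
 let ?c = "(stp N \<alpha> h ^^ m) c"
 have st: "Phi N (stp N \<alpha> h ?c) <= Phi N ?c - h * ramp (Phi N ?c / \<alpha>) / 2 * ip N (gr N ?c) (gr N ?c)"
  by (rule Phi_stp_le[OF assms(1,2)])
 have nn: "0 <= h * ramp (Phi N ?c / \<alpha>) / 2 * ip N (gr N ?c) (gr N ?c)"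
  using assms(1) by (intro mult_nonneg_nonneg ip_nonneg) (auto simp: ramp_def)
 show ?case
 proof (cases "Phi N ?c < \<alpha>")
  case True
  then show ?thesis using st nn by auto
 next
  case False
  then have "ramp (Phi N ?c / \<alpha>) = 1" using assms(3) by (simp add: ramp_def)
  moreover have "h / 2 * e <= h / 2 * ip N (gr N ?c) (gr N ?c)"
   using False big[of ?c] assms(1) by (intro mult_left_mono) auto
  moreover have "real (Suc m) * (h / 2 * e) = m * (h / 2 * e) + h / 2 * e" by (simp add: algebra_simps)
  moreover have "Phi N ?c <= Phi N c - m * (h / 2 * e)" using Suc False by blast
  moreover have "Phi N (stp N \<alpha> h ?c) <= Phi N ?c - h / 2 * ip N (gr N ?c) (gr N ?c)"
   using st \<open>ramp _ = 1\<close> by simp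
  ultimately have "Phi N (stp N \<alpha> h ?c) <= Phi N c - real (Suc m) * (h / 2 * e)" by linarith
  then show ?thesis by simp
 qed
qed simp

lemma stp_iter_id: "Phi N c <= 0 ==> 0 < \<alpha> ==> (stp N \<alpha> h ^^ m) c = c"
 by (induction m) (auto simp: stp_id)

text \<open>The linking argument. If the gradient were bounded away from zero on the set where
 \<open>\<alpha> <= Phi N c\<close>, then iterating the truncated gradient step, which fixes the boundary of the
 half space patch spanned by \<open>\<sigma>\<close> and the nonpositive frequencies, would push the
 patch below level \<open>\<alpha>\<close>. By Poincare-Miranda it still meets the sphere of positive
 frequencies, where \<open>Phi\<close> is at least \<open>\<alpha>\<close>.\<close>

lemma almost_critical_point:
 fixes \<sigma> :: "int \<Rightarrow> real^'n"
 assumes K0: "!!z. 0 <= K z"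
  and \<rho>: "\<rho> > 0" and \<alpha>: "\<alpha> > 0"
  and sphere: "!!c. [|!!k. k <= 0 ==> c k = 0; (\<Sum>k\<in>freqs N. k * (c k \<bullet> c k)) = \<rho>|] ==> \<alpha> <= Phi N c"
  and q0: "(\<Sum>k\<in>freqs N. if 0 < k then k * (\<sigma> k \<bullet> \<sigma> k) else 0) = q" "q > 0"
  and \<kappa>: "\<kappa> > 0"
  and patch: "!!s y. 0 <= s ==> Phi N (%k. if 0 < k then s *\<^sub>R \<sigma> k else y k)
    <= b - \<kappa> * (s\<^sup>2 + (\<Sum>k\<in>freqs N. if 0 < k then 0 else y k \<bullet> y k))"
  and \<eta>: "\<eta> > 0"
 shows "\<exists>c. \<alpha> <= Phi N c \<and> ip N (gr N c) (gr N c) <= \<eta>"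
proof (rule ccontr)
 assume "\<not> ?thesis"
 then have big: "!!c. \<alpha> <= Phi N c ==> \<eta> <= ip N (gr N c) (gr N c)" by force
 define h where "h = 1 / (2 * (pi * N + Lp + 1))"
 have pN: "0 <= pi * N + Lp" using Lp_nonneg by simp
 have h: "0 < h" "h * (pi * N + Lp) <= 1/2" using pN by (auto simp: h_def divide_simps)
 \<comment> \<open>The box is large enough for two purposes: on its outer faces the bound of the
   patch makes \<open>Phi\<close> nonpositive, and the face on which \<sigma> has the coefficient S
   lies strictly beyond the sphere of weight \<rho>.\<close>
 define S where "S = 1 + sqrt (\<bar>b\<bar> / \<kappa>) + sqrt (\<rho> / q)"
 have sq: "0 <= sqrt (\<bar>b\<bar> / \<kappa>)" "0 <= sqrt (\<rho> / q)" using \<kappa> \<rho> q0 by auto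
 have S: "0 < S" unfolding S_def by (intro add_pos_nonneg sq zero_less_one)
 have "\<bar>b\<bar> / \<kappa> <= S\<^sup>2" "\<rho> / q < S\<^sup>2"
 proof -
  have "(sqrt (\<bar>b\<bar> / \<kappa>))\<^sup>2 <= S\<^sup>2" by (rule power_mono) (use sq in \<open>auto simp: S_def\<close>)
  then show "\<bar>b\<bar> / \<kappa> <= S\<^sup>2" using \<kappa> by simp
  have "(sqrt (\<rho> / q))\<^sup>2 < S\<^sup>2" by (rule power_strict_mono) (use sq in \<open>auto simp: S_def intro!: add_pos_nonneg\<close>)
  then show "\<rho> / q < S\<^sup>2" using \<rho> q0 by simp
 qed
 then have S2: "b - \<kappa> * S\<^sup>2 <= 0" "\<rho> < S\<^sup>2 * q"
  using \<kappa> q0 by (auto simp: divide_simps mult.commute split: if_splits)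
 \<comment> \<open>\<open>None\<close> indexes the coefficient of \<sigma>, and
   \<open>Some (k, i)\<close> the i-th component of the coefficient at the nonpositive frequency
   k.\<close>
 define I :: "(int \<times> 'n) option set" where "I = insert None (Some ` ((freqs N \<inter> {..0}) \<times> UNIV))"
 have [simp]: "finite I" by (simp add: I_def)
 define emb where "emb x = (%k. if 0 < k then x None *\<^sub>R \<sigma> k else (\<chi> i. x (Some (k, i))))" for x :: "(int \<times> 'n) option \<Rightarrow> real"
 obtain m :: nat where m: "b < m * (h / 2 * \<eta>)"
  using reals_Archimedean3[of "h / 2 * \<eta>"] h \<eta> by (auto simp: mult.commute)
 define F where "F = (stp N \<alpha> h ^^ m)"
 \<comment> \<open>At a common zero the deformed loop has no nonpositive frequency and positive
   weight exactly \<rho>, that is, it lies on the sphere.\<close>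
 define g where "g x j = (case j of None \<Rightarrow> (\<Sum>k\<in>freqs N. if 0 < k then k * (F (emb x) k \<bullet> F (emb x) k) else 0) - \<rho>
   | Some (k, i) \<Rightarrow> F (emb x) k $ i)" for x j
 define lo :: "(int \<times> 'n) option \<Rightarrow> real" where "lo j = (case j of None \<Rightarrow> 0 | _ \<Rightarrow> - S)" for j
 have patch': "Phi N (emb x) <= b - \<kappa> * ((x None)\<^sup>2 + (\<Sum>k\<in>freqs N. if 0 < k then 0 else (\<chi> i. x (Some (k, i))) \<bullet> (\<chi> i. x (Some (k, i)))))"
  if "0 <= x None" for x
  using patch[OF that, of "%k. \<chi> i. x (Some (k, i))"] by (simp add: emb_def)
 \<comment> \<open>On the face without a \<sigma>-component only nonpositive frequencies remain: the
   action is nonpositive and K is nonnegative, so the deformation does not move these loops.\<close>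
 have fix0: "F (emb x) = emb x" if "x None = 0" for x
 proof -
  have "act N (emb x) <= 0"
   unfolding act_def using that by (intro sum_nonpos) (auto simp: emb_def mult_nonneg_nonpos mult_nonpos_nonneg)
  moreover have "0 <= integral {0..1} (%t. K (trig N (emb x) t))"
   by (intro integral_nonneg integrable_continuous_real cont_comp) (use K0 in auto)
  ultimately show ?thesis unfolding F_def by (intro stp_iter_id \<alpha>) (simp add: Phi_def)
 qed
 have fixS: "F (emb x) = emb x" if "0 <= x None" "j \<in> I" "x j = S \<or> x j = - S" for x j
 proof -
  note jI = that(2)
  have nn: "0 <= (\<Sum>k\<in>freqs N. if 0 < k then 0 else (\<chi> i. x (Some (k, i))) \<bullet> (\<chi> i. x (Some (k, i))))" (is "0 <= ?s")
   by (intro sum_nonneg) auto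
  have "S\<^sup>2 <= (x None)\<^sup>2 + ?s"
  proof (cases j)
   case None
   then show ?thesis using nn that by auto
  next
   case (Some p)
   then obtain k i where ki: "j = Some (k, i)" "k \<in> freqs N" "k <= 0" using jI by (auto simp: I_def)
   have "S\<^sup>2 = (x (Some (k, i)))\<^sup>2" using that ki by auto
   also have "\<dots> <= (\<chi> i. x (Some (k, i))) \<bullet> (\<chi> i. x (Some (k, i)))"
    by (simp add: inner_vec_def power2_eq_square) (rule member_le_sum[of i UNIV "%i. x (Some (k,i)) * x (Some (k,i))"]; simp)
   also have "\<dots> = (if 0 < k then 0 else (\<chi> i. x (Some (k, i))) \<bullet> (\<chi> i. x (Some (k, i))))"
    using ki by simp
   also have "\<dots> <= ?s" by (rule member_le_sum[OF ki(2)]) auto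
   finally show ?thesis using zero_le_power2[of "x None"] by linarith
  qed
  then have "\<kappa> * S\<^sup>2 <= \<kappa> * ((x None)\<^sup>2 + ?s)" using \<kappa> by (intro mult_left_mono) auto
  then have "Phi N (emb x) <= 0" using patch'[of x, OF that(1)] S2 by linarith
  then show ?thesis unfolding F_def by (intro stp_iter_id \<alpha>)
 qed
 have IN: "None \<in> I" by (simp add: I_def)
 have "\<exists>x. (\<forall>j\<in>I. x j \<in> {lo j..S}) \<and> (\<forall>j\<in>I. g x j = 0)"
 proof (rule poincare_miranda)
  show "lo j < S" for j using S by (auto simp: lo_def split: option.splits)
 next
  fix u :: "nat \<Rightarrow> (int \<times> 'n) option \<Rightarrow> real" and l j
  assume u: "j \<in> I" "!!j. j \<in> I ==> (%k. u k j) \<longlonglongrightarrow> l j"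
  have "cv N (%n. emb (u n)) (emb l)"
   unfolding cv_def
  proof
   fix k assume k: "k \<in> freqs N"
   show "(%n. emb (u n) k) \<longlonglongrightarrow> emb l k"
   proof (cases "0 < k")
    case True then show ?thesis by (auto simp: emb_def intro!: tendsto_intros u(2) IN)
   next
    case False
    then have "(%n. \<chi> i. u n (Some (k, i))) \<longlonglongrightarrow> (\<chi> i. l (Some (k, i)))"
     by (intro vec_tendstoI) (use k in \<open>auto simp: I_def intro!: u(2)\<close>)
    then show ?thesis using False by (simp add: emb_def)
   qed
  qed
  then have cF: "cv N (%n. F (emb (u n))) (F (emb l))" unfolding F_def by (rule cv_stp_iter)
  show "(%n. g (u n) j) \<longlonglongrightarrow> g l j"
  proof (cases j)
   case None
   have "(%n. if 0 < k then real_of_int k * (F (emb (u n)) k \<bullet> F (emb (u n)) k) else 0)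
     \<longlonglongrightarrow> (if 0 < k then real_of_int k * (F (emb l) k \<bullet> F (emb l) k) else 0)" if "k \<in> freqs N" for k
    using cF that by (auto simp: cv_def intro!: tendsto_intros)
   then show ?thesis unfolding g_def None option.case by (intro tendsto_intros)
  next
   case (Some p)
   then obtain k i where "j = Some (k, i)" "k \<in> freqs N" using u(1) by (auto simp: I_def)
   then show ?thesis using cF by (auto simp: g_def cv_def intro!: tendsto_intros)
  qed
 next
  fix x j assume x: "j \<in> I" "!!j. j \<in> I ==> x j \<in> {lo j..S}" "x j = lo j"
  have x0: "0 <= x None" using x(2)[OF IN] by (simp add: lo_def)
  show "g x j < 0"
  proof (cases j)
   case None
   then have "x None = 0" using x by (simp add: lo_def)
   then have "(\<Sum>k\<in>freqs N. if 0 < k then k * (F (emb x) k \<bullet> F (emb x) k) else 0) = 0"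
    unfolding fix0[of x, OF \<open>x None = 0\<close>] by (intro sum.neutral) (auto simp: emb_def \<open>x None = 0\<close>)
   then show ?thesis using None \<rho> by (simp add: g_def)
  next
   case (Some p)
   then obtain k i where "j = Some (k, i)" "k \<in> freqs N" "k <= 0" using x(1) by (auto simp: I_def)
   then show ?thesis using x(3) fixS[of x j, OF x0 x(1)] S by (auto simp: g_def lo_def emb_def)
  qed
 next
  fix x j assume x: "j \<in> I" "!!j. j \<in> I ==> x j \<in> {lo j..S}" "x j = S"
  have x0: "0 <= x None" using x(2)[OF IN] by (simp add: lo_def)
  show "g x j > 0"
  proof (cases j)
   case None
   have "(\<Sum>k\<in>freqs N. if 0 < k then k * (F (emb x) k \<bullet> F (emb x) k) else 0) = S\<^sup>2 * q"
    unfolding q0(1)[symmetric] sum_distrib_left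
    by (intro sum.cong refl) (use fixS[of x j, OF x0 x(1)] x(3) None in \<open>auto simp: emb_def power2_eq_square\<close>)
   then show ?thesis using None S2 by (simp add: g_def)
  next
   case (Some p)
   then obtain k i where "j = Some (k, i)" "k \<in> freqs N" "k <= 0" using x(1) by (auto simp: I_def)
   then show ?thesis using x(3) fixS[of x j, OF x0 x(1)] S by (auto simp: g_def lo_def emb_def)
  qed
 qed auto
 then obtain x where x: "!!j. j \<in> I ==> x j \<in> {lo j..S}" "!!j. j \<in> I ==> g x j = 0" by blast
 have x0: "0 <= x None" using x(1)[OF IN] by (simp add: lo_def)
 define c where "c k = (if k \<in> freqs N \<and> 0 < k then F (emb x) k else 0)" for k
 have cF: "c k = F (emb x) k" if "k \<in> freqs N" for k
 proof (cases "0 < k")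
  case True then show ?thesis using that by (simp add: c_def)
 next
  case False
  have "F (emb x) k $ i = 0" for i
   using x(2)[of "Some (k, i)"] that False by (simp add: I_def g_def)
  then show ?thesis using False by (simp add: c_def vec_eq_iff)
 qed
 have PhicF: "Phi N c = Phi N (F (emb x))"
  unfolding Phi_def act_def trig_def using cF by simp
 have "(\<Sum>k\<in>freqs N. k * (c k \<bullet> c k)) = (\<Sum>k\<in>freqs N. if 0 < k then k * (F (emb x) k \<bullet> F (emb x) k) else 0)"
  by (intro sum.cong refl) (auto simp: c_def)
 also have "\<dots> = \<rho>" using x(2)[OF IN] by (simp add: g_def)
 \<comment> \<open>The lower bound on the sphere keeps \<open>Phi\<close> at least \<alpha> here,
   although m steps from a starting value of at most b must end below \<alpha>.\<close>
 finally have "\<alpha> <= Phi N (F (emb x))" unfolding PhicF[symmetric] by (intro sphere) (auto simp: c_def)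
 moreover have "Phi N (emb x) <= b"
 proof -
  have "0 <= \<kappa> * ((x None)\<^sup>2 + (\<Sum>k\<in>freqs N. if 0 < k then 0 else (\<chi> i. x (Some (k, i))) \<bullet> (\<chi> i. x (Some (k, i)))))"
   using \<kappa> by (intro mult_nonneg_nonneg add_nonneg_nonneg sum_nonneg) auto
  then show ?thesis using patch'[of x, OF x0] by linarith
 qed
 ultimately show False
  using Phi_iter_le[OF h \<alpha> less_imp_le[OF \<eta>] big, of m "emb x"] m \<alpha> unfolding F_def by linarith
qed

end

section \<open>Periodic functions, Fejer means and uniqueness of Fourier coefficients\<close>

lemma periodic_of_int:
 fixes f :: "real \<Rightarrow> 'a"
 assumes "!!t. f (t + 1) = f t"
 shows "f (t + of_int n) = f t"
proof (induction n rule: int_induct[where k = 0])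
 case (step1 i)
 then show ?case using assms[of "t + of_int i"] by (simp add: ac_simps)
next
 case (step2 i)
 then show ?case using assms[of "t + of_int (i - 1)"] by (simp add: ac_simps)
qed simp

lemma periodic_frac:
 fixes f :: "real \<Rightarrow> 'a"
 assumes "!!t. f (t + 1) = f t"
 shows "f (frac t) = f t"
 using periodic_of_int[of f, OF assms, of "frac t" "\<lfloor>t\<rfloor>"] by (simp add: frac_def)

lemma integral_periodic:
 fixes f :: "real \<Rightarrow> 'a::banach"
 assumes c: "continuous_on UNIV f" and p: "!!t. f (t + 1) = f t"
 shows "integral {a..a + 1} f = integral {0..1} f"
proof -
 have i: "f integrable_on {u..v}" for u v
  by (rule integrable_continuous_real[OF continuous_on_subset[OF c]]) simp
 define b where "b = frac a"
 have b: "0 <= b" "b <= 1" using frac_lt_1[of a] by (auto simp: b_def)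
 have sh: "integral {u + of_int n..v + of_int n} f = integral {u..v} f" for u v n
  using integral_shift_Icc_real[of u v f "of_int n"] periodic_of_int[of f, OF p] by (simp add: o_def add.commute)
 have "a = b + of_int \<lfloor>a\<rfloor>" by (simp add: b_def frac_def)
 then have "integral {a..a + 1} f = integral {b..b + 1} f"
  using sh[of b "\<lfloor>a\<rfloor>" "b + 1"] by (metis add.commute add.left_commute)
 also have "\<dots> = integral {b..1} f + integral {1..b + 1} f"
  by (rule Henstock_Kurzweil_Integration.integral_combine[symmetric]) (use b i in auto)
 also have "integral {1..b + 1} f = integral {0..b} f" using sh[of 0 1 b] by simp
 also have "integral {b..1} f + integral {0..b} f = integral {0..1} f"
  using Henstock_Kurzweil_Integration.integral_combine[of 0 b 1 f] b i by (simp add: add.commute)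
 finally show ?thesis .
qed

lemma integral_reflect_periodic:
 fixes f :: "real \<Rightarrow> 'a::banach"
 assumes c: "continuous_on UNIV f" and p: "!!t. f (t + 1) = f t"
 shows "integral {0..1} (%s. f (t - s)) = integral {0..1} f"
proof -
 have "integral {0..1} (%s. f (t - s)) = integral {-1..0} (%s. f (t + s))"
  using Henstock_Kurzweil_Integration.integral_reflect_real[of 1 0 "%s. f (t - s)"] by simp
 also have "\<dots> = integral {t - 1..t} f"
  using integral_shift_Icc_real[of "-1" 0 f t] by (simp add: o_def add.commute)
 also have "\<dots> = integral {0..1} f" using integral_periodic[OF c p, of "t - 1"] by simp
 finally show ?thesis .
qed

lemma integral_odd_periodic:
 fixes f :: "real \<Rightarrow> 'a::banach"
 assumes c: "continuous_on UNIV f" and p: "!!t. f (t + 1) = f t" and o: "!!t. f (- t) = - f t"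
 shows "integral {0..1} f = 0"
proof -
 have "integral {0..1} f = integral {0..1} (%s. f (0 - s))"
  using integral_reflect_periodic[OF c p, of 0] by simp
 also have "\<dots> = - integral {0..1} f" by (simp add: o)
 finally show ?thesis
  by (metis add.right_inverse scaleR_2 scaleR_eq_0_iff zero_neq_numeral)
qed

text \<open>The double sum has degree M - 1 and is convenient for integration;
  \<open>fejer_cis\<close> rewrites it as a square divided by M, which gives positivity and the
  decay away from the integers.\<close>

definition fejer :: "nat \<Rightarrow> real \<Rightarrow> real" where
 "fejer M t = (\<Sum>j<M. \<Sum>l<M. cos (2*pi*(int j - int l)*t)) / M"

lemma fejer_cis: "fejer M t = (norm (\<Sum>j<M. cis (2*pi*t) ^ j))\<^sup>2 / M"
proof -
 have "cis (2*pi*t) ^ j = cis (2*pi*j*t)" for j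
  using Complex.DeMoivre[of "2*pi*t" j] by (simp only: ac_simps)
 then have "(\<Sum>j<M. cis (2*pi*t) ^ j) = (\<Sum>j<M. cis (2*pi*j*t))" by simp
 then have "(norm (\<Sum>j<M. cis (2*pi*t) ^ j))\<^sup>2 = (\<Sum>j<M. cos (2*pi*j*t))\<^sup>2 + (\<Sum>j<M. sin (2*pi*j*t))\<^sup>2"
  by (simp add: cmod_power2 Re_sum Im_sum)
 also have "\<dots> = (\<Sum>j<M. \<Sum>l<M. cos (2*pi*(int j - int l)*t))"
  unfolding power2_eq_square sum_product sum.distrib[symmetric]
  by (intro sum.cong refl) (simp add: cos_diff right_diff_distrib left_diff_distrib)
 finally show ?thesis by (simp add: fejer_def)
qed

lemma fejer_nonneg: "0 <= fejer M t"
 by (simp add: fejer_cis)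

lemma continuous_on_fejer [continuous_intros]: "continuous_on S (fejer M)"
 unfolding fejer_def[abs_def] divide_inverse by (intro continuous_intros)

lemma fejer_periodic: "fejer M (t + 1) = fejer M t"
 using cis_mult[of "2*pi*t" "2*pi"] by (simp add: fejer_cis distrib_left)

lemma fejer_integral: "M > 0 ==> (fejer M has_integral 1) {0..1}"
proof -
 assume M: "M > 0"
 have "((%t. \<Sum>j<M. \<Sum>l<M. cos (2*pi*(int j - int l)*t)) has_integral
   (\<Sum>j<M. \<Sum>l<M. if int j - int l = 0 then 1 else 0)) {0..1}"
  by (intro has_integral_sum integral_cos_int) auto
 moreover have "(\<Sum>j<M. \<Sum>l<M. if int j - int l = 0 then 1 else 0) = (\<Sum>j<M. \<Sum>l<M. if j = l then 1 else (0::real))"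
  by (intro sum.cong refl) auto
 ultimately have "((%t. (\<Sum>j<M. \<Sum>l<M. cos (2*pi*(int j - int l)*t)) / M) has_integral real M / M) {0..1}"
  by (intro has_integral_divide) simp
 then show ?thesis using M by (simp add: fejer_def[abs_def])
qed

text \<open>The geometric sum is at most 2 / |1 - w|, and |1 - w| has a positive minimum on the arc
  that stays away from 1.\<close>

lemma fejer_small:
 assumes "0 < \<delta>" "\<delta> <= 1/2"
 shows "\<exists>C. \<forall>M>0. \<forall>s\<in>{\<delta>..1 - \<delta>}. fejer M s <= C / real M"
proof -
 have "\<exists>s0\<in>{\<delta>..1 - \<delta>}. \<forall>s\<in>{\<delta>..1 - \<delta>}. norm (1 - cis (2*pi * s0)) <= norm (1 - cis (2*pi * s))"
  by (intro continuous_attains_inf continuous_intros) (use assms in auto)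
 then obtain s0 where s0: "s0 \<in> {\<delta>..1 - \<delta>}" "!!s. s \<in> {\<delta>..1 - \<delta>} ==> norm (1 - cis (2*pi * s0)) <= norm (1 - cis (2*pi * s))"
  by blast
 define m where "m = norm (1 - cis (2*pi * s0))"
 have "m ~= 0"
 proof
  assume "m = 0"
  then have "cis (2*pi * s0) = 1" by (simp add: m_def)
  then have "cos (2*pi * s0) = 1" by (metis cis.simps(1) one_complex.simps(1))
  then obtain n :: int where "2*pi * s0 = of_int n * 2 * pi" using cos_one_2pi_int by blast
  then have "s0 = of_int n" by simp
  then have "0 < real_of_int n" "real_of_int n < 1" using s0(1) assms by auto
  then show False by simp
 qed
 then have m: "m > 0" by (simp add: m_def)
 have "fejer M s <= (4 / m\<^sup>2) / real M" if "M > 0" "s \<in> {\<delta>..1 - \<delta>}" for M s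
 proof -
  let ?w = "cis (2*pi * s)"
  have "norm (1 - ?w) * norm (\<Sum>j<M. ?w ^ j) = norm (1 - ?w ^ M)"
   by (simp add: one_diff_power_eq norm_mult)
  also have "\<dots> <= 2" using norm_triangle_ineq4[of 1 "?w ^ M"] by (simp add: norm_power)
  finally have "m * norm (\<Sum>j<M. ?w ^ j) <= 2"
   using mult_right_mono[OF s0(2)[OF that(2)], of "norm (\<Sum>j<M. ?w ^ j)"] by (simp add: m_def)
  then have "norm (\<Sum>j<M. ?w ^ j) <= 2 / m" using m by (simp add: field_simps)
  then have "(norm (\<Sum>j<M. ?w ^ j))\<^sup>2 <= (2 / m)\<^sup>2" by (rule power_mono) simp
  then have "(norm (\<Sum>j<M. ?w ^ j))\<^sup>2 / real M <= (2 / m)\<^sup>2 / real M" by (rule divide_right_mono) simp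
  then show ?thesis by (simp add: fejer_cis power_divide)
 qed
 then show ?thesis by blast
qed

definition fejer_mean :: "nat \<Rightarrow> (real \<Rightarrow> 'a::euclidean_space) \<Rightarrow> real \<Rightarrow> 'a" where
 "fejer_mean M f t = integral {0..1} (%s. fejer M s *\<^sub>R f (t - s))"

lemma periodic_bounded:
 fixes f :: "real \<Rightarrow> 'a::euclidean_space"
 assumes c: "continuous_on UNIV f" and p: "!!t. f (t + 1) = f t"
 obtains B where "0 < B" "!!t. norm (f t) <= B"
proof -
 have "bounded (f ` {0..1})"
  by (intro compact_imp_bounded compact_continuous_image continuous_on_subset[OF c]) auto
 then obtain B where B: "!!t. t \<in> {0..1} ==> norm (f t) <= B" unfolding bounded_iff by blast
 have "norm (f t) <= max B 1" for t
  using B[of "frac t"] periodic_frac[of f, OF p, of t] frac_lt_1[of t] by (auto simp: le_max_iff_disj)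
 then show thesis using that[of "max B 1"] by auto
qed

text \<open>The kernel is an approximate identity: it is nonnegative, has mass one, and is O(1/M)
  off the integers. The part with s near 1 is shifted to s near 0 by periodicity.\<close>

lemma fejer_mean_tendsto:
 fixes f :: "real \<Rightarrow> 'a::euclidean_space"
 assumes c: "continuous_on UNIV f" and p: "!!t. f (t + 1) = f t" and e: "0 < e"
 shows "\<exists>M0. \<forall>M>M0. \<forall>t. norm (fejer_mean M f t - f t) <= e"
proof -
 obtain B where B: "0 < B" "!!t. norm (f t) <= B" using periodic_bounded[OF c p] by blast
 have "uniformly_continuous_on {-1..2} f"
  by (intro compact_uniformly_continuous continuous_on_subset[OF c]) auto
 then obtain d where d: "d > 0" "!!u v. u \<in> {-1..2} ==> v \<in> {-1..2} ==> dist v u < d ==> dist (f v) (f u) < e/2"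
  using e unfolding uniformly_continuous_on_def by (metis half_gt_zero)
 define \<delta> where "\<delta> = min (d/2) (1/2)"
 have \<delta>: "0 < \<delta>" "\<delta> <= 1/2" "\<delta> < d" using d(1) by (auto simp: \<delta>_def)
 have near: "norm (f (t - s) - f t) <= e/2" if "\<bar>s\<bar> <= \<delta>" for t s
 proof -
  have "f (frac t - s) = f (t - s)" using periodic_of_int[of f, OF p, of "frac t - s" "\<lfloor>t\<rfloor>"] by (simp add: frac_def)
  moreover have "f (frac t) = f t" by (rule periodic_frac[of f, OF p])
  moreover have "dist (f (frac t - s)) (f (frac t)) < e/2"
   using that \<delta> frac_lt_1[of t] frac_ge_0[of t] by (intro d(2)) (auto simp: dist_real_def abs_le_iff simp del: frac_ge_0)
  ultimately show ?thesis by (simp add: dist_norm)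
 qed
 obtain C where C: "!!M s. M > 0 ==> s \<in> {\<delta>..1 - \<delta>} ==> fejer M s <= C / real M"
  using fejer_small[OF \<delta>(1,2)] by blast
 obtain M0 :: nat where M0: "2 * B * \<bar>C\<bar> < real M0 * (e/2)"
  using reals_Archimedean3[of "e/2"] e by (meson half_gt_zero)
 have "norm (fejer_mean M f t - f t) <= e" if M: "M > M0" for M t
 proof -
  have M': "M > 0" using M by simp
  have cf: "continuous_on {0..1} (%s. f (t - s))"
   by (rule continuous_on_compose2[OF c]) (auto intro!: continuous_intros)
  have a1: "((%s. fejer M s *\<^sub>R f (t - s) - fejer M s *\<^sub>R f t) has_integral (fejer_mean M f t - 1 *\<^sub>R f t)) {0..1}"
   unfolding fejer_mean_def
   by (intro has_integral_diff has_integral_scaleR_left fejer_integral M' integrable_integral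
      integrable_continuous_real continuous_intros cf)
  have a2: "((%s. fejer M s * (e/2) + 2 * B * \<bar>C\<bar> / M) has_integral (1 * (e/2) + 2 * B * \<bar>C\<bar> / M)) {0..1}"
   using has_integral_const_real[of "2 * B * \<bar>C\<bar> / M" 0 1]
   by (intro has_integral_add has_integral_mult_left fejer_integral M') auto
  have a3: "norm (fejer M s *\<^sub>R f (t - s) - fejer M s *\<^sub>R f t) <= fejer M s * (e/2) + 2 * B * \<bar>C\<bar> / M"
   if s: "s \<in> {0..1}" for s
  proof -
   have eq: "norm (fejer M s *\<^sub>R f (t - s) - fejer M s *\<^sub>R f t) = fejer M s * norm (f (t - s) - f t)"
    by (simp add: scaleR_diff_right[symmetric] fejer_nonneg)
   have pos: "0 <= fejer M s * (e/2)" "0 <= 2 * B * \<bar>C\<bar> / M" using fejer_nonneg e B by auto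
   consider "s \<in> {\<delta>..1 - \<delta>}" | "\<bar>s\<bar> <= \<delta>" | "\<bar>s - 1\<bar> <= \<delta>" using s by force
   then show ?thesis
   proof cases
    case 1
    have "norm (f (t - s) - f t) <= 2 * B" using norm_triangle_ineq4[of "f (t - s)" "f t"] B(2)[of t] B(2)[of "t - s"] by linarith
    then have "fejer M s * norm (f (t - s) - f t) <= (\<bar>C\<bar> / M) * (2 * B)"
     using C[OF M' 1] by (intro mult_mono fejer_nonneg order_trans[OF C[OF M' 1]] divide_right_mono) auto
    then show ?thesis using pos unfolding eq by (simp add: mult.commute)
   next
    case 2
    then have "fejer M s * norm (f (t - s) - f t) <= fejer M s * (e/2)"
     by (intro mult_left_mono near fejer_nonneg)
    then show ?thesis using pos unfolding eq by linarith
   next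
    case 3
    have "f (t - s) = f (t - (s - 1))" using p[of "t - s"] by (simp add: algebra_simps)
    then have "fejer M s * norm (f (t - s) - f t) <= fejer M s * (e/2)"
     using near[OF 3, of t] by (intro mult_left_mono fejer_nonneg) auto
    then show ?thesis using pos unfolding eq by linarith
   qed
  qed
  have "norm (fejer_mean M f t - 1 *\<^sub>R f t) <= (1 * (e/2) + 2 * B * \<bar>C\<bar> / M) \<bullet> 1"
   by (rule has_integral_norm_bound_integral_component[OF a1 a2]) (use a3 in simp)
  then have "norm (fejer_mean M f t - f t) <= e/2 + 2 * B * \<bar>C\<bar> / M" by simp
  also have "2 * B * \<bar>C\<bar> / M <= e/2"
  proof -
   have "real M0 * (e/2) <= real M * (e/2)" using M e by (intro mult_right_mono) auto
   then show ?thesis using M0 M' by (simp add: pos_divide_le_eq mult.commute)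
  qed
  finally show ?thesis by simp
 qed
 then show ?thesis by blast
qed

lemma fejer_mean_convolution:
 fixes f :: "real \<Rightarrow> 'a::euclidean_space"
 assumes c: "continuous_on UNIV f" and p: "!!t. f (t + 1) = f t"
 shows "fejer_mean M f t = integral {0..1} (%s. fejer M (t - s) *\<^sub>R f s)"
proof -
 let ?h = "%s. fejer M s *\<^sub>R f (t - s)"
 have ch: "continuous_on UNIV ?h"
  by (intro continuous_intros continuous_on_compose2[OF c]) auto
 have ph: "?h (s + 1) = ?h s" for s
 proof -
  have "t - (s + 1) + 1 = t - s" by simp
  then show ?thesis using p[of "t - (s + 1)"] fejer_periodic[of M s] by simp
 qed
 show ?thesis unfolding fejer_mean_def using integral_reflect_periodic[OF ch ph, of t] by simp
qed

text \<open>All Fejer means of f coincide with its mean value, because only frequency 0 contributes;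
  on the other hand they converge to f.\<close>

lemma fourier_unique:
 fixes f :: "real \<Rightarrow> 'a::euclidean_space"
 assumes c: "continuous_on UNIV f" and p: "!!t. f (t + 1) = f t"
  and cos0: "!!k::int. k ~= (0::int) ==> integral {0..1} (%s. cos (2*pi*k * s) *\<^sub>R f s) = 0"
  and sin0: "!!k::int. k ~= (0::int) ==> integral {0..1} (%s. sin (2*pi*k * s) *\<^sub>R f s) = 0"
 shows "f t = integral {0..1} f"
proof -
 have cf: "continuous_on {0..1} f" by (rule continuous_on_subset[OF c]) simp
 have fm: "fejer_mean M f t = integral {0..1} f" if "M > 0" for M
 proof -
  have 1: "((%s. cos (2*pi*k*(t - s)) *\<^sub>R f s) has_integral (if k = 0 then integral {0..1} f else 0)) {0..1}" for k :: int
  proof (cases "k = 0")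
   case True then show ?thesis using integrable_continuous_real[OF cf] by (simp add: integrable_integral)
  next
   case False
   have "((%s. cos (2*pi*k*t) *\<^sub>R (cos (2*pi*k * s) *\<^sub>R f s) + sin (2*pi*k*t) *\<^sub>R (sin (2*pi*k * s) *\<^sub>R f s))
     has_integral (cos (2*pi*k*t) *\<^sub>R 0 + sin (2*pi*k*t) *\<^sub>R 0)) {0..1}"
    using cos0[OF False] sin0[OF False]
    by (intro has_integral_add has_integral_cmul)
     (auto simp: has_integral_iff intro!: integrable_continuous_real continuous_intros cf)
   then show ?thesis using False by (simp add: cos_diff right_diff_distrib scaleR_add_left)
  qed
  have h1: "((%s. inverse (real M) *\<^sub>R (\<Sum>j<M. \<Sum>l<M. cos (2*pi*(int j - int l)*(t - s)) *\<^sub>R f s)) has_integral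
    inverse (real M) *\<^sub>R (\<Sum>j<M. \<Sum>l<M. if int j - int l = 0 then integral {0..1} f else 0)) {0..1}"
   by (intro has_integral_cmul has_integral_sum 1) auto
  have h2: "(\<Sum>j<M. \<Sum>l<M. if int j - int l = 0 then integral {0..1} f else 0) = real M *\<^sub>R integral {0..1} f"
  proof -
   have "(\<Sum>j<M. \<Sum>l<M. if int j - int l = 0 then integral {0..1} f else 0) = (\<Sum>j<M. \<Sum>l<M. if j = l then integral {0..1} f else 0)"
    by (intro sum.cong refl) auto
   then show ?thesis by (simp add: sum_constant_scaleR)
  qed
  have h3: "fejer M u *\<^sub>R z = inverse (real M) *\<^sub>R (\<Sum>j<M. \<Sum>l<M. cos (2*pi*(int j - int l)*u) *\<^sub>R z)" for u and z :: 'a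
   by (simp add: fejer_def divide_inverse mult.commute[of _ "inverse _"] scaleR_sum_left scaleR_scaleR[symmetric] del: scaleR_scaleR)
  have "((%s. fejer M (t - s) *\<^sub>R f s) has_integral integral {0..1} f) {0..1}"
   using h1 that unfolding h2 h3 by simp
  then show ?thesis unfolding fejer_mean_convolution[OF c p] by (rule integral_unique)
 qed
 have le: "norm (integral {0..1} f - f t) <= 0 + e" if e: "0 < e" for e
 proof -
  obtain M0 where "\<forall>M>M0. \<forall>t. norm (fejer_mean M f t - f t) <= e" using fejer_mean_tendsto[OF c p e] by blast
  then have "norm (fejer_mean (Suc M0) f t - f t) <= e" by blast
  then show ?thesis using fm[of "Suc M0"] by simp
 qed
 have "norm (integral {0..1} f - f t) <= 0" by (rule field_le_epsilon[OF le])
 then show ?thesis by simp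
qed

section \<open>Brake loops and the passage from weak to strong solutions\<close>

text \<open>Period one and the standard involution (q, p) to (q, -p). A general involution is
  brought to this form by \<open>symplectic_coordinates\<close>.\<close>

definition brake_loop :: "(real \<Rightarrow> 'n::finite phase) \<Rightarrow> bool" where
 "brake_loop f \<longleftrightarrow> continuous_on UNIV f \<and> (\<forall>t. f (t + 1) = f t) \<and> (\<forall>t. f (- t) = (fst (f t), - snd (f t)))"

lemma cos_sin_periodic_int: "cos (2*pi*k*(t + 1)) = cos (2*pi*k*t)" "sin (2*pi*k*(t + 1)) = sin (2*pi*k*t)" for k :: int
proof -
 have "2*pi*k*(t + 1) = 2*pi*k*t + of_int k * (2*pi)" by (simp add: algebra_simps)
 then show "cos (2*pi*k*(t + 1)) = cos (2*pi*k*t)" "sin (2*pi*k*(t + 1)) = sin (2*pi*k*t)"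
  using cos.plus_of_int[of "2*pi*k*t" k] sin.plus_of_int[of "2*pi*k*t" k]
  by (simp_all only: of_real_eq_id id_apply)
qed

lemma has_integral_Pair:
 fixes f :: "'a::euclidean_space \<Rightarrow> 'b::real_normed_vector" and g :: "'a \<Rightarrow> 'c::real_normed_vector"
 assumes "(f has_integral a) S" "(g has_integral b) S"
 shows "((%x. (f x, g x)) has_integral (a, b)) S"
proof -
 have l: "bounded_linear (%x::'b. (x, 0::'c))" "bounded_linear (%y::'c. (0::'b, y))"
  by (intro bounded_linear_Pair bounded_linear_ident bounded_linear_zero)+
 have "((%x. (f x, 0) + (0, g x)) has_integral (a, 0) + (0, b)) S"
  using has_integral_linear[OF assms(1) l(1)] has_integral_linear[OF assms(2) l(2)]
  unfolding o_def by (rule has_integral_add)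
 then show ?thesis by simp
qed

lemma bounded_linear_J0: "bounded_linear J0"
 unfolding J0_def[abs_def]
 by (intro bounded_linear_Pair bounded_linear_minus bounded_linear_fst bounded_linear_snd)

lemma J0_zero [simp]: "J0 0 = 0"
 by (simp add: J0_def zero_prod_def)

text \<open>The q-part is even and the p-part odd, so two of the four real Fourier integrals vanish.
  The other two are half the sum and half the difference of the coefficients at k and -k.\<close>

lemma brake_loop_coef:
 fixes f :: "real \<Rightarrow> 'n::finite phase"
 assumes f: "brake_loop f"
 shows "((%s. cos (2*pi*k* s) *\<^sub>R f s) has_integral (1/2) *\<^sub>R (coef f k + coef f (- k), 0)) {0..1}"
  and "((%s. sin (2*pi*k* s) *\<^sub>R f s) has_integral (1/2) *\<^sub>R (0, coef f k - coef f (- k))) {0..1}"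
proof -
 have c: "continuous_on S f" for S using f by (auto simp: brake_loop_def intro: continuous_on_subset)
 have p: "f (t + 1) = f t" and r: "f (- t) = (fst (f t), - snd (f t))" for t using f by (auto simp: brake_loop_def)
 let ?C = "integral {0..1} (%s. cos (2*pi*k* s) *\<^sub>R fst (f s))" and ?S = "integral {0..1} (%s. sin (2*pi*k* s) *\<^sub>R snd (f s))"
 have i: "(%s. cos (2*pi*k* s) *\<^sub>R fst (f s)) integrable_on {0..1}" "(%s. sin (2*pi*k* s) *\<^sub>R snd (f s)) integrable_on {0..1}"
  "(%s. sin (2*pi*k* s) *\<^sub>R fst (f s)) integrable_on {0..1}" "(%s. cos (2*pi*k* s) *\<^sub>R snd (f s)) integrable_on {0..1}"
  by (intro integrable_continuous_real continuous_intros c)+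
 have o1: "integral {0..1} (%s. sin (2*pi*k* s) *\<^sub>R fst (f s)) = 0"
 proof (rule integral_odd_periodic)
  show "continuous_on UNIV (%s. sin (2*pi*k* s) *\<^sub>R fst (f s))" by (intro continuous_intros c)
  show "sin (2*pi*k*(t + 1)) *\<^sub>R fst (f (t + 1)) = sin (2*pi*k*t) *\<^sub>R fst (f t)" for t
   by (simp only: cos_sin_periodic_int p)
 qed (simp add: r)
 have o2: "integral {0..1} (%s. cos (2*pi*k* s) *\<^sub>R snd (f s)) = 0"
 proof (rule integral_odd_periodic)
  show "continuous_on UNIV (%s. cos (2*pi*k* s) *\<^sub>R snd (f s))" by (intro continuous_intros c)
  show "cos (2*pi*k*(t + 1)) *\<^sub>R snd (f (t + 1)) = cos (2*pi*k*t) *\<^sub>R snd (f t)" for t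
   by (simp only: cos_sin_periodic_int p)
 qed (simp add: r)
 have ck: "coef f k = ?C + ?S" "coef f (- k) = ?C - ?S"
  unfolding coef_def modeT_def
  using integral_add[OF i(1,2)] integral_diff[OF i(1,2)] by simp_all
 have "((%s. (cos (2*pi*k* s) *\<^sub>R fst (f s), cos (2*pi*k* s) *\<^sub>R snd (f s))) has_integral (?C, 0)) {0..1}"
  using i o1 o2 by (intro has_integral_Pair) (auto simp: has_integral_iff)
 then show "((%s. cos (2*pi*k* s) *\<^sub>R f s) has_integral (1/2) *\<^sub>R (coef f k + coef f (- k), 0)) {0..1}"
  by (simp add: ck scaleR_prod_def scaleR_2[symmetric])
 have "((%s. (sin (2*pi*k* s) *\<^sub>R fst (f s), sin (2*pi*k* s) *\<^sub>R snd (f s))) has_integral (0, ?S)) {0..1}"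
  using i o1 o2 by (intro has_integral_Pair) (auto simp: has_integral_iff)
 then show "((%s. sin (2*pi*k* s) *\<^sub>R f s) has_integral (1/2) *\<^sub>R (0, coef f k - coef f (- k))) {0..1}"
  by (simp add: ck scaleR_prod_def scaleR_2[symmetric])
qed

lemma brake_loop_unique:
 fixes f :: "real \<Rightarrow> 'n::finite phase"
 assumes f: "brake_loop f" and z: "!!k. k ~= 0 ==> coef f k = 0"
 shows "f t = f 0"
proof -
 have "f t = integral {0..1} f" for t
 proof (rule fourier_unique)
  show "continuous_on UNIV f" "!!t. f (t + 1) = f t" using f by (auto simp: brake_loop_def)
  fix k :: int assume "k ~= 0"
  then show "integral {0..1} (%s. cos (2*pi*k* s) *\<^sub>R f s) = 0" "integral {0..1} (%s. sin (2*pi*k* s) *\<^sub>R f s) = 0"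
   using brake_loop_coef[OF f, of k, THEN integral_unique] z by (simp_all add: zero_prod_def)
 qed
 then show ?thesis by metis
qed

lemma fejer_mean_brake_loop:
 fixes f :: "real \<Rightarrow> 'n::finite phase"
 assumes f: "brake_loop f"
 shows "\<exists>d. \<forall>t. fejer_mean M f t = trig M d t"
proof -
 have c: "continuous_on UNIV f" and p: "!!t. f (t + 1) = f t" using f by (auto simp: brake_loop_def)
 have tm: "((%s. cos (2*pi*k*(t - s)) *\<^sub>R f s) has_integral
   (1/2) *\<^sub>R (mode k t (coef f k) + mode (- k) t (coef f (- k)))) {0..1}" for k t
 proof -
  have "((%s. cos (2*pi*k*t) *\<^sub>R (cos (2*pi*k* s) *\<^sub>R f s) + sin (2*pi*k*t) *\<^sub>R (sin (2*pi*k* s) *\<^sub>R f s)) has_integral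
    cos (2*pi*k*t) *\<^sub>R ((1/2) *\<^sub>R (coef f k + coef f (- k), 0)) + sin (2*pi*k*t) *\<^sub>R ((1/2) *\<^sub>R (0, coef f k - coef f (- k)))) {0..1}"
   by (intro has_integral_add has_integral_cmul brake_loop_coef f)
  moreover have "cos (2*pi*k*t) *\<^sub>R ((1/2) *\<^sub>R (coef f k + coef f (- k), 0)) + sin (2*pi*k*t) *\<^sub>R ((1/2) *\<^sub>R (0, coef f k - coef f (- k)))
    = (1/2) *\<^sub>R (mode k t (coef f k) + mode (- k) t (coef f (- k)))"
   by (simp add: mode_def prod_eq_iff algebra_simps)
  ultimately show ?thesis by (simp add: cos_diff right_diff_distrib scaleR_add_left)
 qed
 \<comment> \<open>The Fejer weight 1 - |k| / M is left in the form of a count of the pairs with j -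
   l = k.\<close>
 define d where "d k = inverse (real M) *\<^sub>R (\<Sum>j<M. \<Sum>l<M. if int j - int l = k then coef f k else 0)" for k
 have "fejer_mean M f t = trig M d t" for t
 proof -
  let ?m = "%k. mode k t (coef f k)"
  have "((%s. inverse (real M) *\<^sub>R (\<Sum>j<M. \<Sum>l<M. cos (2*pi*(int j - int l)*(t - s)) *\<^sub>R f s)) has_integral
    inverse (real M) *\<^sub>R (\<Sum>j<M. \<Sum>l<M. (1/2) *\<^sub>R (?m (int j - int l) + ?m (- (int j - int l))))) {0..1}"
   by (intro has_integral_cmul has_integral_sum tm) auto
  moreover have "fejer M u *\<^sub>R z = inverse (real M) *\<^sub>R (\<Sum>j<M. \<Sum>l<M. cos (2*pi*(int j - int l)*u) *\<^sub>R z)" for u and z :: "'n phase"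
   by (simp add: fejer_def divide_inverse mult.commute[of _ "inverse _"] scaleR_sum_left scaleR_scaleR[symmetric] del: scaleR_scaleR)
  ultimately have "fejer_mean M f t = inverse (real M) *\<^sub>R (\<Sum>j<M. \<Sum>l<M. (1/2) *\<^sub>R (?m (int j - int l) + ?m (- (int j - int l))))"
   unfolding fejer_mean_convolution[OF c p] by (simp only: integral_unique)
  also have "(\<Sum>j<M. \<Sum>l<M. (1/2) *\<^sub>R (?m (int j - int l) + ?m (- (int j - int l))))
    = (1/2) *\<^sub>R ((\<Sum>j<M. \<Sum>l<M. ?m (int j - int l)) + (\<Sum>j<M. \<Sum>l<M. ?m (int l - int j)))"
   by (simp add: scaleR_sum_right sum.distrib scaleR_add_right)
  \<comment> \<open>The difference j - l takes each frequency as often as its negative, so averaging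
    over k and -k changes nothing in the sum.\<close>
  also have "(\<Sum>j<M. \<Sum>l<M. ?m (int l - int j)) = (\<Sum>j<M. \<Sum>l<M. ?m (int j - int l))"
   by (rule sum.swap)
  also have "(\<Sum>j<M. \<Sum>l<M. ?m (int j - int l)) = (\<Sum>j<M. \<Sum>l<M. \<Sum>k\<in>freqs M. if int j - int l = k then ?m k else 0)"
   by (intro sum.cong refl) (auto simp: freqs_def)
  also have "\<dots> = (\<Sum>j<M. \<Sum>k\<in>freqs M. \<Sum>l<M. if int j - int l = k then ?m k else 0)"
   by (rule sum.cong[OF refl], rule sum.swap)
  also have "\<dots> = (\<Sum>k\<in>freqs M. \<Sum>j<M. \<Sum>l<M. if int j - int l = k then ?m k else 0)"
   by (rule sum.swap)
  also have "\<dots> = (\<Sum>k\<in>freqs M. mode k t (\<Sum>j<M. \<Sum>l<M. if int j - int l = k then coef f k else 0))"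
   by (intro sum.cong refl) (simp add: linear_sum[OF mode_linear] if_distrib linear_0[OF mode_linear] cong: if_cong)
  also have "inverse (real M) *\<^sub>R ((1/2) *\<^sub>R (\<dots> + \<dots>)) = trig M d t"
   by (simp add: trig_def d_def linear_scale[OF mode_linear] scaleR_sum_right[symmetric] scaleR_2[symmetric])
  finally show ?thesis .
 qed
 then show ?thesis by blast
qed

lemma antiderivative_UNIV:
 fixes u :: "real \<Rightarrow> 'a::euclidean_space"
 assumes "continuous_on UNIV u"
 obtains W where "W 0 = 0" "!!t. (W has_vector_derivative u t) (at t)"
proof -
 have "((%v. LBINT y=(0::real)..v. u y) has_vector_derivative u t) (at t)" for t
 proof -
  have "((%v. LBINT y=(0::real)..v. u y) has_vector_derivative u t) (at t within {- \<bar>t\<bar> - 1..\<bar>t\<bar> + 1})"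
   by (rule interval_integral_FTC2) (auto intro: continuous_on_subset[OF assms])
  then show ?thesis by (subst (asm) at_within_interior) auto
 qed
 then show thesis by (rule that[rotated]) simp
qed

lemma vector_derivative_eq_imp_const:
 fixes f g :: "real \<Rightarrow> 'a::real_normed_vector"
 assumes "!!t. (f has_vector_derivative u t) (at t)" "!!t. (g has_vector_derivative u t) (at t)"
 shows "f t - g t = f s - g s"
proof -
 have "((%t. f t - g t) has_derivative (%h. 0)) (at t within UNIV)" for t
  using has_vector_derivative_diff[OF assms, of t] by (simp add: has_vector_derivative_def)
 then obtain c where "!!t. f t - g t = c"
  using has_derivative_zero_constant[of UNIV "%t. f t - g t"] by auto
 then show ?thesis by simp
qed

text \<open>A brake loop satisfying Hamilton's equation in the weak sense, that is in terms of Fourier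
 coefficients, satisfies it pointwise.\<close>

lemma weak_imp_strong:
 fixes x g :: "real \<Rightarrow> 'n::finite phase"
 assumes x: "brake_loop x" and g: "brake_loop g"
  and weak: "!!k. (2*pi*k) *\<^sub>R coef x k = coef g k"
 shows "(x has_vector_derivative J0 (g t)) (at t)"
proof -
 have cg: "continuous_on S g" for S using g by (auto simp: brake_loop_def intro: continuous_on_subset)
 have pg: "g (t + 1) = g t" and rg: "g (- t) = (fst (g t), - snd (g t))" for t using g by (auto simp: brake_loop_def)
 have cJ: "continuous_on UNIV (%t. J0 (g t))" unfolding J0_def by (intro continuous_intros cg)
 obtain W where W: "W 0 = 0" "!!t. (W has_vector_derivative J0 (g t)) (at t)"
  using antiderivative_UNIV[OF cJ] by blast
 have cW: "continuous_on S W" for S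
  by (meson W(2) continuous_at_imp_continuous_on has_vector_derivative_continuous)
 \<comment> \<open>The weak equation at frequency 0 says that g has mean zero; this is what makes
   the primitive W of \<open>J0 g\<close> periodic.\<close>
 have "(g has_integral 0) {0..1}"
  using brake_loop_coef(1)[OF g, of 0] weak[of 0] by (simp add: zero_prod_def)
 then have g0: "((%t. J0 (g t)) has_integral 0) {0..1}"
  using has_integral_linear[OF _ bounded_linear_J0, of g 0 "{0..1}"]
  by (simp add: o_def)
 have "((%t. J0 (g t)) has_integral (W 1 - W 0)) {0..1}"
  by (intro fundamental_theorem_of_calculus) (auto intro: has_vector_derivative_at_within W(2))
 from has_integral_unique[OF this g0] have W1: "W 1 = W 0" by simp
 have "((%t. W (t + 1)) has_vector_derivative J0 (g t)) (at t)" for t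
 proof -
  have "((%t. t + 1) has_vector_derivative 1) (at t)" by (auto intro!: derivative_eq_intros simp: has_vector_derivative_def)
  from vector_diff_chain_at[OF this W(2)] show ?thesis by (simp add: o_def pg)
 qed
 from vector_derivative_eq_imp_const[OF this W(2), of _ 0] have pW: "W (t + 1) = W t" for t
  using W1 by (metis add_0 diff_self eq_iff_diff_eq_0)
 have "((%t. (fst (W (- t)), - snd (W (- t)))) has_vector_derivative J0 (g t)) (at t)" for t
 proof -
  have "((%t. - t) has_vector_derivative - 1) (at t)" by (auto intro!: derivative_eq_intros simp: has_vector_derivative_def)
  from vector_diff_chain_at[OF this W(2)] have d: "((%t. W (- t)) has_vector_derivative - J0 (g (- t))) (at t)" by (simp add: o_def)
  have "((%t. (fst (W (- t)), - snd (W (- t)))) has_vector_derivative (fst (- J0 (g (- t))), - snd (- J0 (g (- t))))) (at t)"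
   using bounded_linear.has_vector_derivative[OF bounded_linear_fst d] bounded_linear.has_vector_derivative[OF bounded_linear_snd d]
   by (intro has_vector_derivative_Pair has_vector_derivative_minus)
  then show ?thesis by (simp add: rg J0_def)
 qed
 from vector_derivative_eq_imp_const[OF this W(2), of _ 0] have "(fst (W (- t)), - snd (W (- t))) = W t" for t
  using W(1) by (metis diff_self eq_iff_diff_eq_0 fst_zero minus_zero neg_equal_0_iff_equal snd_zero zero_prod_def)
 then have rW: "W (- t) = (fst (W t), - snd (W t))" for t by (metis fst_conv minus_minus prod.collapse snd_conv)
 have bW: "brake_loop W" using cW pW rW by (simp add: brake_loop_def)
 \<comment> \<open>Integration by parts gives W the same equation as x at every nonzero frequency.
   Hence x - W is a brake loop without nonzero frequencies, that is, a constant.\<close>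
 have cfW: "coef W k = coef x k" if k: "k ~= 0" for k
 proof -
  let ?F = "%t. sin (2*pi*k*t) *\<^sub>R fst (W t) - cos (2*pi*k*t) *\<^sub>R snd (W t)"
  have "(?F has_vector_derivative ((2*pi*k) *\<^sub>R modeT k t (W t) - modeT k t (g t))) (at t)" for t
  proof -
   have s: "((%t. sin (2*pi*k*t)) has_real_derivative cos (2*pi*k*t) * (2*pi*k)) (at t)"
    "((%t. cos (2*pi*k*t)) has_real_derivative - (sin (2*pi*k*t) * (2*pi*k))) (at t)"
    by (auto intro!: derivative_eq_intros)
   note d = bounded_linear.has_vector_derivative[OF bounded_linear_fst W(2)[of t]] bounded_linear.has_vector_derivative[OF bounded_linear_snd W(2)[of t]]
   from has_vector_derivative_diff[OF has_vector_derivative_scaleR[OF s(1) d(1)] has_vector_derivative_scaleR[OF s(2) d(2)]]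
   show ?thesis by (rule has_vector_derivative_eq_rhs) (simp add: modeT_def J0_def algebra_simps)
  qed
  then have i1: "((%t. (2*pi*k) *\<^sub>R modeT k t (W t) - modeT k t (g t)) has_integral (?F 1 - ?F 0)) {0..1}"
   by (intro fundamental_theorem_of_calculus) (auto intro: has_vector_derivative_at_within)
  have i2: "((%t. (2*pi*k) *\<^sub>R modeT k t (W t) - modeT k t (g t)) has_integral ((2*pi*k) *\<^sub>R coef W k - coef g k)) {0..1}"
   unfolding coef_def
   by (intro has_integral_diff has_integral_cmul integrable_integral integrable_continuous_real continuous_intros cW cg)
  have "?F 1 = ?F 0" using pW[of 0] cos_sin_periodic_int[of k 0] by simp
  then have "(2*pi*k) *\<^sub>R coef W k = coef g k"
   using has_integral_unique[OF i1 i2] by simp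
  then show ?thesis using weak[of k] k by (metis mult_eq_0_iff of_int_eq_0_iff pi_neq_zero real_vector.scale_cancel_left zero_neq_numeral)
 qed
 have cx: "continuous_on S x" for S using x by (auto simp: brake_loop_def intro: continuous_on_subset)
 have "brake_loop (%t. x t - W t)"
  using x bW by (auto simp: brake_loop_def intro!: continuous_intros)
 moreover have "coef (%t. x t - W t) k = 0" if "k ~= 0" for k
  using coef_diff[OF cx cW, of k] cfW[OF that] by simp
 ultimately have eq: "x s - W s = x 0 - W 0" for s using brake_loop_unique[of "%t. x t - W t"] by blast
 have "x = (%t. W t + x 0)"
 proof
  fix s show "x s = W s + x 0" using eq[of s] unfolding W(1) by (simp only: diff_eq_eq diff_zero add.commute)
 qed
 then show ?thesis using has_vector_derivative_add[OF W(2) has_vector_derivative_const[of "x 0"]] by simp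
qed

section \<open>A priori bounds and compactness of almost critical loops\<close>

lemma has_integral_unit_const: "((%t. c) has_integral c) {0..1::real}"
 using has_integral_const_real[of c 0 1] by simp

lemma norm_J0 [simp]: "norm (J0 z) = norm z"
 by (simp add: J0_def norm_prod_def add.commute)

lemma ip_add_le: "ip N (%k. a k + b k) (%k. a k + b k) <= 2 * ip N a a + 2 * ip N b b"
proof -
 have "(u + v) \<bullet> (u + v) <= 2 * (u \<bullet> u) + 2 * (v \<bullet> v)" for u v :: "real^'n"
  using inner_ge_zero[of "u - v"] by (simp add: inner_simps inner_commute)
 then have "ip N (%k. a k + b k) (%k. a k + b k) <= (\<Sum>k\<in>freqs N. 2 * (a k \<bullet> a k) + 2 * (b k \<bullet> b k))"
  unfolding ip_def by (intro sum_mono)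
 then show ?thesis by (simp add: ip_def sum.distrib sum_distrib_left)
qed

lemma ip_le:
 assumes "0 < \<delta>" "0 < R" "ip N a a <= \<delta>\<^sup>2" "ip N b b <= R\<^sup>2"
 shows "ip N a b <= \<delta> * R"
proof -
 have "u \<bullet> v <= (R / \<delta>) / 2 * (u \<bullet> u) + (\<delta> / R) / 2 * (v \<bullet> v)" for u v :: "real^'n"
 proof -
  have "0 <= (R *\<^sub>R u - \<delta> *\<^sub>R v) \<bullet> (R *\<^sub>R u - \<delta> *\<^sub>R v)" by simp
  then have "2 * (\<delta> * R) * (u \<bullet> v) <= R * R * (u \<bullet> u) + \<delta> * \<delta> * (v \<bullet> v)"
   by (simp add: inner_simps inner_commute algebra_simps)
  then show ?thesis using assms(1,2) by (simp add: field_simps)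
 qed
 then have "ip N a b <= (\<Sum>k\<in>freqs N. (R / \<delta>) / 2 * (a k \<bullet> a k) + (\<delta> / R) / 2 * (b k \<bullet> b k))"
  unfolding ip_def by (intro sum_mono)
 also have "\<dots> = (R / \<delta>) / 2 * ip N a a + (\<delta> / R) / 2 * ip N b b"
  by (simp add: ip_def sum.distrib sum_distrib_left)
 also have "\<dots> <= (R / \<delta>) / 2 * \<delta>\<^sup>2 + (\<delta> / R) / 2 * R\<^sup>2"
  using assms by (intro add_mono mult_left_mono) auto
 also have "\<dots> = \<delta> * R" using assms by (simp add: power2_eq_square)
 finally show ?thesis .
qed

text \<open>The speed is at most e / 2 * speed^2 + 1 / (2 * e). With e = sqrt (t - s) the integral
  over [s, t] has the Hoelder exponent 1/2, and no root of the velocity integral is taken.\<close>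

lemma trig_hoelder:
 fixes c :: "int \<Rightarrow> real^'n::finite"
 assumes st: "0 <= s" "s <= t" "t <= 1"
 shows "norm (trig N c t - trig N c s) <= sqrt (t - s) * (ip N (%k. (2*pi*k) *\<^sub>R c k) (%k. (2*pi*k) *\<^sub>R c k) + 1) / 2"
proof (cases "s = t")
 case False
 let ?d = "%k. (2*pi*k) *\<^sub>R c k"
 let ?V = "ip N ?d ?d"
 define e where "e = sqrt (t - s)"
 have e: "e > 0" "e * e = t - s" using False st by (auto simp: e_def)
 have "((%u. J0 (trig N ?d u)) has_integral (trig N c t - trig N c s)) {s..t}"
  by (intro fundamental_theorem_of_calculus st trig_has_vector_derivative)
 moreover have "((%u. e / 2 * (trig N ?d u \<bullet> trig N ?d u) + 1 / (2*e)) has_integral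
   (e / 2 * integral {s..t} (%u. trig N ?d u \<bullet> trig N ?d u) + (t - s) * (1 / (2*e)))) {s..t}"
  using has_integral_const_real[of "1 / (2*e)" s t] st
  by (intro has_integral_add has_integral_mult_right integrable_integral integrable_continuous_real continuous_intros) auto
 moreover have "norm (J0 (trig N ?d u)) <= (e / 2 * (trig N ?d u \<bullet> trig N ?d u) + 1 / (2*e)) \<bullet> 1" for u
 proof -
  let ?n = "norm (trig N ?d u)"
  have "0 <= (e * ?n - 1)\<^sup>2" by simp
  then have "2 * e * ?n <= e * e * (?n * ?n) + 1" by (simp add: power2_eq_square algebra_simps)
  then have "?n <= (e * e * (?n * ?n) + 1) / (2 * e)" using e(1) by (simp add: pos_le_divide_eq mult.commute)
  also have "\<dots> = e / 2 * (?n * ?n) + 1 / (2*e)" using e(1) by (simp add: add_divide_distrib)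
  finally show ?thesis by (simp add: dot_square_norm power2_eq_square)
 qed
 ultimately have "norm (trig N c t - trig N c s) <= (e / 2 * integral {s..t} (%u. trig N ?d u \<bullet> trig N ?d u) + (t - s) * (1 / (2*e))) \<bullet> 1"
  by (rule has_integral_norm_bound_integral_component)
 also have "\<dots> = e / 2 * integral {s..t} (%u. trig N ?d u \<bullet> trig N ?d u) + e / 2"
  using e by (simp add: e(2)[symmetric])
 also have "integral {s..t} (%u. trig N ?d u \<bullet> trig N ?d u) <= integral {0..1} (%u. trig N ?d u \<bullet> trig N ?d u)"
  by (rule integral_subset_le) (use st in \<open>auto intro!: integrable_continuous_real continuous_intros\<close>)
 also have "\<dots> = ?V" by (rule integral_unique[OF trig_inner_trig])
 finally show ?thesis using e(1) by (simp add: e_def[symmetric] algebra_simps)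
qed simp

text \<open>The value at t differs from the value at s by a bounded amount, and averaging over s
  replaces the latter by the mean square.\<close>

lemma trig_sup_bound:
 fixes c :: "int \<Rightarrow> real^'n::finite"
 assumes t: "t \<in> {0..1}"
 shows "norm (trig N c t) <= (ip N c c + ip N (%k. (2*pi*k) *\<^sub>R c k) (%k. (2*pi*k) *\<^sub>R c k) + 2) / 2"
proof -
 let ?d = "%k. (2*pi*k) *\<^sub>R c k"
 let ?V = "ip N ?d ?d"
 have V: "0 <= ?V" by (rule ip_nonneg)
 have 1: "norm (trig N c t) <= (trig N c s \<bullet> trig N c s + 1) / 2 + (?V + 1) / 2" if s: "s \<in> {0..1}" for s
 proof -
  have "norm (trig N c t - trig N c s) <= (?V + 1) / 2"
  proof -
   have *: "norm (trig N c v - trig N c u) <= (?V + 1) / 2" if "0 <= u" "u <= v" "v <= 1" for u v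
   proof -
    have "sqrt (v - u) * ((?V + 1) / 2) <= 1 * ((?V + 1) / 2)" using that V by (intro mult_right_mono) auto
    then show ?thesis using trig_hoelder[OF that, of N c] by simp
   qed
   show ?thesis using *[of s t] *[of t s] s t by (cases "s <= t") (auto simp: norm_minus_commute)
  qed
  moreover have "norm (trig N c s) <= (trig N c s \<bullet> trig N c s + 1) / 2"
   using zero_le_power2[of "norm (trig N c s) - 1"] by (simp add: power2_diff dot_square_norm)
  ultimately show ?thesis using norm_triangle_sub[of "trig N c t" "trig N c s"] by linarith
 qed
 have 2: "((%s. (trig N c s \<bullet> trig N c s + 1) / 2 + (?V + 1) / 2) has_integral ((ip N c c + 1) / 2 + (?V + 1) / 2)) {0..1}"
  by (intro has_integral_unit_const has_integral_add has_integral_divide trig_inner_trig)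
 have 3: "((%s. norm (trig N c t)) has_integral norm (trig N c t)) {0..1::real}"
  by (rule has_integral_unit_const)
 from has_integral_le[OF 3 2 1] have "norm (trig N c t) <= (ip N c c + 1) / 2 + (?V + 1) / 2" by blast
 then show ?thesis by (simp add: add_divide_distrib)
qed

context lipschitz_hamiltonian
begin

text \<open>The velocity coefficient is the gradient plus the Fourier coefficient of
  \<open>gK\<close> along the loop. Bessel's inequality and linear growth of \<open>gK\<close> bound
  the latter, so a small gradient gives a Sobolev bound that is uniform in N.\<close>

lemma velocity_bound:
 fixes c :: "int \<Rightarrow> real^'n"
 shows "ip N (%k. (2*pi*k) *\<^sub>R c k) (%k. (2*pi*k) *\<^sub>R c k)
   <= 2 * ip N (gr N c) (gr N c) + 4 * (norm (gK 0))\<^sup>2 + 4 * Lp\<^sup>2 * ip N c c"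
proof -
 let ?g = "%t. gK (trig N c t)"
 have eq: "(%k. (2*pi*k) *\<^sub>R c k) = (%k. gr N c k + coef ?g k)" by (simp add: gr_def)
 have "ip N (coef ?g) (coef ?g) <= integral {0..1} (%t. ?g t \<bullet> ?g t)" by (rule bessel[OF cont_comp(2)])
 also have "\<dots> <= 2 * (norm (gK 0))\<^sup>2 + 2 * Lp\<^sup>2 * ip N c c"
 proof (rule has_integral_le)
  show "((%t. ?g t \<bullet> ?g t) has_integral integral {0..1} (%t. ?g t \<bullet> ?g t)) {0..1}"
   by (intro integrable_integral integrable_continuous_real continuous_intros cont_comp)
  show "((%t. 2 * (norm (gK 0))\<^sup>2 + 2 * Lp\<^sup>2 * (trig N c t \<bullet> trig N c t)) has_integral (2 * (norm (gK 0))\<^sup>2 + 2 * Lp\<^sup>2 * ip N c c)) {0..1}"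
   by (intro has_integral_unit_const has_integral_add has_integral_mult_right trig_inner_trig)
  fix t
  have "norm (?g t) <= norm (gK 0) + Lp * norm (trig N c t)"
   using lip[of "trig N c t" 0] norm_triangle_sub[of "?g t" "gK 0"] by simp
  then have "(norm (?g t))\<^sup>2 <= (norm (gK 0) + Lp * norm (trig N c t))\<^sup>2" by (rule power_mono) simp
  also have "\<dots> <= 2 * (norm (gK 0))\<^sup>2 + 2 * (Lp * norm (trig N c t))\<^sup>2"
   using zero_le_power2[of "norm (gK 0) - Lp * norm (trig N c t)"] unfolding power2_sum power2_diff by linarith
  finally show "?g t \<bullet> ?g t <= 2 * (norm (gK 0))\<^sup>2 + 2 * Lp\<^sup>2 * (trig N c t \<bullet> trig N c t)"
   by (simp add: dot_square_norm power_mult_distrib)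
 qed
 finally show ?thesis using ip_add_le[of N "gr N c" "coef ?g"] unfolding eq by simp
qed

text \<open>Half the derivative in the direction c removes the quadratic action. What remains is an
  integral over the values of the loop alone, whose sign and decay can be read off from K.\<close>

lemma Phi_eq:
 "Phi N c = ip N (gr N c) c / 2 + integral {0..1} (%t. (trig N c t \<bullet> gK (trig N c t)) / 2 - K (trig N c t))"
proof -
 have "((%t. (trig N c t \<bullet> gK (trig N c t)) / 2 - K (trig N c t)) has_integral
   ((\<Sum>k\<in>freqs N. c k \<bullet> coef (%t. gK (trig N c t)) k) / 2 - integral {0..1} (%t. K (trig N c t)))) {0..1}"
  by (intro has_integral_diff has_integral_divide trig_inner_coef integrable_integral integrable_continuous_real cont_comp)
 moreover have "ip N (gr N c) c = 2 * act N c - (\<Sum>k\<in>freqs N. c k \<bullet> coef (%t. gK (trig N c t)) k)"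
  by (simp add: act_ip ip_def gr_def inner_diff_left sum_subtractf inner_commute[of "coef _ _"])
 ultimately show ?thesis by (simp add: Phi_def integral_unique diff_divide_distrib)
qed

text \<open>For a loop of large mean square norm R the rescaled loop has bounded velocity, so the
  original one is at most C2 * R everywhere, and its mean norm is at least R / C2. The decay then
  contributes at most C0 - \<kappa> * R / C2 to \<open>Phi_eq\<close>, while the gradient term is at
  most \<delta> * R / 2; since \<delta> * C2 <= \<kappa>, it uses only half of the decay, and
  \<open>Phi\<close> would be negative.\<close>

lemma almost_critical_bounded:
 assumes \<kappa>: "\<kappa> > 0" and decay: "!!z. (z \<bullet> gK z) / 2 - K z <= C0 - \<kappa> * norm z"
 shows "\<exists>B \<delta>. 0 < \<delta> \<and> (\<forall>N c. 0 <= Phi N c --> ip N (gr N c) (gr N c) <= \<delta>\<^sup>2 --> ip N c c <= B)"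
proof -
 define C1 where "C1 = 2 + 4 * (norm (gK 0))\<^sup>2 + 4 * Lp\<^sup>2"
 define C2 where "C2 = (3 + C1) / 2"
 have C2: "C2 > 0" by (simp add: C2_def C1_def add_pos_nonneg)
 define \<delta> where "\<delta> = min 1 (\<kappa> / C2)"
 have \<delta>: "0 < \<delta>" "\<delta> <= 1" "\<delta> * C2 <= \<kappa>" using \<kappa> C2 by (auto simp: \<delta>_def min_def field_simps)
 define R0 where "R0 = max 1 (2 * C2 * C0 / \<kappa>)"
 have "ip N c c <= R0\<^sup>2" if P: "0 <= Phi N c" and G: "ip N (gr N c) (gr N c) <= \<delta>\<^sup>2" for N c
 proof (rule ccontr)
  assume big: "\<not> ip N c c <= R0\<^sup>2"
  define R where "R = sqrt (ip N c c)"
  have R2: "R\<^sup>2 = ip N c c" using ip_nonneg[of N c] by (simp add: R_def)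
  have R0: "1 <= R0" by (simp add: R0_def)
  have "0 <= R" using ip_nonneg[of N c] by (simp add: R_def)
  then have RR: "R0 < R" by (rule power2_less_imp_less[rotated]) (use big R2 in simp)
  have R1: "1 <= R" using RR R0 by linarith
  let ?e = "%k. (1/R) *\<^sub>R c k"
  have ee: "ip N ?e ?e = 1"
   using R1 by (simp add: ip_def sum_divide_distrib[symmetric] power2_eq_square[symmetric] R2[unfolded ip_def, symmetric])
  have "ip N (%k. (2*pi*k) *\<^sub>R c k) (%k. (2*pi*k) *\<^sub>R c k) <= C1 * R\<^sup>2"
  proof -
   have "\<delta>\<^sup>2 <= 1" using \<delta> by (simp add: power_le_one)
   moreover have "1 * 1 <= R\<^sup>2" unfolding power2_eq_square using R1 by (intro mult_mono) auto
   then have "(2 + 4 * (norm (gK 0))\<^sup>2) * 1 <= (2 + 4 * (norm (gK 0))\<^sup>2) * R\<^sup>2" by (intro mult_left_mono) auto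
   ultimately show ?thesis using velocity_bound[of N c] G unfolding R2[symmetric] C1_def by (simp add: algebra_simps)
  qed
  moreover have "ip N (%k. (2*pi*k) *\<^sub>R ?e k) (%k. (2*pi*k) *\<^sub>R ?e k) = ip N (%k. (2*pi*k) *\<^sub>R c k) (%k. (2*pi*k) *\<^sub>R c k) / R\<^sup>2"
   by (simp add: ip_def sum_divide_distrib power2_eq_square mult.commute mult.left_commute)
  ultimately have V: "ip N (%k. (2*pi*k) *\<^sub>R ?e k) (%k. (2*pi*k) *\<^sub>R ?e k) <= C1"
   using R1 by (simp add: divide_le_eq)
  have sup: "norm (trig N c t) <= C2 * R" if t: "t \<in> {0..1}" for t
  proof -
   have "norm (trig N ?e t) <= C2" using trig_sup_bound[OF t, of N ?e] V ee by (simp add: C2_def)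
   then show ?thesis using R1 by (simp add: trig_scale divide_le_eq)
  qed
  have ci: "(%t. norm (trig N c t)) integrable_on {0..1}" by (intro integrable_continuous_real continuous_intros)
  let ?L = "integral {0..1} (%t. norm (trig N c t))"
  have "R\<^sup>2 <= C2 * R * ?L"
   unfolding R2
  proof (rule has_integral_le[OF trig_inner_trig has_integral_mult_right[OF integrable_integral[OF ci]]])
   fix t assume "t \<in> {0..1::real}"
   then show "trig N c t \<bullet> trig N c t <= C2 * R * norm (trig N c t)"
    using mult_right_mono[OF sup[of t], of "norm (trig N c t)"] by (simp add: dot_square_norm power2_eq_square)
  qed
  then have RL: "R <= C2 * ?L" using R1 by (simp add: power2_eq_square mult.assoc mult.left_commute[of C2])
  have "integral {0..1} (%t. (trig N c t \<bullet> gK (trig N c t)) / 2 - K (trig N c t)) <= C0 - \<kappa> * ?L"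
  proof (rule has_integral_le)
   show "((%t. (trig N c t \<bullet> gK (trig N c t)) / 2 - K (trig N c t)) has_integral
     integral {0..1} (%t. (trig N c t \<bullet> gK (trig N c t)) / 2 - K (trig N c t))) {0..1}"
    by (intro integrable_integral integrable_continuous_real continuous_intros cont_comp) auto
   show "((%t. C0 - \<kappa> * norm (trig N c t)) has_integral (C0 - \<kappa> * ?L)) {0..1}"
    by (intro has_integral_unit_const has_integral_diff has_integral_mult_right integrable_integral ci)
  qed (rule decay)
  moreover have "ip N (gr N c) c <= \<delta> * R" by (rule ip_le) (use \<delta> R1 G R2 in auto)
  ultimately have "\<kappa> * ?L <= C0 + \<delta> * R / 2" using P unfolding Phi_eq by linarith
  then have "C2 * (\<kappa> * ?L) <= C2 * (C0 + \<delta> * R / 2)" using C2 by (intro mult_left_mono) auto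
  moreover have "\<kappa> * R <= \<kappa> * (C2 * ?L)" using RL \<kappa> by (intro mult_left_mono) auto
  moreover have "\<delta> * C2 * R <= \<kappa> * R" using \<delta> R1 by (intro mult_right_mono) auto
  ultimately have "\<kappa> * R <= 2 * C2 * C0" by (simp add: algebra_simps)
  then have "R <= 2 * C2 * C0 / \<kappa>" using \<kappa> by (simp add: field_simps)
  then show False using RR by (simp add: R0_def)
 qed
 then show ?thesis using \<delta>(1) by blast
qed

lemma gK_reflect:
 assumes sym: "!!z. K (fst z, - snd z) = K z"
 shows "gK (fst z, - snd z) = (fst (gK z), - snd (gK z))"
proof -
 let ?r = "%z::'n phase. (fst z, - snd z)"
 have lr: "(?r has_derivative ?r) (at z)"
  by (auto intro!: derivative_eq_intros)
 have "((%z. K (?r z)) has_derivative (%v. ?r v \<bullet> gK (?r z))) (at z)"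
  by (rule has_derivative_compose[OF lr deriv])
 then have "(K has_derivative (%v. ?r v \<bullet> gK (?r z))) (at z)" by (simp add: sym)
 from has_derivative_unique[OF this deriv] have "?r v \<bullet> gK (?r z) = v \<bullet> gK z" for v by (rule fun_cong)
 then have e: "v \<bullet> ?r (gK (?r z)) = v \<bullet> gK z" for v by (simp add: inner_prod_def)
 have "?r (gK (?r z)) = gK z" using e by (metis vector_eq_ldot)
 then show ?thesis by (metis fst_conv minus_minus prod.collapse snd_conv)
qed

text \<open>The uniform Hoelder estimate allows Arzela-Ascoli. A fixed frequency k lies in every
  later range, as N j >= j, and there the gradient coefficient tends to 0. So the limit satisfies
  the weak equation at every frequency, and \<open>weak_imp_strong\<close> applies.\<close>

lemma brake_limit:
 assumes sym: "!!z. K (fst z, - snd z) = K z"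
  and N: "!!j. j <= N j"
  and B: "!!j. ip (N j) (c j) (c j) <= B"
  and G: "!!j. ip (N j) (gr (N j) (c j)) (gr (N j) (c j)) <= inverse (real (Suc j))"
 obtains x r where "strict_mono (r :: nat \<Rightarrow> nat)" "brake_loop x"
  "uniform_limit UNIV (%j. trig (N (r j)) (c (r j))) x sequentially"
  "!!t. (x has_vector_derivative J0 (gK (x t))) (at t)"
proof -
 define M where "M = 2 + 4 * (norm (gK 0))\<^sup>2 + 4 * Lp\<^sup>2 * B"
 have vel: "ip (N j) (%k::int. (2*pi*k) *\<^sub>R c j k) (%k::int. (2*pi*k) *\<^sub>R c j k) <= M" for j
 proof -
  have "inverse (real (Suc j)) <= 1" by (simp add: field_simps)
  moreover have "4 * Lp\<^sup>2 * ip (N j) (c j) (c j) <= 4 * Lp\<^sup>2 * B" using B by (intro mult_left_mono) auto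
  ultimately show ?thesis using velocity_bound[of "N j" "c j"] G[of j] unfolding M_def by linarith
 qed
 have M0: "0 <= M" using order_trans[OF ip_nonneg vel] .
 let ?x = "%j. trig (N j) (c j)"
 have hold: "norm (?x j t - ?x j s) <= sqrt \<bar>t - s\<bar> * (M + 1) / 2" if "s \<in> {0..1}" "t \<in> {0..1}" for j s t
 proof -
  have *: "norm (?x j v - ?x j u) <= sqrt (v - u) * (M + 1) / 2" if "0 <= u" "u <= v" "v <= 1" for u v
  proof -
   have "sqrt (v - u) * (ip (N j) (%k::int. (2*pi*k) *\<^sub>R c j k) (%k::int. (2*pi*k) *\<^sub>R c j k) + 1) <= sqrt (v - u) * (M + 1)"
    using that vel[of j] by (intro mult_left_mono) auto
   then show ?thesis using trig_hoelder[OF that, of "N j" "c j"] by linarith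
  qed
  show ?thesis using *[of s t] *[of t s] that by (cases "s <= t") (auto simp: norm_minus_commute abs_if)
 qed
 obtain g r where g: "continuous_on {0..1} g" "strict_mono (r :: nat \<Rightarrow> nat)"
  "!!e. 0 < e ==> \<exists>n. \<forall>j t. j \<ge> n \<and> t \<in> {0..1} --> norm (?x (r j) t - g t) < e"
 proof (rule Arzela_Ascoli[of "{0..1::real}" ?x "(B + M + 2) / 2"])
  show "norm (?x j t) <= (B + M + 2) / 2" if "t \<in> {0..1}" for j t
   by (rule order_trans[OF trig_sup_bound[OF that]], intro divide_right_mono add_mono B vel order_refl) simp
  fix t e :: real assume t: "t \<in> {0..1}" and e: "0 < e"
  define d where "d = (e / (M + 1))\<^sup>2"
  have "0 < d" using e M0 by (simp add: d_def)
  moreover have "norm (?x j t - ?x j s) < e" if "s \<in> {0..1}" "norm (t - s) < d" for j s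
  proof -
   have "sqrt \<bar>t - s\<bar> < sqrt d" using that by simp
   also have "sqrt d = e / (M + 1)" using e M0 by (simp add: d_def)
   finally have "sqrt \<bar>t - s\<bar> * (M + 1) < e" using M0 by (simp add: pos_less_divide_eq)
   moreover have "0 <= sqrt \<bar>t - s\<bar> * (M + 1)" using M0 by simp
   ultimately show ?thesis using hold[OF that(1) t, of j] by linarith
  qed
  ultimately show "\<exists>d. 0 < d \<and> (\<forall>j s. s \<in> {0..1} \<and> norm (t - s) < d --> norm (?x j t - ?x j s) < e)" by blast
 qed auto
 define x where "x t = g (frac t)" for t
 have U: "uniform_limit UNIV (%j. ?x (r j)) x sequentially"
 proof (rule uniform_limitI)
  fix e :: real assume "0 < e"
  then obtain n where n: "!!j t. j \<ge> n ==> t \<in> {0..1} ==> norm (?x (r j) t - g t) < e" using g(3) by blast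
  have "dist (?x (r j) t) (x t) < e" if "j \<ge> n" for j t
   using n[OF that, of "frac t"] frac_lt_1[of t] periodic_frac[of "?x (r j)", OF trig_periodic, of t]
   by (simp add: dist_norm x_def less_imp_le)
  then show "\<forall>\<^sub>F j in sequentially. \<forall>t\<in>UNIV. dist (?x (r j) t) (x t) < e"
   unfolding eventually_sequentially by blast
 qed
 have pt: "(%j. ?x (r j) t) \<longlonglongrightarrow> x t" for t using tendsto_uniform_limitI[OF U] by simp
 have cx: "continuous_on UNIV x"
  by (rule uniform_limit_theorem[OF _ U]) (auto intro!: always_eventually continuous_on_trig)
 have bx: "brake_loop x"
  unfolding brake_loop_def
 proof (intro conjI allI cx)
  fix t
  have "(%j. ?x (r j) (t + 1)) \<longlonglongrightarrow> x t" using pt[of t] by (simp add: trig_periodic)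
  then show "x (t + 1) = x t" using LIMSEQ_unique[OF pt] by blast
  have "(%j. ?x (r j) (- t)) \<longlonglongrightarrow> (fst (x t), - snd (x t))"
   unfolding trig_reflect by (intro tendsto_intros pt)
  then show "x (- t) = (fst (x t), - snd (x t))" using LIMSEQ_unique[OF pt] by blast
 qed
 have cgx: "continuous_on UNIV (%t. gK (x t))" by (rule continuous_on_compose2[OF cont_gK[of UNIV] cx]) simp
 have bg: "brake_loop (%t. gK (x t))"
  using bx cgx gK_reflect[OF sym] by (simp add: brake_loop_def)
 have U01: "uniform_limit {0..1} (%j. ?x (r j)) x sequentially" by (rule uniform_limit_on_subset[OF U]) simp
 have weak: "(2*pi*k) *\<^sub>R coef x k = coef (%t. gK (x t)) k" for k
 proof -
  have "(%j. (2*pi*k) *\<^sub>R coef (?x (r j)) k - coef (%t. gK (?x (r j) t)) k) \<longlonglongrightarrow> (2*pi*k) *\<^sub>R coef x k - coef (%t. gK (x t)) k"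
   by (intro tendsto_intros unif_coef unif_gK U01 cont_comp continuous_on_trig)
  moreover have "(%j. (2*pi*k) *\<^sub>R coef (?x (r j)) k - coef (%t. gK (?x (r j) t)) k) \<longlonglongrightarrow> 0"
  proof (rule Lim_null_comparison)
   show "(%j. sqrt (inverse (real (Suc j)))) \<longlonglongrightarrow> 0"
    using tendsto_real_sqrt[OF LIMSEQ_inverse_real_of_nat] by simp
   show "\<forall>\<^sub>F j in sequentially. norm ((2*pi*k) *\<^sub>R coef (?x (r j)) k - coef (%t. gK (?x (r j) t)) k) <= sqrt (inverse (real (Suc j)))"
    using eventually_ge_at_top[of "nat \<bar>k\<bar>"]
   proof eventually_elim
    case (elim j)
    have rj: "j <= r j" by (rule seq_suble[OF g(2)])
    then have "nat \<bar>k\<bar> <= N (r j)" using elim N[of "r j"] by linarith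
    then have k: "k \<in> freqs (N (r j))" by (auto simp: freqs_def)
    then have "(2*pi*k) *\<^sub>R coef (?x (r j)) k - coef (%t. gK (?x (r j) t)) k = gr (N (r j)) (c (r j)) k"
     by (simp add: coef_trig gr_def)
    moreover have "(norm (gr (N (r j)) (c (r j)) k))\<^sup>2 <= inverse (real (Suc j))"
    proof -
     have "(norm (gr (N (r j)) (c (r j)) k))\<^sup>2 <= ip (N (r j)) (gr (N (r j)) (c (r j))) (gr (N (r j)) (c (r j)))"
      unfolding ip_def power2_norm_eq_inner by (rule member_le_sum[OF k]) auto
     also have "\<dots> <= inverse (real (Suc (r j)))" by (rule G)
     also have "\<dots> <= inverse (real (Suc j))" using rj by (simp add: le_imp_inverse_le)
     finally show ?thesis .
    qed
    ultimately show ?case by (simp add: real_le_rsqrt)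
   qed
  qed
  ultimately show ?thesis using LIMSEQ_unique by fastforce
 qed
 show thesis by (rule that[OF g(2) bx U weak_imp_strong[OF bx bg weak]])
qed

end

section \<open>Positively homogeneous gauges and the Moreau envelope\<close>

text \<open>Homogeneity is asked for nonnegative factors only, since the bodies need not be
  symmetric about 0.\<close>

locale sublinear_gauge =
 fixes j :: "'a::euclidean_space \<Rightarrow> real" and \<kappa> \<beta> :: real
 assumes add: "j (x + y) <= j x + j y"
  and scale: "0 <= t ==> j (t *\<^sub>R x) = t * j x"
  and lower: "\<kappa> * norm x <= j x" and upper: "j x <= \<beta> * norm x"
  and \<kappa>: "0 < \<kappa>" and \<beta>: "0 < \<beta>"
begin

lemma nonneg: "0 <= j x"
 using lower[of x] \<kappa> by (meson mult_nonneg_nonneg norm_ge_zero less_imp_le order_trans)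

lemma lipschitz: "\<bar>j x - j y\<bar> <= \<beta> * norm (x - y)"
 using add[of y "x - y"] add[of x "y - x"] upper[of "x - y"] upper[of "y - x"] by (auto simp: norm_minus_commute)

lemma cont: "continuous_on S j"
proof (rule continuous_on_subset[OF lipschitz_on_continuous_on])
 show "\<beta>-lipschitz_on UNIV j"
  using lipschitz \<beta> by (auto simp: lipschitz_on_def dist_norm)
qed auto

end

locale moreau = sublinear_gauge +
 fixes b D lam :: real
 assumes b: "0 < b" and D: "0 < D" and lam: "0 < lam"
begin

text \<open>The growth to be added outside the body, before smoothing. The quadratic term exceeds
  the isoperimetric threshold and makes the functional negative far out on the patch; the linear
  term makes the action density z . grad / 2 - K tend to minus infinity, which bounds almost
  critical loops.\<close>

definition k0 :: "'a \<Rightarrow> real" where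
 "k0 x = max 0 (b * ((j x)\<^sup>2 - 1) + D * (j x - 1))"

lemma k0_nonneg: "0 <= k0 x"
 by (simp add: k0_def)

lemma k0_le: "0 <= g ==> j x <= g ==> k0 x <= max 0 (b * (g\<^sup>2 - 1) + D * (g - 1))"
 unfolding k0_def using b D nonneg[of x]
 by (intro max.mono add_mono mult_left_mono diff_mono power_mono order_refl) auto

lemma k0_ge: "1 <= j x ==> k0 x = b * ((j x)\<^sup>2 - 1) + D * (j x - 1)"
 unfolding k0_def using b D by (auto intro!: max.absorb2 add_nonneg_nonneg mult_nonneg_nonneg)

lemma k0_small: "j x <= 1 ==> k0 x = 0"
 unfolding k0_def using b D nonneg[of x]
 by (auto intro!: max.absorb1 add_nonpos_nonpos mult_nonneg_nonpos simp: power_le_one)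

lemma k0_pos: "1 < j x ==> 0 < k0 x"
 unfolding k0_ge[OF less_imp_le] using b D
 by (intro add_pos_pos mult_pos_pos) (auto simp: one_less_power)

lemma k0_convex:
 assumes t: "0 <= t" "t <= 1"
 shows "k0 ((1 - t) *\<^sub>R x + t *\<^sub>R y) <= (1 - t) * k0 x + t * k0 y"
proof -
 define g where "g = (1 - t) * j x + t * j y"
 have g: "0 <= g" using t nonneg by (simp add: g_def)
 have "j ((1 - t) *\<^sub>R x + t *\<^sub>R y) <= g"
  using add[of "(1 - t) *\<^sub>R x" "t *\<^sub>R y"] t by (simp add: g_def scale)
 then have "k0 ((1 - t) *\<^sub>R x + t *\<^sub>R y) <= max 0 (b * (g\<^sup>2 - 1) + D * (g - 1))"
  by (rule k0_le[OF g])
 also have "\<dots> <= (1 - t) * k0 x + t * k0 y"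
 proof (rule max.boundedI)
  show "0 <= (1 - t) * k0 x + t * k0 y" using t k0_nonneg by simp
  have "g\<^sup>2 <= (1 - t) * (j x)\<^sup>2 + t * (j y)\<^sup>2"
  proof -
   have "(1 - t) * (j x)\<^sup>2 + t * (j y)\<^sup>2 - g\<^sup>2 = t * (1 - t) * (j x - j y)\<^sup>2"
    unfolding g_def by (simp add: power2_eq_square algebra_simps)
   moreover have "0 <= t * (1 - t) * (j x - j y)\<^sup>2" using t by simp
   ultimately show ?thesis by linarith
  qed
  then have "b * (g\<^sup>2 - 1) <= b * ((1 - t) * (j x)\<^sup>2 + t * (j y)\<^sup>2 - 1)" using b by simp
  then have "b * (g\<^sup>2 - 1) + D * (g - 1)
   <= (1 - t) * (b * ((j x)\<^sup>2 - 1) + D * (j x - 1)) + t * (b * ((j y)\<^sup>2 - 1) + D * (j y - 1))"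
   unfolding g_def by (simp add: algebra_simps)
  also have "\<dots> <= (1 - t) * k0 x + t * k0 y"
   using t by (intro add_mono mult_left_mono) (auto simp: k0_def)
  finally show "b * (g\<^sup>2 - 1) + D * (g - 1) <= (1 - t) * k0 x + t * k0 y" .
 qed
 finally show ?thesis .
qed

definition prox :: "'a \<Rightarrow> 'a" where
 "prox z = (SOME p. \<forall>w. k0 p + (norm (z - p))\<^sup>2 / (2*lam) <= k0 w + (norm (z - w))\<^sup>2 / (2*lam))"

definition env :: "'a \<Rightarrow> real" where
 "env z = k0 (prox z) + (norm (z - prox z))\<^sup>2 / (2*lam)"

definition genv :: "'a \<Rightarrow> 'a" where
 "genv z = (z - prox z) /\<^sub>R lam"

lemma prox_min: "env z <= k0 w + (norm (z - w))\<^sup>2 / (2*lam)"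
proof -
 let ?f = "%w. k0 w + (norm (z - w))\<^sup>2 / (2*lam)"
 \<comment> \<open>Outside the ball of this radius about z the quadratic term alone is at least the
   value \<open>k0 z\<close> taken at w = z, so a minimum over the ball is a global one.\<close>
 define R where "R = sqrt (2 * lam * k0 z)"
 have R: "0 <= R" "R\<^sup>2 = 2 * lam * k0 z" using lam k0_nonneg by (auto simp: R_def)
 have "continuous_on (cball z R) ?f"
  unfolding k0_def using lam by (intro continuous_intros cont) auto
 then obtain p where p: "p \<in> cball z R" "!!w. w \<in> cball z R ==> ?f p <= ?f w"
  using continuous_attains_inf[of "cball z R" ?f] R by auto
 have "?f p <= ?f w" for w
 proof (cases "w \<in> cball z R")
  case False
  then have "R <= norm (z - w)" by (simp add: dist_norm)
  then have "R\<^sup>2 <= (norm (z - w))\<^sup>2" using R by (intro power_mono) auto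
  then have "k0 z <= (norm (z - w))\<^sup>2 / (2*lam)" using lam R by (simp add: field_simps)
  moreover have "?f p <= k0 z" using p(2)[of z] R by simp
  ultimately show ?thesis using k0_nonneg[of w] by linarith
 qed (rule p(2))
 then have "\<forall>w. ?f (prox z) <= ?f w" unfolding prox_def by (intro someI[where P = "%p. \<forall>w. ?f p <= ?f w"]) blast
 then show ?thesis by (simp add: env_def)
qed

lemma prox_eq: "prox z = z - lam *\<^sub>R genv z"
 using lam by (simp add: genv_def)

lemma env_eq: "env z = k0 (prox z) + lam / 2 * (genv z \<bullet> genv z)"
proof -
 have "(norm (z - prox z))\<^sup>2 = lam\<^sup>2 * (genv z \<bullet> genv z)"
  unfolding power2_norm_eq_inner prox_eq by (simp add: power2_eq_square)
 then show ?thesis using lam by (simp add: env_def power2_eq_square)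
qed

text \<open>The minimality of \<open>prox z\<close> is tested along the segment to w. Convexity of
  \<open>k0\<close> makes the inequality linear in t up to t^2; division by t and t to 0 give the
  claim.\<close>

lemma subgradient: "k0 (prox z) + (w - prox z) \<bullet> genv z <= k0 w"
proof -
 let ?p = "prox z"
 let ?A = "(norm (w - ?p))\<^sup>2 / (2*lam)"
 have "k0 ?p + (w - ?p) \<bullet> genv z - k0 w <= t * ?A" if t: "0 < t" "t <= 1" for t
 proof -
  have "env z <= k0 ((1 - t) *\<^sub>R ?p + t *\<^sub>R w) + (norm (z - ((1 - t) *\<^sub>R ?p + t *\<^sub>R w)))\<^sup>2 / (2*lam)"
   by (rule prox_min)
  also have "\<dots> <= (1 - t) * k0 ?p + t * k0 w + (norm (z - ((1 - t) *\<^sub>R ?p + t *\<^sub>R w)))\<^sup>2 / (2*lam)"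
   using k0_convex[of t ?p w] t by simp
  also have "(norm (z - ((1 - t) *\<^sub>R ?p + t *\<^sub>R w)))\<^sup>2 = (norm (z - ?p))\<^sup>2 - 2 * t * ((w - ?p) \<bullet> (z - ?p)) + t\<^sup>2 * (norm (w - ?p))\<^sup>2"
  proof -
   have "z - ((1 - t) *\<^sub>R ?p + t *\<^sub>R w) = (z - ?p) - t *\<^sub>R (w - ?p)" by (simp add: algebra_simps)
   then show ?thesis by (simp only: power2_norm_eq_inner) (simp add: inner_diff_left inner_diff_right inner_commute power2_eq_square algebra_simps)
  qed
  also have "(z - ?p) = lam *\<^sub>R genv z" by (simp add: prox_eq)
  finally have "k0 ?p + (norm (lam *\<^sub>R genv z))\<^sup>2 / (2*lam) <= (1 - t) * k0 ?p + t * k0 w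
    + ((norm (lam *\<^sub>R genv z))\<^sup>2 - 2 * t * ((w - ?p) \<bullet> (lam *\<^sub>R genv z)) + t\<^sup>2 * (norm (w - ?p))\<^sup>2) / (2*lam)"
   by (simp add: env_def prox_eq)
  then have "t * (k0 ?p + (w - ?p) \<bullet> genv z - k0 w) <= t * (t * ?A)"
   using lam by (simp add: diff_divide_distrib add_divide_distrib power2_eq_square algebra_simps)
  then show ?thesis using t(1) by (rule mult_left_le_imp_le)
 qed
 then have "!!t. 0 < t ==> t < 1 ==> k0 ?p + (w - ?p) \<bullet> genv z - k0 w <= t * ?A" by simp
 moreover have "((%t. t * ?A) \<longlongrightarrow> 0 * ?A) (at_right 0)" by (intro tendsto_intros)
 ultimately have "k0 ?p + (w - ?p) \<bullet> genv z - k0 w <= 0 * ?A"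
  by (intro tendsto_lowerbound[where F = "at_right (0::real)" and f = "%t. t * ?A"])
   (auto simp: eventually_at_right_field intro!: exI[of _ 1])
 then show ?thesis by simp
qed

text \<open>This is \<open>subgradient\<close> at z, tested with the proximal point of z'. The
  surplus square makes the gradient cocoercive, from which \<open>genv_lipschitz\<close>
  follows.\<close>

lemma env_lower: "env z + (z' - z) \<bullet> genv z + lam / 2 * ((genv z' - genv z) \<bullet> (genv z' - genv z)) <= env z'"
 using subgradient[of z "prox z'"] unfolding env_eq prox_eq
 by (simp add: inner_diff_left inner_diff_right inner_commute algebra_simps)

lemma env_upper: "env z' <= env z + (z' - z) \<bullet> genv z + (norm (z' - z))\<^sup>2 / (2*lam)"
proof -
 have "env z' <= k0 (prox z) + (norm (z' - prox z))\<^sup>2 / (2*lam)" by (rule prox_min)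
 also have "z' - prox z = (z' - z) + lam *\<^sub>R genv z" by (simp add: prox_eq)
 also have "(norm ((z' - z) + lam *\<^sub>R genv z))\<^sup>2 = (norm (z' - z))\<^sup>2 + 2 * lam * ((z' - z) \<bullet> genv z) + lam * lam * (genv z \<bullet> genv z)"
  by (simp only: power2_norm_eq_inner) (simp add: inner_add_left inner_add_right inner_commute algebra_simps)
 finally show ?thesis using lam by (simp add: env_eq add_divide_distrib)
qed

lemma genv_lipschitz: "norm (genv z - genv w) <= inverse lam * norm (z - w)"
proof -
 let ?d = "genv z - genv w"
 have "lam * (norm ?d)\<^sup>2 <= (z - w) \<bullet> ?d"
  using env_lower[of z w] env_lower[of w z]
  by (simp add: power2_norm_eq_inner inner_diff_left inner_diff_right inner_commute algebra_simps)
 also have "\<dots> <= norm (z - w) * norm ?d" by (rule norm_cauchy_schwarz)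
 finally have "norm ?d * (lam * norm ?d) <= norm ?d * norm (z - w)" by (simp add: power2_eq_square algebra_simps)
 then have "norm ?d = 0 \<or> lam * norm ?d <= norm (z - w)"
  by (metis mult_left_le_imp_le norm_ge_zero order_le_less)
 then show ?thesis using lam by (auto simp: field_simps)
qed

lemma env_deriv: "(env has_derivative (%v. v \<bullet> genv z)) (at z)"
proof (rule has_derivativeI)
 show "bounded_linear (%v. v \<bullet> genv z)" by (rule bounded_linear_inner_left)
 have "((%y. norm (y - z) / (2*lam)) \<longlongrightarrow> norm (z - z) / (2*lam)) (at z)"
  using lam by (intro tendsto_intros) auto
 then have lim: "((%y. norm (y - z) / (2*lam)) \<longlongrightarrow> 0) (at z)" by simp
 show "((%y. ((env y - env z) - (y - z) \<bullet> genv z) /\<^sub>R norm (y - z)) \<longlongrightarrow> 0) (at z)"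
 proof (rule Lim_null_comparison[OF always_eventually lim], rule allI)
  fix y
  have "0 <= env y - env z - (y - z) \<bullet> genv z"
  proof -
   have "0 <= lam / 2 * ((genv y - genv z) \<bullet> (genv y - genv z))" using lam by simp
   then show ?thesis using env_lower[of z y] by linarith
  qed
  moreover have "env y - env z - (y - z) \<bullet> genv z <= norm (y - z) * (norm (y - z) / (2*lam))"
   using env_upper[of y z] by (simp add: power2_eq_square)
  ultimately show "norm ((env y - env z - (y - z) \<bullet> genv z) /\<^sub>R norm (y - z)) <= norm (y - z) / (2*lam)"
   using lam by (cases "y = z") (auto simp: abs_mult divide_simps)
 qed
qed

lemma env_nonneg: "0 <= env z"
 using k0_nonneg lam by (simp add: env_def)

lemma env_zero:
 assumes "j z <= 1" shows "env z = 0" "genv z = 0"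
proof -
 show e: "env z = 0" using prox_min[of z z] k0_small[OF assms] env_nonneg[of z] by simp
 have "lam / 2 * (genv z \<bullet> genv z) <= 0" using e k0_nonneg[of "prox z"] by (simp add: env_eq)
 then have "genv z \<bullet> genv z <= 0" using lam by (simp add: mult_le_0_iff)
 then show "genv z = 0" using inner_ge_zero[of "genv z"] by (simp add: order_antisym)
qed

text \<open>If the proximal point were strictly inside, \<open>genv z\<close> would be nonzero and
  \<open>k0\<close> would still vanish a little further in its direction, contrary to the
  subgradient inequality.\<close>

lemma prox_outside:
 assumes "1 < j z" shows "1 <= j (prox z)"
proof (rule ccontr)
 assume "\<not> 1 <= j (prox z)"
 then have p: "j (prox z) < 1" by simp
 have g0: "genv z ~= 0" using assms p by (auto simp: prox_eq)
 define s where "s = (1 - j (prox z)) / (\<beta> * norm (genv z))"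
 have s: "0 < s" using p g0 \<beta> by (simp add: s_def)
 have "j (prox z + s *\<^sub>R genv z) <= j (prox z) + \<beta> * norm (s *\<^sub>R genv z)"
  using add[of "prox z" "s *\<^sub>R genv z"] upper[of "s *\<^sub>R genv z"] by linarith
 also have "\<dots> = 1" using s g0 \<beta> p by (simp add: s_def)
 finally have "k0 (prox z + s *\<^sub>R genv z) = 0" by (rule k0_small)
 then have "s * (genv z \<bullet> genv z) <= 0"
  using subgradient[of z "prox z + s *\<^sub>R genv z"] k0_nonneg[of "prox z"] by simp
 moreover have "0 < s * (genv z \<bullet> genv z)" using s g0 by simp
 ultimately show False by linarith
qed

text \<open>The square of \<open>genv\<close> cancels between the two terms, so only the proximal
  point enters. Stretching that point by 1 + t in the subgradient inequality gives an Euler type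
  bound, in which the quadratic part of \<open>k0\<close> contributes just b and the linear part
  leaves the decay.\<close>

lemma env_action:
 assumes z: "1 < j z"
 shows "(z \<bullet> genv z) / 2 - env z <= b + D - D / 2 * j (prox z)"
proof -
 let ?p = "prox z" and ?g = "j (prox z)"
 have g: "1 <= ?g" by (rule prox_outside[OF z])
 have "?p \<bullet> genv z - (2 * b * ?g\<^sup>2 + D * ?g) <= t * (b * ?g\<^sup>2)" if t: "0 < t" for t
 proof -
  have sc: "j ((1 + t) *\<^sub>R ?p) = (1 + t) * ?g" using t by (intro scale) simp
  have "1 * 1 <= (1 + t) * ?g" using t g by (intro mult_mono) auto
  then have "k0 ((1 + t) *\<^sub>R ?p) = b * (((1 + t) * ?g)\<^sup>2 - 1) + D * ((1 + t) * ?g - 1)"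
   by (simp add: k0_ge sc)
  moreover have "(1 + t) *\<^sub>R ?p - ?p = t *\<^sub>R ?p" by (simp add: algebra_simps)
  ultimately have "t * (?p \<bullet> genv z - (2 * b * ?g\<^sup>2 + D * ?g)) <= t * (t * (b * ?g\<^sup>2))"
   using subgradient[of z "(1 + t) *\<^sub>R ?p"] by (simp add: k0_ge[OF g] power2_eq_square algebra_simps)
  then show ?thesis using t by simp
 qed
 moreover have "((%t. t * (b * ?g\<^sup>2)) \<longlongrightarrow> 0 * (b * ?g\<^sup>2)) (at_right 0)" by (intro tendsto_intros)
 ultimately have "?p \<bullet> genv z - (2 * b * ?g\<^sup>2 + D * ?g) <= 0 * (b * ?g\<^sup>2)"
  by (intro tendsto_lowerbound[where F = "at_right (0::real)" and f = "%t. t * (b * ?g\<^sup>2)"])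
   (auto simp: eventually_at_right_field intro!: exI[of _ 1])
 moreover have "(z \<bullet> genv z) / 2 - env z = (?p \<bullet> genv z) / 2 - k0 ?p"
  by (simp add: env_eq prox_eq inner_diff_left)
 ultimately show ?thesis by (simp add: k0_ge[OF g] algebra_simps)
qed

text \<open>Converts the decay of \<open>env_action\<close>, which is measured at the proximal
  point, into decay in the norm of z. The gradient grows at most linearly, as a subgradient step of
  length one in its own direction shows.\<close>

lemma norm_le_prox:
 assumes z: "1 < j z"
 shows "norm z <= (1 / \<kappa> + lam * (2 * b * \<beta> + b * \<beta>\<^sup>2 + D * \<beta>)) * j (prox z)"
proof -
 let ?p = "prox z" and ?g = "j (prox z)"
 have g: "1 <= ?g" by (rule prox_outside[OF z])
 have "norm (genv z) <= b * (2 * ?g * \<beta> + \<beta>\<^sup>2) + D * \<beta>"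
 proof (cases "genv z = 0")
  case True then show ?thesis using b D \<beta> g by simp
 next
  case False
  define u where "u = genv z /\<^sub>R norm (genv z)"
  have u: "norm u = 1" "u \<bullet> genv z = norm (genv z)"
   using False by (auto simp: u_def dot_square_norm power2_eq_square)
  have "j (?p + u) <= ?g + \<beta>" using add[of ?p u] upper[of u] u by simp
  then have "k0 (?p + u) <= max 0 (b * ((?g + \<beta>)\<^sup>2 - 1) + D * (?g + \<beta> - 1))"
   using g \<beta> by (intro k0_le) auto
  also have "\<dots> = b * ((?g + \<beta>)\<^sup>2 - 1) + D * (?g + \<beta> - 1)"
   using g \<beta> b D by (intro max.absorb2 add_nonneg_nonneg mult_nonneg_nonneg) (auto intro!: one_le_power)
  finally show ?thesis using subgradient[of z "?p + u"] u by (simp add: k0_ge[OF g] power2_eq_square algebra_simps)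
 qed
 also have "\<dots> <= b * (2 * ?g * \<beta> + \<beta>\<^sup>2 * ?g) + D * \<beta> * ?g"
  using b D \<beta> g mult_left_mono[of 1 ?g "\<beta>\<^sup>2"] mult_left_mono[of 1 ?g "D * \<beta>"] by (intro add_mono mult_left_mono) auto
 finally have G: "norm (genv z) <= (2 * b * \<beta> + b * \<beta>\<^sup>2 + D * \<beta>) * ?g" by (simp add: algebra_simps)
 have "norm z <= norm ?p + norm (lam *\<^sub>R genv z)"
  using norm_triangle_ineq[of ?p "lam *\<^sub>R genv z"] by (simp add: prox_eq)
 also have "\<dots> <= ?g / \<kappa> + lam * ((2 * b * \<beta> + b * \<beta>\<^sup>2 + D * \<beta>) * ?g)"
  using lower[of ?p] \<kappa> lam G by (intro add_mono) (auto simp: pos_le_divide_eq mult.commute)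
 finally show ?thesis by (simp add: algebra_simps)
qed

text \<open>Young's inequality with weight \<theta> splits (j z)^2 into a part at the proximal point
  and a multiple of the squared distance. For small lam the penalty of the envelope pays for the
  distance, so the quadratic growth rate drops only by the factor 1 + \<theta>.\<close>

lemma env_coercive:
 assumes th: "0 < \<theta>" and l: "b * (1 + 1/\<theta>) * \<beta>\<^sup>2 * (2*lam) <= 1"
 shows "b / (1 + \<theta>) * (j z)\<^sup>2 - b <= env z"
proof -
 let ?p = "prox z" and ?n = "norm (z - prox z)"
 have "j z <= j ?p + \<beta> * ?n" using lipschitz[of z ?p] by linarith
 then have "(j z)\<^sup>2 <= (j ?p + \<beta> * ?n)\<^sup>2" by (intro power_mono nonneg)
 also have "\<dots> <= (1 + \<theta>) * (j ?p)\<^sup>2 + (1 + 1/\<theta>) * (\<beta> * ?n)\<^sup>2"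
 proof -
  have "0 <= (\<theta> * j ?p - \<beta> * ?n)\<^sup>2 / \<theta>" using th by simp
  also have "\<dots> = (1 + \<theta>) * (j ?p)\<^sup>2 + (1 + 1/\<theta>) * (\<beta> * ?n)\<^sup>2 - (j ?p + \<beta> * ?n)\<^sup>2"
   using th by (simp add: field_simps power2_eq_square)
  finally show ?thesis by simp
 qed
 finally have "b / (1 + \<theta>) * (j z)\<^sup>2 <= b / (1 + \<theta>) * ((1 + \<theta>) * (j ?p)\<^sup>2 + (1 + 1/\<theta>) * (\<beta> * ?n)\<^sup>2)"
  using b th by (intro mult_left_mono) auto
 also have "\<dots> = b * (j ?p)\<^sup>2 + (b / (1 + \<theta>)) * ((1 + 1/\<theta>) * \<beta>\<^sup>2 * ?n\<^sup>2)"
  using th by (simp add: distrib_left power_mult_distrib)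
 also have "\<dots> <= b * (j ?p)\<^sup>2 + b * ((1 + 1/\<theta>) * \<beta>\<^sup>2 * ?n\<^sup>2)"
  using b th by (intro add_mono mult_right_mono order_refl) (auto simp: divide_le_eq)
 also have "b * ((1 + 1/\<theta>) * \<beta>\<^sup>2 * ?n\<^sup>2) <= ?n\<^sup>2 / (2*lam)"
  using mult_right_mono[OF l, of "?n\<^sup>2"] lam by (simp add: pos_le_divide_eq ac_simps)
 also have "b * (j ?p)\<^sup>2 <= k0 ?p + b"
 proof (cases "1 <= j ?p")
  case True
  then have "0 <= D * (j ?p - 1)" using D by simp
  then show ?thesis by (simp add: k0_ge[OF True] algebra_simps)
 next
  case False
  then have "b * (j ?p)\<^sup>2 <= b * 1" using b nonneg[of ?p] by (intro mult_left_mono) (auto simp: power_le_one)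
  then show ?thesis using k0_nonneg[of ?p] by simp
 qed
 finally show ?thesis by (simp add: env_def)
qed

lemma env_invariant:
 assumes r: "!!z. r (r z) = z" "!!z w. norm (r z - r w) = norm (z - w)" "!!z. j (r z) = j z"
 shows "env (r z) = env z"
proof -
 have k: "k0 (r z) = k0 z" for z by (simp add: k0_def r)
 have "env (r z) <= env z" for z
  using prox_min[of "r z" "r (prox z)"] by (simp add: env_def k r)
 from this[of z] this[of "r z"] show ?thesis by (simp add: r)
qed

end

section \<open>A brake orbit for a Hamiltonian whose maximum exceeds c\<close>

text \<open>The variational core of the upper bound, in coordinates where the involution is (q, p)
  to (q, -p). The directions in \<open>loop\<close> nearly realise the extremal area for the given
  support length, and this keeps the functional bounded above on the patch. At a positive critical
  level the action density is positive somewhere; that rules out orbits reaching j >= 1, so the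
  orbit belongs to H itself.\<close>

theorem brake_orbit_exists:
 fixes j :: "'n::finite phase \<Rightarrow> real" and H :: "'n phase \<Rightarrow> real"
 assumes j: "sublinear_gauge j \<kappa> \<beta>"
  and jr: "!!z. j (fst z, - snd z) = j z"
  and H: "lipschitz_hamiltonian H gH L"
  and Hr: "!!z. H (fst z, - snd z) = H z"
  and H_le: "!!z. H z <= m" and H_ge: "!!z. 0 <= H z" and H_out: "!!z. 1 <= j z ==> H z = m"
  and H0: "0 < r0" "!!z. norm z < r0 ==> H z = 0"
  and c: "0 < c" "c < m"
  and loop: "!!e. 0 < e ==> \<exists>M d. c - e <= act M d \<and>
    (\<forall>z t. z \<bullet> trig M (%k::int. (2*pi*k) *\<^sub>R d k) t <= 2 * c * j z)"
 shows "\<exists>x. brake_loop x \<and> (\<forall>t. (x has_vector_derivative J0 (gH (x t))) (at t)) \<and> (\<forall>t. j (x t) < 1)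
  \<and> (\<exists>s t. x s ~= x t)"
proof -
 interpret j: sublinear_gauge j \<kappa> \<beta> by (rule j)
 interpret H: lipschitz_hamiltonian H gH L by (rule H)
 \<comment> \<open>The gap m - c is divided into four: b2 = c + \<epsilon> enters Young's inequality
   on the patch, b1 = c + 2 \<epsilon> is the growth left after the envelope, b = c + 3 \<epsilon>
   is the growth before it, and b + D remains below m. The choice of \<theta> makes b / (1 +
   \<theta>) equal to b1.\<close>
 define \<epsilon> where "\<epsilon> = (m - c) / 4"
 have \<epsilon>: "0 < \<epsilon>" using c by (simp add: \<epsilon>_def)
 define b2 where "b2 = c + \<epsilon>"
 define \<theta> where "\<theta> = \<epsilon> / (c + 2 * \<epsilon>)"
 define b where "b = c + 3 * \<epsilon>"
 define b1 where "b1 = b / (1 + \<theta>)"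
 define D where "D = \<epsilon> / 2"
 have \<theta>: "0 < \<theta>" using \<epsilon> c by (simp add: \<theta>_def)
 have b1: "b1 = c + 2 * \<epsilon>" using \<epsilon> c by (simp add: b1_def b_def \<theta>_def field_simps)
 have bD: "b + D < m" "0 < b" "0 < D" "c < b2" "b2 < b1" "0 < b2" using \<epsilon> c by (auto simp: b1 b_def D_def b2_def \<epsilon>_def field_simps)
 define lam where "lam = 1 / (2 * (b * (1 + 1/\<theta>) * \<beta>\<^sup>2))"
 have lam: "0 < lam" using bD \<theta> j.\<beta> by (simp add: lam_def add_pos_pos)
 interpret m: moreau j \<kappa> \<beta> b D lam
  by unfold_locales (use bD lam in auto)
 let ?E = m.env and ?G = m.genv
 have coerc: "b1 * (j z)\<^sup>2 - b <= ?E z" for z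
  unfolding b1_def
 proof (rule m.env_coercive[OF \<theta>])
  have "0 < b * (1 + 1/\<theta>) * \<beta>\<^sup>2" using bD \<theta> j.\<beta> by (simp add: add_pos_pos)
  then show "b * (1 + 1/\<theta>) * \<beta>\<^sup>2 * (2*lam) <= 1" by (simp add: lam_def)
 qed
 define K where "K z = H z + ?E z" for z
 define gK where "gK z = gH z + ?G z" for z
 interpret K: lipschitz_hamiltonian K gK "L + inverse lam"
 proof
  show "(K has_derivative (%v. v \<bullet> gK z)) (at z)" for z
   unfolding K_def[abs_def] gK_def inner_add_right by (intro has_derivative_add H.deriv m.env_deriv)
  show "norm (gK z - gK w) <= (L + inverse lam) * norm (z - w)" for z w
  proof -
   have "gK z - gK w = (gH z - gH w) + (?G z - ?G w)" by (simp add: gK_def)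
   then show ?thesis using norm_triangle_ineq[of "gH z - gH w" "?G z - ?G w"] H.lip[of z w] m.genv_lipschitz[of z w]
    by (simp add: distrib_right)
  qed
 qed
 have Er: "?E (fst z, - snd z) = ?E z" for z
 proof (rule m.env_invariant[where r = "%z. (fst z, - snd z)"])
  show "norm ((fst z, - snd z) - (fst w, - snd w)) = norm (z - w)" for z w :: "'n phase"
   using norm_minus_commute[of "snd w" "snd z"] by (cases z, cases w) (simp add: norm_Pair)
 qed (simp_all add: jr)
 have Kr: "K (fst z, - snd z) = K z" for z by (simp add: K_def Hr Er)
 have gH_max: "gH z = 0" if "H z = m" for z
 proof -
  have "((%v. v \<bullet> gH z)) = (%v. 0)"
   by (rule differential_zero_maxmin[of z UNIV H, OF _ _ H.deriv]) (use that H_le in auto)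
  then have "gH z \<bullet> gH z = 0" by (rule fun_cong)
  then show ?thesis by simp
 qed
 have K0: "0 <= K z" for z using H_ge[of z] m.env_nonneg[of z] by (simp add: K_def)
 \<comment> \<open>Outside the body H equals its maximum m and has zero gradient, so the bound for
   the envelope is lowered by m; as b + D < m, the action density is negative there.\<close>
 have out: "(z \<bullet> gK z) / 2 - K z <= b + D - D / 2 * j (m.prox z) - m" if "1 < j z" for z
  using m.env_action[OF that] gH_max[of z] H_out[of z] that by (simp add: K_def gK_def)
 define \<mu> where "\<mu> = 1 / \<kappa> + lam * (2 * b * \<beta> + b * \<beta>\<^sup>2 + D * \<beta>)"
 have \<mu>: "0 < \<mu>" using j.\<kappa> j.\<beta> lam bD by (simp add: \<mu>_def add_pos_pos)
 define \<nu> where "\<nu> = D / 2 / \<mu>"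
 have \<nu>: "0 < \<nu>" using \<mu> bD by (simp add: \<nu>_def)
 obtain C0 where decay: "!!z. (z \<bullet> gK z) / 2 - K z <= C0 - \<nu> * norm z"
 proof
  fix z
  let ?R = "1 / \<kappa>"
  let ?B = "?R * (norm (gH 0) + L * ?R)"
  show "(z \<bullet> gK z) / 2 - K z <= (?B + b + D + \<nu> * ?R) - \<nu> * norm z"
  proof (cases "1 < j z")
   case True
   have "\<nu> * norm z <= \<nu> * (\<mu> * j (m.prox z))"
    using m.norm_le_prox[OF True] \<nu> unfolding \<mu>_def by (intro mult_left_mono) auto
   then have "\<nu> * norm z <= D / 2 * j (m.prox z)" using \<mu> by (simp add: \<nu>_def)
   moreover have "0 <= ?B" using j.\<kappa> H.Lp_nonneg by simp
   moreover have "0 <= \<nu> * ?R" using \<nu> j.\<kappa> by simp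
   ultimately show ?thesis using out[OF True] c by linarith
  next
   case False
   then have "\<kappa> * norm z <= 1" using j.lower[of z] by linarith
   then have nz: "norm z <= ?R" using j.\<kappa> by (simp add: pos_le_divide_eq mult.commute)
   have "z \<bullet> gH z <= norm z * norm (gH z)" by (rule norm_cauchy_schwarz)
   also have "norm (gH z) <= norm (gH 0) + L * norm z"
    using H.lip[of z 0] norm_triangle_sub[of "gH z" "gH 0"] by simp
   also have "norm z * (norm (gH 0) + L * norm z) <= ?B"
    using nz H.Lp_nonneg j.\<kappa> by (intro mult_mono add_mono mult_left_mono) auto
   finally have "z \<bullet> gH z <= ?B" by (simp add: mult_left_mono)
   moreover have "0 <= ?B" using j.\<kappa> H.Lp_nonneg by simp
   moreover have "\<nu> * norm z <= \<nu> * ?R" using nz \<nu> by (intro mult_left_mono) auto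
   moreover have "?G z = 0" using m.env_zero[of z] False by simp
   ultimately show ?thesis using K0[of z] bD by (simp add: gK_def)
  qed
 qed

 \<comment> \<open>The error is chosen such that the area of d is at least c^2 / b2, the constant
   that Young's inequality leaves on the patch.\<close>
 obtain M d where d: "c - c * \<epsilon> / b2 <= act M d"
  "!!z t. z \<bullet> trig M (%k::int. (2*pi*k) *\<^sub>R d k) t <= 2 * c * j z"
  using loop[of "c * \<epsilon> / b2"] c \<epsilon> bD by auto
 have actd: "c\<^sup>2 / b2 <= act M d"
 proof -
  have "c - c * \<epsilon> / b2 = c\<^sup>2 / b2" using bD by (simp add: b2_def field_simps power2_eq_square)
  then show ?thesis using d by simp
 qed
 then have actd0: "0 < act M d" using c bD by (meson divide_pos_pos less_le_trans zero_less_power)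
 \<comment> \<open>Cut off outside its range, the same direction serves every N >= M with the same
   area and the same weights.\<close>
 define d' where "d' k = (if k \<in> freqs M then d k else 0)" for k
 define q where "q = (\<Sum>k\<in>freqs M. if 0 < k then k * (d k \<bullet> d k) else 0)"
 have qle: "act M d <= pi * q"
  unfolding act_def q_def sum_distrib_left by (intro sum_mono) (auto simp: mult_nonpos_nonneg mult_le_0_iff)
 then have q: "0 < q" using actd0 by (metis less_le_trans pi_gt_zero zero_less_mult_pos)
 define q1 where "q1 = (\<Sum>k\<in>freqs M. if 0 < k then d k \<bullet> d k else 0)"
 have "q <= M * q1"
  unfolding q_def q1_def sum_distrib_left by (intro sum_mono) (auto simp: freqs_def intro!: mult_right_mono)
 then have q1: "0 < q1" using q by (metis less_le_trans mult_le_0_iff not_less of_nat_0_le_iff)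

 define C4 where "C4 = (m / r0^4 + 1 / (2*lam) / r0\<^sup>2)"
 define r1 where "r1 = min r0 (1 / \<beta>)"
 have r1: "0 < r1" using H0 j.\<beta> by (simp add: r1_def)
 define C4 where "C4 = m / r1^4 + 1 / (2*lam) / r1\<^sup>2"
 have C4: "0 < C4" unfolding C4_def using c r1 lam by (intro add_pos_pos divide_pos_pos) auto
 \<comment> \<open>K vanishes near 0 and grows at most quadratically, so a quartic bound holds
   globally. With \<open>trig_L4\<close> it makes the integral of K quadratic in the weight \<rho>,
   uniformly in N.\<close>
 have K4: "K z <= C4 * norm z ^ 4" for z
 proof (cases "norm z < r1")
  case True
  then have "\<beta> * norm z <= 1" using j.\<beta> by (simp add: r1_def field_simps)
  then have "j z <= 1" using j.upper[of z] by linarith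
  then show ?thesis using True H0(2)[of z] m.env_zero[of z] C4 by (simp add: K_def r1_def)
 next
  case False
  have "?E z <= (norm z)\<^sup>2 / (2*lam)" using m.env_upper[of z 0] m.env_zero[of 0] j.upper[of 0] by simp
  also have "\<dots> <= 1 / (2*lam) / r1\<^sup>2 * norm z ^ 4"
  proof -
   have "r1\<^sup>2 <= (norm z)\<^sup>2" using False r1 by (intro power_mono) auto
   then have "r1\<^sup>2 * (norm z)\<^sup>2 <= (norm z)\<^sup>2 * (norm z)\<^sup>2" by (intro mult_right_mono) auto
   then have "(norm z)\<^sup>2 <= norm z ^ 4 / r1\<^sup>2" using r1 by (simp add: field_simps power4_eq_xxxx power2_eq_square)
   then have "1 / (2*lam) * (norm z)\<^sup>2 <= 1 / (2*lam) * (norm z ^ 4 / r1\<^sup>2)" using lam by (intro mult_left_mono) auto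
   then show ?thesis by simp
  qed
  finally have "?E z <= 1 / (2*lam) / r1\<^sup>2 * norm z ^ 4" .
  moreover have "H z <= m / r1^4 * norm z ^ 4"
  proof -
   have "r1 ^ 4 <= norm z ^ 4" using False r1 by (intro power_mono) auto
   then have "m * 1 <= m * (norm z ^ 4 / r1 ^ 4)" using c r1 by (intro mult_left_mono) (auto simp: field_simps)
   then show ?thesis using H_le[of z] by simp
  qed
  ultimately show ?thesis by (simp add: K_def C4_def distrib_right)
 qed
 \<comment> \<open>With this weight the quartic bound consumes exactly half of the action pi *
   \<rho>.\<close>
 define \<rho> where "\<rho> = pi / (2 * C4 * real CARD('n))"
 define \<alpha> where "\<alpha> = pi * \<rho> / 2"
 have \<rho>: "0 < \<rho>" using C4 by (simp add: \<rho>_def)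
 have \<alpha>: "0 < \<alpha>" using \<rho> by (simp add: \<alpha>_def)
 have sphere: "\<alpha> <= K.Phi N e" if e: "!!k. k <= 0 ==> e k = 0" "(\<Sum>k\<in>freqs N. k * (e k \<bullet> e k)) = \<rho>" for N e
 proof -
  have "integral {0..1} (%t. K (trig N e t)) <= C4 * integral {0..1} (%t. norm (trig N e t) ^ 4)"
   by (rule has_integral_le[OF integrable_integral has_integral_mult_right[OF integrable_integral]])
    (auto intro!: integrable_continuous_real K.cont_comp continuous_intros K4)
  also have "\<dots> <= C4 * (real CARD('n) * \<rho>\<^sup>2)"
   using trig_L4[where N = N and c = e, OF e(1)] C4 unfolding e(2) by simp
  also have "\<dots> = pi * \<rho> / 2" using C4 by (simp add: \<rho>_def power2_eq_square)
  moreover have "act N e = pi * \<rho>" by (simp add: act_def e(2)[symmetric] sum_distrib_left mult.assoc)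
  ultimately show ?thesis by (simp add: K.Phi_def \<alpha>_def)
 qed
 define \<kappa>1 where "\<kappa>1 = (b1 - b2) * \<kappa>\<^sup>2 * min 1 q1"
 have \<kappa>1: "0 < \<kappa>1" using bD q1 j.\<kappa> by (simp add: \<kappa>1_def)
 have jc: "(%t. (j (trig N e t))\<^sup>2) integrable_on {0..1}" "(%t. j (trig N e t)) integrable_on {0..1}" for N e
  by (intro integrable_continuous_real continuous_intros continuous_on_compose2[OF j.cont[of UNIV]]; auto intro: continuous_on_trig)+

 have ext: "act N d' = act M d" "trig N (%k::int. (2*pi*k) *\<^sub>R d' k) t = trig M (%k::int. (2*pi*k) *\<^sub>R d k) t"
  "(\<Sum>k\<in>freqs N. if 0 < k then k * (d' k \<bullet> d' k) else 0) = q"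
  "(\<Sum>k\<in>freqs N. if 0 < k then d' k \<bullet> d' k else 0) = q1" if "M <= N" for N t
 proof -
  have sub: "freqs M \<subseteq> freqs N" using that by (auto simp: freqs_def)
  show "act N d' = act M d" unfolding act_def
   by (rule sum.mono_neutral_cong_right) (use sub in \<open>auto simp: d'_def\<close>)
  show "trig N (%k::int. (2*pi*k) *\<^sub>R d' k) t = trig M (%k::int. (2*pi*k) *\<^sub>R d k) t" unfolding trig_def
   by (rule sum.mono_neutral_cong_right) (use sub in \<open>auto simp: d'_def linear_0[OF mode_linear]\<close>)
  show "(\<Sum>k\<in>freqs N. if 0 < k then k * (d' k \<bullet> d' k) else 0) = q" unfolding q_def
   by (rule sum.mono_neutral_cong_right) (use sub in \<open>auto simp: d'_def\<close>)
  show "(\<Sum>k\<in>freqs N. if 0 < k then d' k \<bullet> d' k else 0) = q1" unfolding q1_def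
   by (rule sum.mono_neutral_cong_right) (use sub in \<open>auto simp: d'_def\<close>)
 qed
 \<comment> \<open>Expanding the action about s * d' leaves a nonpositive term, a term linear in the
   loop e, and - s^2 times the area of d'. The support bound on the velocity of d' estimates the
   linear term by 2 * c * s * j, and Young's inequality with b2 splits it into b2 * j^2 and s^2 *
   c^2 / b2; the latter is cancelled by the area. The surplus b1 - b2 in the growth of K gives the
   quadratic decay.\<close>
 have patch: "K.Phi N (%k. if 0 < k then s *\<^sub>R d' k else y k)
    <= b - \<kappa>1 * (s\<^sup>2 + (\<Sum>k\<in>freqs N. if 0 < k then 0 else y k \<bullet> y k))" if s: "0 <= s" and N: "M <= N" for N s y
 proof -
  define e where "e k = (if 0 < k then s *\<^sub>R d' k else y k)" for k
  define y' where "y' k = (if 0 < k then 0 else y k - s *\<^sub>R d' k)" for k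
  define S where "S k = s *\<^sub>R d' k" for k
  let ?v = "%k::int. (2*pi*k) *\<^sub>R d' k"
  have e: "e = (%k. S k + y' k)" by (auto simp: e_def S_def y'_def)
  have y'0: "act N y' <= 0" unfolding act_def by (intro sum_nonpos) (auto simp: y'_def mult_nonpos_nonneg mult_nonneg_nonpos)
  have Sd: "S = (%k. s *\<^sub>R d' k)" by (simp add: S_def fun_eq_iff)
  have vS: "ip N (%k::int. (2*pi*k) *\<^sub>R S k) y' = s * ip N ?v y'" "ip N ?v S = s * (2 * act N d')" "act N S = s\<^sup>2 * act N d'"
   unfolding Sd act_scale by (simp_all add: act_ip ip_def sum_distrib_left ac_simps)
  have "ip N e ?v = ip N ?v S + ip N ?v y'" unfolding e by (simp add: ip_def inner_add_left inner_commute sum.distrib inner_add_right distrib_left)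
  then have "act N e = act N y' + s * ip N e ?v - s\<^sup>2 * act N d'"
   using act_add[of N S y'] unfolding e[symmetric] vS by (simp add: power2_eq_square algebra_simps)
  moreover have "s * ip N e ?v <= b2 * integral {0..1} (%t. (j (trig N e t))\<^sup>2) + s\<^sup>2 * (c\<^sup>2 / b2)"
  proof (rule has_integral_le)
   show "((%t. s * (trig N e t \<bullet> trig N ?v t)) has_integral s * ip N e ?v) {0..1}"
    by (intro has_integral_mult_right trig_inner_trig)
   show "((%t. b2 * (j (trig N e t))\<^sup>2 + s\<^sup>2 * (c\<^sup>2 / b2)) has_integral (b2 * integral {0..1} (%t. (j (trig N e t))\<^sup>2) + s\<^sup>2 * (c\<^sup>2 / b2))) {0..1}"
    by (intro has_integral_unit_const has_integral_add has_integral_mult_right integrable_integral jc)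
   fix t
   let ?z = "trig N e t"
   have "s * (?z \<bullet> trig N ?v t) <= s * (2 * c * j ?z)" using d(2)[of ?z t] s unfolding ext(2)[OF N] by (intro mult_left_mono) auto
   also have "\<dots> <= b2 * (j ?z)\<^sup>2 + s\<^sup>2 * (c\<^sup>2 / b2)"
   proof -
    have "0 <= (b2 * j ?z - s * c)\<^sup>2 / b2" using bD by simp
    also have "\<dots> = b2 * (j ?z)\<^sup>2 + s\<^sup>2 * (c\<^sup>2 / b2) - s * (2 * c * j ?z)" using bD by (simp add: field_simps power2_eq_square)
    finally show ?thesis by simp
   qed
   finally show "s * (?z \<bullet> trig N ?v t) <= b2 * (j ?z)\<^sup>2 + s\<^sup>2 * (c\<^sup>2 / b2)" .
  qed
  moreover have "s\<^sup>2 * (c\<^sup>2 / b2) <= s\<^sup>2 * act N d'" using actd unfolding ext(1)[OF N] by (intro mult_left_mono) auto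
  ultimately have A: "act N e <= b2 * integral {0..1} (%t. (j (trig N e t))\<^sup>2)" using y'0 by linarith
  have B: "b1 * integral {0..1} (%t. (j (trig N e t))\<^sup>2) - b <= integral {0..1} (%t. K (trig N e t))"
  proof (rule has_integral_le)
   show "((%t. b1 * (j (trig N e t))\<^sup>2 - b) has_integral (b1 * integral {0..1} (%t. (j (trig N e t))\<^sup>2) - b)) {0..1}"
    by (intro has_integral_unit_const has_integral_diff has_integral_mult_right integrable_integral jc)
   show "b1 * (j (trig N e t))\<^sup>2 - b <= K (trig N e t)" for t
    using coerc[of "trig N e t"] H_ge[of "trig N e t"] by (simp add: K_def)
  qed (intro integrable_integral integrable_continuous_real K.cont_comp)
  have C: "\<kappa>\<^sup>2 * ip N e e <= integral {0..1} (%t. (j (trig N e t))\<^sup>2)"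
  proof (rule has_integral_le[OF has_integral_mult_right[OF trig_inner_trig] integrable_integral[OF jc(1)]])
   fix t
   have "(\<kappa> * norm (trig N e t))\<^sup>2 <= (j (trig N e t))\<^sup>2" using j.\<kappa> by (intro power_mono j.lower) auto
   then show "\<kappa>\<^sup>2 * (trig N e t \<bullet> trig N e t) <= (j (trig N e t))\<^sup>2" by (simp add: power_mult_distrib dot_square_norm)
  qed
  let ?Y = "\<Sum>k\<in>freqs N. if 0 < k then 0 else y k \<bullet> y k"
  have Y: "0 <= ?Y" by (intro sum_nonneg) auto
  have "ip N e e = (\<Sum>k\<in>freqs N. s\<^sup>2 * (if 0 < k then d' k \<bullet> d' k else 0) + (if 0 < k then 0 else y k \<bullet> y k))"
   unfolding ip_def by (intro sum.cong refl) (simp add: e_def power2_eq_square)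
  also have "\<dots> = s\<^sup>2 * q1 + ?Y" by (simp add: sum.distrib sum_distrib_left[symmetric] ext(4)[OF N])
  finally have ipe: "ip N e e = s\<^sup>2 * q1 + ?Y" .
  have "min 1 q1 * s\<^sup>2 <= q1 * s\<^sup>2" "min 1 q1 * ?Y <= 1 * ?Y" using Y by (intro mult_right_mono; simp)+
  then have "min 1 q1 * (s\<^sup>2 + ?Y) <= ip N e e" unfolding ipe by (simp add: algebra_simps)
  then have "(b1 - b2) * \<kappa>\<^sup>2 * (min 1 q1 * (s\<^sup>2 + ?Y)) <= (b1 - b2) * \<kappa>\<^sup>2 * ip N e e" using bD by (intro mult_left_mono) auto
  also have "\<dots> <= (b1 - b2) * integral {0..1} (%t. (j (trig N e t))\<^sup>2)" using C bD by (simp add: mult.assoc mult_left_mono)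
  finally have "\<kappa>1 * (s\<^sup>2 + ?Y) <= (b1 - b2) * integral {0..1} (%t. (j (trig N e t))\<^sup>2)" by (simp add: \<kappa>1_def mult.assoc)
  then have "K.Phi N e <= b - \<kappa>1 * (s\<^sup>2 + ?Y)" using A B unfolding K.Phi_def by (simp add: algebra_simps)
  then show ?thesis by (simp add: e_def[abs_def])
 qed

 obtain B \<delta> where B: "0 < \<delta>" "!!N c. 0 <= K.Phi N c ==> ip N (K.gr N c) (K.gr N c) <= \<delta>\<^sup>2 ==> ip N c c <= B"
  using K.almost_critical_bounded[OF \<nu> decay] by blast
 define N where "N i = max M i" for i :: nat
 have "\<exists>e. \<alpha> <= K.Phi (N i) e \<and> ip (N i) (K.gr (N i) e) (K.gr (N i) e) <= min (\<delta>\<^sup>2) (inverse (real (Suc i)))" for i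
  by (rule K.almost_critical_point[OF K0 \<rho> \<alpha> sphere ext(3) q \<kappa>1 patch]) (use B in \<open>auto simp: N_def\<close>)
 then obtain e where e: "!!i. \<alpha> <= K.Phi (N i) (e i)"
  "!!i. ip (N i) (K.gr (N i) (e i)) (K.gr (N i) (e i)) <= min (\<delta>\<^sup>2) (inverse (real (Suc i)))" by metis
 have eB: "ip (N i) (e i) (e i) <= B" for i using B(2)[of "N i" "e i"] e[of i] \<alpha> by simp
 obtain x r where x: "strict_mono (r :: nat \<Rightarrow> nat)" "brake_loop x"
  "uniform_limit UNIV (%i. trig (N (r i)) (e (r i))) x sequentially"
  "!!t. (x has_vector_derivative J0 (gK (x t))) (at t)"
 proof (rule K.brake_limit[of N e B])
  show "i <= N i" for i by (simp add: N_def)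
  show "ip (N i) (K.gr (N i) (e i)) (K.gr (N i) (e i)) <= inverse (real (Suc i))" for i using e(2)[of i] by simp
 qed (rule Kr eB that; assumption)+
 let ?f = "%z. (z \<bullet> gK z) / 2 - K z"
 have cf: "continuous_on UNIV ?f" by (intro continuous_intros K.cont_gK K.cont_K) auto
 have cx: "continuous_on S x" for S using x(2) by (auto simp: brake_loop_def intro: continuous_on_subset)
 \<comment> \<open>In \<open>Phi_eq\<close> the gradient term tends to 0 since the loops are
   bounded, so the level \<alpha> passes to the integral of the action density along the
   limit.\<close>
 have PhiI: "\<alpha> <= integral {0..1} (%t. ?f (x t))"
 proof -
  define R where "R = sqrt (max B 1)"
  have R: "0 < R" "R\<^sup>2 = max B 1" by (auto simp: R_def)
  have l1: "(%i. integral {0..1} (%t. ?f (trig (N (r i)) (e (r i)) t))) \<longlonglongrightarrow> integral {0..1} (%t. ?f (x t))"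
   by (rule uniform_limit_integral_comp[OF cf uniform_limit_on_subset[OF x(3)]]) (auto intro: continuous_on_trig)
  have l2: "(%i. \<alpha> - sqrt (inverse (real (Suc i))) * R / 2) \<longlonglongrightarrow> \<alpha> - 0 * R / 2"
   using tendsto_real_sqrt[OF LIMSEQ_inverse_real_of_nat] by (intro tendsto_intros) auto
  have l3: "\<alpha> - sqrt (inverse (real (Suc i))) * R / 2 <= integral {0..1} (%t. ?f (trig (N (r i)) (e (r i)) t))" for i
  proof -
   have "i <= r i" by (rule seq_suble[OF x(1)])
   then have "inverse (real (Suc (r i))) <= inverse (real (Suc i))" by (simp add: le_imp_inverse_le)
   then have "ip (N (r i)) (K.gr (N (r i)) (e (r i))) (K.gr (N (r i)) (e (r i))) <= inverse (real (Suc i))"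
    by (rule order_trans[rotated]) (use e(2)[of "r i"] in simp)
   then have "ip (N (r i)) (K.gr (N (r i)) (e (r i))) (K.gr (N (r i)) (e (r i))) <= (sqrt (inverse (real (Suc i))))\<^sup>2"
    by simp
   then have "ip (N (r i)) (K.gr (N (r i)) (e (r i))) (e (r i)) <= sqrt (inverse (real (Suc i))) * R"
    using eB[of "r i"] R by (intro ip_le) auto
   then show ?thesis using e(1)[of "r i"] unfolding K.Phi_eq by linarith
  qed
  have "\<alpha> - 0 * R / 2 <= integral {0..1} (%t. ?f (x t))"
   by (rule LIMSEQ_le[OF l2 l1]) (use l3 in blast)
  then show ?thesis by simp
 qed
 have if': "((%t. ?f (x t)) has_integral integral {0..1} (%t. ?f (x t))) {0..1}"
  by (intro integrable_integral integrable_continuous_real continuous_on_compose2[OF cf cx]) auto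
 have neg: "\<exists>t\<in>{0..1}. 0 < ?f (x t)"
 proof (rule ccontr)
  assume "\<not> ?thesis"
  then have "integral {0..1} (%t. ?f (x t)) <= 0"
   by (intro has_integral_le[OF if' has_integral_unit_const]) force
  then show False using PhiI \<alpha> by linarith
 qed
 have Kconst: "K (x t) = K (x s)" for s t
 proof -
  have "((%t. K (x t)) has_vector_derivative 0) (at t)" for t
  proof -
   have "((%t. K (x t)) has_derivative (%h. (h *\<^sub>R J0 (gK (x t))) \<bullet> gK (x t))) (at t)"
    using has_derivative_compose[OF x(4)[of t, unfolded has_vector_derivative_def] K.deriv[of "x t"]] .
   moreover have "J0 w \<bullet> w = 0" for w :: "'n phase" by (simp add: J0_def inner_prod_def inner_commute)
   ultimately show ?thesis by (simp add: has_vector_derivative_def)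
  qed
  from vector_derivative_eq_imp_const[OF this has_vector_derivative_const[of 0], of t s] show ?thesis by simp
 qed
 \<comment> \<open>An orbit that reaches j >= 1 has energy at least m by conservation. Then the
   action density is nonpositive everywhere: outside by \<open>out\<close>, and inside because H = m
   is maximal there and its gradient vanishes.\<close>
 have in_C: "j (x t0) < 1" for t0
 proof (rule ccontr)
  assume "\<not> j (x t0) < 1"
  then have Km: "m <= K (x t)" for t
   using H_out[of "x t0"] m.env_nonneg[of "x t0"] unfolding Kconst[of t t0] by (simp add: K_def)
  have "?f (x t) <= 0" for t
  proof (cases "1 < j (x t)")
   case True
   have "0 <= D / 2 * j (m.prox (x t))" using bD j.nonneg by simp
   then show ?thesis using out[OF True] bD by linarith
  next
   case False
   then have E: "?E (x t) = 0" "?G (x t) = 0" using m.env_zero[of "x t"] by auto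
   then have "H (x t) = m" using Km[of t] H_le[of "x t"] by (simp add: K_def)
   then show ?thesis using gH_max[of "x t"] E c by (simp add: K_def gK_def)
  qed
  then show False using neg linorder_not_le by blast
 qed
 have gKH: "gK (x t) = gH (x t)" for t using m.env_zero[of "x t"] in_C[of t] by (simp add: gK_def)
 have "\<exists>s t. x s ~= x t"
 proof (rule ccontr)
  assume const: "\<not> ?thesis"
  then have "x = (%t. x 0)" by (auto simp: fun_eq_iff)
  then have "(x has_vector_derivative 0) (at t)" for t by (metis has_vector_derivative_const)
  from vector_derivative_unique_at[OF this x(4)] have "norm (J0 (gK (x t))) = 0" for t by (metis norm_zero)
  then have "gK (x t) = 0" for t by simp
  then have "?f (x t) <= 0" for t using K0[of "x t"] by simp
  then show False using neg linorder_not_le by blast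
 qed
 then show ?thesis using x(2,4) in_C gKH by (intro exI[of _ x]) auto
qed

section \<open>Support functions, polars and gauges of convex bodies\<close>

definition supp :: "'a::euclidean_space set \<Rightarrow> 'a \<Rightarrow> real" where
 "supp K v = Sup ((%x. x \<bullet> v) ` K)"

lemma supp_upper:
 assumes "compact K" "x \<in> K" shows "x \<bullet> v <= supp K v"
 unfolding supp_def
proof (rule cSup_upper)
 show "bdd_above ((%x. x \<bullet> v) ` K)"
  by (intro bounded_imp_bdd_above compact_imp_bounded compact_continuous_image continuous_intros assms(1))
qed (use assms in auto)

lemma supp_least:
 assumes "K ~= {}" "!!x. x \<in> K ==> x \<bullet> v <= s" shows "supp K v <= s"
 unfolding supp_def by (rule cSup_least) (use assms in auto)

lemma supp_gauge:
 assumes K: "compact K" and r: "0 < r" "cball 0 r \<subseteq> K" and R: "K \<subseteq> cball 0 R"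
 shows "sublinear_gauge (supp K) r R"
proof
 have ne: "K ~= {}" using r by auto
 show "supp K (x + y) <= supp K x + supp K y" for x y
  by (rule supp_least[OF ne]) (simp add: inner_add_right add_mono supp_upper[OF K])
 show sc: "supp K (t *\<^sub>R x) = t * supp K x" if t: "0 <= t" for t x
 proof (cases "t = 0")
  case True
  have "supp K 0 <= 0" by (rule supp_least[OF ne]) simp
  moreover have "0 <= supp K 0" using ne supp_upper[OF K, of _ 0] by fastforce
  ultimately show ?thesis using True by simp
 next
  case False
  then have t: "0 < t" using t by simp
  have "supp K (t *\<^sub>R x) <= t * supp K x"
   by (rule supp_least[OF ne]) (use t in \<open>simp add: mult_left_mono supp_upper[OF K]\<close>)
  moreover have "supp K x <= supp K (t *\<^sub>R x) / t"
   by (rule supp_least[OF ne]) (use t supp_upper[OF K, of _ "t *\<^sub>R x"] in \<open>simp add: pos_le_divide_eq mult.commute\<close>)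
  ultimately show ?thesis using t by (simp add: pos_le_divide_eq mult.commute)
 qed
 show "r * norm x <= supp K x" for x
 proof (cases "x = 0")
  case True then show ?thesis using sc[of 0 0] by simp
 next
  case False
  have "(r / norm x) *\<^sub>R x \<in> K" using r False by (intro subsetD[OF r(2)]) simp
  from supp_upper[OF K this, of x] show ?thesis using False by (simp add: dot_square_norm power2_eq_square)
 qed
 show "supp K x <= R * norm x" for x
 proof (rule supp_least[OF ne])
  fix y assume "y \<in> K"
  then have "norm y <= R" using R by auto
  then show "y \<bullet> x <= R * norm x" by (meson mult_right_mono norm_cauchy_schwarz norm_ge_zero order_trans)
 qed
 show "0 < r" by fact
 obtain b :: 'a where "b \<in> Basis" using nonempty_Basis by blast
 then have "r *\<^sub>R b \<in> K" using r by (intro subsetD[OF r(2)]) simp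
 then have "r *\<^sub>R b \<in> cball 0 R" using R by blast
 then show "0 < R" using r(1) \<open>b \<in> Basis\<close> by (simp add: abs_of_pos)
qed

lemma body_radii:
 fixes K :: "'a::euclidean_space set"
 assumes "compact K" "0 \<in> interior K"
 obtains r R where "0 < r" "cball 0 r \<subseteq> K" "K \<subseteq> cball 0 R"
proof -
 obtain r where "0 < r" "cball 0 r \<subseteq> K" using assms(2) mem_interior_cball by blast
 moreover obtain R where "!!x. x \<in> K ==> norm x <= R"
  using compact_imp_bounded[OF assms(1)] bounded_iff by blast
 then have "K \<subseteq> cball 0 R" by auto
 ultimately show thesis by (rule that)
qed

lemma mem_of_supp:
 assumes K: "compact K" "convex K" "K ~= {}" and x: "!!v. x \<bullet> v <= supp K v"
 shows "x \<in> K"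
proof (rule ccontr)
 assume "x \<notin> K"
 then obtain a b where ab: "a \<bullet> x < b" "!!y. y \<in> K ==> b < a \<bullet> y"
  using separating_hyperplane_closed_point[OF K(2) compact_imp_closed[OF K(1)]] by blast
 have "supp K (- a) <= - b"
  by (rule supp_least[OF K(3)]) (use ab(2) in \<open>auto simp: inner_commute less_imp_le\<close>)
 then show False using x[of "- a"] ab(1) by (simp add: inner_commute)
qed

definition polar :: "'a::euclidean_space set \<Rightarrow> 'a set" where
 "polar K = {a. \<forall>x\<in>K. a \<bullet> x <= 1}"

lemma polar_body:
 assumes r: "0 < r" "cball 0 r \<subseteq> K" and R: "0 < R" "K \<subseteq> cball 0 R"
 shows "compact (polar K)" "cball 0 (1 / R) \<subseteq> polar K" "polar K \<subseteq> cball 0 (1 / r)"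
proof -
 show sub: "polar K \<subseteq> cball 0 (1 / r)"
 proof
  fix a assume a: "a \<in> polar K"
  show "a \<in> cball 0 (1 / r)"
  proof (cases "a = 0")
   case False
   have "(r / norm a) *\<^sub>R a \<in> K" using r False by (intro subsetD[OF r(2)]) simp
   then have "a \<bullet> ((r / norm a) *\<^sub>R a) <= 1" using a unfolding polar_def by blast
   then have "r * norm a <= 1" using False by (simp add: dot_square_norm power2_eq_square)
   then show ?thesis using r by (simp add: field_simps)
  qed (use r in simp)
 qed
 have "closed (polar K)"
 proof -
  have "polar K = (\<Inter>x\<in>K. {a. a \<bullet> x <= 1})" by (auto simp: polar_def)
  then show ?thesis by (auto intro!: closed_INT closed_Collect_le continuous_intros)
 qed
 then show "compact (polar K)" using sub by (meson bounded_cball bounded_subset compact_eq_bounded_closed)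
 show "cball 0 (1 / R) \<subseteq> polar K"
 proof
  fix a :: 'a assume a: "a \<in> cball 0 (1 / R)"
  have "a \<bullet> x <= 1" if "x \<in> K" for x
  proof -
   have "a \<bullet> x <= norm a * norm x" by (rule norm_cauchy_schwarz)
   also have "\<dots> <= 1 / R * R" using a that R by (intro mult_mono) auto
   finally show ?thesis using R by simp
  qed
  then show "a \<in> polar K" by (simp add: polar_def)
 qed
qed

text \<open>The gauge as support function of the polar body, rather than as an infimum as in
  \<open>minkowski\<close>; in this form \<open>supp_gauge\<close> yields sublinearity and both norm
  bounds at once.\<close>

definition gauge_of :: "'a::euclidean_space set \<Rightarrow> 'a \<Rightarrow> real" where
 "gauge_of K = supp (polar K)"

text \<open>All clauses are duality. A functional separating an outside point from K belongs to the
  polar after scaling; an interior point can be stretched by 1 + t within K; and the supremum over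
  the compact polar is attained.\<close>

lemma gauge_of_body:
 fixes K :: "'a::euclidean_space set"
 assumes K: "compact K" "convex K" "0 \<in> interior K"
 shows "\<exists>\<kappa> \<beta>. sublinear_gauge (gauge_of K) \<kappa> \<beta>"
  and "x \<in> interior K \<longleftrightarrow> gauge_of K x < 1"
  and "z \<bullet> w <= gauge_of K z * supp K w"
  and "\<exists>a. (\<forall>y\<in>K. a \<bullet> y <= 1) \<and> a \<bullet> x = gauge_of K x"
proof -
 obtain r R where r: "0 < r" "cball 0 r \<subseteq> K" and R: "K \<subseteq> cball 0 R" using body_radii[OF K(1,3)] by blast
 interpret s: sublinear_gauge "supp K" r R by (rule supp_gauge[OF K(1) r R])
 have R0: "0 < R" by (rule s.\<beta>)
 have P: "compact (polar K)" "cball 0 (1 / R) \<subseteq> polar K" "polar K \<subseteq> cball 0 (1 / r)"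
  using polar_body[OF r R0 R] by auto
 have R1: "0 < 1 / R" using R0 by simp
 have sl: "sublinear_gauge (gauge_of K) (1 / R) (1 / r)"
  unfolding gauge_of_def by (rule supp_gauge[OF P(1) R1 P(2,3)])
 then show "\<exists>\<kappa> \<beta>. sublinear_gauge (gauge_of K) \<kappa> \<beta>" by blast
 interpret g: sublinear_gauge "gauge_of K" "1 / R" "1 / r" by (rule sl)
 have Pne: "polar K ~= {}" using P(2) R0 by auto
 have le1: "gauge_of K y <= 1" if "y \<in> K" for y
  unfolding gauge_of_def by (rule supp_least[OF Pne]) (use that in \<open>auto simp: polar_def\<close>)
 have out: "1 < gauge_of K y" if y: "y \<notin> K" for y
 proof -
  obtain a b where ab: "a \<bullet> y < b" "!!x. x \<in> K ==> b < a \<bullet> x"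
   using separating_hyperplane_closed_point[OF K(2) compact_imp_closed[OF K(1)] y] by blast
  have "0 \<in> K" using K(3) interior_subset by blast
  then have b: "b < 0" using ab(2)[of 0] by simp
  have "(1 / b) *\<^sub>R a \<in> polar K"
   using ab(2) b by (auto simp: polar_def field_simps less_imp_le)
  then have "y \<bullet> ((1 / b) *\<^sub>R a) <= gauge_of K y"
   unfolding gauge_of_def using supp_upper[OF P(1), of _ y] by (metis inner_commute)
  moreover have "1 < y \<bullet> ((1 / b) *\<^sub>R a)" using ab(1) b by (simp add: inner_commute field_simps)
  ultimately show ?thesis by simp
 qed
 show "x \<in> interior K \<longleftrightarrow> gauge_of K x < 1"
 proof
  assume x: "x \<in> interior K"
  then obtain e where e: "0 < e" "ball x e \<subseteq> K" using mem_interior by blast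
  define t where "t = e / (2 * (norm x + 1))"
  have t: "0 < t" using e by (simp add: t_def add_nonneg_pos)
  have "t * norm x < e" using e by (simp add: t_def divide_simps) (smt (verit) mult_less_cancel_left_pos mult_nonneg_nonneg norm_ge_zero)
  then have "(1 + t) *\<^sub>R x \<in> ball x e" using t by (simp add: dist_norm algebra_simps)
  then have "(1 + t) * gauge_of K x <= 1" using le1[of "(1 + t) *\<^sub>R x"] e t by (auto simp: g.scale)
  then show "gauge_of K x < 1"
   using t g.nonneg[of x] by (smt (verit, ccfv_SIG) mult_le_cancel_right1 mult_less_cancel_right1)
 next
  assume x: "gauge_of K x < 1"
  have "open {y. gauge_of K y < 1}" by (intro open_Collect_less g.cont continuous_on_const)
  moreover have "{y. gauge_of K y < 1} \<subseteq> K" using out by force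
  ultimately show "x \<in> interior K" using x interiorI by blast
 qed
 show "z \<bullet> w <= gauge_of K z * supp K w"
 proof (cases "w = 0")
  case False
  then have s: "0 < supp K w" using s.lower[of w] r by (metis less_le_trans mult_pos_pos zero_less_norm_iff)
  have "(1 / supp K w) *\<^sub>R w \<in> polar K"
   using supp_upper[OF K(1), of _ w] s by (auto simp: polar_def inner_commute pos_divide_le_eq)
  then have "z \<bullet> ((1 / supp K w) *\<^sub>R w) <= gauge_of K z"
   unfolding gauge_of_def using supp_upper[OF P(1), of _ z] by (metis inner_commute)
  then show ?thesis using s by (simp add: pos_divide_le_eq)
 qed (use s.scale[of 0 0] in simp)
 have "\<exists>a\<in>polar K. \<forall>b\<in>polar K. b \<bullet> x <= a \<bullet> x"
  by (rule continuous_attains_sup[OF P(1) Pne]) (intro continuous_intros)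
 then obtain a where a: "a \<in> polar K" "!!b. b \<in> polar K ==> b \<bullet> x <= a \<bullet> x" by blast
 then have "gauge_of K x = a \<bullet> x"
  unfolding gauge_of_def by (intro order_antisym supp_least[OF Pne] supp_upper[OF P(1)]) auto
 then show "\<exists>a. (\<forall>y\<in>K. a \<bullet> y <= 1) \<and> a \<bullet> x = gauge_of K x" using a(1) by (auto simp: polar_def)
qed

section \<open>Staircases, their area and their length\<close>

text \<open>The integral of \<open>omega0 z dz\<close> along the path from 0 that makes, for each i
  in turn, the q-move \<open>fst (w i)\<close> and then the p-move \<open>snd (w i)\<close>. The
  ranges j <= i and j < i record this order.\<close>

definition stair :: "nat \<Rightarrow> (nat \<Rightarrow> 'n::finite phase) \<Rightarrow> real" where
 "stair m w = (\<Sum>i<m. (\<Sum>j\<le>i. fst (w j)) \<bullet> snd (w i) - (\<Sum>j<i. snd (w j)) \<bullet> fst (w i))"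

text \<open>Abel summation. For fixed p-moves the right side is linear in the q-moves, which is what
  Caratheodory's theorem exploits.\<close>

lemma stair_abel:
 "stair m w = (\<Sum>i<m. fst (w i)) \<bullet> (\<Sum>i<m. snd (w i)) - 2 * (\<Sum>i<m. (\<Sum>j<i. snd (w j)) \<bullet> fst (w i))"
proof (induction m)
 case (Suc m)
 have "(\<Sum>j\<le>m. fst (w j)) = (\<Sum>j<m. fst (w j)) + fst (w m)"
  by (simp add: lessThan_Suc_atMost[symmetric])
 then show ?case using Suc by (simp add: stair_def inner_add_left inner_add_right inner_commute)
qed (simp add: stair_def)

locale two_gauges =
 Q: sublinear_gauge hQ \<kappa>Q \<beta>Q + P: sublinear_gauge hP \<kappa>P \<beta>P
 for hQ hP :: "real^'n::finite \<Rightarrow> real" and \<kappa>Q \<beta>Q \<kappa>P \<beta>P :: real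
begin

text \<open>With the gauges inserted in \<open>staircase_minimizer\<close> this is the maximum of
  \<open>omega0 \<zeta> v\<close> over \<zeta> in the product body: \<open>hP\<close> is the support
  function of \<Delta>, and \<open>hQ\<close> that of \<Lambda> at the negative vector.\<close>

definition cost :: "'n phase \<Rightarrow> real" where
 "cost v = hQ (fst v) + hP (snd v)"

definition total :: "nat \<Rightarrow> (nat \<Rightarrow> 'n phase) \<Rightarrow> real" where
 "total m w = (\<Sum>i<m. cost (w i))"

lemma hQ_zero [simp]: "hQ 0 = 0" and hP_zero [simp]: "hP 0 = 0"
 using Q.scale[of 0 0] P.scale[of 0 0] by simp_all

lemma cost_nonneg: "0 <= cost v"
 by (simp add: cost_def Q.nonneg P.nonneg)

lemma cost_add: "cost (v + w) <= cost v + cost w"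
 using Q.add[of "fst v" "fst w"] P.add[of "snd v" "snd w"] by (simp add: cost_def)

lemma cost_scale: "0 <= t ==> cost (t *\<^sub>R v) = t * cost v"
 by (simp add: cost_def Q.scale P.scale distrib_left)

lemma cost_lower: "min \<kappa>Q \<kappa>P * norm v <= cost v"
proof -
 have "norm v <= norm (fst v) + norm (snd v)" by (metis norm_Pair_le prod.collapse)
 then have "min \<kappa>Q \<kappa>P * norm v <= min \<kappa>Q \<kappa>P * norm (fst v) + min \<kappa>Q \<kappa>P * norm (snd v)"
  using Q.\<kappa> P.\<kappa> by (metis distrib_left less_eq_real_def min_less_iff_conj mult_left_mono)
 also have "\<dots> <= \<kappa>Q * norm (fst v) + \<kappa>P * norm (snd v)"
  by (intro add_mono mult_right_mono) auto
 also have "\<dots> <= cost v" unfolding cost_def by (intro add_mono Q.lower P.lower)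
 finally show ?thesis .
qed

lemma cont_cost: "continuous_on S cost"
 unfolding cost_def
 by (intro continuous_intros continuous_on_compose2[OF Q.cont[of UNIV]] continuous_on_compose2[OF P.cont[of UNIV]]) auto

text \<open>The area of a path depends linearly on its configuration velocity as long as the
 momentum part is kept. By Caratheodory's theorem the velocity may therefore be concentrated in
 boundedly many instants, which turns the path into a staircase of bounded length.\<close>

lemma staircase_reduction:
 fixes b :: "real \<Rightarrow> real^'n" and V :: "real \<Rightarrow> real"
 assumes T: "0 <= T" and l: "0 < l"
  and V: "!!s t. 0 <= s ==> s <= t ==> t <= T ==> hP (b t - b s) <= V t - V s"
  and hull: "(a /\<^sub>R l, f / l) \<in> convex hull {(u, u \<bullet> b t) | u t. hQ u <= 1 \<and> t \<in> {0..T}}"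
 shows "\<exists>w. fst (w 0) = 0 \<and> snd (w (CARD('n) + 3)) = 0 \<and>
  (\<Sum>i<CARD('n) + 4. w i) = (a, b T - b 0) \<and>
  stair (CARD('n) + 4) w = a \<bullet> (b T - b 0) - 2 * (f - a \<bullet> b 0) \<and>
  total (CARD('n) + 4) w <= l + (V T - V 0)"
proof -
 let ?n = "CARD('n)"
 let ?Y = "{(u, u \<bullet> b t) | u t. hQ u <= 1 \<and> t \<in> {0..T}}"
 \<comment> \<open>The pairs live in dimension n + 1, so n + 2 of them suffice.\<close>
 obtain S p where S: "finite S" "S \<subseteq> ?Y" "card S <= ?n + 2"
  and p: "!!y. y \<in> S ==> 0 <= p y" "sum p S = 1" and sp: "(\<Sum>y\<in>S. p y *\<^sub>R y) = (a /\<^sub>R l, f / l)"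
  using hull unfolding convex_hull_caratheodory by auto
 have "\<exists>t. t \<in> {0..T} \<and> hQ (fst y) <= 1 \<and> snd y = fst y \<bullet> b t" if "y \<in> S" for y
  using that S(2) by force
 then obtain \<tau> where \<tau>: "!!y. y \<in> S ==> \<tau> y \<in> {0..T} \<and> hQ (fst y) <= 1 \<and> snd y = fst y \<bullet> b (\<tau> y)" by metis
 obtain xs where xs: "set xs = S" "distinct xs" using finite_distinct_list[OF S(1)] by blast
 define ys where "ys = sort_key \<tau> xs"
 have ys: "set ys = S" "distinct ys" "sorted (map \<tau> ys)" using xs by (auto simp: ys_def)
 define r where "r = length ys"
 have r: "r <= ?n + 2" using S(3) ys distinct_card[of ys] by (simp add: r_def)
 \<comment> \<open>Step i makes its q-move at time t i and then follows b up to t (i + 1). Step 0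
   only carries the p-move before the first chosen instant. The last of the n + 4 steps starts at T
   and has no p-move. These are the two end conditions of the conclusion.\<close>
 define t where "t i = (if i = 0 then 0 else if i <= r then \<tau> (ys ! (i - 1)) else T)" for i
 have inS: "ys ! (i - 1) \<in> S" if "0 < i" "i <= r" for i
  using that ys(1) by (metis One_nat_def Suc_le_eq Suc_pred nth_mem r_def)
 have tT: "0 <= t i \<and> t i <= T" for i
  using \<tau>[OF inS[of i]] T by (auto simp: t_def)
 have t_mono: "t i <= t (Suc i)" for i
 proof (cases "0 < i \<and> Suc i <= r")
  case True
  then have "\<tau> (ys ! (i - 1)) <= \<tau> (ys ! i)"
   using sorted_nth_mono[OF ys(3), of "i - 1" i] nth_map[of "i - 1" ys \<tau>] nth_map[of i ys \<tau>] by (auto simp: r_def)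
  then show ?thesis using True by (simp add: t_def)
 next
  case False
  then show ?thesis using tT[of i] tT[of "Suc i"] by (auto simp: t_def)
 qed
 define \<alpha> where "\<alpha> i = (if 0 < i \<and> i <= r then (l * p (ys ! (i - 1))) *\<^sub>R fst (ys ! (i - 1)) else 0)" for i
 define w where "w i = (\<alpha> i, b (t (Suc i)) - b (t i))" for i
 let ?m = "?n + 4"
 have tm: "t ?m = T" "t (?n + 3) = T" using r by (auto simp: t_def)
 have t0: "t 0 = 0" by (simp add: t_def)
 have tele: "(\<Sum>j<i. snd (w j)) = b (t i) - b 0" for i
  using sum_lessThan_telescope[of "%i. b (t i)" i] by (simp add: w_def t0)
 have reindex: "(\<Sum>i<?m. if 0 < i \<and> i <= r then g (ys ! (i - 1)) else 0) = sum g S" for g :: "_ \<Rightarrow> 'b::comm_monoid_add"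
 proof -
  have "(\<Sum>i<?m. if 0 < i \<and> i <= r then g (ys ! (i - 1)) else 0) = (\<Sum>i\<in>Suc ` {..<r}. g (ys ! (i - 1)))"
   by (rule sum.mono_neutral_cong_right) (use r in \<open>auto simp: image_iff gr0_conv_Suc\<close>)
  also have "\<dots> = (\<Sum>i<r. g (ys ! i))" by (simp add: sum.reindex)
  also have "\<dots> = sum_list (map g ys)" by (simp add: r_def sum_list_sum_nth atLeast0LessThan)
  also have "\<dots> = sum g S" using sum_list_distinct_conv_sum_set[OF ys(2), of g] ys(1) by simp
  finally show ?thesis .
 qed
 have fst_sp: "(\<Sum>y\<in>S. p y *\<^sub>R fst y) = a /\<^sub>R l" and snd_sp: "(\<Sum>y\<in>S. p y * snd y) = f / l"
  using arg_cong[OF sp, of fst] arg_cong[OF sp, of snd] by (simp_all add: fst_sum snd_sum)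
 have sum_a: "(\<Sum>i<?m. fst (w i)) = a"
 proof -
  have "(\<Sum>i<?m. fst (w i)) = (\<Sum>y\<in>S. (l * p y) *\<^sub>R fst y)"
   using reindex[of "%y. (l * p y) *\<^sub>R fst y"] by (simp add: w_def \<alpha>_def)
  also have "\<dots> = l *\<^sub>R (\<Sum>y\<in>S. p y *\<^sub>R fst y)" by (simp add: scaleR_sum_right)
  finally show ?thesis using l by (simp add: fst_sp)
 qed
 have tot: "(\<Sum>i<?m. w i) = (a, b T - b 0)"
  using sum_a tele[of ?m] tm by (simp add: prod_eq_iff fst_sum snd_sum)
 have "(\<Sum>i<?m. (\<Sum>j<i. snd (w j)) \<bullet> fst (w i)) = (\<Sum>i<?m. if 0 < i \<and> i <= r then (%y. l * p y * (snd y - fst y \<bullet> b 0)) (ys ! (i - 1)) else 0)"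
 proof (intro sum.cong refl)
  fix i
  show "(\<Sum>j<i. snd (w j)) \<bullet> fst (w i) = (if 0 < i \<and> i <= r then (%y. l * p y * (snd y - fst y \<bullet> b 0)) (ys ! (i - 1)) else 0)"
  proof (cases "0 < i \<and> i <= r")
   case True
   then show ?thesis using \<tau>[OF inS[of i]] unfolding tele
    by (simp add: w_def \<alpha>_def t_def inner_commute[of "b _ - b 0"] inner_diff_right right_diff_distrib)
  qed (auto simp: w_def \<alpha>_def)
 qed
 also have "\<dots> = (\<Sum>y\<in>S. l * p y * (snd y - fst y \<bullet> b 0))" by (rule reindex)
 also have "\<dots> = l * ((\<Sum>y\<in>S. p y * snd y) - (\<Sum>y\<in>S. p y *\<^sub>R fst y) \<bullet> b 0)"
  by (simp add: inner_sum_left sum_subtractf[symmetric] sum_distrib_left algebra_simps)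
 also have "\<dots> = f - a \<bullet> b 0" using l unfolding fst_sp snd_sp by (simp add: right_diff_distrib)
 finally have st: "stair ?m w = a \<bullet> (b T - b 0) - 2 * (f - a \<bullet> b 0)"
  unfolding stair_abel using sum_a tele[of ?m] tm by simp
 have "(\<Sum>i<?m. hQ (fst (w i))) = (\<Sum>i<?m. if 0 < i \<and> i <= r then (%y. l * p y * hQ (fst y)) (ys ! (i - 1)) else 0)"
 proof (intro sum.cong refl)
  fix i show "hQ (fst (w i)) = (if 0 < i \<and> i <= r then (%y. l * p y * hQ (fst y)) (ys ! (i - 1)) else 0)"
   using p(1)[OF inS[of i]] l by (auto simp: w_def \<alpha>_def Q.scale)
 qed
 also have "\<dots> = (\<Sum>y\<in>S. l * p y * hQ (fst y))" by (rule reindex)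
 also have "\<dots> <= (\<Sum>y\<in>S. l * p y * 1)"
  using p(1) l \<tau> by (intro sum_mono mult_left_mono) auto
 also have "\<dots> = l" using p(2) by (simp add: sum_distrib_left[symmetric])
 finally have ca: "(\<Sum>i<?m. hQ (fst (w i))) <= l" .
 have "(\<Sum>i<?m. hP (snd (w i))) <= (\<Sum>i<?m. V (t (Suc i)) - V (t i))"
  unfolding w_def snd_conv by (intro sum_mono V t_mono) (use tT in auto)
 also have "\<dots> = V T - V 0" using sum_lessThan_telescope[of "%i. V (t i)" ?m] by (simp add: t0 tm)
 finally have "total ?m w <= l + (V T - V 0)"
  using ca by (simp add: total_def cost_def sum.distrib)
 moreover have "fst (w 0) = 0" by (simp add: w_def \<alpha>_def)
 moreover have "snd (w (?n + 3)) = 0" using tm by (simp add: w_def eval_nat_numeral)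
 ultimately show ?thesis using tot st by blast
qed

end

section \<open>First variation of the area and a multiplier rule\<close>

lemma abel_mixed:
 fixes x y :: "nat \<Rightarrow> 'a::real_inner"
 shows "(\<Sum>i<m. (\<Sum>j\<le>i. x j) \<bullet> y i) + (\<Sum>i<m. (\<Sum>j<i. y j) \<bullet> x i) = (\<Sum>i<m. x i) \<bullet> (\<Sum>i<m. y i)"
proof (induction m)
 case (Suc m)
 have "(\<Sum>j\<le>m. x j) = (\<Sum>j<m. x j) + x m" by (simp add: lessThan_Suc_atMost[symmetric])
 then show ?case using Suc by (simp add: inner_add_left inner_add_right inner_commute)
qed simp

lemma stair_scale: "stair m (%i. t *\<^sub>R w i) = t\<^sup>2 * stair m w"
 by (simp add: stair_def sum_distrib_left right_diff_distrib power2_eq_square scaleR_sum_right[symmetric] mult.assoc)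

definition bil :: "nat \<Rightarrow> (nat \<Rightarrow> 'n::finite phase) \<Rightarrow> (nat \<Rightarrow> 'n phase) \<Rightarrow> real" where
 "bil m w v = (\<Sum>i<m. (\<Sum>j\<le>i. fst (w j)) \<bullet> snd (v i) - (\<Sum>j<i. snd (w j)) \<bullet> fst (v i))"

lemma stair_add:
 "stair m (%i. w i + e *\<^sub>R v i) = stair m w + e * (bil m w v + bil m v w) + e\<^sup>2 * stair m v"
 by (simp add: stair_def bil_def sum.distrib sum_distrib_left scaleR_sum_right[symmetric] inner_add_left inner_add_right
   sum_subtractf algebra_simps power2_eq_square)

text \<open>The derivative of \<open>stair\<close> in the j-th moves, by \<open>bil_sym\<close>:
  twice the position measured from the midpoint of the two end points, with q taken after the j-th
  q-move and p before the j-th p-move.\<close>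

definition lin :: "nat \<Rightarrow> (nat \<Rightarrow> 'n::finite phase) \<Rightarrow> nat \<Rightarrow> 'n phase" where
 "lin m w j = (2 *\<^sub>R (\<Sum>i\<le>j. fst (w i)) - (\<Sum>i<m. fst (w i)), 2 *\<^sub>R (\<Sum>i<j. snd (w i)) - (\<Sum>i<m. snd (w i)))"

lemma bil_sym: "bil m w v + bil m v w = (\<Sum>j<m. omega0 (lin m w j) (v j))"
proof -
 have 1: "(\<Sum>i<m. (\<Sum>j\<le>i. fst (v j)) \<bullet> snd (w i)) = (\<Sum>i<m. fst (v i)) \<bullet> (\<Sum>i<m. snd (w i)) - (\<Sum>i<m. (\<Sum>j<i. snd (w j)) \<bullet> fst (v i))"
  using abel_mixed[of "%i. fst (v i)" "%i. snd (w i)" m] by simp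
 have 2: "(\<Sum>i<m. (\<Sum>j<i. snd (v j)) \<bullet> fst (w i)) = (\<Sum>i<m. fst (w i)) \<bullet> (\<Sum>i<m. snd (v i)) - (\<Sum>i<m. (\<Sum>j\<le>i. fst (w j)) \<bullet> snd (v i))"
  using abel_mixed[of "%i. fst (w i)" "%i. snd (v i)" m] by simp
 have 3: "(\<Sum>j<m. omega0 (lin m w j) (v j)) = 2 * (\<Sum>j<m. (\<Sum>i\<le>j. fst (w i)) \<bullet> snd (v j)) - (\<Sum>i<m. fst (w i)) \<bullet> (\<Sum>j<m. snd (v j))
   - (2 * (\<Sum>j<m. (\<Sum>i<j. snd (w i)) \<bullet> fst (v j)) - (\<Sum>i<m. snd (w i)) \<bullet> (\<Sum>j<m. fst (v j)))"
  unfolding omega0_def lin_def fst_conv snd_conv inner_diff_left inner_scaleR_left sum_subtractf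
  by (simp add: sum_distrib_left inner_sum_right)
 show ?thesis unfolding bil_def sum_subtractf 1 2 3 by (simp add: inner_commute)
qed

text \<open>A Lagrange multiplier for the condition that the sum of the moves lies in L. A
  hyperplane separates L times the negative reals from the convex set of all pairs of a sum of moves
  and an upper bound for its penalty. The coefficient of the penalty cannot vanish: a single move is
  an arbitrary vector, so the other coefficient would be nonnegative on all vectors.\<close>

lemma multiplier:
 fixes pen :: "nat \<Rightarrow> 'a::euclidean_space \<Rightarrow> real"
 assumes L: "subspace L" and m: "0 < m"
  and add: "!!j v w. pen j (v + w) <= pen j v + pen j w"
  and sc: "!!j v t. 0 <= t ==> pen j (t *\<^sub>R v) = t * pen j v"
  and pos: "!!v. (\<Sum>j<m. v j) \<in> L ==> 0 <= (\<Sum>j<m. pen j (v j))"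
 shows "\<exists>\<zeta>. (\<forall>l\<in>L. \<zeta> \<bullet> l = 0) \<and> (\<forall>j<m. \<forall>v. 0 <= pen j v + \<zeta> \<bullet> v)"
proof -
 define S where "S = L \<times> {r::real. r < 0}"
 define T where "T = {(\<Sum>j<m. v j, r) | v r. (\<Sum>j<m. pen j (v j)) <= r}"
 have pen0: "pen j 0 = 0" for j using sc[of 0 j 0] by simp
 have TI: "(s, r) \<in> T" if "s = (\<Sum>j<m. v j)" "(\<Sum>j<m. pen j (v j)) <= r" for s r v
  using that unfolding T_def by blast
 have "convex T"
 proof (rule convexI)
  fix x y and u v :: real assume xy: "x \<in> T" "y \<in> T" and uv: "0 <= u" "0 <= v" "u + v = 1"
  obtain p r where x: "x = (\<Sum>j<m. p j, r)" "(\<Sum>j<m. pen j (p j)) <= r" using xy(1) unfolding T_def by blast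
  obtain q r' where y: "y = (\<Sum>j<m. q j, r')" "(\<Sum>j<m. pen j (q j)) <= r'" using xy(2) unfolding T_def by blast
  have "(\<Sum>j<m. pen j (u *\<^sub>R p j + v *\<^sub>R q j)) <= (\<Sum>j<m. u * pen j (p j) + v * pen j (q j))"
   by (intro sum_mono order_trans[OF add]) (simp add: sc uv)
  also have "\<dots> = u * (\<Sum>j<m. pen j (p j)) + v * (\<Sum>j<m. pen j (q j))" by (simp add: sum.distrib sum_distrib_left)
  also have "\<dots> <= u * r + v * r'" using x y uv by (intro add_mono mult_left_mono) auto
  finally have "(u *\<^sub>R (\<Sum>j<m. p j) + v *\<^sub>R (\<Sum>j<m. q j), u * r + v * r') \<in> T"
   by (intro TI[of _ "%j. u *\<^sub>R p j + v *\<^sub>R q j"]) (auto simp: sum.distrib scaleR_sum_right)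
  then show "u *\<^sub>R x + v *\<^sub>R y \<in> T" by (simp add: x y)
 qed
 moreover have "convex S" unfolding S_def by (intro convex_Times subspace_imp_convex L convex_halfspace_lt[of "1::real", simplified])
 moreover have "S \<inter> T = {}" using pos by (fastforce simp: S_def T_def)
 moreover have "(0, -1) \<in> S" using subspace_0[OF L] by (simp add: S_def)
 moreover have T0: "(0, 0) \<in> T" by (rule TI[of _ "%j. 0"]) (auto simp: pen0)
 ultimately obtain a b where ab: "a ~= 0" "!!x. x \<in> S ==> a \<bullet> x <= b" "!!x. x \<in> T ==> b <= a \<bullet> x"
  using separating_hyperplane_sets[of S T] by blast
 obtain \<xi> \<rho> where a: "a = (\<xi>, \<rho>)" by (cases a)
 have b0: "b <= 0" using ab(3)[OF T0] by (simp add: a)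
 have s: "\<xi> \<bullet> l + \<rho> * r <= b" if "l \<in> L" "r < 0" for l r using ab(2)[of "(l, r)"] that by (simp add: a S_def)
 have t: "b <= \<xi> \<bullet> (\<Sum>j<m. v j) + \<rho> * r" if "(\<Sum>j<m. pen j (v j)) <= r" for v r
  using ab(3)[OF TI[OF refl that]] by (simp add: a)
 have slot: "(\<Sum>j<m. (if j = i then v else 0)) = v" "(\<Sum>j<m. pen j (if j = i then v else 0)) = pen i v" if "i < m" for i v
 proof -
  show "(\<Sum>j<m. (if j = i then v else 0)) = v" using that by simp
  have "(\<Sum>j<m. pen j (if j = i then v else 0)) = (\<Sum>j<m. if j = i then pen i v else 0)"
   by (intro sum.cong refl) (simp add: pen0)
  then show "(\<Sum>j<m. pen j (if j = i then v else 0)) = pen i v" using that by simp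
 qed
 have bneg: "0 <= b"
 proof (rule ccontr)
  assume "\<not> 0 <= b"
  then have b: "b < 0" by simp
  \<comment> \<open>So small a negative height that \<rho> * r has absolute value at most half of
    that of b, which contradicts \<rho> * r <= b < 0.\<close>
  define r where "r = - (- b / (2 * (\<bar>\<rho>\<bar> + 1)))"
  have "r < 0" using b by (simp add: r_def divide_neg_pos add_nonneg_pos)
  then have "\<rho> * r <= b" using s[of 0 r] subspace_0[OF L] by simp
  moreover have "\<bar>\<rho> * r\<bar> <= - b / 2"
  proof -
   have "\<bar>\<rho>\<bar> / (\<bar>\<rho>\<bar> + 1) <= 1" by simp
   then have "\<bar>\<rho>\<bar> / (\<bar>\<rho>\<bar> + 1) * (- b / 2) <= 1 * (- b / 2)" using b by (intro mult_right_mono) auto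
   moreover have "\<bar>\<rho> * r\<bar> = \<bar>\<rho>\<bar> / (\<bar>\<rho>\<bar> + 1) * (- b / 2)" using b by (simp add: r_def abs_mult abs_divide)
   ultimately show ?thesis by simp
  qed
  ultimately show False using b by linarith
 qed
 then have b: "b = 0" using b0 by simp
 have \<rho>0: "0 <= \<rho>" using s[of 0 "-1"] subspace_0[OF L] b by simp
 have "\<rho> ~= 0"
 proof
  assume r: "\<rho> = 0"
  have "0 <= \<xi> \<bullet> v" for v
   using t[of "%j. if j = 0 then v else 0" "pen 0 v"] slot[OF m, of v] by (simp add: r b)
  from this[of "- \<xi>"] have "\<xi> \<bullet> \<xi> <= 0" by simp
  then have "\<xi> = 0" by (metis inner_gt_zero_iff not_less)
  then show False using ab(1) by (simp add: a r zero_prod_def)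
 qed
 then have \<rho>: "0 < \<rho>" using \<rho>0 by simp
 define \<zeta> where "\<zeta> = \<xi> /\<^sub>R \<rho>"
 have "\<zeta> \<bullet> l = 0" if l: "l \<in> L" for l
 proof -
  have le: "\<xi> \<bullet> l' <= 0" if "l' \<in> L" for l'
  proof (rule field_le_epsilon)
   fix e :: real assume "0 < e"
   then show "\<xi> \<bullet> l' <= 0 + e" using s[OF that, of "- e / \<rho>"] \<rho> b by simp
  qed
  have "\<xi> \<bullet> l = 0" using le[OF l] le[OF subspace_neg[OF L l]] by simp
  then show ?thesis by (simp add: \<zeta>_def)
 qed
 moreover have "0 <= pen i v + \<zeta> \<bullet> v" if "i < m" for i v
 proof -
  have "0 <= \<xi> \<bullet> v + \<rho> * pen i v"
   using t[of "%j. if j = i then v else 0" "pen i v"] slot[OF that, of v] by (simp add: b)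
  then have "0 <= (\<xi> \<bullet> v + \<rho> * pen i v) / \<rho>" using \<rho> by simp
  moreover have "pen i v + \<zeta> \<bullet> v = (\<xi> \<bullet> v + \<rho> * pen i v) / \<rho>" using \<rho> by (simp add: \<zeta>_def field_simps)
  ultimately show ?thesis by simp
 qed
 ultimately show ?thesis by blast
qed

section \<open>The optimal staircase\<close>

context two_gauges
begin

lemma hP_sum: "finite A ==> hP (sum f A) <= (\<Sum>x\<in>A. hP (f x))"
proof (induction A rule: finite_induct)
 case (insert x A)
 then show ?case using P.add[of "f x" "sum f A"] by simp
qed simp

text \<open>The staircase is read as a curve whose momentum jumps after the integer times; b is
  left-continuous, so b i is the momentum at which the i-th q-move is made. Positive area forces
  positive q-length l, by which the convex combination is normalised.\<close>

lemma stair_reduction: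
 assumes pos: "0 < stair m w"
 shows "\<exists>w'. fst (w' 0) = 0 \<and> snd (w' (CARD('n) + 3)) = 0 \<and> (\<Sum>i<CARD('n) + 4. w' i) = (\<Sum>i<m. w i) \<and>
  stair (CARD('n) + 4) w' = stair m w \<and> total (CARD('n) + 4) w' <= total m w"
proof -
 define b where "b t = (\<Sum>j | j < m \<and> real j < t. snd (w j))" for t
 define V where "V t = (\<Sum>j | j < m \<and> real j < t. hP (snd (w j)))" for t
 define l where "l = (\<Sum>i<m. hQ (fst (w i)))"
 define a where "a = (\<Sum>i<m. fst (w i))"
 define f where "f = (\<Sum>i<m. (\<Sum>j<i. snd (w j)) \<bullet> fst (w i))"
 have bi: "b (real i) = (\<Sum>j<i. snd (w j))" "V (real i) = (\<Sum>j<i. hP (snd (w j)))" if "i <= m" for i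
 proof -
  have "{j. j < m \<and> real j < real i} = {..<i}" using that by auto
  then show "b (real i) = (\<Sum>j<i. snd (w j))" "V (real i) = (\<Sum>j<i. hP (snd (w j)))" by (simp_all add: b_def V_def)
 qed
 have l: "0 < l"
 proof (rule ccontr)
  assume "\<not> 0 < l"
  then have "l = 0" using Q.nonneg by (simp add: l_def sum_nonneg order_antisym)
  then have h0: "\<forall>i<m. hQ (fst (w i)) = 0" unfolding l_def by (subst (asm) sum_nonneg_eq_0_iff) (auto simp: Q.nonneg)
  have "fst (w i) = 0" if "i < m" for i
  proof -
   have "\<kappa>Q * norm (fst (w i)) <= 0" using h0 that Q.lower[of "fst (w i)"] by simp
   then show ?thesis using Q.\<kappa> by (simp add: mult_le_0_iff)
  qed
  then have "stair m w = 0" unfolding stair_abel by simp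
  then show False using pos by simp
 qed
 have "\<exists>w'. fst (w' 0) = 0 \<and> snd (w' (CARD('n) + 3)) = 0 \<and>
  (\<Sum>i<CARD('n) + 4. w' i) = (a, b (real m) - b 0) \<and>
  stair (CARD('n) + 4) w' = a \<bullet> (b (real m) - b 0) - 2 * (f - a \<bullet> b 0) \<and>
  total (CARD('n) + 4) w' <= l + (V (real m) - V 0)"
 proof (rule staircase_reduction[OF _ l])
  fix s t :: real assume st: "0 <= s" "s <= t" "t <= real m"
  let ?D = "{j. j < m \<and> s <= real j \<and> real j < t}"
  have split: "{j. j < m \<and> real j < t} = {j. j < m \<and> real j < s} \<union> ?D" using st by auto
  have "b t - b s = (\<Sum>j\<in>?D. snd (w j))" "V t - V s = (\<Sum>j\<in>?D. hP (snd (w j)))"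
   unfolding b_def V_def split by (subst sum.union_disjoint; auto)+
  then show "hP (b t - b s) <= V t - V s" using hP_sum[of ?D "%j. snd (w j)"] by simp
 next
  let ?Y = "{(u, u \<bullet> b t) | u t. hQ u <= 1 \<and> t \<in> {0..real m}}"
  define u where "u i = fst (w i) /\<^sub>R hQ (fst (w i))" for i
  have hu: "hQ (u i) <= 1" "hQ (fst (w i)) *\<^sub>R u i = fst (w i)" for i
  proof -
   show "hQ (u i) <= 1" using Q.nonneg[of "fst (w i)"] by (cases "hQ (fst (w i)) = 0") (simp_all add: u_def Q.scale)
   show "hQ (fst (w i)) *\<^sub>R u i = fst (w i)"
   proof (cases "hQ (fst (w i)) = 0")
    case True
    then have "\<kappa>Q * norm (fst (w i)) <= 0" using Q.lower[of "fst (w i)"] by simp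
    then have "fst (w i) = 0" using Q.\<kappa> by (simp add: mult_le_0_iff)
    then show ?thesis by (simp add: u_def)
   qed (simp add: u_def)
  qed
  have "(\<Sum>i<m. (hQ (fst (w i)) / l) *\<^sub>R (u i, u i \<bullet> b (real i))) \<in> convex hull ?Y"
  proof (rule convex_sum)
   show "(\<Sum>i<m. hQ (fst (w i)) / l) = 1" using l by (simp add: sum_divide_distrib[symmetric] l_def[symmetric])
   fix i assume "i \<in> {..<m}"
   then show "(u i, u i \<bullet> b (real i)) \<in> convex hull ?Y" using hu(1)[of i] by (intro hull_inc) (auto intro!: exI[of _ "u i"] exI[of _ "real i"])
   show "0 <= hQ (fst (w i)) / l" using l Q.nonneg by simp
  qed auto
  moreover have "(\<Sum>i<m. (hQ (fst (w i)) / l) *\<^sub>R (u i, u i \<bullet> b (real i))) = (a /\<^sub>R l, f / l)"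
  proof -
   have 1: "(hQ (fst (w i)) / l) *\<^sub>R u i = fst (w i) /\<^sub>R l" for i
    using hu(2)[of i] by (metis divide_inverse_commute scaleR_scaleR)
   have 2: "(hQ (fst (w i)) / l) * (u i \<bullet> b (real i)) = ((\<Sum>j<i. snd (w j)) \<bullet> fst (w i)) / l" if "i < m" for i
   proof -
    have "(hQ (fst (w i)) / l) * (u i \<bullet> b (real i)) = ((hQ (fst (w i)) / l) *\<^sub>R u i) \<bullet> b (real i)" by simp
    then show ?thesis unfolding 1 using bi(1)[of i] that by (simp add: inner_commute divide_inverse mult.commute)
   qed
   have "(\<Sum>i<m. (hQ (fst (w i)) / l) * (u i \<bullet> b (real i))) = f / l"
    unfolding f_def sum_divide_distrib by (intro sum.cong refl 2) simp
   moreover have "(\<Sum>i<m. (hQ (fst (w i)) / l) *\<^sub>R u i) = a /\<^sub>R l" by (simp only: 1 a_def scaleR_sum_right)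
   ultimately show ?thesis by (simp add: prod_eq_iff fst_sum snd_sum)
  qed
  ultimately show "(a /\<^sub>R l, f / l) \<in> convex hull ?Y" by simp
 qed simp
 moreover have "b 0 = 0" "V 0 = 0" by (simp_all add: b_def V_def)
 moreover have "(a, b (real m)) = (\<Sum>i<m. w i)" using bi(1)[of m] by (simp add: a_def prod_eq_iff fst_sum snd_sum)
 moreover have "stair m w = a \<bullet> b (real m) - 2 * f" unfolding stair_abel a_def f_def using bi(1)[of m] by simp
 moreover have "total m w = l + V (real m)" using bi(2)[of m] by (simp add: total_def cost_def l_def sum.distrib)
 ultimately show ?thesis by simp
qed

text \<open>With the number of moves fixed and the length at most 1, the admissible staircases form
  a compact set, on which the area is continuous. Quadratic scaling turns the maximum M into an
  inequality for all staircases with end displacement in L.\<close>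

lemma optimal_staircase:
 assumes L: "subspace L"
 shows "\<exists>w M. fst (w 0) = 0 \<and> snd (w (CARD('n) + 3)) = 0 \<and> (\<Sum>i<CARD('n) + 4. w i) \<in> L \<and> 0 < M \<and>
  stair (CARD('n) + 4) w = M \<and> total (CARD('n) + 4) w <= 1 \<and>
  (\<forall>v. (\<Sum>i<CARD('n) + 4. v i) \<in> L --> stair (CARD('n) + 4) v <= M * (total (CARD('n) + 4) v)\<^sup>2)"
proof -
 let ?m = "CARD('n) + 4"
 define \<mu> where "\<mu> = min \<kappa>Q \<kappa>P"
 have \<mu>: "0 < \<mu>" using Q.\<kappa> P.\<kappa> by (simp add: \<mu>_def)
 define Adm where "Adm = {w. (\<Sum>i<?m. w i) \<in> L \<and> total ?m w <= 1}"
 have single: "cost (w i) <= total ?m w" if "i < ?m" for w i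
  unfolding total_def by (rule member_le_sum) (use that cost_nonneg in auto)
 have comp: "\<exists>r w'. strict_mono (r :: nat \<Rightarrow> nat) \<and> w' \<in> Adm \<and> (%k. stair ?m (W (r k))) \<longlonglongrightarrow> stair ?m w'"
  if W: "!!k. W k \<in> Adm" for W
 proof -
  have "bounded (range (%k. W k i))" if "i \<in> {..<?m}" for i
  proof (rule boundedI)
   fix x assume "x \<in> range (%k. W k i)"
   then obtain k where x: "x = W k i" by auto
   have "\<mu> * norm x <= 1" unfolding x \<mu>_def using cost_lower[of "W k i"] single[of i "W k"] that W[of k] by (simp add: Adm_def)
   then show "norm x <= 1 / \<mu>" using \<mu> by (simp add: pos_le_divide_eq mult.commute)
  qed
  then obtain r l where r: "strict_mono (r :: nat \<Rightarrow> nat)" and l: "!!i. i < ?m ==> (%k. W (r k) i) \<longlonglongrightarrow> l i"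
   using bounded_imp_convergent_subseq_finite[of "{..<?m}" W] by auto
  have "(%k. \<Sum>i<?m. W (r k) i) \<longlonglongrightarrow> (\<Sum>i<?m. l i)" by (intro tendsto_sum l) auto
  then have "(\<Sum>i<?m. l i) \<in> L"
   by (rule closed_sequentially[OF closed_subspace[OF L], rotated]) (use W in \<open>auto simp: Adm_def\<close>)
  moreover have "(%k. total ?m (W (r k))) \<longlonglongrightarrow> total ?m l"
   unfolding total_def
   by (intro tendsto_sum continuous_on_tendsto_compose[OF cont_cost[of UNIV]] l) auto
  then have "total ?m l <= 1" by (rule LIMSEQ_le_const2) (use W in \<open>auto simp: Adm_def\<close>)
  moreover have "(%k. stair ?m (W (r k))) \<longlonglongrightarrow> stair ?m l"
   unfolding stair_def by (intro tendsto_intros l) auto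
  ultimately show ?thesis using r by (auto simp: Adm_def)
 qed
 have bdd: "bdd_above (stair ?m ` Adm)"
 proof (rule ccontr)
  assume "\<not> ?thesis"
  then have "\<exists>w\<in>Adm. real k < stair ?m w" for k unfolding bdd_above_def by (auto simp: not_le)
  then obtain W where W: "!!k. W k \<in> Adm" "!!k. real k < stair ?m (W k)" by metis
  obtain r and w' :: "nat \<Rightarrow> 'n phase" where r: "strict_mono r" "(%k. stair ?m (W (r k))) \<longlonglongrightarrow> stair ?m w'" using comp[of W, OF W(1)] by (elim exE conjE) (rule that; assumption)
  have "real k <= stair ?m (W (r k))" for k
   using W(2)[of "r k"] seq_suble[OF r(1), of k] by linarith
  then have "filterlim (%k. stair ?m (W (r k))) at_top sequentially"
   by (intro filterlim_at_top_mono[OF filterlim_real_sequentially]) auto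
  then show False using r(2) not_tendsto_and_filterlim_at_infinity[of sequentially]
   by (meson filterlim_at_top_imp_at_infinity trivial_limit_sequentially)
 qed
 have "(%i. 0) \<in> Adm" using subspace_0[OF L] by (simp add: Adm_def total_def cost_def)
 then have ne: "stair ?m ` Adm ~= {}" by blast
 define M where "M = Sup (stair ?m ` Adm)"
 have up: "stair ?m w <= M" if "w \<in> Adm" for w unfolding M_def by (rule cSup_upper) (use that bdd in auto)
 have "\<exists>w\<in>Adm. M - inverse (real (Suc k)) < stair ?m w" for k
  using less_cSup_iff[OF ne bdd, of "M - inverse (real (Suc k))"] by (auto simp: M_def)
 then obtain W where W: "!!k. W k \<in> Adm" "!!k. M - inverse (real (Suc k)) < stair ?m (W k)" by metis
 obtain r w where r: "strict_mono r" "w \<in> Adm" "(%k. stair ?m (W (r k))) \<longlonglongrightarrow> stair ?m w" using comp[of W, OF W(1)] by (elim exE conjE) (rule that; assumption)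
 have "(%k. M - inverse (real (Suc (r k)))) \<longlonglongrightarrow> M - 0"
  using LIMSEQ_subseq_LIMSEQ[OF LIMSEQ_inverse_real_of_nat r(1)] by (intro tendsto_intros) (simp add: o_def)
 then have "M - 0 <= stair ?m w" by (rule LIMSEQ_le[OF _ r(3)]) (use W(2) less_imp_le in blast)
 then have wM: "stair ?m w = M" using up[OF r(2)] by simp
 have scaled: "stair ?m v <= M * (total ?m v)\<^sup>2" if v: "(\<Sum>i<?m. v i) \<in> L" for v
 proof (cases "total ?m v = 0")
  case True
  have "v i = 0" if "i < ?m" for i
  proof -
   have "\<mu> * norm (v i) <= 0" using cost_lower[of "v i"] single[OF that, of v] True by (simp add: \<mu>_def)
   then show ?thesis using \<mu> by (simp add: mult_le_0_iff)
  qed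
  then have "stair ?m v = 0" unfolding stair_def by (intro sum.neutral) auto
  then show ?thesis using True by simp
 next
  case False
  define t where "t = total ?m v"
  have t: "0 < t" using False cost_nonneg by (simp add: t_def total_def sum_nonneg order_less_le)
  have "(%i. (1/t) *\<^sub>R v i) \<in> Adm"
   using v t subspace_scale[OF L v, of "1/t"] by (simp add: Adm_def scaleR_sum_right[symmetric] total_def cost_scale sum_divide_distrib[symmetric])
    (simp add: t_def total_def)
  from up[OF this] have "(1/t)\<^sup>2 * stair ?m v <= M" by (simp add: stair_scale)
  then show ?thesis using t by (simp add: t_def[symmetric] field_simps power2_eq_square)
 qed
 have M: "0 < M"
 proof -
  obtain e :: "real^'n" where e: "e \<in> Basis" using nonempty_Basis by blast
  \<comment> \<open>A closed square spanned by one basis direction in q and in p; its displacement 0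
    lies in every L and its \<open>stair\<close> is 2, so M is positive.\<close>
  define v :: "nat \<Rightarrow> 'n phase" where "v i = (if i = 0 then (e, e) else if i = 1 then (- e, - e) else 0)" for i
  have s: "(\<Sum>i<?m. g (v i)) = g (e, e) + g (- e, - e)" if "g 0 = 0" for g :: "'n phase \<Rightarrow> 'b::comm_monoid_add"
  proof -
   have "(\<Sum>i<?m. g (v i)) = (\<Sum>i\<in>{0, 1}. g (v i))"
    by (rule sum.mono_neutral_right) (auto simp: v_def that)
   then show ?thesis by (simp add: v_def)
  qed
  have "(\<Sum>i<?m. (\<Sum>j<i. snd (v j)) \<bullet> fst (v i)) = (\<Sum>i\<in>{1}. (\<Sum>j<i. snd (v j)) \<bullet> fst (v i))"
   by (rule sum.mono_neutral_right) (auto simp: v_def)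
  also have "\<dots> = - 1" using e by (simp add: v_def)
  finally have "stair ?m v = 2" unfolding stair_abel using s[of fst] by simp
  moreover have "(\<Sum>i<?m. v i) \<in> L" using s[of "%x. x"] subspace_0[OF L] by (simp add: zero_prod_def)
  ultimately have "0 < M * (total ?m v)\<^sup>2" using scaled[of v] by linarith
  then show ?thesis by (simp add: zero_less_mult_iff)
 qed
 \<comment> \<open>The maximiser found by compactness may violate the end conditions on the first
   and the last move; one more reduction restores them without changing displacement or area and
   without adding length.\<close>
 have "0 < stair ?m w" using wM M by simp
 from stair_reduction[OF this] obtain w' where w': "fst (w' 0) = 0" "snd (w' (CARD('n) + 3)) = 0"
  "(\<Sum>i<?m. w' i) = (\<Sum>i<?m. w i)" "stair ?m w' = stair ?m w" "total ?m w' <= total ?m w" by blast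
 then show ?thesis using r(2) wM M scaled by (intro exI[of _ w'] exI[of _ M]) (auto simp: Adm_def)
qed

end

section \<open>The isoperimetric inequality for curves\<close>

lemma has_integral_le_finite:
 fixes f g :: "real \<Rightarrow> real"
 assumes "(f has_integral i) {a..b}" "(g has_integral j) {a..b}" "finite S"
  and "!!t. t \<in> {a..b} - S ==> f t <= g t"
 shows "i <= j"
proof (rule has_integral_le)
 show "((%t. if t \<in> S then 0 else f t) has_integral i) {a..b}"
  by (rule has_integral_spike_finite[OF assms(3) _ assms(1)]) auto
 show "((%t. if t \<in> S then 0 else g t) has_integral j) {a..b}"
  by (rule has_integral_spike_finite[OF assms(3) _ assms(2)]) auto
qed (use assms(4) in auto)

context two_gauges
begin

text \<open>The curve is replaced by a staircase with the same displacement and area and no more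
  length, up to a slack, and the inequality for staircases is applied. The functions ka and kb are
  majorants of the two length densities, so that integrability is asked of convenient formulas
  instead of the support functions.\<close>

lemma curve_isoperimetric:
 fixes x p x' p' :: "real \<Rightarrow> real^'n"
 assumes iso: "!!v. (\<Sum>i<CARD('n) + 4. v i) \<in> L ==> stair (CARD('n) + 4) v <= M * (total (CARD('n) + 4) v)\<^sup>2"
  and M: "0 <= M"
  and rep: "!!v. \<exists>q. q \<bullet> v = hP v \<and> (\<forall>w. q \<bullet> w <= hP w)"
  and h: "0 <= h" and S: "finite S"
  and cx: "continuous_on {0..h} x" and cp: "continuous_on {0..h} p"
  and dx: "!!t. t \<in> {0<..<h} - S ==> (x has_vector_derivative x' t) (at t)"
  and dp: "!!t. t \<in> {0<..<h} - S ==> (p has_vector_derivative p' t) (at t)"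
  and kQ: "!!t. t \<in> {0<..<h} - S ==> hQ (x' t) <= ka t"
  and kP: "!!t. t \<in> {0<..<h} - S ==> hP (p' t) <= kb t"
  and ika: "ka integrable_on {0..h}" and ikb: "kb integrable_on {0..h}"
  and iF: "(%t. p t \<bullet> x' t) integrable_on {0..h}"
  and inL: "(x h - x 0, p h - p 0) \<in> L"
 shows "(x h - x 0) \<bullet> (p h - p 0) - 2 * (integral {0..h} (%t. p t \<bullet> x' t) - (x h - x 0) \<bullet> p 0)
  <= M * (integral {0..h} ka + integral {0..h} kb)\<^sup>2"
proof -
 let ?S = "insert 0 (insert h S)"
 have S': "finite ?S" using S by simp
 define f where "f = integral {0..h} (%t. p t \<bullet> x' t)"
 define a where "a = x h - x 0"
 have ia: "(x' has_integral a) {0..h}"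
  unfolding a_def by (rule fundamental_theorem_of_calculus_interior_strong[OF S h dx cx])
 \<comment> \<open>The functional q that represents hP at the increment is integrated along p'; this
   is the triangle inequality for integrals in the gauge hP.\<close>
 have V: "hP (p t - p s) <= integral {0..t} kb - integral {0..s} kb" if st: "0 <= s" "s <= t" "t <= h" for s t
 proof -
  obtain q where q: "q \<bullet> (p t - p s) = hP (p t - p s)" "!!w. q \<bullet> w <= hP w" using rep by blast
  have kb': "kb integrable_on {u..v}" if "0 <= u" "v <= h" for u v
   by (rule integrable_on_subinterval[OF ikb]) (use that in auto)
  have "(p' has_integral (p t - p s)) {s..t}"
   by (rule fundamental_theorem_of_calculus_interior_strong[OF S])
     (use st in \<open>auto intro!: dp intro: continuous_on_subset[OF cp]\<close>)
  then have "((%u. q \<bullet> p' u) has_integral (q \<bullet> (p t - p s))) {s..t}"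
   using has_integral_linear[OF _ bounded_linear_inner_right] by (auto simp: o_def)
  moreover have "(kb has_integral integral {s..t} kb) {s..t}" by (rule integrable_integral[OF kb']) (use st in auto)
  ultimately have "q \<bullet> (p t - p s) <= integral {s..t} kb"
  proof (rule has_integral_le_finite[OF _ _ S'])
   fix u assume "u \<in> {s..t} - ?S"
   then have "u \<in> {0<..<h} - S" using st by auto
   then show "q \<bullet> p' u <= kb u" using q(2)[of "p' u"] kP by fastforce
  qed
  also have "integral {s..t} kb = integral {0..t} kb - integral {0..s} kb"
   using Henstock_Kurzweil_Integration.integral_combine[OF st(1,2) kb'[of 0 t]] st by simp
  finally show ?thesis using q(1) by simp
 qed
 define Y where "Y = {(u, u \<bullet> p t) | u t. hQ u <= 1 \<and> t \<in> {0..h}}"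
 have "compact {u. hQ u <= 1}"
 proof -
  have "closed {u. hQ u <= 1}" by (intro closed_Collect_le Q.cont continuous_on_const)
  moreover have "norm u <= 1 / \<kappa>Q" if "hQ u <= 1" for u
   using Q.lower[of u] that Q.\<kappa> by (simp add: pos_le_divide_eq mult.commute)
  then have "bounded {u. hQ u <= 1}" unfolding bounded_iff by blast
  ultimately show ?thesis by (simp add: compact_eq_bounded_closed)
 qed
 then have "compact ((%(u, t). (u, u \<bullet> p t)) ` ({u. hQ u <= 1} \<times> {0..h}))"
  unfolding case_prod_unfold
  by (intro compact_continuous_image compact_Times continuous_intros continuous_on_compose2[OF cp]) auto
 moreover have "(%(u, t). (u, u \<bullet> p t)) ` ({u. hQ u <= 1} \<times> {0..h}) = Y" by (auto simp: Y_def)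
 ultimately have Yc: "closed (convex hull Y)" by (metis compact_convex_hull compact_imp_closed)
 \<comment> \<open>Otherwise a hyperplane separates the point from the hull. Its inequality at the
   normalised velocity is multiplied by hQ of the velocity and integrated, which contradicts the
   separation. The level r is negative since (0, 0) lies in Y, and this sign allows ka and l to be
   inserted for the true length.\<close>
 have hull: "(a /\<^sub>R l, f / l) \<in> convex hull Y" if l: "0 < l" "integral {0..h} ka <= l" for l
 proof (rule ccontr)
  assume notin: "(a /\<^sub>R l, f / l) \<notin> convex hull Y"
  obtain \<xi> r where sep': "\<xi> \<bullet> (a /\<^sub>R l, f / l) < r \<and> (\<forall>y\<in>convex hull Y. r < \<xi> \<bullet> y)"
   using separating_hyperplane_closed_point[OF convex_convex_hull Yc notin] by (elim exE) (rule that)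
  note sep = sep'[THEN conjunct1] sep'[THEN conjunct2, rule_format]
  have Yin: "r < \<xi> \<bullet> (u, u \<bullet> p t)" if "hQ u <= 1" "t \<in> {0..h}" for u t
  proof -
   have "(u, u \<bullet> p t) \<in> Y" using that unfolding Y_def by blast
   then show ?thesis by (intro sep(2) hull_inc)
  qed
  have r: "r < 0" using Yin[of 0 0] h by (simp add: zero_prod_def[symmetric])
  have i1: "((%t. \<xi> \<bullet> (x' t, p t \<bullet> x' t)) has_integral \<xi> \<bullet> (a, f)) {0..h}"
   using has_integral_add[OF has_integral_linear[OF ia bounded_linear_inner_right[of "fst \<xi>"]] has_integral_mult_right[OF integrable_integral[OF iF], of "snd \<xi>"]]
   by (simp add: o_def inner_prod_def f_def)
  have i2: "((%t. r * ka t) has_integral r * integral {0..h} ka) {0..h}"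
   by (intro has_integral_mult_right integrable_integral ika)
  have "r * integral {0..h} ka <= \<xi> \<bullet> (a, f)"
  proof (rule has_integral_le_finite[OF i2 i1 S'])
   fix t assume "t \<in> {0..h} - ?S"
   then have t: "t \<in> {0<..<h} - S" by auto
   show "r * ka t <= \<xi> \<bullet> (x' t, p t \<bullet> x' t)"
   proof (cases "hQ (x' t) = 0")
    case True
    then have "\<kappa>Q * norm (x' t) <= 0" using Q.lower[of "x' t"] by simp
    then have "x' t = 0" using Q.\<kappa> by (simp add: mult_le_0_iff)
    then show ?thesis using kQ[OF t] r by (simp add: mult_nonpos_nonneg zero_prod_def[symmetric])
   next
    case False
    then have q: "0 < hQ (x' t)" using Q.nonneg[of "x' t"] by simp
    have "r < \<xi> \<bullet> (x' t /\<^sub>R hQ (x' t), (x' t /\<^sub>R hQ (x' t)) \<bullet> p t)"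
     by (rule Yin) (use q t in \<open>auto simp: Q.scale\<close>)
    also have "\<dots> = (\<xi> \<bullet> (x' t, p t \<bullet> x' t)) / hQ (x' t)"
     using q by (simp add: inner_prod_def field_simps inner_commute)
    finally have "r * hQ (x' t) <= \<xi> \<bullet> (x' t, p t \<bullet> x' t)" using q by (simp add: pos_less_divide_eq)
    moreover have "r * ka t <= r * hQ (x' t)" using kQ[OF t] r by (intro mult_left_mono_neg) auto
    ultimately show ?thesis by linarith
   qed
  qed
  moreover have "\<xi> \<bullet> (a /\<^sub>R l, f / l) = (\<xi> \<bullet> (a, f)) / l" using l by (simp add: inner_prod_def field_simps)
  then have "\<xi> \<bullet> (a, f) < r * l" using sep(1) l by (simp add: pos_divide_less_eq)
  moreover have "r * l <= r * integral {0..h} ka" using l r by (intro mult_left_mono_neg) auto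
  ultimately show False by linarith
 qed
 have nn: "0 <= integral {0..h} ka"
 proof (rule has_integral_le_finite[OF has_integral_0 integrable_integral[OF ika] S'])
  fix t assume "t \<in> {0..h} - ?S"
  then have t: "t \<in> {0<..<h} - S" by auto
  show "0 <= ka t" by (rule order_trans[OF Q.nonneg kQ[OF t]])
 qed
 \<comment> \<open>The weight l must be positive while the q-length of the curve may be 0; the slack
   e disappears in the limit.\<close>
 have step: "a \<bullet> (p h - p 0) - 2 * (f - a \<bullet> p 0) <= M * (integral {0..h} ka + e + integral {0..h} kb)\<^sup>2" if e: "0 < e" for e
 proof -
  define l where "l = integral {0..h} ka + e"
  have l: "0 < l" "integral {0..h} ka <= l" using nn e by (auto simp: l_def)
  from staircase_reduction[OF h l(1) V hull[OF l, unfolded Y_def]] obtain w where w: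
   "(\<Sum>i<CARD('n) + 4. w i) = (a, p h - p 0)"
   "stair (CARD('n) + 4) w = a \<bullet> (p h - p 0) - 2 * (f - a \<bullet> p 0)"
   "total (CARD('n) + 4) w <= l + (integral {0..h} kb - integral {0..0} kb)" by blast
  have "(total (CARD('n) + 4) w)\<^sup>2 <= (l + integral {0..h} kb)\<^sup>2"
   using w(3) by (intro power_mono) (auto simp: total_def intro!: sum_nonneg cost_nonneg)
  then have "M * (total (CARD('n) + 4) w)\<^sup>2 <= M * (l + integral {0..h} kb)\<^sup>2" using M by (intro mult_left_mono)
  then show ?thesis using iso[of w] inL unfolding w by (simp add: a_def l_def)
 qed
 have "((%e. M * (integral {0..h} ka + e + integral {0..h} kb)\<^sup>2) \<longlongrightarrow> M * (integral {0..h} ka + 0 + integral {0..h} kb)\<^sup>2) (at_right 0)"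
  by (intro tendsto_intros)
 then have "a \<bullet> (p h - p 0) - 2 * (f - a \<bullet> p 0) <= M * (integral {0..h} ka + 0 + integral {0..h} kb)\<^sup>2"
  by (rule tendsto_lowerbound) (use step in \<open>auto simp: eventually_at_right_field intro!: exI[of _ 1]\<close>)
 then show ?thesis by (simp add: a_def f_def)
qed

end

section \<open>Antisymplectic involutions and the minimal polygon\<close>

lemma omega0_linear:
 "omega0 (z + w) v = omega0 z v + omega0 w v" "omega0 v (z + w) = omega0 v z + omega0 v w"
 "omega0 (z - w) v = omega0 z v - omega0 w v" "omega0 v (z - w) = omega0 v z - omega0 v w"
 "omega0 (t *\<^sub>R z) v = t * omega0 z v" "omega0 v (t *\<^sub>R z) = t * omega0 v z"
 "omega0 0 v = 0" "omega0 v 0 = 0" "omega0 (- z) v = - omega0 z v" "omega0 v (- z) = - omega0 v z"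
 by (simp_all add: omega0_def inner_add_left inner_add_right inner_diff_left inner_diff_right algebra_simps)

lemma omega0_self [simp]: "omega0 z z = 0"
 by (simp add: omega0_def inner_commute)

lemma omega0_sum: "omega0 z (sum f A) = (\<Sum>x\<in>A. omega0 z (f x))"
 by (simp add: omega0_def fst_sum snd_sum inner_sum_right sum_subtractf)

locale antisymp_involution =
 fixes \<tau> :: "'n::finite phase \<Rightarrow> 'n phase"
 assumes inv: "lin_antisymp_inv \<tau>"
begin

lemma lin: "linear \<tau>" and anti: "omega0 (\<tau> z) (\<tau> w) = - omega0 z w" and invol [simp]: "\<tau> (\<tau> z) = z"
 using inv unfolding lin_antisymp_inv_def by blast+

lemma Fix_subspace: "subspace (Fix \<tau>)"
 by (auto simp: Fix_def subspace_def linear_0[OF lin] linear_add[OF lin] linear_scale[OF lin])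

lemma Fix_isotropic: "z \<in> Fix \<tau> ==> w \<in> Fix \<tau> ==> omega0 z w = 0"
 using anti[of z w] by (simp add: Fix_def)

text \<open>Together with \<open>Fix_isotropic\<close>: the fixed space is Lagrangian. The vector u
  = z - \<tau> z pairs to 0 with v + \<tau> v, and its pairings with v and with \<tau> v agree
  because u is anti-invariant; so u pairs to 0 with everything.\<close>

lemma Fix_maximal:
 assumes "!!l. l \<in> Fix \<tau> ==> omega0 z l = 0" shows "z \<in> Fix \<tau>"
proof -
 define u where "u = z - \<tau> z"
 have u: "\<tau> u = - u" by (simp add: u_def linear_diff[OF lin])
 have "omega0 u v = 0" for v
 proof -
  have "v + \<tau> v \<in> Fix \<tau>" by (simp add: Fix_def linear_add[OF lin])
  moreover have "omega0 u l = 0" if "l \<in> Fix \<tau>" for l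
   using assms[OF that] anti[of z l] that by (simp add: u_def omega0_linear Fix_def)
  ultimately have "omega0 u v + omega0 u (\<tau> v) = 0" by (simp add: omega0_linear(2)[symmetric])
  moreover have "omega0 u (\<tau> v) = omega0 u v" using anti[of u "\<tau> v"] anti[of u v] by (simp add: u omega0_linear)
  ultimately show ?thesis by simp
 qed
 from this[of "J0 u"] have "u = 0" by (simp add: omega0_J0)
 then show ?thesis by (simp add: u_def Fix_def)
qed

end

lemma sum_pairs: "(\<Sum>k<2 * m. g k) = (\<Sum>j<m. g (2 * j) + g (2 * j + 1))" for g :: "nat \<Rightarrow> 'a::comm_monoid_add"
 by (induction m) (auto simp: ac_simps)

lemma supp_attained:
 assumes "compact K" "K ~= {}"
 shows "\<exists>q\<in>K. q \<bullet> v = supp K v"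
proof -
 have "continuous_on K (%x. x \<bullet> v)" by (intro continuous_intros)
 then obtain q where q: "q \<in> K" "!!y. y \<in> K ==> y \<bullet> v <= q \<bullet> v"
  using continuous_attains_sup[OF assms] by blast
 then show ?thesis using supp_least[OF assms(2), of v "q \<bullet> v"] supp_upper[OF assms(1) q(1), of v] by force
qed

text \<open>At a staircase of maximal area the first variation, corrected by the multiplier of the
  end condition, says that c times the recentred position pairs with every move by at most its cost.
  This places all vertices in \<Delta> x \<Lambda>; equality for the moves actually made is the
  inequality that holds along each edge. The last conclusion is the isoperimetric inequality with c
  = 1 / M.\<close>

theorem staircase_minimizer:
 fixes \<tau> :: "'n::finite phase \<Rightarrow> 'n phase" and \<Delta> \<Lambda> :: "(real^'n) set"
 assumes inv: "lin_antisymp_inv \<tau>"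
  and D: "compact \<Delta>" "convex \<Delta>" "0 \<in> interior \<Delta>" and Lam: "compact \<Lambda>" "convex \<Lambda>" "0 \<in> interior \<Lambda>"
 obtains c z m where "0 < (c::real)" "z 0 \<in> Fix \<tau>" "z m \<in> Fix \<tau>"
  "!!i. i <= m ==> z i \<in> \<Delta> \<times> \<Lambda>"
  "!!i \<zeta>. i < m ==> \<zeta> \<in> \<Delta> \<times> \<Lambda> ==> omega0 \<zeta> (z (Suc i) - z i) <= omega0 (z i) (z (Suc i) - z i)"
  "(\<Sum>i<m. omega0 (z i) (z (Suc i) - z i)) = c"
  "!!h S x p x' p' ka kb. [|0 <= h; finite S; continuous_on {0..h} x; continuous_on {0..h} p;
   !!t. t \<in> {0<..<h} - S ==> (x has_vector_derivative x' t) (at t);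
   !!t. t \<in> {0<..<h} - S ==> (p has_vector_derivative p' t) (at t);
   !!t. t \<in> {0<..<h} - S ==> supp \<Lambda> (- x' t) <= ka t;
   !!t. t \<in> {0<..<h} - S ==> supp \<Delta> (p' t) <= kb t;
   ka integrable_on {0..h}; kb integrable_on {0..h}; (%t. p t \<bullet> x' t) integrable_on {0..h};
   (x 0, p 0) \<in> Fix \<tau>; (x h, p h) \<in> Fix \<tau>|]
   ==> c * (x h \<bullet> p h - x 0 \<bullet> p 0 - 2 * integral {0..h} (%t. p t \<bullet> x' t)) <= (integral {0..h} ka + integral {0..h} kb)\<^sup>2"
proof -
 interpret antisymp_involution \<tau> by unfold_locales (rule inv)
 obtain rD RD where rD: "0 < rD" "cball 0 rD \<subseteq> \<Delta>" "\<Delta> \<subseteq> cball 0 RD" using body_radii[OF D(1,3)] by blast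
 obtain rL RL where rL: "0 < rL" "cball 0 rL \<subseteq> \<Lambda>" "\<Lambda> \<subseteq> cball 0 RL" using body_radii[OF Lam(1,3)] by blast
 define hQ where "hQ v = supp \<Lambda> (- v)" for v
 interpret sD: sublinear_gauge "supp \<Delta>" rD RD by (rule supp_gauge[OF D(1) rD])
 interpret sL: sublinear_gauge "supp \<Lambda>" rL RL by (rule supp_gauge[OF Lam(1) rL])
 interpret sQ: sublinear_gauge hQ rL RL
 proof
  show "hQ (x + y) <= hQ x + hQ y" for x y using sL.add[of "- x" "- y"] by (simp add: hQ_def)
  show "hQ (t *\<^sub>R x) = t * hQ x" if "0 <= t" for t x using sL.scale[OF that, of "- x"] by (simp add: hQ_def)
 qed (use sL.lower[of "- _"] sL.upper[of "- _"] sL.\<kappa> sL.\<beta> in \<open>auto simp: hQ_def\<close>)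
 interpret two_gauges hQ "supp \<Delta>" rL RL rD RD by unfold_locales
 have Dne: "\<Delta> ~= {}" and Lne: "\<Lambda> ~= {}" using rD(1,2) rL(1,2) by auto
 define m where "m = CARD('n) + 4"
 have m1: "m - 1 = CARD('n) + 3" by (simp add: m_def)
 obtain w M where w: "fst (w 0) = 0" "snd (w (m - 1)) = 0" "(\<Sum>i<m. w i) \<in> Fix \<tau>" "0 < M"
  "stair m w = M" "total m w <= 1"
  and opt: "!!v. (\<Sum>i<m. v i) \<in> Fix \<tau> ==> stair m v <= M * (total m v)\<^sup>2"
  using optimal_staircase[OF Fix_subspace] unfolding m_def[symmetric] m1[symmetric] by blast
 have m0: "0 < m" by (simp add: m_def)
 have t0: "0 <= total m v" for v by (simp add: total_def sum_nonneg cost_nonneg)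
 have tot1: "total m w = 1"
 proof -
  have "1 <= (total m w)\<^sup>2" using opt[OF w(3)] w(4,5) by simp
  then have "1 <= total m w" using t0[of w] by (metis abs_of_nonneg abs_1 abs_le_square_iff one_power2)
  then show ?thesis using w(6) by simp
 qed
 \<comment> \<open>The maximal area has length 1. Scaling the staircase by c makes its length and
   its area both equal to c, which is the normalisation of a characteristic.\<close>
 define c where "c = 1 / M"
 have c: "0 < c" "c * M = 1" using w(4) by (auto simp: c_def)
 let ?lin = "%v. \<Sum>j<m. omega0 (lin m w j) (v j)"
 have linw: "?lin w = 2 * M"
 proof -
  have "bil m w w = stair m w" by (simp add: bil_def stair_def)
  then show ?thesis using bil_sym[of m w w] w(5) by simp
 qed
 \<comment> \<open>The maximiser is compared with its convex combinations with v. Length is convex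
   along the segment and area is quadratic, so dividing by e and letting e tend to 0 leaves the
   linear terms.\<close>
 have first: "?lin v <= 2 * M * total m v" if v: "(\<Sum>i<m. v i) \<in> Fix \<tau>" for v
 proof -
  define u where "u i = v i - w i" for i
  define \<delta> where "\<delta> = total m v - 1"
  have uF: "(\<Sum>i<m. u i) \<in> Fix \<tau>" using subspace_diff[OF Fix_subspace v w(3)] by (simp add: u_def sum_subtractf)
  have lu: "?lin u = ?lin v - 2 * M" using linw by (simp add: u_def omega0_linear sum_subtractf)
  have ineq: "?lin u <= 2 * M * \<delta> + e * (M * \<delta>\<^sup>2 - stair m u)" if e: "0 < e" "e <= 1" for e
  proof -
   have tc: "total m (%i. w i + e *\<^sub>R u i) <= 1 + e * \<delta>"
   proof -
    have "cost (w i + e *\<^sub>R u i) <= (1 - e) * cost (w i) + e * cost (v i)" for i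
    proof -
     have "w i + e *\<^sub>R u i = (1 - e) *\<^sub>R w i + e *\<^sub>R v i" by (simp add: u_def algebra_simps)
     then show ?thesis using cost_add[of "(1 - e) *\<^sub>R w i" "e *\<^sub>R v i"] e by (simp add: cost_scale)
    qed
    then have "total m (%i. w i + e *\<^sub>R u i) <= (\<Sum>i<m. (1 - e) * cost (w i) + e * cost (v i))"
     unfolding total_def by (intro sum_mono)
    also have "\<dots> = (1 - e) * total m w + e * total m v" by (simp add: total_def sum.distrib sum_distrib_left)
    finally show ?thesis by (simp add: tot1 \<delta>_def algebra_simps)
   qed
   have "(\<Sum>i<m. w i + e *\<^sub>R u i) \<in> Fix \<tau>"
    using subspace_add[OF Fix_subspace w(3) subspace_scale[OF Fix_subspace uF, of e]] by (simp add: sum.distrib scaleR_sum_right)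
   then have "stair m (%i. w i + e *\<^sub>R u i) <= M * (total m (%i. w i + e *\<^sub>R u i))\<^sup>2" by (rule opt)
   also have "\<dots> <= M * (1 + e * \<delta>)\<^sup>2" using tc t0 w(4) by (intro mult_left_mono power_mono) auto
   finally have "M + e * ?lin u + e\<^sup>2 * stair m u <= M * (1 + e * \<delta>)\<^sup>2" unfolding stair_add bil_sym w(5) .
   then have "e * ?lin u <= e * (2 * M * \<delta> + e * (M * \<delta>\<^sup>2 - stair m u))" by (simp add: power2_eq_square algebra_simps)
   then show ?thesis using e(1) by simp
  qed
  have "((%e. 2 * M * \<delta> + e * (M * \<delta>\<^sup>2 - stair m u)) \<longlongrightarrow> 2 * M * \<delta> + 0 * (M * \<delta>\<^sup>2 - stair m u)) (at_right 0)"
   by (intro tendsto_intros)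
  then have "?lin u <= 2 * M * \<delta> + 0 * (M * \<delta>\<^sup>2 - stair m u)"
   by (rule tendsto_lowerbound) (use ineq in \<open>auto simp: eventually_at_right_field intro!: exI[of _ 1]\<close>)
  then show ?thesis unfolding lu \<delta>_def by (simp add: algebra_simps)
 qed
 define pen where "pen j v = cost v - omega0 ((c / 2) *\<^sub>R lin m w j) v" for j v
 have "\<exists>\<zeta>. (\<forall>l\<in>Fix \<tau>. \<zeta> \<bullet> l = 0) \<and> (\<forall>j<m. \<forall>v. 0 <= pen j v + \<zeta> \<bullet> v)"
 proof (rule multiplier[OF Fix_subspace m0])
  show "pen j (v + u) <= pen j v + pen j u" for j v u using cost_add[of v u] by (simp add: pen_def omega0_linear)
  show "pen j (t *\<^sub>R v) = t * pen j v" if "0 <= t" for j v t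
   by (simp add: pen_def cost_scale[OF that] omega0_linear right_diff_distrib)
  fix v assume "(\<Sum>j<m. v j) \<in> Fix \<tau>"
  then have "c / 2 * ?lin v <= c / 2 * (2 * M * total m v)" using c by (intro mult_left_mono first) auto
  also have "c / 2 * (2 * M * total m v) = (c * M) * total m v" by simp
  finally have "c / 2 * ?lin v <= total m v" unfolding c(2) by simp
  then show "0 <= (\<Sum>j<m. pen j (v j))"
   by (simp add: pen_def omega0_linear sum_subtractf total_def sum_distrib_left)
 qed
 then obtain \<zeta> where \<zeta>: "!!l. l \<in> Fix \<tau> ==> \<zeta> \<bullet> l = 0" "!!j v. j < m ==> 0 <= pen j v + \<zeta> \<bullet> v" by blast
 \<comment> \<open>The multiplier is Euclidean orthogonal to \<open>Fix \<tau>\<close>; rotated, it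
   is symplectically orthogonal to it and hence lies in it by \<open>Fix_maximal\<close>. The end
   points stay in \<open>Fix \<tau>\<close> after translation by it.\<close>
 define zs where "zs = J0 \<zeta>"
 have zs_om: "omega0 zs v = - (\<zeta> \<bullet> v)" for v by (simp add: zs_def omega0_def J0_def inner_prod_def)
 have zsF: "zs \<in> Fix \<tau>" by (rule Fix_maximal) (simp add: zs_om \<zeta>)
 \<comment> \<open>Position at which the j-th moves are made in the scaled, centred and translated
   staircase; testing \<open>cost_ge\<close> with pure p-moves and pure q-moves puts its two
   components into \<Delta> and \<Lambda>.\<close>
 define Z where "Z j = (c / 2) *\<^sub>R lin m w j + zs" for j
 have cost_ge: "omega0 (Z j) v <= cost v" if "j < m" for j v
  using \<zeta>(2)[OF that, of v] by (simp add: Z_def omega0_linear zs_om pen_def)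
 have hP_ge: "fst (Z j) \<bullet> b <= supp \<Delta> b" if "j < m" for j b
  using cost_ge[OF that, of "(0, b)"] by (simp add: omega0_def cost_def)
 have hQ_ge: "- (snd (Z j) \<bullet> a) <= hQ a" if "j < m" for j a
  using cost_ge[OF that, of "(a, 0)"] by (simp add: omega0_def cost_def)
 have ZD: "fst (Z j) \<in> \<Delta>" if "j < m" for j using mem_of_supp[OF D(1,2) Dne hP_ge[OF that]] .
 have ZL: "snd (Z j) \<in> \<Lambda>" if "j < m" for j
 proof (rule mem_of_supp[OF Lam(1,2) Lne])
  fix v show "snd (Z j) \<bullet> v <= supp \<Lambda> v" using hQ_ge[OF that, of "- v"] by (simp add: hQ_def)
 qed
 \<comment> \<open>All summands are nonnegative, so the vanishing sum makes every single move of the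
   maximiser attain the support function.\<close>
 have "(\<Sum>j<m. cost (w j) - omega0 (Z j) (w j)) = 0"
 proof -
  have "(\<Sum>j<m. omega0 (Z j) (w j)) = c / 2 * ?lin w + omega0 zs (\<Sum>j<m. w j)"
   by (simp add: Z_def omega0_linear omega0_sum sum.distrib sum_distrib_left)
  also have "\<dots> = 1" using c linw zs_om \<zeta>(1)[OF w(3)] by simp
  finally show ?thesis using tot1 by (simp add: sum_subtractf total_def)
 qed
 then have eq: "cost (w j) = omega0 (Z j) (w j)" if "j < m" for j
  using sum_nonneg_eq_0_iff[of "{..<m}" "%j. cost (w j) - omega0 (Z j) (w j)"] cost_ge that by auto
 have eqQ: "hQ (fst (w j)) = - (snd (Z j) \<bullet> fst (w j))" and eqP: "supp \<Delta> (snd (w j)) = fst (Z j) \<bullet> snd (w j)" if "j < m" for j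
  using eq[OF that] hQ_ge[OF that, of "fst (w j)"] hP_ge[OF that, of "snd (w j)"] by (auto simp: cost_def omega0_def)
 \<comment> \<open>The vertices after k single moves: (k + 1) div 2 of them are q-moves and k div 2
   are p-moves. The end points are symmetric about zs.\<close>
 define z where "z k = (c *\<^sub>R ((\<Sum>i<(k + 1) div 2. fst (w i)) - (1/2) *\<^sub>R (\<Sum>i<m. fst (w i))),
   c *\<^sub>R ((\<Sum>i<k div 2. snd (w i)) - (1/2) *\<^sub>R (\<Sum>i<m. snd (w i)))) + zs" for k
 have fz: "fst (z k) = fst (Z j)" if "(k + 1) div 2 = Suc j" for k j
  unfolding z_def that Z_def lin_def lessThan_Suc_atMost by (simp add: algebra_simps)
 have sz: "snd (z k) = snd (Z (k div 2))" for k
  by (simp add: z_def Z_def lin_def algebra_simps)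
 \<comment> \<open>\<open>Z j\<close> controls q only after the j-th q-move and p only before the
   j-th p-move. The initial q and the final p are covered because the first q-move and the last
   p-move are trivial.\<close>
 have fzD: "fst (z k) \<in> \<Delta>" if "k <= 2 * m" for k
 proof (cases "(k + 1) div 2")
  case 0
  then have "fst (z k) = fst (z 1)" using w(1) by (simp add: z_def)
  then show ?thesis using fz[of 1 0] ZD[OF m0] by simp
 next
  case (Suc j)
  then have "j < m" using that by linarith
  then show ?thesis using fz[OF Suc] ZD by simp
 qed
 have szL: "snd (z k) \<in> \<Lambda>" if "k <= 2 * m" for k
 proof (cases "k div 2 < m")
  case True then show ?thesis using sz ZL by simp
 next
  case False
  then have "k div 2 = Suc (m - 1)" using that m0 by linarith
  then have "snd (z k) = snd (Z (m - 1))" unfolding sz using w(2) by (simp add: Z_def lin_def)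
  then show ?thesis using ZL[of "m - 1"] m0 by simp
 qed
 have ev: "z (Suc (2 * j)) - z (2 * j) = c *\<^sub>R (fst (w j), 0)" and od: "z (Suc (Suc (2 * j))) - z (Suc (2 * j)) = c *\<^sub>R (0, snd (w j))" for j
  by (simp_all add: z_def algebra_simps)
 have ev_om: "omega0 (z (2 * j)) (z (Suc (2 * j)) - z (2 * j)) = c * hQ (fst (w j))" if "j < m" for j
  unfolding ev omega0_linear using sz[of "2 * j"] eqQ[OF that] by (simp add: omega0_def)
 have od_om: "omega0 (z (Suc (2 * j))) (z (Suc (Suc (2 * j))) - z (Suc (2 * j))) = c * supp \<Delta> (snd (w j))" if "j < m" for j
  unfolding od omega0_linear using fz[of "Suc (2 * j)" j] eqP[OF that] by (simp add: omega0_def)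
 show thesis
 proof (rule that[of c z "2 * m"])
  show "0 < c" by (rule c)
  have "z 0 = - c *\<^sub>R ((1/2) *\<^sub>R (\<Sum>i<m. w i)) + zs" "z (2 * m) = c *\<^sub>R ((1/2) *\<^sub>R (\<Sum>i<m. w i)) + zs"
   by (simp_all add: z_def prod_eq_iff fst_sum snd_sum vec_eq_iff field_simps)
  then show "z 0 \<in> Fix \<tau>" "z (2 * m) \<in> Fix \<tau>"
   using subspace_diff[OF Fix_subspace zsF subspace_scale[OF Fix_subspace w(3), of "c / 2"]]
    subspace_add[OF Fix_subspace subspace_scale[OF Fix_subspace w(3), of "c / 2"] zsF] by simp_all
  show "z i \<in> \<Delta> \<times> \<Lambda>" if "i <= 2 * m" for i using fzD[OF that] szL[OF that] by (simp add: mem_Times_iff)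
  show "(\<Sum>i<2 * m. omega0 (z i) (z (Suc i) - z i)) = c"
  proof -
   have "(\<Sum>i<2 * m. omega0 (z i) (z (Suc i) - z i)) = (\<Sum>j<m. c * hQ (fst (w j)) + c * supp \<Delta> (snd (w j)))"
    unfolding sum_pairs using ev_om od_om by (intro sum.cong refl) simp
   also have "\<dots> = c * total m w" by (simp add: total_def cost_def sum_distrib_left distrib_left)
   finally show ?thesis by (simp add: tot1)
  qed
  fix i \<xi> assume i: "i < 2 * m" and \<xi>: "\<xi> \<in> \<Delta> \<times> \<Lambda>"
  show "omega0 \<xi> (z (Suc i) - z i) <= omega0 (z i) (z (Suc i) - z i)"
  proof (cases "even i")
   case True
   then obtain j where j: "i = 2 * j" by blast
   have "- (snd \<xi> \<bullet> fst (w j)) <= hQ (fst (w j))"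
    using supp_upper[OF Lam(1), of "snd \<xi>" "- fst (w j)"] \<xi> by (auto simp: hQ_def)
   then have "c * (- (snd \<xi> \<bullet> fst (w j))) <= c * hQ (fst (w j))" using c by (intro mult_left_mono) auto
   moreover have "omega0 \<xi> (z (Suc i) - z i) = c * (- (snd \<xi> \<bullet> fst (w j)))"
    unfolding j ev omega0_linear by (simp add: omega0_def)
   moreover have "omega0 (z i) (z (Suc i) - z i) = c * hQ (fst (w j))" using ev_om[of j] i unfolding j by simp
   ultimately show ?thesis by simp
  next
   case False
   then obtain j where j: "i = Suc (2 * j)" by (metis oddE Suc_eq_plus1)
   have "fst \<xi> \<bullet> snd (w j) <= supp \<Delta> (snd (w j))"
    using supp_upper[OF D(1), of "fst \<xi>" "snd (w j)"] \<xi> by auto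
   then have "c * (fst \<xi> \<bullet> snd (w j)) <= c * supp \<Delta> (snd (w j))" using c by (intro mult_left_mono) auto
   moreover have "omega0 \<xi> (z (Suc i) - z i) = c * (fst \<xi> \<bullet> snd (w j))"
    unfolding j od omega0_linear by (simp add: omega0_def)
   moreover have "omega0 (z i) (z (Suc i) - z i) = c * supp \<Delta> (snd (w j))" using od_om[of j] i unfolding j by simp
   ultimately show ?thesis by simp
  qed
 next
  fix h S x p x' p' ka kb
  assume a: "0 <= h" "finite S" "continuous_on {0..h} x" "continuous_on {0..h} p"
   "!!t. t \<in> {0<..<h} - S ==> (x has_vector_derivative x' t) (at t)"
   "!!t. t \<in> {0<..<h} - S ==> (p has_vector_derivative p' t) (at t)"
   "!!t. t \<in> {0<..<h} - S ==> supp \<Lambda> (- x' t) <= ka t"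
   "!!t. t \<in> {0<..<h} - S ==> supp \<Delta> (p' t) <= kb t"
   "ka integrable_on {0..h}" "kb integrable_on {0..h}" "(%t. p t \<bullet> x' t) integrable_on {0..h}"
   and F: "(x 0, p 0) \<in> Fix \<tau>" "(x h, p h) \<in> Fix \<tau>"
  have rep: "\<exists>q. q \<bullet> v = supp \<Delta> v \<and> (\<forall>w. q \<bullet> w <= supp \<Delta> w)" for v
   using supp_attained[OF D(1) Dne, of v] supp_upper[OF D(1)] by blast
  have "(x h - x 0, p h - p 0) \<in> Fix \<tau>" using subspace_diff[OF Fix_subspace F(2,1)] by simp
  from curve_isoperimetric[OF opt[unfolded m_def] less_imp_le[OF w(4)] rep a(1-6) _ a(8-11) this] a(7)
  have "(x h - x 0) \<bullet> (p h - p 0) - 2 * (integral {0..h} (%t. p t \<bullet> x' t) - (x h - x 0) \<bullet> p 0)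
    <= M * (integral {0..h} ka + integral {0..h} kb)\<^sup>2" by (simp add: hQ_def)
  then have "c * ((x h - x 0) \<bullet> (p h - p 0) - 2 * (integral {0..h} (%t. p t \<bullet> x' t) - (x h - x 0) \<bullet> p 0))
    <= c * (M * (integral {0..h} ka + integral {0..h} kb)\<^sup>2)" using c by (intro mult_left_mono) auto
  moreover have "c * (M * (integral {0..h} ka + integral {0..h} kb)\<^sup>2) = (integral {0..h} ka + integral {0..h} kb)\<^sup>2"
   using c(2) by (simp add: mult.assoc[symmetric])
  moreover have "x 0 \<bullet> p h = x h \<bullet> p 0" using Fix_isotropic[OF F] by (simp add: omega0_def inner_commute)
  then have "(x h - x 0) \<bullet> (p h - p 0) - 2 * (integral {0..h} (%t. p t \<bullet> x' t) - (x h - x 0) \<bullet> p 0)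
    = x h \<bullet> p h - x 0 \<bullet> p 0 - 2 * integral {0..h} (%t. p t \<bullet> x' t)"
   by (simp add: inner_diff_left inner_diff_right)
  ultimately show "c * (x h \<bullet> p h - x 0 \<bullet> p 0 - 2 * integral {0..h} (%t. p t \<bullet> x' t)) <= (integral {0..h} ka + integral {0..h} kb)\<^sup>2"
   by (simp only:)
 qed
qed

section \<open>Tangents of smooth bodies and the gradient of the gauge\<close>

text \<open>First-order smoothness of the boundary seen from inside: near x the set contains every
  cone slightly narrower than the half space with outer normal n. It follows from a local defining
  function with nonzero gradient and is stable under translation.\<close>

definition has_tangent :: "'a::euclidean_space set \<Rightarrow> 'a \<Rightarrow> 'a \<Rightarrow> bool" where
 "has_tangent K x n \<longleftrightarrow> n ~= 0 \<and> (\<forall>e>0. \<exists>d>0. \<forall>y. norm (y - x) < d \<and> n \<bullet> (y - x) <= - e * norm (y - x) --> y \<in> K)"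

lemma smooth_body_tangent:
 fixes K :: "'a::euclidean_space set"
 assumes K: "smooth_convex_body K" and x: "x \<in> frontier K"
 shows "\<exists>n. has_tangent K x n"
proof -
 obtain U f where U: "open U" "x \<in> U" "C_inf U f" "frechet_derivative f (at x) ~= (%v. 0)" "K \<inter> U = {y\<in>U. f y <= 0}"
  using K x unfolding smooth_convex_body_def by blast
 have "x \<in> K" using x K by (metis compact_imp_closed convex_body_def frontier_subset_eq smooth_convex_body_def subsetD)
 then have fx: "f x <= 0" using U by blast
 obtain g where g: "\<forall>x\<in>U. (f has_derivative (%v. \<Sum>i\<in>Basis. (v \<bullet> i) * g i x)) (at x)"
  using U(3) by (cases rule: C_inf.cases) blast
 define n where "n = (\<Sum>i\<in>Basis. g i x *\<^sub>R i)"
 have nv: "(\<Sum>i\<in>Basis. (v \<bullet> i) * g i x) = n \<bullet> v" for v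
  unfolding n_def inner_sum_left inner_scaleR_left by (rule sum.cong[OF refl]) (simp add: inner_commute)
 have df: "(f has_derivative (%v. n \<bullet> v)) (at x)" using g[rule_format, OF U(2)] unfolding nv by simp
 have "n ~= 0" using U(4) frechet_derivative_at[OF df] by auto
 moreover have "\<exists>d>0. \<forall>y. norm (y - x) < d \<and> n \<bullet> (y - x) <= - e * norm (y - x) --> y \<in> K" if e: "0 < e" for e
 proof -
  obtain d1 where d1: "0 < d1" "!!y. norm (y - x) < d1 ==> norm (f y - f x - n \<bullet> (y - x)) <= e * norm (y - x)"
   using df e unfolding has_derivative_at_alt by blast
  obtain d2 where d2: "0 < d2" "ball x d2 \<subseteq> U" using U(1,2) open_contains_ball by blast
  have "y \<in> K" if y: "norm (y - x) < min d1 d2" "n \<bullet> (y - x) <= - e * norm (y - x)" for y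
  proof -
   have "f y <= f x + n \<bullet> (y - x) + e * norm (y - x)" using d1(2)[of y] y by (simp add: abs_le_iff)
   then have "f y <= 0" using fx y(2) by simp
   moreover have "y \<in> U" using y d2(2) by (auto simp: dist_norm norm_minus_commute)
   ultimately show ?thesis using U(5) by blast
  qed
  then show ?thesis using d1(1) d2(1) by (intro exI[of _ "min d1 d2"]) auto
 qed
 ultimately show ?thesis unfolding has_tangent_def by blast
qed

lemma tangent_translate:
 assumes "has_tangent K (x + a) n"
 shows "has_tangent ((%q. q - a) ` K) x n"
 unfolding has_tangent_def
proof (intro conjI allI impI)
 show "n ~= 0" using assms by (simp add: has_tangent_def)
 fix e :: real assume "0 < e"
 then obtain d where d: "0 < d" "!!y. norm (y - (x + a)) < d ==> n \<bullet> (y - (x + a)) <= - e * norm (y - (x + a)) ==> y \<in> K"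
  using assms unfolding has_tangent_def by blast
 show "\<exists>d>0. \<forall>y. norm (y - x) < d \<and> n \<bullet> (y - x) <= - e * norm (y - x) --> y \<in> (%q. q - a) ` K"
 proof (intro exI[of _ d] conjI allI impI d(1))
  fix y assume "norm (y - x) < d \<and> n \<bullet> (y - x) <= - e * norm (y - x)"
  then have "y + a \<in> K" by (intro d(2)) auto
  then show "y \<in> (%q. q - a) ` K" by (force intro: image_eqI[of _ _ "y + a"])
 qed
qed

text \<open>A direction v with n . v < 0 points into K, so w . v <= 0. Testing with the part of w
  orthogonal to n, tilted by - s n, and letting s tend to 0 shows that this part vanishes.\<close>

lemma tangent_normal:
 assumes t: "has_tangent K x n" and w: "!!y. y \<in> K ==> w \<bullet> y <= w \<bullet> x"
 obtains l where "0 <= l" "w = l *\<^sub>R n"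
proof -
 have n0: "n ~= 0" using t by (simp add: has_tangent_def)
 have dir: "w \<bullet> v <= 0" if v: "n \<bullet> v < 0" for v
 proof -
  have v0: "v ~= 0" using v by auto
  define e where "e = - (n \<bullet> v) / norm v"
  have e: "0 < e" using v v0 by (simp add: e_def divide_neg_pos)
  then obtain d where d: "0 < d" "!!y. norm (y - x) < d ==> n \<bullet> (y - x) <= - e * norm (y - x) ==> y \<in> K"
   using t unfolding has_tangent_def by blast
  define s where "s = d / (2 * norm v)"
  have s: "0 < s" using d v0 by (simp add: s_def)
  have "x + s *\<^sub>R v \<in> K"
  proof (rule d(2))
   show "norm (x + s *\<^sub>R v - x) < d" using d(1) v0 by (simp add: s_def)
   show "n \<bullet> (x + s *\<^sub>R v - x) <= - e * norm (x + s *\<^sub>R v - x)" using s v0 by (simp add: e_def)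
  qed
  from w[OF this] have "s * (w \<bullet> v) <= 0" by (simp add: inner_add_right)
  then show ?thesis using s by (simp add: mult_le_0_iff)
 qed
 have "n \<bullet> (- n) < 0" using n0 by simp
 from dir[OF this] have wn0: "0 <= w \<bullet> n" by simp
 define w' where "w' = w - ((w \<bullet> n) / (n \<bullet> n)) *\<^sub>R n"
 have wn: "n \<bullet> w' = 0" using n0 by (simp add: w'_def inner_diff_right inner_commute)
 have weq: "w = w' + ((w \<bullet> n) / (n \<bullet> n)) *\<^sub>R n" by (simp add: w'_def)
 have ww: "w \<bullet> w' = w' \<bullet> w'"
 proof -
  have "w \<bullet> w' = w' \<bullet> w' + (w \<bullet> n) / (n \<bullet> n) * (n \<bullet> w')"
   by (subst weq) (simp only: inner_add_left inner_scaleR_left)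
  then show ?thesis using wn by simp
 qed
 have "w' \<bullet> w' <= s * (w \<bullet> n)" if s: "0 < s" for s
 proof -
  have "n \<bullet> (w' - s *\<^sub>R n) < 0" using wn n0 s by (simp add: inner_diff_right)
  from dir[OF this] show ?thesis by (simp add: inner_diff_right ww)
 qed
 moreover have "((%s. s * (w \<bullet> n)) \<longlongrightarrow> 0 * (w \<bullet> n)) (at_right 0)" by (intro tendsto_intros)
 ultimately have "w' \<bullet> w' <= 0 * (w \<bullet> n)"
  by (intro tendsto_lowerbound[where F = "at_right (0::real)" and f = "%s. s * (w \<bullet> n)"])
   (auto simp: eventually_at_right_field intro!: exI[of _ 1])
 then have "w' = 0" by (metis inner_gt_zero_iff mult_zero_left not_less)
 then show thesis using wn0 weq n0 that[of "(w \<bullet> n) / (n \<bullet> n)"] by simp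
qed

lemma minkowski_le: "0 < t ==> x \<in> (%y. t *\<^sub>R y) ` K ==> minkowski K x <= t"
 unfolding minkowski_def by (rule cInf_lower) (auto intro!: bdd_belowI[of _ 0])

lemma minkowski_ge:
 assumes r: "0 < r" "cball 0 r \<subseteq> K" and a: "!!y. y \<in> K ==> a \<bullet> y <= 1"
 shows "a \<bullet> x <= minkowski K x"
 unfolding minkowski_def
proof (rule cInf_greatest)
 define t where "t = norm x / r + 1"
 have t: "0 < t" using r by (simp add: t_def add_nonneg_pos)
 have "norm ((1 / t) *\<^sub>R x) <= r" using t r by (simp add: t_def field_simps)
 then have "(1 / t) *\<^sub>R x \<in> K" using r(2) by (intro subsetD[OF r(2)]) simp
 then have "x \<in> (%y. t *\<^sub>R y) ` K" using t by (intro image_eqI[of _ _ "(1 / t) *\<^sub>R x"]) auto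
 then show "{t. 0 < t \<and> x \<in> (%y. t *\<^sub>R y) ` K} ~= {}" using t by blast
next
 fix t assume "t \<in> {t. 0 < t \<and> x \<in> (%y. t *\<^sub>R y) ` K}"
 then obtain y where y: "0 < t" "y \<in> K" "x = t *\<^sub>R y" by blast
 then show "a \<bullet> x <= t" using a[of y] by (simp add: mult_left_le)
qed

text \<open>The normal scaled to M . x = 1 is the gradient. The lower estimate holds because M is at
  most 1 on K. For the upper one the tangent cone is used to show that x + v lies in (1 + s) K with
  s = M . v + e |v|. Only after differentiability is known does the choice in \<open>grad\<close>
  have a determined value.\<close>

theorem gauge_gradient:
 fixes K :: "'a::euclidean_space set"
 assumes K: "compact K" "convex K" "0 \<in> interior K" and x: "x \<in> frontier K" and t: "has_tangent K x n"
 defines "N \<equiv> grad (minkowski K) x"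
 shows "N \<bullet> x = 1" "!!y. y \<in> K ==> N \<bullet> y <= 1"
  "!!w. (!!y. y \<in> K ==> w \<bullet> y <= w \<bullet> x) ==> w = (w \<bullet> x) *\<^sub>R N \<and> 0 <= w \<bullet> x"
proof -
 obtain r where r: "0 < r" "cball 0 r \<subseteq> K" using K(3) by (auto simp: mem_interior_cball)
 have xK: "x \<in> K" using frontier_subset_closed[OF compact_imp_closed[OF K(1)]] x by auto
 have n0: "n ~= 0" using t by (simp add: has_tangent_def)
 have nK: "n \<bullet> y <= n \<bullet> x" if y: "y \<in> K" for y
 proof -
  have "x \<notin> interior K" using x by (simp add: frontier_def)
  then have nri: "x \<notin> rel_interior K" using K(3) by (metis empty_iff rel_interior_nonempty_interior)
  obtain a where a: "a ~= 0" "!!y. y \<in> K ==> a \<bullet> x <= a \<bullet> y"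
   by (rule supporting_hyperplane_rel_boundary[OF K(2) xK nri]) (rule that)
  have s: "(- a) \<bullet> y <= (- a) \<bullet> x" if "y \<in> K" for y using a(2)[OF that] by simp
  obtain l where l: "0 <= l" "- a = l *\<^sub>R n" using tangent_normal[OF t s] by blast
  have l0: "0 < l" using l a(1) by (cases "l = 0") auto
  have "l * (n \<bullet> y) <= l * (n \<bullet> x)" using s[OF y] unfolding l(2) by simp
  then show ?thesis using l0 by simp
 qed
 have nx: "0 < n \<bullet> x"
 proof -
  have "(r / norm n) *\<^sub>R n \<in> K" using r n0 by (intro subsetD[OF r(2)]) simp
  from nK[OF this] have "r * norm n <= n \<bullet> x" using n0 by (simp add: dot_square_norm power2_eq_square)
  moreover have "0 < r * norm n" using r n0 by simp
  ultimately show ?thesis by linarith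
 qed
 define M where "M = (1 / (n \<bullet> x)) *\<^sub>R n"
 have Mx: "M \<bullet> x = 1" using nx by (simp add: M_def)
 have MK: "M \<bullet> y <= 1" if "y \<in> K" for y using nK[OF that] nx by (simp add: M_def)
 have jx: "minkowski K x = 1"
 proof (rule antisym)
  show "minkowski K x <= 1" by (rule minkowski_le) (use xK in auto)
  show "1 <= minkowski K x" using minkowski_ge[OF r MK, of x] Mx by simp
 qed
 have low: "1 + M \<bullet> v <= minkowski K (x + v)" for v
  using minkowski_ge[OF r MK, of "x + v"] Mx by (simp add: inner_add_right)
 have "(minkowski K has_derivative (%h. h \<bullet> M)) (at x)"
  unfolding has_derivative_at_alt
 proof (intro conjI allI impI bounded_linear_inner_left)
  fix e :: real assume e: "0 < e"
  \<comment> \<open>C bounds |v - s x| by C |v|. With the tangent tolerance e * (n . x) / C, the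
    point p = (x + v) / (1 + s) satisfies the cone condition exactly, and d' keeps 1 + s above 1/2
    and p within distance d of x.\<close>
  define C where "C = 1 + (norm M + e) * norm x"
  have C: "0 < C" using e by (simp add: C_def add_pos_nonneg)
  have "0 < e * (n \<bullet> x) / C" using e nx C by simp
  then obtain d where d: "0 < d" "!!y. norm (y - x) < d ==> n \<bullet> (y - x) <= - (e * (n \<bullet> x) / C) * norm (y - x) ==> y \<in> K"
   using t unfolding has_tangent_def by blast
  define d' where "d' = min (d / (2 * C)) (1 / (2 * (norm M + e)))"
  have Me: "0 < norm M + e" using e by (simp add: add_nonneg_pos)
  have d': "0 < d'" using d C Me by (simp add: d'_def)
  have "norm (minkowski K y - minkowski K x - (y - x) \<bullet> M) <= e * norm (y - x)" if y: "norm (y - x) < d'" for y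
  proof -
   define v where "v = y - x"
   define s where "s = M \<bullet> v + e * norm v"
   have vd: "norm v < d / (2 * C)" "norm v < 1 / (2 * (norm M + e))" using y by (auto simp: v_def d'_def)
   have sv: "\<bar>s\<bar> <= (norm M + e) * norm v"
   proof -
    have "\<bar>s\<bar> <= \<bar>M \<bullet> v\<bar> + \<bar>e * norm v\<bar>" unfolding s_def by (rule abs_triangle_ineq)
    also have "\<dots> <= norm M * norm v + e * norm v" using Cauchy_Schwarz_ineq2[of M v] e by simp
    finally show ?thesis by (simp add: distrib_right)
   qed
   have "(norm M + e) * norm v < 1 / 2" using vd(2) Me by (simp add: field_simps)
   then have t2: "1 / 2 < 1 + s" using sv by linarith
   define p where "p = (1 / (1 + s)) *\<^sub>R (x + v)"
   have px: "p - x = (1 / (1 + s)) *\<^sub>R (v - s *\<^sub>R x)"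
   proof -
    have "p - x = (1 / (1 + s)) *\<^sub>R ((x + v) - (1 + s) *\<^sub>R x)" unfolding scaleR_diff_right p_def using t2 by simp
    also have "(x + v) - (1 + s) *\<^sub>R x = v - s *\<^sub>R x" by (simp add: scaleR_add_left)
    finally show ?thesis .
   qed
   have nv: "norm (v - s *\<^sub>R x) <= C * norm v"
   proof -
    have "norm (v - s *\<^sub>R x) <= norm v + \<bar>s\<bar> * norm x" using norm_triangle_ineq4[of v "s *\<^sub>R x"] by simp
    also have "\<dots> <= norm v + ((norm M + e) * norm v) * norm x" using sv by (intro add_left_mono mult_right_mono) auto
    finally show ?thesis by (simp add: C_def algebra_simps)
   qed
   have npx: "norm (p - x) <= C * norm v / (1 + s)"
    unfolding px using nv t2 by (simp add: divide_right_mono)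
   have "p \<in> K"
   proof (rule d(2))
    have "C * norm v / (1 + s) <= C * norm v / (1/2)" using t2 C by (intro divide_left_mono) auto
    also have "\<dots> < d" using vd(1) C by (simp add: field_simps)
    finally show "norm (p - x) < d" using npx by linarith
    have "n = (n \<bullet> x) *\<^sub>R M" using nx by (simp add: M_def)
    then have "n \<bullet> v = (n \<bullet> x) * (M \<bullet> v)" by (metis inner_scaleR_left)
    then have "n \<bullet> (v - s *\<^sub>R x) = - (e * (n \<bullet> x)) * norm v" by (simp add: s_def inner_diff_right algebra_simps)
    then have "n \<bullet> (p - x) = - (e * (n \<bullet> x) / C) * (C * norm v / (1 + s))"
     unfolding px using C by simp
    also have "\<dots> <= - (e * (n \<bullet> x) / C) * norm (p - x)"
     using npx e nx C by (intro mult_left_mono_neg) auto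
    finally show "n \<bullet> (p - x) <= - (e * (n \<bullet> x) / C) * norm (p - x)" .
   qed
   then have "x + v \<in> (%y. (1 + s) *\<^sub>R y) ` K" using t2 by (intro image_eqI[of _ _ p]) (auto simp: p_def)
   then have "minkowski K (x + v) <= 1 + s" using t2 by (intro minkowski_le) auto
   then show ?thesis using low[of v] by (simp add: jx v_def s_def inner_commute abs_le_iff)
  qed
  then show "\<exists>d>0. \<forall>y. norm (y - x) < d --> norm (minkowski K y - minkowski K x - (y - x) \<bullet> M) <= e * norm (y - x)"
   using d' by blast
 qed
 then have gd: "GDERIV (minkowski K) x :> M" by (simp add: gderiv_def)
 then have "GDERIV (minkowski K) x :> N" unfolding N_def grad_def by (rule someI)
 then have "(%h. h \<bullet> N) = (%h. h \<bullet> M)" using gd unfolding gderiv_def by (rule has_derivative_unique)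
 then have NM: "N = M" by (metis vector_eq_ldot)
 show "N \<bullet> x = 1" "!!y. y \<in> K ==> N \<bullet> y <= 1" using Mx MK NM by auto
 fix w assume w: "!!y. y \<in> K ==> w \<bullet> y <= w \<bullet> x"
 obtain l where wl: "0 <= l" "w = l *\<^sub>R n" using tangent_normal[OF t w] by blast
 then have "w \<bullet> x = l * (n \<bullet> x)" by simp
 moreover have "(l * (n \<bullet> x)) *\<^sub>R N = w" using wl nx by (simp add: NM M_def)
 ultimately show "w = (w \<bullet> x) *\<^sub>R N \<and> 0 <= w \<bullet> x" using wl nx by simp
qed

section \<open>Smooth functions: algebra, profiles and smoothed gauges\<close>

lemma C_infD:
 assumes "C_inf U f"
 obtains g where "!!x. x \<in> U ==> (f has_derivative (%v. \<Sum>i\<in>Basis. (v \<bullet> i) * g i x)) (at x)"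
  "!!i. i \<in> Basis ==> C_inf U (g i)"
 using assms by (cases rule: C_inf.cases) blast

text \<open>Smoothness is coinductive, so a closure property needs a class of functions that is
  closed under differentiation. The derivative of a product or a composition is a sum of products of
  functions of the same kind, hence stays in this ring.\<close>

inductive smooth_ring :: "'a::euclidean_space set \<Rightarrow> real set \<Rightarrow> ('a \<Rightarrow> real) \<Rightarrow> bool" for U V where
 base: "C_inf U f ==> smooth_ring U V f"
| comp: "C_inf V \<phi> ==> C_inf U f ==> f ` U \<subseteq> V ==> smooth_ring U V (%x. \<phi> (f x))"
| add: "smooth_ring U V f ==> smooth_ring U V g ==> smooth_ring U V (%x. f x + g x)"
| mult: "smooth_ring U V f ==> smooth_ring U V g ==> smooth_ring U V (%x. f x * g x)"

lemma smooth_ring_deriv: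
 assumes "smooth_ring U V f"
 shows "\<exists>g. (\<forall>x\<in>U. (f has_derivative (%v. \<Sum>i\<in>Basis. (v \<bullet> i) * g i x)) (at x)) \<and> (\<forall>i\<in>Basis. smooth_ring U V (g i))"
 using assms
proof induction
 case (base f)
 then show ?case by (rule C_infD) (blast intro: smooth_ring.base)
next
 case (comp \<phi> f)
 obtain p where p: "!!x. x \<in> V ==> (\<phi> has_derivative (%v. \<Sum>i\<in>Basis. (v \<bullet> i) * p i x)) (at x)" "!!i. i \<in> Basis ==> C_inf V (p i)"
  by (rule C_infD[OF comp(1)]) (rule that)
 obtain g where g: "!!x. x \<in> U ==> (f has_derivative (%v. \<Sum>i\<in>Basis. (v \<bullet> i) * g i x)) (at x)" "!!i. i \<in> Basis ==> C_inf U (g i)"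
  by (rule C_infD[OF comp(2)]) (rule that)
 have "((%x. \<phi> (f x)) has_derivative (%v. \<Sum>i\<in>Basis. (v \<bullet> i) * (p 1 (f x) * g i x))) (at x)" if x: "x \<in> U" for x
  using has_derivative_compose[OF g(1)[OF x] p(1)[of "f x"]] comp(3) x
  by (simp add: image_subset_iff sum_distrib_left ac_simps)
 moreover have "smooth_ring U V (%x. p 1 (f x) * g i x)" if "i \<in> Basis" for i
  by (rule smooth_ring.mult[OF smooth_ring.comp[OF p(2) comp(2,3)] smooth_ring.base[OF g(2)[OF that]]]) simp
 ultimately show ?case by (intro exI[of _ "%i x. p 1 (f x) * g i x"]) blast
next
 case (add f g)
 then obtain f' g' where f: "\<forall>x\<in>U. (f has_derivative (%v. \<Sum>i\<in>Basis. (v \<bullet> i) * f' i x)) (at x)" "\<forall>i\<in>Basis. smooth_ring U V (f' i)"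
  and g: "\<forall>x\<in>U. (g has_derivative (%v. \<Sum>i\<in>Basis. (v \<bullet> i) * g' i x)) (at x)" "\<forall>i\<in>Basis. smooth_ring U V (g' i)" by blast
 show ?case
 proof (intro exI[of _ "%i x. f' i x + g' i x"] conjI ballI)
  fix x assume "x \<in> U"
  then show "((%x. f x + g x) has_derivative (%v. \<Sum>i\<in>Basis. (v \<bullet> i) * (f' i x + g' i x))) (at x)"
   using has_derivative_add f(1) g(1) by (fastforce simp: distrib_left sum.distrib)
 qed (use f g in \<open>auto intro: smooth_ring.add\<close>)
next
 case (mult f g)
 then obtain f' g' where f: "\<forall>x\<in>U. (f has_derivative (%v. \<Sum>i\<in>Basis. (v \<bullet> i) * f' i x)) (at x)" "\<forall>i\<in>Basis. smooth_ring U V (f' i)"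
  and g: "\<forall>x\<in>U. (g has_derivative (%v. \<Sum>i\<in>Basis. (v \<bullet> i) * g' i x)) (at x)" "\<forall>i\<in>Basis. smooth_ring U V (g' i)" by blast
 show ?case
 proof (intro exI[of _ "%i x. f x * g' i x + f' i x * g x"] conjI ballI)
  fix x assume x: "x \<in> U"
  have "((%x. f x * g x) has_derivative (%v. f x * (\<Sum>i\<in>Basis. (v \<bullet> i) * g' i x) + (\<Sum>i\<in>Basis. (v \<bullet> i) * f' i x) * g x)) (at x)"
   by (rule has_derivative_mult) (use f(1) g(1) x in auto)
  then show "((%x. f x * g x) has_derivative (%v. \<Sum>i\<in>Basis. (v \<bullet> i) * (f x * g' i x + f' i x * g x))) (at x)"
   by (simp add: sum_distrib_left sum_distrib_right distrib_left sum.distrib ac_simps)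
 qed (use f g mult(1,2) in \<open>auto intro!: smooth_ring.add smooth_ring.mult\<close>)
qed

lemma smooth_ring_C_inf: "smooth_ring U V f ==> C_inf U f"
proof (coinduction arbitrary: f)
 case C_inf
 from smooth_ring_deriv[OF this] show ?case by blast
qed

lemma C_inf_add: "C_inf U f ==> C_inf U g ==> C_inf U (%x. f x + g x)"
 by (rule smooth_ring_C_inf[OF smooth_ring.add[OF smooth_ring.base smooth_ring.base]])

lemma C_inf_mult: "C_inf U f ==> C_inf U g ==> C_inf U (%x. f x * g x)"
 by (rule smooth_ring_C_inf[OF smooth_ring.mult[OF smooth_ring.base smooth_ring.base]])

lemma C_inf_compose: "C_inf V \<phi> ==> C_inf U f ==> f ` U \<subseteq> V ==> C_inf U (%x. \<phi> (f x))"
 by (rule smooth_ring_C_inf[OF smooth_ring.comp])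

lemma C_inf_const: "C_inf U (%x. c)"
proof (coinduction arbitrary: c)
 case C_inf
 show ?case by (intro exI[of _ "%i x. 0"] exI[of _ "%x. c"]) auto
qed

lemma C_inf_inner: "C_inf U (%x. a \<bullet> x)"
proof (rule C_inf.intros[of _ _ "%i x. a \<bullet> i"])
 have "(\<Sum>i\<in>Basis. (v \<bullet> i) * (a \<bullet> i)) = a \<bullet> v" for v
  using euclidean_inner[of a v] by (simp add: mult.commute)
 then show "\<forall>x\<in>U. ((%x. a \<bullet> x) has_derivative (%v. \<Sum>i\<in>Basis. (v \<bullet> i) * (a \<bullet> i))) (at x)"
  by (auto intro!: derivative_eq_intros)
qed (auto intro: C_inf_const)

lemma C_inf_sum: "finite I ==> (!!i. i \<in> I ==> C_inf U (f i)) ==> C_inf U (%x. \<Sum>i\<in>I. f i x)"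
 by (induction I rule: finite_induct) (auto intro: C_inf_const C_inf_add)

lemma C_inf_real:
 assumes "!!x. x \<in> V ==> (f has_real_derivative g x) (at x)" "C_inf V g"
 shows "C_inf V (f :: real \<Rightarrow> real)"
 by (rule C_inf.intros[of _ _ "%i. g"]) (use assms in \<open>auto simp: has_field_derivative_def mult_commute_abs\<close>)

lemma C_inf_exp: "C_inf V (exp :: real \<Rightarrow> real)"
proof -
 have "C_inf V f" if "f = (exp :: real \<Rightarrow> real)" for f
  using that
 proof (coinduction arbitrary: f)
  case C_inf
  show ?case
   by (intro exI[of _ "%i. exp"] exI[of _ f])
    (use C_inf in \<open>auto intro!: derivative_eq_intros\<close>)
 qed
 then show ?thesis by simp
qed

lemma C_inf_inverse: "C_inf {0<..} (inverse :: real \<Rightarrow> real)"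
proof -
 have "C_inf {0<..} f" if "\<exists>c n. f = (%x. c * inverse x ^ Suc n)" for f :: "real \<Rightarrow> real"
  using that
 proof (coinduction arbitrary: f)
  case C_inf
  then obtain c n where f: "f = (%x. c * inverse x ^ Suc n)" by blast
  have "(f has_derivative (%v. \<Sum>i\<in>Basis. (v \<bullet> i) * ((- c * real (Suc n)) * inverse x ^ Suc (Suc n)))) (at x)" if "x \<in> {0<..}" for x
  proof -
   have "((%x. inverse x ^ Suc n) has_real_derivative real (Suc n) * (- (inverse x ^ Suc (Suc 0)) * inverse x ^ n)) (at x)"
    using DERIV_power[OF DERIV_inverse[of x], of "Suc n"] that by simp
   from DERIV_cmult[OF this, of c] show ?thesis
    unfolding f has_field_derivative_def by (rule has_derivative_eq_rhs) (simp add: fun_eq_iff algebra_simps)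
  qed
  then show ?case
   by (intro exI[of _ "%i x. (- c * real (Suc n)) * inverse x ^ Suc (Suc n)"] exI[of _ f]) blast
 qed
 from this[of inverse] show ?thesis by (metis mult_1 power_0 power_one_right One_nat_def)
qed

lemma C_inf_ln: "C_inf {0<..} (ln :: real \<Rightarrow> real)"
 by (rule C_inf_real[OF _ C_inf_inverse]) (auto intro!: derivative_eq_intros simp: inverse_eq_divide)

text \<open>For n = 0 the classical function with all derivatives zero at 0. The additional powers
  make the linear span closed under differentiation, as the coinduction in \<open>C_inf_flat\<close>
  demands.\<close>

definition flat :: "nat \<Rightarrow> real \<Rightarrow> real" where
 "flat n x = (if 0 < x then inverse x ^ n * exp (- inverse x) else 0)"

lemma flat_tendsto: "(flat n \<longlongrightarrow> 0) (at 0)"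
proof -
 have "((%x. inverse x ^ n / exp (inverse x)) \<longlongrightarrow> 0) (at_right (0::real))"
  using filterlim_compose[OF tendsto_power_div_exp_0[of n] filterlim_inverse_at_top_right] .
 moreover have "\<forall>\<^sub>F x in at_right 0. inverse x ^ n / exp (inverse x) = flat n x"
  by (auto simp: eventually_at_right_field flat_def exp_minus divide_inverse intro!: exI[of _ 1])
 ultimately have "(flat n \<longlongrightarrow> 0) (at_right 0)" by (rule Lim_transform_eventually)
 moreover have "\<forall>\<^sub>F x in at_left 0. 0 = flat n x"
  by (auto simp: eventually_at_left_field flat_def intro!: exI[of _ "-1"])
 then have "(flat n \<longlongrightarrow> 0) (at_left 0)" using Lim_transform_eventually[OF tendsto_const] by blast
 ultimately show ?thesis using filterlim_split_at_real by (simp add: filterlim_at_split)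
qed

lemma flat_deriv: "(flat n has_real_derivative (flat (n + 2) x - n * flat (n + 1) x)) (at x)"
proof -
 consider "x < 0" | "x = 0" | "0 < x" by linarith
 then show ?thesis
 proof cases
  case 1
  have "((%x. 0) has_real_derivative 0) (at x)" by simp
  moreover have "\<forall>\<^sub>F y in nhds x. flat n y = 0"
   using 1 by (intro eventually_nhds_in_open[THEN eventually_mono, of "{..<0}"]) (auto simp: flat_def)
  ultimately show ?thesis using 1 by (subst DERIV_cong_ev[OF refl _ refl]) (auto simp: flat_def)
 next
  case 2
  have "((%h. (flat n (0 + h) - flat n 0) / h) \<longlongrightarrow> 0) (at 0)"
  proof (rule Lim_transform_eventually[OF flat_tendsto[of "Suc n"]])
   show "\<forall>\<^sub>F h in at 0. flat (Suc n) h = (flat n (0 + h) - flat n 0) / h"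
    by (auto simp: flat_def divide_inverse eventually_at_filter)
  qed
  then show ?thesis using 2 by (simp add: DERIV_def flat_def)
 next
  case 3
  have "((%x. inverse x ^ n * exp (- inverse x)) has_real_derivative (flat (n + 2) x - n * flat (n + 1) x)) (at x)"
  proof -
   have i: "(inverse has_real_derivative - (inverse x ^ Suc (Suc 0))) (at x)" using DERIV_inverse[of x] 3 by simp
   from DERIV_mult[OF DERIV_power[OF i, of n] DERIV_chain2[OF DERIV_exp DERIV_minus[OF i]]] show ?thesis
    by (rule DERIV_cong) (cases n; use 3 in \<open>simp add: flat_def algebra_simps\<close>)
  qed
  moreover have "\<forall>\<^sub>F y in nhds x. flat n y = inverse y ^ n * exp (- inverse y)"
   using 3 by (intro eventually_nhds_in_open[THEN eventually_mono, of "{0<..}"]) (auto simp: flat_def)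
  ultimately show ?thesis by (subst DERIV_cong_ev[OF refl _ refl]) auto
 qed
qed

inductive flat_span :: "(real \<Rightarrow> real) \<Rightarrow> bool" where
 flat: "flat_span (%x. c * flat n x)"
| add: "flat_span f ==> flat_span g ==> flat_span (%x. f x + g x)"

lemma flat_span_deriv: "flat_span f ==> \<exists>g. (\<forall>x. (f has_real_derivative g x) (at x)) \<and> flat_span g"
proof (induction rule: flat_span.induct)
 case (flat c n)
 have "((%x. c * flat n x) has_real_derivative c * flat (n + 2) x + (- c * n) * flat (n + 1) x) (at x)" for x
  using DERIV_cmult[OF flat_deriv[of n x], of c] by (simp add: algebra_simps)
 then show ?case
  by (intro exI[of _ "%x. c * flat (n + 2) x + (- c * n) * flat (n + 1) x"] conjI allI flat_span.add flat_span.flat)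
next
 case (add f g)
 then obtain f' g' where "\<forall>x. (f has_real_derivative f' x) (at x)" "flat_span f'"
  "\<forall>x. (g has_real_derivative g' x) (at x)" "flat_span g'" by blast
 then show ?case by (intro exI[of _ "%x. f' x + g' x"]) (auto intro: flat_span.add DERIV_add)
qed

lemma C_inf_flat: "C_inf V (flat 0)"
proof -
 have "C_inf V f" if "flat_span f" for f
  using that
 proof (coinduction arbitrary: f)
  case C_inf
  from flat_span_deriv[OF this] obtain g where "\<forall>x. (f has_real_derivative g x) (at x)" "flat_span g" by blast
  then show ?case
   by (intro exI[of _ "%i. g"] exI[of _ f]) (auto simp: has_field_derivative_def mult_commute_abs)
 qed
 from this[OF flat_span.flat[of 1 0]] show ?thesis by simp
qed

text \<open>The derivative is 2 * c * (1 - e) * s times 1 - exp (- R * q), where q is a bump on (e,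
  1 - e). This factor is at most 1, and at least 1 - e on [2 * e, 1 - 2 * e]; comparison with a
  parabola there gives the rise, which tends to c as e tends to 0.\<close>

lemma plateau_profile:
 fixes c e :: real
 assumes c: "0 < c" and e: "0 < e" "e < 1/4"
 obtains \<phi> \<phi>' where "C_inf UNIV \<phi>" "!!s. (\<phi> has_real_derivative \<phi>' s) (at s)"
  "!!s. s <= e ==> \<phi> s = 0" "!!s. 1 - e <= s ==> \<phi> s = \<phi> 1" "mono \<phi>"
  "!!s. 0 <= \<phi>' s" "!!s. \<phi>' s ~= 0 ==> e < s \<and> s < 1 - e" "!!s. 0 <= s ==> \<phi>' s <= 2 * c * (1 - e) * s"
  "c * (1 - e) * (1 - e) * (1 - 4 * e) <= \<phi> 1"
proof -
 define q where "q s = flat 0 (s - e) * flat 0 (1 - e - s)" for s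
 have f0: "flat 0 x = (if 0 < x then exp (- inverse x) else 0)" for x by (simp add: flat_def)
 have q0: "0 <= q s" for s by (simp add: q_def f0)
 have q_out: "q s = 0" if "\<not> (e < s \<and> s < 1 - e)" for s using that by (auto simp: q_def f0)
 define k where "k = exp (- inverse e) * exp (- inverse e)"
 have k: "0 < k" by (simp add: k_def)
 have q_in: "k <= q s" if "2 * e <= s" "s <= 1 - 2 * e" for s
 proof -
  have "exp (- inverse e) <= flat 0 (s - e)" "exp (- inverse e) <= flat 0 (1 - e - s)"
   using that e by (auto simp: f0 intro!: le_imp_inverse_le)
  then show ?thesis unfolding k_def q_def by (intro mult_mono) (auto simp: f0)
 qed
 \<comment> \<open>Chosen such that exp (- R * k) = e, where k bounds the bump from below on the
   middle interval.\<close>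
 define R where "R = - ln e / k"
 have R: "0 <= R" using e k by (simp add: R_def divide_nonpos_pos)
 define \<phi>' where "\<phi>' s = 2 * c * (1 - e) * s * (1 - exp (- R * q s))" for s
 have lin: "C_inf UNIV (%s::real. a + b * s)" for a b
  using C_inf_add[OF C_inf_const[of UNIV a] C_inf_inner[of UNIV b]] by simp
 have "C_inf UNIV q"
  unfolding q_def
  using C_inf_mult[OF C_inf_compose[OF C_inf_flat[of UNIV] lin[of "- e" 1]] C_inf_compose[OF C_inf_flat[of UNIV] lin[of "1 - e" "- 1"]]]
  by (simp add: algebra_simps)
 then have "C_inf UNIV (%s. exp (- R * q s))"
  using C_inf_compose[OF C_inf_exp[of UNIV] C_inf_mult[OF C_inf_const[of UNIV "- R"]]] by simp
 from C_inf_mult[OF lin[of 0 "2 * c * (1 - e)"] C_inf_add[OF C_inf_const[of UNIV 1] C_inf_mult[OF C_inf_const[of UNIV "-1"] this]]]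
 have sm: "C_inf UNIV \<phi>'" unfolding \<phi>'_def by simp
 have "continuous_on UNIV \<phi>'"
 proof -
  obtain g where "!!x. x \<in> UNIV ==> (\<phi>' has_derivative (%v. \<Sum>i\<in>Basis. (v \<bullet> i) * g i x)) (at x)" by (rule C_infD[OF sm]) (rule that)
  then show ?thesis by (meson UNIV_I continuous_at_imp_continuous_on has_derivative_continuous)
 qed
 then obtain \<phi> where \<phi>: "\<phi> 0 = 0" "!!s. (\<phi> has_vector_derivative \<phi>' s) (at s)" using antiderivative_UNIV by blast
 have d: "(\<phi> has_real_derivative \<phi>' s) (at s)" for s using \<phi>(2) by (simp add: has_real_derivative_iff_has_vector_derivative)
 have ex1: "exp (- R * q s) <= 1" for s using R q0[of s] by simp
 have pos: "0 <= \<phi>' s" for s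
 proof (cases "e < s \<and> s < 1 - e")
  case True then show ?thesis using c e ex1[of s] by (simp add: \<phi>'_def)
 next
  case False then show ?thesis using q_out by (simp add: \<phi>'_def)
 qed
 have m: "mono \<phi>"
  by (intro monoI, rule DERIV_nonneg_imp_nondecreasing) (use d pos in auto)
 have const: "\<phi> s = \<phi> t" if "s <= t" "!!u. s <= u ==> u <= t ==> \<phi>' u = 0" for s t
  by (rule antisym[OF monoD[OF m that(1)]], rule DERIV_nonpos_imp_nonincreasing[OF that(1)]) (use d that(2) in force)
 have supp: "e < s \<and> s < 1 - e" if "\<phi>' s ~= 0" for s using that q_out[of s] by (auto simp: \<phi>'_def)
 show thesis
 proof (rule that[of \<phi> \<phi>'])
  show "C_inf UNIV \<phi>" by (rule C_inf_real[OF d sm])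
  show "\<phi> s = 0" if "s <= e" for s
  proof (cases "s <= 0")
   case True then show ?thesis using const[of s 0] supp e \<phi>(1) by force
  next
   case False then show ?thesis using const[of 0 s] supp that \<phi>(1) by force
  qed
  show "\<phi> s = \<phi> 1" if "1 - e <= s" for s
  proof (cases "s <= 1")
   case True then show ?thesis using const[of s 1] supp that by force
  next
   case False then show ?thesis using const[of 1 s] supp e by force
  qed
  show "\<phi>' s <= 2 * c * (1 - e) * s" if "0 <= s" for s
  proof -
   have "2 * c * (1 - e) * s * (1 - exp (- R * q s)) <= 2 * c * (1 - e) * s * 1" using c e that by (intro mult_left_mono) auto
   then show ?thesis by (simp add: \<phi>'_def)
  qed
  show "c * (1 - e) * (1 - e) * (1 - 4 * e) <= \<phi> 1"
  proof -
   let ?k = "c * (1 - e) * (1 - e)"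
   have low: "2 * ?k * s <= \<phi>' s" if s: "2 * e <= s" "s <= 1 - 2 * e" for s
   proof -
    have "R * k <= R * q s" using q_in[OF s] R by (intro mult_left_mono) auto
    then have "exp (- R * q s) <= exp (- R * k)" by simp
    also have "exp (- R * k) = e" using k e by (simp add: R_def)
    finally have "2 * c * (1 - e) * s * (1 - e) <= 2 * c * (1 - e) * s * (1 - exp (- R * q s))"
     using c e s by (intro mult_left_mono) auto
    then show ?thesis by (simp add: \<phi>'_def algebra_simps)
   qed
   have "\<phi> (2 * e) - ?k * (2 * e)\<^sup>2 <= \<phi> (1 - 2 * e) - ?k * (1 - 2 * e)\<^sup>2"
   proof (rule DERIV_nonneg_imp_nondecreasing[where f = "%s. \<phi> s - ?k * s\<^sup>2"])
    show "2 * e <= 1 - 2 * e" using e by simp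
    fix s assume s: "2 * e <= s" "s <= 1 - 2 * e"
    have "((%s. \<phi> s - ?k * s\<^sup>2) has_real_derivative \<phi>' s - ?k * (2 * s)) (at s)"
     by (auto intro!: derivative_eq_intros d)
    then show "\<exists>y. ((%s. \<phi> s - ?k * s\<^sup>2) has_real_derivative y) (at s) \<and> 0 <= y" using low[OF s] by (intro exI[of _ "\<phi>' s - ?k * (2 * s)"]) auto
   qed
   moreover have "?k * (1 - 2 * e)\<^sup>2 - ?k * (2 * e)\<^sup>2 = ?k * (1 - 4 * e)" by (simp add: power2_eq_square algebra_simps)
   moreover have "\<phi> 0 <= \<phi> (2 * e)" "\<phi> (1 - 2 * e) <= \<phi> 1" using m e by (auto intro: monoD)
   ultimately show ?thesis using \<phi>(1) by linarith
  qed
 qed (use d m pos supp in auto)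
qed

text \<open>A normalised log-sum-exp over finitely many functionals below j. By compactness of the
  unit sphere of j they approximate j up to e there; log-sum-exp is convex and smooth. Its defect
  from the maximum is at most ln N / b.\<close>

lemma soft_max:
 fixes j :: "'a::euclidean_space \<Rightarrow> real"
 assumes j: "sublinear_gauge j \<kappa> \<beta>0"
  and T: "linear T" "!!z. T (T z) = z" "!!z. j (T z) = j z"
  and rep: "!!x. \<exists>a. (\<forall>y. a \<bullet> y <= j y) \<and> a \<bullet> x = j x"
  and e: "0 < e"
 obtains G gG where "C_inf UNIV G" "!!z. (G has_derivative (%v. v \<bullet> gG z)) (at z)" "continuous_on UNIV gG"
  "!!z. G (T z) = G z" "!!z w. gG z \<bullet> (w - z) <= G w - G z" "G 0 = 0"
  "!!z. gG z \<bullet> z <= G z + e"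
  "!!z s. j z <= 1 ==> 0 <= s ==> G (s *\<^sub>R z) <= s"
  "!!z s. j z = 1 ==> 0 <= s ==> s * (1 - e) - e <= G (s *\<^sub>R z)"
proof -
 interpret sublinear_gauge j \<kappa> \<beta>0 by (rule j)
 define P where "P = {a. \<forall>y. a \<bullet> y <= j y}"
 define S where "S = {z. j z = 1}"
 have "closed S" unfolding S_def by (intro closed_Collect_eq cont continuous_on_const)
 moreover have "bounded S"
 proof (rule boundedI)
  fix z assume "z \<in> S"
  then show "norm z <= 1 / \<kappa>" using lower[of z] \<kappa> by (simp add: S_def pos_le_divide_eq mult.commute)
 qed
 ultimately have cS: "compact S" by (simp add: compact_eq_bounded_closed)
 have op: "open {z. 1 - e < a \<bullet> z}" for a by (intro open_Collect_less continuous_intros)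
 have cov: "S \<subseteq> (\<Union>a\<in>P. {z. 1 - e < a \<bullet> z})"
 proof
  fix z assume z: "z \<in> S"
  obtain a where "\<forall>y. a \<bullet> y <= j y" "a \<bullet> z = j z" using rep by blast
  then show "z \<in> (\<Union>a\<in>P. {z. 1 - e < a \<bullet> z})" using z e by (auto simp: P_def S_def)
 qed
 obtain F where F: "F \<subseteq> P" "finite F" "S \<subseteq> (\<Union>a\<in>F. {z. 1 - e < a \<bullet> z})"
  by (rule compactE_image[OF cS, of P "%a. {z. 1 - e < a \<bullet> z}"]) (use op cov in auto)
 have adj: "adjoint T a \<bullet> z = a \<bullet> T z" for a z using adjoint_works[OF T(1)] by (simp add: inner_commute)
 have adj2: "adjoint T (adjoint T a) = a" for a
 proof -
  have "adjoint T (adjoint T a) \<bullet> z = a \<bullet> z" for z by (simp add: adj T(2))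
  then show ?thesis by (metis vector_eq_rdot)
 qed
 \<comment> \<open>Adding the images under the adjoint makes the family, and hence G, invariant
   under T; the images still lie below j because j is invariant.\<close>
 define I where "I = insert 0 F \<union> adjoint T ` insert 0 F"
 have fI: "finite I" "0 \<in> I" using F(2) by (auto simp: I_def)
 have aI: "adjoint T ` I = I" by (auto simp: I_def image_Un image_image adj2)
 have inj: "inj_on (adjoint T) I" by (metis adj2 inj_onI)
 have IP: "a \<bullet> y <= j y" if "a \<in> I" for a y
 proof -
  have "a \<bullet> y <= j y" if "a \<in> insert 0 F" for a y using that F(1) nonneg[of y] by (auto simp: P_def)
  then show ?thesis using \<open>a \<in> I\<close> adj T(3) unfolding I_def by (metis (no_types, lifting) Un_iff imageE)
 qed
 define N where "N = real (card I)"
 have "0 < card I" using fI by (auto simp: card_gt_0_iff)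
 then have N: "1 <= N" by (simp add: N_def)
 \<comment> \<open>This sharpness makes ln N <= b * e, so the loss due to the number of functionals
   is at most e.\<close>
 define b where "b = ln N / e + 1"
 have b: "0 < b" "ln N <= b * e" using N e by (auto simp: b_def add_nonneg_pos distrib_right)
 define W where "W z = (\<Sum>a\<in>I. exp (b * (a \<bullet> z)))" for z
 have W0: "0 < W z" for z unfolding W_def using fI by (intro sum_pos) auto
 define G where "G z = ln (W z / N) / b" for z
 have expG: "W z = N * exp (b * G z)" for z using W0[of z] N b by (simp add: G_def)
 define gG where "gG z = (1 / W z) *\<^sub>R (\<Sum>a\<in>I. exp (b * (a \<bullet> z)) *\<^sub>R a)" for z
 have gGv: "gG z \<bullet> v = (\<Sum>a\<in>I. exp (b * (a \<bullet> z)) * (a \<bullet> v)) / W z" for z v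
  by (simp add: gG_def inner_sum_left)
 have up: "G z <= M" if "!!a. a \<in> I ==> a \<bullet> z <= M" for z M
 proof -
  have "W z <= (\<Sum>a\<in>I. exp (b * M))" unfolding W_def using that b by (intro sum_mono) auto
  then have "exp (b * G z) <= exp (b * M)" using N expG[of z] by (simp add: N_def)
  then show ?thesis using b by simp
 qed
 have low: "a \<bullet> z <= G z + e" if a: "a \<in> I" for a z
 proof -
  have "exp (b * (a \<bullet> z)) <= W z" unfolding W_def using fI a by (intro member_le_sum) auto
  also have "\<dots> = exp (ln N + b * G z)" using expG[of z] N by (simp add: exp_add)
  finally have "b * (a \<bullet> z) <= b * (G z + e)" using b by (simp add: distrib_left)
  then show ?thesis using b by simp
 qed
 show thesis
 proof (rule that[of G gG])
  have "C_inf UNIV (%z. exp (b * (a \<bullet> z)))" for a :: 'a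
   using C_inf_compose[OF C_inf_exp[of UNIV] C_inf_inner[of UNIV "b *\<^sub>R a"]] by simp
  then have "C_inf UNIV (%z. (1 / N) * W z)"
   unfolding W_def by (intro C_inf_mult C_inf_const C_inf_sum fI)
  from C_inf_compose[OF C_inf_ln this] have "C_inf UNIV (%z. ln ((1 / N) * W z))" using W0 N by force
  from C_inf_mult[OF C_inf_const[of _ "1 / b"] this] show "C_inf UNIV G" unfolding G_def by simp
  show "(G has_derivative (%v. v \<bullet> gG z)) (at z)" for z
  proof -
   have "(W has_derivative (%v. \<Sum>a\<in>I. (b * (a \<bullet> v)) * exp (b * (a \<bullet> z)))) (at z)"
    unfolding W_def by (auto intro!: derivative_eq_intros)
   then have "((%z. W z / N) has_derivative (%v. (\<Sum>a\<in>I. (b * (a \<bullet> v)) * exp (b * (a \<bullet> z))) / N)) (at z)"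
    by (rule bounded_linear.has_derivative[OF bounded_linear_divide])
   moreover have "(ln has_derivative (%h. h * (1 / (W z / N)))) (at (W z / N))"
    unfolding mult_commute_abs by (rule DERIV_ln_divide[unfolded has_field_derivative_def]) (use W0[of z] N in simp)
   ultimately have "((%z. ln (W z / N)) has_derivative (%v. (\<Sum>a\<in>I. (b * (a \<bullet> v)) * exp (b * (a \<bullet> z))) / N * (1 / (W z / N)))) (at z)"
    by (rule has_derivative_compose)
   then have "(G has_derivative (%v. (\<Sum>a\<in>I. (b * (a \<bullet> v)) * exp (b * (a \<bullet> z))) / N * (1 / (W z / N)) / b)) (at z)"
    unfolding G_def by (rule bounded_linear.has_derivative[OF bounded_linear_divide])
   moreover have "(\<Sum>a\<in>I. (b * (a \<bullet> v)) * exp (b * (a \<bullet> z))) / N * (1 / (W z / N)) / b = v \<bullet> gG z" for v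
   proof -
    have "(\<Sum>a\<in>I. (b * (a \<bullet> v)) * exp (b * (a \<bullet> z))) = b * (\<Sum>a\<in>I. exp (b * (a \<bullet> z)) * (a \<bullet> v))"
     by (simp add: sum_distrib_left ac_simps)
    then show ?thesis using N b by (simp add: gGv inner_commute[of v])
   qed
   ultimately show ?thesis by simp
  qed
  have "W z ~= 0" for z using W0[of z] by simp
  moreover have "continuous_on UNIV W" unfolding W_def by (intro continuous_intros)
  ultimately show "continuous_on UNIV gG"
   unfolding gG_def by (intro continuous_intros) auto
  show "G (T z) = G z" for z
  proof -
   have "W (T z) = (\<Sum>a\<in>I. exp (b * (adjoint T a \<bullet> z)))" by (simp add: W_def adj)
   also have "\<dots> = (\<Sum>a\<in>adjoint T ` I. exp (b * (a \<bullet> z)))" by (subst sum.reindex[OF inj]) simp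
   finally have "W (T z) = W z" by (simp add: aI W_def)
   then show ?thesis by (simp add: G_def)
  qed
  show "gG z \<bullet> (w - z) <= G w - G z" for z w
  proof -
   have "exp (b * (a \<bullet> z)) * (b * (a \<bullet> (w - z)) - b * (G w - G z) + 1) <= exp (b * (a \<bullet> w)) * exp (- (b * (G w - G z)))" for a
   proof -
    have "b * (a \<bullet> (w - z)) - b * (G w - G z) + 1 <= exp (b * (a \<bullet> (w - z)) - b * (G w - G z))"
     using exp_ge_add_one_self[of "b * (a \<bullet> (w - z)) - b * (G w - G z)"] by linarith
    then have "exp (b * (a \<bullet> z)) * (b * (a \<bullet> (w - z)) - b * (G w - G z) + 1)
     <= exp (b * (a \<bullet> z)) * exp (b * (a \<bullet> (w - z)) - b * (G w - G z))" by (rule mult_left_mono) simp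
    also have "\<dots> = exp (b * (a \<bullet> w)) * exp (- (b * (G w - G z)))"
     by (simp add: exp_add[symmetric] inner_diff_right algebra_simps)
    finally show ?thesis .
   qed
   then have "(\<Sum>a\<in>I. exp (b * (a \<bullet> z)) * (b * (a \<bullet> (w - z)) - b * (G w - G z) + 1)) <= W w * exp (- (b * (G w - G z)))"
    unfolding W_def sum_distrib_right by (rule sum_mono)
   moreover have "(\<Sum>a\<in>I. exp (b * (a \<bullet> z)) * (b * (a \<bullet> (w - z)) - b * (G w - G z) + 1))
    = b * (\<Sum>a\<in>I. exp (b * (a \<bullet> z)) * (a \<bullet> (w - z))) + W z * (1 - b * (G w - G z))"
    unfolding W_def sum_distrib_left sum_distrib_right sum.distrib[symmetric] by (rule sum.cong) (simp_all add: algebra_simps)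
   moreover have "W w * exp (- (b * (G w - G z))) = W z"
    by (simp add: expG exp_add[symmetric] right_diff_distrib)
   ultimately have "b * (\<Sum>a\<in>I. exp (b * (a \<bullet> z)) * (a \<bullet> (w - z))) <= b * (W z * (G w - G z))"
    by (simp add: algebra_simps)
   then have "(\<Sum>a\<in>I. exp (b * (a \<bullet> z)) * (a \<bullet> (w - z))) <= W z * (G w - G z)" using b by simp
   then show ?thesis using W0[of z] by (simp add: gGv pos_divide_le_eq mult.commute)
  qed
  show "G 0 = 0" using N by (simp add: G_def W_def N_def)
  show "gG z \<bullet> z <= G z + e" for z
  proof -
   have "(\<Sum>a\<in>I. exp (b * (a \<bullet> z)) * (a \<bullet> z)) <= (\<Sum>a\<in>I. exp (b * (a \<bullet> z)) * (G z + e))"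
    by (intro sum_mono mult_left_mono low) auto
   also have "\<dots> = W z * (G z + e)" by (simp add: W_def sum_distrib_right)
   finally show ?thesis using W0[of z] by (simp add: gGv pos_divide_le_eq mult.commute)
  qed
  show "G (s *\<^sub>R z) <= s" if "j z <= 1" "0 <= s" for z s
  proof (rule up)
   fix a assume "a \<in> I"
   then have "a \<bullet> z <= 1" using IP[of a z] that(1) by linarith
   then show "a \<bullet> s *\<^sub>R z <= s" using that(2) by (simp add: mult_left_le)
  qed
  show "s * (1 - e) - e <= G (s *\<^sub>R z)" if z: "j z = 1" "0 <= s" for z s
  proof -
   have "z \<in> S" using z by (simp add: S_def)
   then obtain a where a: "a \<in> F" "1 - e < a \<bullet> z" using F(3) by auto
   have "a \<in> I" using a by (simp add: I_def)
   from low[OF this, of "s *\<^sub>R z"] have "s * (a \<bullet> z) <= G (s *\<^sub>R z) + e" by simp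
   moreover have "s * (1 - e) <= s * (a \<bullet> z)" using a z by (intro mult_left_mono) auto
   ultimately show ?thesis by linarith
  qed
 qed
qed

section \<open>The lower bound for the capacity\<close>

lemma C_inf_subset: "C_inf U f ==> V \<subseteq> U ==> C_inf V f"
proof (coinduction arbitrary: f)
 case C_inf
 then obtain g where "!!x. x \<in> U ==> (f has_derivative (%v. \<Sum>i\<in>Basis. (v \<bullet> i) * g i x)) (at x)" "!!i. i \<in> Basis ==> C_inf U (g i)"
  using C_infD by blast
 then show ?case using C_inf(2) by (intro exI[of _ g] exI[of _ f]) auto
qed

lemma omega0_nondegenerate: "(!!v. omega0 v a = omega0 v b) ==> a = b"
proof (rule prod_eqI)
 assume h: "!!v. omega0 v a = omega0 v b"
 have "w \<bullet> fst a = w \<bullet> fst b" for w using h[of "(0, w)"] by (simp add: omega0_def)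
 then show "fst a = fst b" by (metis vector_eq_ldot)
 have "w \<bullet> snd a = w \<bullet> snd b" for w using h[of "(w, 0)"] by (simp add: omega0_def)
 then show "snd a = snd b" by (metis vector_eq_ldot)
qed

text \<open>The last conclusion of \<open>staircase_minimizer\<close> as a predicate. The bracket on
  the left is the integral of \<open>omega0\<close> of curve and velocity, written after an
  integration by parts; \<open>isoperimetric_phase\<close> undoes this.\<close>

definition isoperimetric :: "('n::finite phase \<Rightarrow> 'n phase) \<Rightarrow> (real^'n) set \<Rightarrow> (real^'n) set \<Rightarrow> real \<Rightarrow> bool" where
 "isoperimetric \<tau> \<Delta> \<Lambda> c \<longleftrightarrow> (\<forall>h S x p x' p' ka kb.
   0 <= h --> finite S --> continuous_on {0..h} x --> continuous_on {0..h} p -->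
   (\<forall>t \<in> {0<..<h} - S. (x has_vector_derivative x' t) (at t)) -->
   (\<forall>t \<in> {0<..<h} - S. (p has_vector_derivative p' t) (at t)) -->
   (\<forall>t \<in> {0<..<h} - S. supp \<Lambda> (- x' t) <= ka t) -->
   (\<forall>t \<in> {0<..<h} - S. supp \<Delta> (p' t) <= kb t) -->
   ka integrable_on {0..h} --> kb integrable_on {0..h} --> (%t. p t \<bullet> x' t) integrable_on {0..h} -->
   (x 0, p 0) \<in> Fix \<tau> --> (x h, p h) \<in> Fix \<tau> -->
   c * (x h \<bullet> p h - x 0 \<bullet> p 0 - 2 * integral {0..h} (%t. p t \<bullet> x' t)) <= (integral {0..h} ka + integral {0..h} kb)\<^sup>2)"

lemma isoperimetric_phase:
 assumes iso: "isoperimetric \<tau> \<Delta> \<Lambda> c" and h: "0 <= h" "finite S" "continuous_on {0..h} y"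
  and y': "!!t. t \<in> {0<..<h} - S ==> (y has_vector_derivative y' t) (at t)"
  and k: "!!t. t \<in> {0<..<h} - S ==> supp \<Lambda> (- fst (y' t)) <= ka t" "!!t. t \<in> {0<..<h} - S ==> supp \<Delta> (snd (y' t)) <= kb t"
  "ka integrable_on {0..h}" "kb integrable_on {0..h}"
  and bd: "y 0 \<in> Fix \<tau>" "y h \<in> Fix \<tau>"
  and A: "((%t. omega0 (y t) (y' t)) has_integral A) {0..h}"
 shows "c * A <= (integral {0..h} ka + integral {0..h} kb)\<^sup>2"
proof -
 have d1: "((%t. fst (y t)) has_vector_derivative fst (y' t)) (at t)" if "t \<in> {0<..<h} - S" for t
  using bounded_linear.has_vector_derivative[OF bounded_linear_fst y'[OF that]] .
 have d2: "((%t. snd (y t)) has_vector_derivative snd (y' t)) (at t)" if "t \<in> {0<..<h} - S" for t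
  using bounded_linear.has_vector_derivative[OF bounded_linear_snd y'[OF that]] .
 have c1: "continuous_on {0..h} (%t. fst (y t))" "continuous_on {0..h} (%t. snd (y t))"
  using h(3) by (auto intro: continuous_intros)
 have "((%t. fst (y t) \<bullet> snd (y' t) + fst (y' t) \<bullet> snd (y t)) has_integral (fst (y h) \<bullet> snd (y h) - fst (y 0) \<bullet> snd (y 0))) {0..h}"
 proof (rule fundamental_theorem_of_calculus_interior_strong[OF h(2,1)])
  fix t assume t: "t \<in> {0<..<h} - S"
  show "((%t. fst (y t) \<bullet> snd (y t)) has_vector_derivative fst (y t) \<bullet> snd (y' t) + fst (y' t) \<bullet> snd (y t)) (at t)"
   using bounded_bilinear.has_vector_derivative[OF bounded_bilinear_inner d1[OF t] d2[OF t]] .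
 qed (intro continuous_intros c1)
 from has_integral_mult_right[OF has_integral_diff[OF this A], of "1/2"]
 have pq: "((%t. snd (y t) \<bullet> fst (y' t)) has_integral (1/2) * (fst (y h) \<bullet> snd (y h) - fst (y 0) \<bullet> snd (y 0) - A)) {0..h}"
  by (rule has_integral_eq[rotated]) (simp add: omega0_def inner_commute)
 have "c * (fst (y h) \<bullet> snd (y h) - fst (y 0) \<bullet> snd (y 0) - 2 * integral {0..h} (%t. snd (y t) \<bullet> fst (y' t)))
  <= (integral {0..h} ka + integral {0..h} kb)\<^sup>2"
  using iso[unfolded isoperimetric_def, rule_format, where h = h and S = S and x = "%t. fst (y t)" and p = "%t. snd (y t)"
    and x' = "%t. fst (y' t)" and p' = "%t. snd (y' t)" and ka = ka and kb = kb] h c1 d1 d2 k bd has_integral_integrable[OF pq]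
  by simp
 moreover have "a - b - 2 * ((1/2) * (a - b - A)) = A" for a b :: real by (simp add: field_simps)
 ultimately show ?thesis unfolding integral_unique[OF pq] by simp
qed

lemma gauge_polar:
 fixes K :: "'a::euclidean_space set"
 assumes K: "compact K" "convex K" "0 \<in> interior K" and a: "!!y. y \<in> K ==> a \<bullet> y <= 1"
 shows "a \<bullet> x <= gauge_of K x"
proof -
 obtain \<kappa> \<beta> where j: "sublinear_gauge (gauge_of K) \<kappa> \<beta>" using gauge_of_body(1)[OF K] by blast
 have "supp K a <= 1" by (rule supp_least) (use K(3) interior_subset a in \<open>auto simp: inner_commute\<close>)
 have "x \<bullet> a <= gauge_of K x * supp K a" by (rule gauge_of_body(3)[OF K])
 also have "\<dots> <= gauge_of K x * 1" by (rule mult_left_mono[OF \<open>supp K a <= 1\<close> sublinear_gauge.nonneg[OF j]])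
 finally show ?thesis by (simp add: inner_commute)
qed

lemma gauge_invariant:
 fixes K :: "'a::euclidean_space set"
 assumes K: "compact K" "convex K" "0 \<in> interior K" and T: "linear T" "!!z. T (T z) = z" "T ` K \<subseteq> K"
 shows "gauge_of K (T z) = gauge_of K z"
proof -
 have le: "gauge_of K (T z) <= gauge_of K z" for z
 proof -
  obtain a where a: "\<forall>y\<in>K. a \<bullet> y <= 1" "a \<bullet> T z = gauge_of K (T z)" using gauge_of_body(4)[OF K] by blast
  have adj: "adjoint T a \<bullet> y = a \<bullet> T y" for y using adjoint_works[OF T(1)] by (simp add: inner_commute)
  have "adjoint T a \<bullet> z <= gauge_of K z" by (rule gauge_polar[OF K]) (use a(1) T(3) adj in auto)
  then show ?thesis using adj a(2) by simp
 qed
 from le[of z] le[of "T z"] show ?thesis by (simp add: T(2))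
qed

text \<open>An orbit lies on a level G = s with constant speed factor p. Its half from fixed point
  to fixed point has area A at most h * p * (s + d) with h <= 1/2, and length at most A / s, so the
  isoperimetric inequality gives c * s^2 <= A. With p <= 2 * c * (1 - e) * s this becomes s <= (1 -
  e) * (s + d), which is false for s > e.\<close>

lemma lower_bound_admissible:
 fixes \<tau> :: "'n::finite phase \<Rightarrow> 'n phase"
 assumes inv: "lin_antisymp_inv \<tau>"
  and D: "compact \<Delta>" "convex \<Delta>" "0 \<in> interior \<Delta>" and Lam: "compact \<Lambda>" "convex \<Lambda>" "0 \<in> interior \<Lambda>"
  and sym: "\<tau> ` (\<Delta> \<times> \<Lambda>) = \<Delta> \<times> \<Lambda>"
  and iso: "isoperimetric \<tau> \<Delta> \<Lambda> c" and c: "0 < c" and e: "0 < e" "e < 1/4"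
 shows "\<exists>H. admissible_sym \<tau> (interior (\<Delta> \<times> \<Lambda>)) H \<and> c * (1 - e) * (1 - e) * (1 - 4 * e) <= Sup (H ` interior (\<Delta> \<times> \<Lambda>))"
proof -
 interpret antisymp_involution \<tau> by unfold_locales (rule inv)
 define C where "C = \<Delta> \<times> \<Lambda>"
 have C: "compact C" "convex C" "0 \<in> interior C" and C0: "0 \<in> C"
  using D Lam interior_subset by (auto simp: C_def compact_Times convex_Times interior_Times zero_prod_def)
 have TC: "\<tau> ` C \<subseteq> C" using sym by (simp add: C_def)
 define j where "j = gauge_of C"
 obtain \<kappa> \<beta> where "sublinear_gauge j \<kappa> \<beta>" using gauge_of_body(1)[OF C] unfolding j_def by blast
 then interpret sublinear_gauge j \<kappa> \<beta> .
 define U where "U = interior C"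
 have U: "z \<in> U \<longleftrightarrow> j z < 1" for z unfolding U_def j_def by (rule gauge_of_body(2)[OF C])
 have jC: "j z <= 1" if "z \<in> C" for z using gauge_of_body(4)[OF C, of z] that unfolding j_def by auto
 have Uop: "open U" and UC: "U \<subseteq> C" unfolding U_def using interior_subset by auto
 have jt: "j (\<tau> z) = j z" for z unfolding j_def by (rule gauge_invariant[OF C lin invol TC])
 have rep: "\<exists>a. (\<forall>y. a \<bullet> y <= j y) \<and> a \<bullet> x = j x" for x
  using gauge_of_body(4)[OF C, of x] gauge_polar[OF C] unfolding j_def by blast
 \<comment> \<open>The smoothing error must be smaller than e * s for all s > e, the gap left by the
   factor 1 - e, and also allow 3 * d <= e at the plateau.\<close>
 define d where "d = e\<^sup>2 / 4"
 have d: "0 < d" "d < e * e" "3 * d <= e" using e by (auto simp: d_def power2_eq_square)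
 obtain G gG where G: "C_inf UNIV G" "!!z. (G has_derivative (%v. v \<bullet> gG z)) (at z)" "continuous_on UNIV gG"
  "!!z. G (\<tau> z) = G z" "!!z w. gG z \<bullet> (w - z) <= G w - G z" "G 0 = 0"
  "!!z. gG z \<bullet> z <= G z + d"
  "!!z s. j z <= 1 ==> 0 <= s ==> G (s *\<^sub>R z) <= s"
  "!!z s. j z = 1 ==> 0 <= s ==> s * (1 - d) - d <= G (s *\<^sub>R z)"
  by (rule soft_max[OF sublinear_gauge_axioms lin invol jt rep d(1)]) (rule that)
 obtain \<phi> \<phi>' where \<phi>: "C_inf UNIV \<phi>" "!!s. (\<phi> has_real_derivative \<phi>' s) (at s)"
  "!!s. s <= e ==> \<phi> s = 0" "!!s. 1 - e <= s ==> \<phi> s = \<phi> 1" "mono \<phi>"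
  "!!s. 0 <= \<phi>' s" "!!s. \<phi>' s ~= 0 ==> e < s \<and> s < 1 - e" "!!s. 0 <= s ==> \<phi>' s <= 2 * c * (1 - e) * s"
  "c * (1 - e) * (1 - e) * (1 - 4 * e) <= \<phi> 1"
  by (rule plateau_profile[OF c e]) (rule that)
 define H where "H z = \<phi> (G z)" for z
 have contG: "continuous_on UNIV G"
  using G(2) by (meson UNIV_I continuous_at_imp_continuous_on has_derivative_continuous)
 have dH: "frechet_derivative H (at z) = (%v. \<phi>' (G z) * (v \<bullet> gG z))" for z
 proof -
  have "(H has_derivative (%v. \<phi>' (G z) * (v \<bullet> gG z))) (at z)"
   unfolding H_def by (rule has_derivative_compose[OF G(2) \<phi>(2)[unfolded has_field_derivative_def]])
  from frechet_derivative_at[OF this] show ?thesis by simp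
 qed
 have max: "\<phi> s <= \<phi> 1" for s using monoD[OF \<phi>(5), of s "max s 1"] \<phi>(4)[of "max s 1"] e by simp
 have min: "0 <= \<phi> s" for s using monoD[OF \<phi>(5), of "min s e" s] \<phi>(3)[of "min s e"] by simp
 \<comment> \<open>The maximum is attained inside the body: the point (1 - d) * y with j y = 1 is
   interior, and 3 * d <= e brings it to the plateau.\<close>
 obtain u where u: "u \<in> U" "G u \<ge> 1 - e"
 proof -
  define v where "v = (SOME i. i \<in> (Basis :: 'n phase set))"
  have "v ~= 0" unfolding v_def by (rule nonzero_Basis[OF SOME_Basis])
  then have "0 < \<kappa> * norm v" using \<kappa> by simp
  then have jv: "0 < j v" using lower[of v] by linarith
  define y where "y = (1 / j v) *\<^sub>R v"
  have jy: "j y = 1" using jv by (simp add: y_def scale)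
  have d1: "d < 1" using d e by linarith
  have "(1 - d) *\<^sub>R y \<in> U" unfolding U using d d1 jy by (subst scale) auto
  moreover have "1 - e <= G ((1 - d) *\<^sub>R y)"
  proof -
   have "(1 - d) * (1 - d) - d = 1 - 3 * d + d * d" by (simp add: algebra_simps)
   moreover have "0 <= d * d" by simp
   ultimately show ?thesis using G(9)[OF jy, of "1 - d"] d d1 by linarith
  qed
  ultimately show thesis using that by blast
 qed
 have no_orbit: False if T: "0 < T" "T <= 1" and orb: "ham_brake_orbit \<tau> U H x T" for x T
 proof -
  define X where "X t = J0 (\<phi>' (G (x t)) *\<^sub>R gG (x t))" for t
  have X: "(x has_vector_derivative X t) (at t)" for t
  proof -
   obtain x' where x': "(x has_vector_derivative x') (at t)" "\<forall>v. omega0 x' v = - frechet_derivative H (at (x t)) v"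
    using orb unfolding ham_brake_orbit_def by blast
   have "omega0 v x' = omega0 v (X t)" for v
   proof -
    have "omega0 v x' = - omega0 x' v" by (simp add: omega0_def inner_commute)
    also have "\<dots> = \<phi>' (G (x t)) * (v \<bullet> gG (x t))" using x'(2)[rule_format, of v] by (simp add: dH)
    also have "\<dots> = omega0 v (X t)" unfolding X_def omega0_J0 by simp
    finally show ?thesis .
   qed
   then show ?thesis using omega0_nondegenerate x'(1) by metis
  qed
  have oX: "omega0 v (X t) = \<phi>' (G (x t)) * (v \<bullet> gG (x t))" for v t unfolding X_def omega0_J0 by simp
  have "((%t. G (x t)) has_real_derivative 0) (at t)" for t
  proof -
   have "((%t. G (x t)) has_derivative (%h. (h *\<^sub>R X t) \<bullet> gG (x t))) (at t)"
    by (rule has_derivative_compose[OF X[unfolded has_vector_derivative_def] G(2)])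
   moreover have "X t \<bullet> gG (x t) = 0" by (simp add: X_def J0_def inner_prod_def inner_commute)
   then have "(%h. (h *\<^sub>R X t) \<bullet> gG (x t)) = (*) 0" by (simp add: fun_eq_iff)
   ultimately show ?thesis by (simp only: has_field_derivative_def)
  qed
  then have "G (x t) = G (x 0)" for t by (rule DERIV_isconst_all[rule_format])
  then obtain s where s: "!!t. G (x t) = s" by blast
  define p where "p = \<phi>' s"
  have "p ~= 0"
  proof
   assume p0: "p = 0"
   have "\<exists>k. \<forall>t\<in>UNIV. x t = k"
   proof (rule has_derivative_zero_constant)
    show "(x has_derivative (%h. 0)) (at t within UNIV)" for t
     using X[of t] p0 by (simp add: X_def s p_def J0_zero has_vector_derivative_def)
   qed simp
   then show False using orb unfolding ham_brake_orbit_def by (metis UNIV_I)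
  qed
  then have p: "0 < p" "e < s" "s < 1 - e" "p <= 2 * c * (1 - e) * s" using \<phi>(6)[of s] \<phi>(7)[of s] \<phi>(8)[of s] e by (auto simp: p_def)
  have s0: "0 < s" using p e by linarith
  have oX: "omega0 v (X t) = p * (v \<bullet> gG (x t))" for v t unfolding oX s p_def ..
  have up: "omega0 (x t) (X t) <= p * (s + d)" for t
   unfolding oX using G(7)[of "x t"] p(1) by (simp add: s inner_commute)
  have low: "p * s <= omega0 (x t) (X t)" for t
   unfolding oX using G(5)[of "x t" 0] p(1) by (simp add: s G(6) inner_commute inner_diff_right)
  \<comment> \<open>The sublevel set of the convex function G at s contains s times the body, so the
    gradient at x t is an outer normal to this smaller copy. Hence the support length of the
    velocity is at most its area density divided by s.\<close>
  have cone: "s * omega0 z (X t) <= omega0 (x t) (X t)" if z: "z \<in> C" for z t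
  proof -
   have "gG (x t) \<bullet> (s *\<^sub>R z - x t) <= 0" using G(5)[of "x t" "s *\<^sub>R z"] G(8)[OF jC[OF z], of s] s0 by (simp add: s)
   then have "s * (z \<bullet> gG (x t)) <= x t \<bullet> gG (x t)" by (simp add: inner_diff_right inner_commute)
   then have "p * (s * (z \<bullet> gG (x t))) <= p * (x t \<bullet> gG (x t))" using p(1) by simp
   then show ?thesis unfolding oX by (simp add: ac_simps)
  qed
  define ka kb where "ka t = supp \<Lambda> (- fst (X t))" and "kb t = supp \<Delta> (snd (X t))" for t
  have k: "s * (ka t + kb t) <= omega0 (x t) (X t)" "0 <= ka t + kb t" for t
  proof -
   have ne: "\<Lambda> ~= {}" "\<Delta> ~= {}" using D(3) Lam(3) interior_subset by auto
   obtain r where r: "r \<in> \<Lambda>" "r \<bullet> - fst (X t) = ka t" using supp_attained[OF Lam(1) ne(1)] unfolding ka_def by blast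
   obtain q where q: "q \<in> \<Delta>" "q \<bullet> snd (X t) = kb t" using supp_attained[OF D(1) ne(2)] unfolding kb_def by blast
   have "omega0 (q, r) (X t) = ka t + kb t" using r(2) q(2) by (simp add: omega0_def)
   then show "s * (ka t + kb t) <= omega0 (x t) (X t)" using cone[of "(q, r)" t] q r by (simp add: C_def)
   have "0 \<in> \<Lambda>" "0 \<in> \<Delta>" using D(3) Lam(3) interior_subset by auto
   then show "0 <= ka t + kb t" using supp_upper[OF Lam(1), of 0 "- fst (X t)"] supp_upper[OF D(1), of 0 "snd (X t)"]
    by (simp add: ka_def kb_def)
  qed
  have contx: "continuous_on S x" for S
   by (rule continuous_on_vector_derivative) (use X has_vector_derivative_at_within in blast)
  have contX: "continuous_on S X" for S
  proof -
   have "continuous_on S (%t. gG (x t))" by (rule continuous_on_compose2[OF G(3) contx]) simp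
   then have "continuous_on S (%t. J0 (p *\<^sub>R gG (x t)))"
    by (intro bounded_linear.continuous_on[OF bounded_linear_J0] continuous_intros)
   then show ?thesis by (simp add: X_def[abs_def] s p_def)
  qed
  define h where "h = T / 2"
  have h: "0 < h" "h <= 1/2" using T by (auto simp: h_def)
  obtain rD RD where rD: "0 < rD" "cball 0 rD \<subseteq> \<Delta>" "\<Delta> \<subseteq> cball 0 RD" by (rule body_radii[OF D(1,3)])
  obtain rL RL where rL: "0 < rL" "cball 0 rL \<subseteq> \<Lambda>" "\<Lambda> \<subseteq> cball 0 RL" by (rule body_radii[OF Lam(1,3)])
  have ca: "continuous_on {0..h} ka" unfolding ka_def
   by (rule continuous_on_compose2[OF sublinear_gauge.cont[OF supp_gauge[OF Lam(1) rL], of UNIV]]) (auto intro!: continuous_intros contX)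
  have cb: "continuous_on {0..h} kb" unfolding kb_def
   by (rule continuous_on_compose2[OF sublinear_gauge.cont[OF supp_gauge[OF D(1) rD], of UNIV]]) (auto intro!: continuous_intros contX)
  note ik = integrable_continuous_real[OF ca] integrable_continuous_real[OF cb]
  have cw: "continuous_on {0..h} (%t. omega0 (x t) (X t))" unfolding omega0_def by (intro continuous_intros contx contX)
  define A where "A = integral {0..h} (%t. omega0 (x t) (X t))"
  have A: "((%t. omega0 (x t) (X t)) has_integral A) {0..h}"
   unfolding A_def by (rule integrable_integral[OF integrable_continuous_real[OF cw]])
  have fx: "x 0 \<in> Fix \<tau>" "x h \<in> Fix \<tau>"
  proof -
   have b: "x (T - t) = x (- t)" "x (- t) = \<tau> (x t)" for t using orb unfolding ham_brake_orbit_def by auto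
   show "x 0 \<in> Fix \<tau>" using b(2)[of 0] by (simp add: Fix_def)
   show "x h \<in> Fix \<tau>" using b(1)[of h] b(2)[of h] by (simp add: Fix_def h_def)
  qed
  have cA: "c * A <= (integral {0..h} ka + integral {0..h} kb)\<^sup>2"
   by (rule isoperimetric_phase[OF iso _ finite.emptyI contx X _ _ ik fx A]) (use h in \<open>auto simp: ka_def kb_def\<close>)
  define E where "E = integral {0..h} ka + integral {0..h} kb"
  have Ei: "((%t. ka t + kb t) has_integral E) {0..h}"
   unfolding E_def by (intro has_integral_add integrable_integral ik)
  have E0: "0 <= E" by (rule has_integral_nonneg[OF Ei]) (use k in auto)
  have EA: "s * E <= A" by (rule has_integral_le[OF has_integral_mult_right[OF Ei] A]) (use k in auto)
  have cst: "((%t. w) has_integral h * w) {0..h}" for w :: real using has_integral_const_real[of w 0 h] h by simp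
  have A_up: "A <= h * (p * (s + d))" by (rule has_integral_le[OF A cst]) (use up in auto)
  have "h * (p * s) <= A" by (rule has_integral_le[OF cst A]) (use low in auto)
  moreover have "0 < h * (p * s)" using h p(1) s0 by simp
  ultimately have A0: "0 < A" by linarith
  have "(s * E)\<^sup>2 <= A\<^sup>2" by (rule power_mono[OF EA]) (use s0 E0 in simp)
  then have "s\<^sup>2 * (c * A) <= A\<^sup>2" using mult_left_mono[OF cA[folded E_def], of "s\<^sup>2"] by (simp add: power_mult_distrib)
  then have "A * (c * s\<^sup>2) <= A * A" by (simp add: power2_eq_square ac_simps)
  then have "c * s\<^sup>2 <= A" using A0 by simp
  also have "A <= (1/2) * (p * (s + d))"
  proof -
   have "0 <= p * (s + d)" using p(1) s0 d(1) by simp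
   from mult_right_mono[OF h(2) this] A_up show ?thesis by linarith
  qed
  also have "\<dots> <= (1/2) * ((2 * c * (1 - e) * s) * (s + d))" using p s0 d by (intro mult_left_mono mult_right_mono) auto
  finally have "(c * s) * s <= (c * s) * ((1 - e) * (s + d))" by (simp add: power2_eq_square algebra_simps)
  then have "s <= (1 - e) * (s + d)" using c s0 by simp
  then have "e * s + e * d <= d" by (simp add: algebra_simps)
  moreover have "e * e < e * s" using p(2) e by simp
  moreover have "0 < e * d" using e d by simp
  ultimately show False using d(2) by linarith
 qed
 have adm: "admissible_sym \<tau> U H"
  unfolding admissible_sym_def
 proof (intro conjI ballI allI impI)
  show "H (\<tau> z) = H z" for z by (simp add: H_def G(4))
  show "C_inf U H" unfolding H_def
   by (rule C_inf_compose[OF \<phi>(1) C_inf_subset[OF G(1)]]) auto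
  show "0 <= H z" for z by (simp add: H_def min)
  show "\<exists>V. open V \<and> V ~= {} \<and> V \<subseteq> U \<and> V \<inter> Fix \<tau> ~= {} \<and> (\<forall>z\<in>V. H z = 0)"
  proof (intro exI[of _ "U \<inter> {z. G z < e}"] conjI)
   show "open (U \<inter> {z. G z < e})" by (intro open_Int Uop open_Collect_less contG continuous_on_const)
   have "0 \<in> U \<inter> {z. G z < e}" using C(3) G(6) e by (simp add: U_def)
   moreover have "0 \<in> Fix \<tau>" by (simp add: Fix_def linear_0[OF lin])
   ultimately show "U \<inter> {z. G z < e} ~= {}" "U \<inter> {z. G z < e} \<inter> Fix \<tau> ~= {}" by auto
  qed (auto simp: H_def \<phi>(3))
  show "\<exists>m. (\<forall>z\<in>U. H z <= m) \<and> (\<exists>z\<in>U. H z = m) \<and> (\<exists>K. compact K \<and> K \<subseteq> U \<and> (\<forall>z\<in>U - K. H z = m))"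
  proof (intro exI[of _ "\<phi> 1"] conjI)
   show "\<forall>z\<in>U. H z <= \<phi> 1" by (simp add: H_def max)
   show "\<exists>z\<in>U. H z = \<phi> 1" using u \<phi>(4) by (auto simp: H_def)
   show "\<exists>K. compact K \<and> K \<subseteq> U \<and> (\<forall>z\<in>U - K. H z = \<phi> 1)"
   proof (intro exI[of _ "C \<inter> {z. G z <= 1 - e}"] conjI ballI)
    show "compact (C \<inter> {z. G z <= 1 - e})"
     by (intro compact_Int_closed C closed_Collect_le contG continuous_on_const)
    show "C \<inter> {z. G z <= 1 - e} \<subseteq> U"
    proof
     fix z assume z: "z \<in> C \<inter> {z. G z <= 1 - e}"
     have "j z ~= 1"
     proof
      assume "j z = 1"
      from G(9)[OF this, of 1] have "1 - 2 * d <= G z" by simp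
      then show False using z d by auto
     qed
     then show "z \<in> U" using jC[of z] z by (simp add: U)
    qed
    fix z assume "z \<in> U - C \<inter> {z. G z <= 1 - e}"
    then have "1 - e <= G z" using UC by auto
    then show "H z = \<phi> 1" using \<phi>(4) by (simp add: H_def)
   qed
  qed
  fix x T assume "T \<in> {0<..1::real}"
  then show "\<not> ham_brake_orbit \<tau> U H x T" using no_orbit[of T x] by auto
 qed
 have "H u <= Sup (H ` U)"
  by (rule cSup_upper) (use u max in \<open>auto simp: H_def intro!: bdd_aboveI[of _ "\<phi> 1"]\<close>)
 moreover have "H u = \<phi> 1" using u \<phi>(4) by (simp add: H_def)
 ultimately show ?thesis using adm \<phi>(9) unfolding U_def C_def by (intro exI[of _ H]) linarith
qed

section \<open>Polygons parametrised by symplectic length\<close>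

lemma partial_sum_index:
 fixes s :: "nat \<Rightarrow> real"
 assumes "s 0 <= a" "a < s N"
 obtains i where "i < N" "s i <= a" "a < s (Suc i)"
proof -
 define i where "i = (LEAST i. a < s i)"
 have 1: "a < s i" unfolding i_def by (rule LeastI[of "%i. a < s i" N]) (rule assms(2))
 have "i <= N" unfolding i_def by (rule Least_le) (rule assms(2))
 moreover have "i ~= 0" using 1 assms(1) by (metis not_less)
 then obtain l where l: "i = Suc l" using not0_implies_Suc by blast
 have "\<not> a < s l" using not_less_Least[of l "%i. a < s i"] l by (simp add: i_def)
 ultimately show thesis using that[of l] 1 l by auto
qed

text \<open>The version with intervals closed on the right, for statements about the past of a
  point; the other one serves its future.\<close>

lemma partial_sum_index':
 fixes s :: "nat \<Rightarrow> real"
 assumes "s 0 < a" "a <= s N"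
 obtains i where "i < N" "s i < a" "a <= s (Suc i)"
proof -
 define i where "i = (LEAST i. a <= s i)"
 have 1: "a <= s i" unfolding i_def by (rule LeastI[of "%i. a <= s i" N]) (rule assms(2))
 have "i <= N" unfolding i_def by (rule Least_le) (rule assms(2))
 moreover have "i ~= 0" using 1 assms(1) by (metis not_le)
 then obtain l where l: "i = Suc l" using not0_implies_Suc by blast
 have "\<not> a <= s l" using not_less_Least[of l "%i. a <= s i"] l by (simp add: i_def)
 ultimately show thesis using that[of l] 1 l by auto
qed

text \<open>Testing with the multiple of - \<open>J0 v\<close> of norm r turns a bound on the
  symplectic support function into a bound on the norm.\<close>

lemma omega0_bound_norm:
 fixes v :: "'n::finite phase"
 assumes r: "0 < r" "cball 0 r \<subseteq> C" and b: "!!\<zeta>. \<zeta> \<in> C ==> omega0 \<zeta> v <= b"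
 shows "r * norm v <= b"
proof (cases "v = 0")
 case True
 then show ?thesis using b[of 0] subsetD[OF r(2), of 0] r(1) by (simp add: omega0_linear)
next
 case False
 have "norm (J0 v) = norm v" by (rule norm_J0)
 then have "(r / norm v) *\<^sub>R (- J0 v) \<in> cball 0 r" using r False by simp
 from b[OF subsetD[OF r(2) this]] have "omega0 ((r / norm v) *\<^sub>R (- J0 v)) v <= b" .
 moreover have "omega0 (- J0 v) v = norm v * norm v"
  using norm_Pair[of "fst v" "snd v"] by (simp add: omega0_def J0_def dot_square_norm power2_eq_square[symmetric])
 ultimately show ?thesis using False unfolding omega0_linear(5) by simp
qed

text \<open>Edge i takes time k i, and the clamped quotient is the fraction of it traversed at time
  a. An edge with k i = 0 contributes 0, by division by zero, which is right for the trivial edges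
  that occur.\<close>

definition polygon_path :: "nat \<Rightarrow> (nat \<Rightarrow> 'a::real_vector) \<Rightarrow> (nat \<Rightarrow> real) \<Rightarrow> real \<Rightarrow> 'a" where
 "polygon_path N z k a = z 0 + (\<Sum>i<N. (max 0 (min (k i) (a - sum k {..<i})) / k i) *\<^sub>R (z (Suc i) - z i))"

lemma polygon_path_eq:
 assumes k: "!!i. i < N ==> 0 <= k i" "!!i. i < N ==> k i = 0 ==> z (Suc i) = z i"
  and i: "i < N" "sum k {..<i} <= a" "a <= sum k {..<Suc i}" "0 < k i"
 shows "polygon_path N z k a = z i + ((a - sum k {..<i}) / k i) *\<^sub>R (z (Suc i) - z i)"
proof -
 let ?c = "%l. max 0 (min (k l) (a - sum k {..<l})) / k l"
 have mono: "sum k {..<l} <= sum k {..<l'}" if "l <= l'" "l' <= N" for l l'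
  by (rule sum_mono2) (use that k(1) in auto)
 have below: "?c l *\<^sub>R (z (Suc l) - z l) = z (Suc l) - z l" if l: "l < i" for l
 proof (cases "k l = 0")
  case True
  then show ?thesis using k(2)[of l] l i(1) by simp
 next
  case False
  then have "0 < k l" using k(1)[of l] l i(1) by simp
  moreover have "sum k {..<Suc l} <= a" using mono[of "Suc l" i] l i by linarith
  ultimately have "?c l = 1" by simp
  then show ?thesis by simp
 qed
 have above: "?c l = 0" if l: "i < l" "l < N" for l
 proof -
  have "a <= sum k {..<l}" using mono[of "Suc i" l] l i by linarith
  then show ?thesis using k(1)[OF l(2)] by (simp add: max_def min_def)
 qed
 have at: "?c i = (a - sum k {..<i}) / k i" using i by (simp add: max_def min_def)
 have "{..<N} = {..<i} \<union> {i} \<union> {Suc i..<N}" using i(1) by auto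
 then have "(\<Sum>l<N. ?c l *\<^sub>R (z (Suc l) - z l)) = (\<Sum>l\<in>{..<i} \<union> {i} \<union> {Suc i..<N}. ?c l *\<^sub>R (z (Suc l) - z l))" by simp
 also have "\<dots> = (\<Sum>l<i. ?c l *\<^sub>R (z (Suc l) - z l)) + ?c i *\<^sub>R (z (Suc i) - z i) + (\<Sum>l\<in>{Suc i..<N}. ?c l *\<^sub>R (z (Suc l) - z l))"
  by (subst sum.union_disjoint; (subst sum.union_disjoint)?) auto
 also have "(\<Sum>l\<in>{Suc i..<N}. ?c l *\<^sub>R (z (Suc l) - z l)) = 0" using above by (intro sum.neutral) auto
 also have "(\<Sum>l<i. ?c l *\<^sub>R (z (Suc l) - z l)) = (\<Sum>l<i. z (Suc l) - z l)" using below by (intro sum.cong) auto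
 also have "\<dots> = z i - z 0" by (rule sum_lessThan_telescope)
 finally show ?thesis unfolding polygon_path_def at by simp
qed

lemma clamp_sum:
 fixes k :: "nat \<Rightarrow> real"
 assumes "!!i. i < N ==> 0 <= k i"
 shows "(\<Sum>i<N. max 0 (min (k i) (a - sum k {..<i}))) = max 0 (min (sum k {..<N}) (a::real))"
 using assms
proof (induction N)
 case (Suc N)
 have "0 <= sum k {..<N}" "0 <= k N" using Suc.prems by (auto intro: sum_nonneg)
 moreover have "max 0 (min S a) + max 0 (min q (a - S)) = max 0 (min (S + q) a)" if "0 <= S" "0 <= q" for S q :: real
  using that by (simp add: max_def min_def)
 ultimately show ?case using Suc by simp
qed simp

text \<open>Run through at the rate of its own symplectic length, a polygon whose edges are maximal
  at their vertices has one-sided velocities that pair to K with the current point and to at most K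
  with the body. The one-sided affine pieces are kept because at vertices there is no two-sided
  derivative.\<close>

lemma closed_polygon_loop:
 fixes z :: "nat \<Rightarrow> 'n::finite phase"
 assumes C: "convex C" "0 < r" "cball 0 r \<subseteq> C" and zC: "!!i. i <= N ==> z i \<in> C" and closed: "z N = z 0"
  and k: "!!i. i < N ==> k i = omega0 (z i) (z (Suc i) - z i)"
  and cone: "!!i \<zeta>. i < N ==> \<zeta> \<in> C ==> omega0 \<zeta> (z (Suc i) - z i) <= k i"
  and K: "sum k {..<N} = K" "0 < K"
 defines "g \<equiv> polygon_path N z k"
 defines "\<gamma> \<equiv> %t. g (K * frac t)"
 shows "\<gamma> (t + 1) = \<gamma> t" "t <= t' ==> \<zeta> \<in> C ==> omega0 \<zeta> (\<gamma> t' - \<gamma> t) <= K * (t' - t)" "\<gamma> t \<in> C"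
  "\<exists>d>0. \<exists>v. omega0 (\<gamma> t) v = K \<and> (\<forall>\<zeta>\<in>C. omega0 \<zeta> v <= K) \<and> (\<forall>s\<in>{t..<t+d}. \<gamma> s = \<gamma> t + (s - t) *\<^sub>R v)"
  "\<exists>d>0. \<exists>v. omega0 (\<gamma> t) v = K \<and> (\<forall>\<zeta>\<in>C. omega0 \<zeta> v <= K) \<and> (\<forall>s\<in>{t-d<..t}. \<gamma> s = \<gamma> t + (s - t) *\<^sub>R v)"
  "!!i a. [|i < N; sum k {..<i} <= a; a <= sum k {..<Suc i}; 0 < k i|] ==> g a = z i + ((a - sum k {..<i}) / k i) *\<^sub>R (z (Suc i) - z i)"
  "g K = g 0"
proof -
 have C0: "0 \<in> C" using C by auto
 have k0: "0 <= k i" if "i < N" for i using cone[OF that C0] by (simp add: omega0_linear)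
 have kz: "z (Suc i) = z i" if "i < N" "k i = 0" for i
  using omega0_bound_norm[OF C(2,3), of "z (Suc i) - z i" 0] cone[OF that(1)] that(2) C(2) by (auto simp: mult_le_0_iff)
 have eq: "g a = z i + ((a - sum k {..<i}) / k i) *\<^sub>R (z (Suc i) - z i)"
  if "i < N" "sum k {..<i} <= a" "a <= sum k {..<Suc i}" "0 < k i" for i a
  unfolding g_def by (rule polygon_path_eq) (use k0 kz that in auto)
 show "!!i a. [|i < N; sum k {..<i} <= a; a <= sum k {..<Suc i}; 0 < k i|] ==> g a = z i + ((a - sum k {..<i}) / k i) *\<^sub>R (z (Suc i) - z i)"
  by (rule eq)
 have gC: "g a \<in> C" if "i < N" "sum k {..<i} <= a" "a <= sum k {..<Suc i}" "0 < k i" for i a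
 proof -
  define u where "u = (a - sum k {..<i}) / k i"
  have u: "0 <= u" "u <= 1" using that by (auto simp: u_def)
  have "g a = (1 - u) *\<^sub>R z i + u *\<^sub>R z (Suc i)" unfolding eq[OF that] u_def[symmetric] by (simp add: algebra_simps)
  then show ?thesis using convexD[OF C(1) zC[of i] zC[of "Suc i"]] u that(1) by simp
 qed
 have g0: "g 0 = z 0"
 proof -
  have "max 0 (min (k i) (0 - sum k {..<i})) = 0" if "i < N" for i
  proof -
   have "0 <= sum k {..<i}" using k0 that by (intro sum_nonneg) auto
   then show ?thesis by (simp add: max_def min_def)
  qed
  then show ?thesis unfolding g_def polygon_path_def by (simp add: sum.neutral)
 qed
 have cs: "(\<Sum>i<N. max 0 (min (k i) (a - sum k {..<i}))) = max 0 (min K a)" for a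
  unfolding K(1)[symmetric] by (rule clamp_sum) (rule k0)
 have inc: "omega0 \<zeta> (g b - g a) <= b - a" if ab: "0 <= a" "a <= b" "b <= K" and \<zeta>: "\<zeta> \<in> C" for a b \<zeta>
 proof -
  let ?E = "%a i. max 0 (min (k i) (a - sum k {..<i}))"
  have "g b - g a = (\<Sum>i<N. (?E b i / k i - ?E a i / k i) *\<^sub>R (z (Suc i) - z i))"
   unfolding g_def polygon_path_def by (simp add: sum_subtractf scaleR_diff_left)
  then have "omega0 \<zeta> (g b - g a) = (\<Sum>i<N. (?E b i / k i - ?E a i / k i) * omega0 \<zeta> (z (Suc i) - z i))"
   by (simp only: omega0_sum omega0_linear)
  also have "\<dots> <= (\<Sum>i<N. ?E b i - ?E a i)"
  proof (rule sum_mono)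
   fix i assume "i \<in> {..<N}"
   then have i: "i < N" by simp
   show "(?E b i / k i - ?E a i / k i) * omega0 \<zeta> (z (Suc i) - z i) <= ?E b i - ?E a i"
   proof (cases "k i = 0")
    case True then show ?thesis by simp
   next
    case False
    have le: "?E a i <= ?E b i" using ab(2) by (intro max.mono min.mono) auto
    then have "(?E b i / k i - ?E a i / k i) * omega0 \<zeta> (z (Suc i) - z i) <= (?E b i / k i - ?E a i / k i) * k i"
     using cone[OF i \<zeta>] k0[OF i] by (intro mult_left_mono) (auto simp: divide_right_mono simp del: max.bounded_iff)
    also have "\<dots> = ?E b i - ?E a i" using False by (simp add: left_diff_distrib)
    finally show ?thesis .
   qed
  qed
  also have "\<dots> = max 0 (min K b) - max 0 (min K a)" unfolding sum_subtractf by (simp only: cs)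
  also have "\<dots> = b - a" using ab by simp
  finally show ?thesis .
 qed
 have gK: "g K = g 0"
 proof -
  have "max 0 (min (k i) (K - sum k {..<i})) / k i = (if k i = 0 then 0 else 1)" if i: "i < N" for i
  proof -
   have "sum k {..<Suc i} <= K" unfolding K(1)[symmetric] by (rule sum_mono2) (use i k0 in auto)
   then show ?thesis using k0[OF i] by (simp add: max_def min_def)
  qed
  then have "g K = z 0 + (\<Sum>i<N. (if k i = 0 then 0 else 1) *\<^sub>R (z (Suc i) - z i))"
   unfolding g_def polygon_path_def by simp
  also have "(\<Sum>i<N. (if k i = 0 then 0 else 1) *\<^sub>R (z (Suc i) - z i)) = (\<Sum>i<N. z (Suc i) - z i)"
   using kz by (intro sum.cong) auto
  also have "\<dots> = 0" by (simp add: sum_lessThan_telescope closed)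
  finally show ?thesis by (simp add: g0)
 qed
 show "g K = g 0" by (rule gK)
 show per: "\<gamma> (t + 1) = \<gamma> t" for t by (simp add: \<gamma>_def frac_1_eq)
 have frac: "0 <= frac t" "frac t < 1" for t :: real by (simp_all add: frac_lt_1)
 have a_range: "0 <= K * frac t" "K * frac t < K" for t using K(2) frac[of t] by auto
 show "omega0 \<zeta> (\<gamma> t' - \<gamma> t) <= K * (t' - t)" if "t <= t'" "\<zeta> \<in> C"
 proof (cases "\<lfloor>t\<rfloor> = \<lfloor>t'\<rfloor>")
  case True
  then have fr: "frac t' - frac t = t' - t" by (simp add: frac_def)
  have "omega0 \<zeta> (\<gamma> t' - \<gamma> t) <= K * frac t' - K * frac t"
   unfolding \<gamma>_def by (rule inc) (use that fr a_range[of t] a_range[of t'] frac[of t'] K(2) in auto)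
  also have "\<dots> = K * (t' - t)" by (simp add: fr[symmetric] right_diff_distrib)
  finally show ?thesis .
 next
  case False
  then have "\<lfloor>t\<rfloor> + 1 <= \<lfloor>t'\<rfloor>" using floor_mono[OF that(1)] by linarith
  then have fr: "1 + frac t' - frac t <= t' - t" by (simp add: frac_def)
  have "omega0 \<zeta> (g K - \<gamma> t) <= K - K * frac t" unfolding \<gamma>_def by (rule inc) (use that a_range[of t] frac[of t] in auto)
  moreover have "omega0 \<zeta> (\<gamma> t' - g 0) <= K * frac t' - 0" unfolding \<gamma>_def by (rule inc) (use that a_range[of t'] frac[of t'] in auto)
  moreover have "omega0 \<zeta> (\<gamma> t' - \<gamma> t) = omega0 \<zeta> (g K - \<gamma> t) + omega0 \<zeta> (\<gamma> t' - g 0)"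
   by (simp add: gK omega0_linear)
  moreover have "K * (1 + frac t' - frac t) = K - K * frac t + K * frac t'" by (simp add: algebra_simps)
  ultimately have "omega0 \<zeta> (\<gamma> t' - \<gamma> t) <= K * (1 + frac t' - frac t)" by linarith
  also have "\<dots> <= K * (t' - t)" using fr K(2) by simp
  finally show ?thesis .
 qed
 have seg: "omega0 (g a) ((K / k i) *\<^sub>R (z (Suc i) - z i)) = K" "\<zeta> \<in> C ==> omega0 \<zeta> ((K / k i) *\<^sub>R (z (Suc i) - z i)) <= K"
  if i: "i < N" "sum k {..<i} <= a" "a <= sum k {..<Suc i}" "0 < k i" for i a \<zeta>
 proof -
  have "omega0 (g a) (z (Suc i) - z i) = k i" unfolding eq[OF i] omega0_linear(1,5) by (simp add: k[OF i(1)])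
  then show "omega0 (g a) ((K / k i) *\<^sub>R (z (Suc i) - z i)) = K" using i(4) by (simp add: omega0_linear(6))
  assume "\<zeta> \<in> C"
  then have "(K / k i) * omega0 \<zeta> (z (Suc i) - z i) <= (K / k i) * k i" using cone[OF i(1)] i(4) K(2) by (intro mult_left_mono) auto
  then show "omega0 \<zeta> ((K / k i) *\<^sub>R (z (Suc i) - z i)) <= K" using i(4) by (simp add: omega0_linear(6))
 qed
 have move: "g b = g a + ((b - a) / K) *\<^sub>R ((K / k i) *\<^sub>R (z (Suc i) - z i))"
  if "i < N" "sum k {..<i} <= a" "a <= sum k {..<Suc i}" "0 < k i" "sum k {..<i} <= b" "b <= sum k {..<Suc i}" for a b i
  unfolding eq[OF that(1,2,3,4)] eq[OF that(1,5,6,4)] using K(2)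
  by (simp add: scaleR_left_distrib[symmetric] add_divide_distrib[symmetric] add.assoc)
 have right: "\<exists>i<N. sum k {..<i} <= K * frac t \<and> K * frac t < sum k {..<Suc i}" for t
  using partial_sum_index[of "%i. sum k {..<i}" "K * frac t" N] a_range[of t] K(1) by auto
 show "\<gamma> t \<in> C"
 proof -
  obtain i where i: "i < N" "sum k {..<i} <= K * frac t" "K * frac t < sum k {..<Suc i}" using right by blast
  show ?thesis unfolding \<gamma>_def by (rule gC[OF i(1,2) less_imp_le[OF i(3)]]) (use i in simp)
 qed
 show "\<exists>d>0. \<exists>v. omega0 (\<gamma> t) v = K \<and> (\<forall>\<zeta>\<in>C. omega0 \<zeta> v <= K) \<and> (\<forall>s\<in>{t..<t+d}. \<gamma> s = \<gamma> t + (s - t) *\<^sub>R v)"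
 proof -
  define a where "a = K * frac t"
  obtain i where i: "i < N" "sum k {..<i} <= a" "a < sum k {..<Suc i}" using right unfolding a_def by blast
  have ki: "0 < k i" using i by simp
  have SiK: "sum k {..<Suc i} <= K" unfolding K(1)[symmetric] by (rule sum_mono2) (use i k0 in auto)
  define d where "d = (sum k {..<Suc i} - a) / K"
  define v where "v = (K / k i) *\<^sub>R (z (Suc i) - z i)"
  have "0 < d" using i K by (simp add: d_def)
  moreover have "\<gamma> s = \<gamma> t + (s - t) *\<^sub>R v" if s: "s \<in> {t..<t+d}" for s
  proof -
   define b where "b = a + K * (s - t)"
   have "K * (s - t) < K * d" using s K(2) by simp
   then have b: "a <= b" "b < sum k {..<Suc i}" using s K(2) by (auto simp: b_def d_def)
   have fs: "frac s = frac t + (s - t)"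
   proof (rule frac_unique_iff[THEN iffD2], intro conjI)
    show "s - (frac t + (s - t)) \<in> \<int>" by (simp add: frac_def)
    show "0 <= frac t + (s - t)" using s frac(1)[of t] by simp
    have "K * (frac t + (s - t)) < K * 1" using b SiK by (simp add: b_def a_def distrib_left)
    then show "frac t + (s - t) < 1" using K(2) by simp
   qed
   have "\<gamma> s = g b" by (simp add: \<gamma>_def fs b_def a_def distrib_left)
   also have "g b = g a + ((b - a) / K) *\<^sub>R v" unfolding v_def by (rule move) (use i ki b in auto)
   also have "(b - a) / K = s - t" using K(2) by (simp add: b_def)
   finally show ?thesis by (simp add: \<gamma>_def a_def)
  qed
  moreover have "omega0 (\<gamma> t) v = K" "\<forall>\<zeta>\<in>C. omega0 \<zeta> v <= K"
   using seg[OF i(1,2) less_imp_le[OF i(3)] ki] by (auto simp: \<gamma>_def a_def v_def)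
  ultimately show ?thesis by blast
 qed
 show "\<exists>d>0. \<exists>v. omega0 (\<gamma> t) v = K \<and> (\<forall>\<zeta>\<in>C. omega0 \<zeta> v <= K) \<and> (\<forall>s\<in>{t-d<..t}. \<gamma> s = \<gamma> t + (s - t) *\<^sub>R v)"
 proof -
  \<comment> \<open>The fractional part with values in (0, 1]: at an integer the past lies at the
    end of the parameter interval, where g K = g 0 identifies the point.\<close>
  define f where "f = t - of_int \<lceil>t\<rceil> + 1"
  have f: "0 < f" "f <= 1" unfolding f_def by linarith+
  define a where "a = K * f"
  have a: "0 < a" "a <= K" using f K(2) by (auto simp: a_def)
  have ga: "\<gamma> t = g a"
  proof (cases "f = 1")
   case True
   then have "t = of_int \<lceil>t\<rceil>" by (simp add: f_def)
   then have f0: "frac t = 0" by (metis frac_of_int)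
   show ?thesis unfolding \<gamma>_def a_def f0 True using gK by simp
  next
   case False
   have f1: "f < 1" using f False by simp
   have "t - f \<in> \<int>" by (simp add: f_def)
   then have "frac t = f" using frac_unique_iff[of t f] f f1 by simp
   then show ?thesis by (simp add: \<gamma>_def a_def)
  qed
  obtain i where i: "i < N" "sum k {..<i} < a" "a <= sum k {..<Suc i}"
   using partial_sum_index'[of "%i. sum k {..<i}" a N] a K(1) by auto
  have ki: "0 < k i" using i by simp
  have S0: "0 <= sum k {..<i}" using i k0 by (intro sum_nonneg) auto
  define d where "d = (a - sum k {..<i}) / K"
  define v where "v = (K / k i) *\<^sub>R (z (Suc i) - z i)"
  have "0 < d" using i K by (simp add: d_def)
  moreover have "\<gamma> s = \<gamma> t + (s - t) *\<^sub>R v" if s: "s \<in> {t-d<..t}" for s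
  proof (cases "s = t")
   case False
   define b where "b = a + K * (s - t)"
   have "K * (t - s) < K * d" using s K(2) by simp
   moreover have "K * d = a - sum k {..<i}" using K(2) by (simp add: d_def)
   moreover have "K * (s - t) <= 0" using s K(2) by (simp add: mult_nonneg_nonpos)
   moreover have "K * (t - s) = - (K * (s - t))" by (simp add: algebra_simps)
   ultimately have b: "b <= a" "sum k {..<i} < b" unfolding b_def by linarith+
   have fs: "frac s = f + (s - t)"
   proof (rule frac_unique_iff[THEN iffD2], intro conjI)
    show "s - (f + (s - t)) \<in> \<int>" by (simp add: f_def)
    have "K * 0 < K * (f + (s - t))" using b S0 by (simp add: b_def a_def distrib_left)
    then show "0 <= f + (s - t)" using K(2) by (simp add: zero_less_mult_iff)
    show "f + (s - t) < 1" using f s False by auto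
   qed
   have "\<gamma> s = g b" by (simp add: \<gamma>_def fs b_def a_def distrib_left)
   also have "g b = g a + ((b - a) / K) *\<^sub>R v" unfolding v_def by (rule move) (use i ki b in auto)
   also have "(b - a) / K = s - t" using K(2) by (simp add: b_def)
   finally show ?thesis by (simp add: ga)
  qed simp
  moreover have "omega0 (\<gamma> t) v = K" "\<forall>\<zeta>\<in>C. omega0 \<zeta> v <= K"
   using seg[OF i(1) less_imp_le[OF i(2)] i(3) ki] by (auto simp: ga v_def)
  ultimately show ?thesis by blast
 qed
qed

text \<open>A closed symmetric characteristic in one-sided form. The rate is 2 * c because a polygon
  of symplectic length c from \<open>Fix \<tau>\<close> to \<open>Fix \<tau>\<close> and its mirror
  image are run through in unit time.\<close>

definition polygonal_loop :: "('n::finite phase \<Rightarrow> 'n phase) \<Rightarrow> 'n phase set \<Rightarrow> real \<Rightarrow> (real \<Rightarrow> 'n phase) \<Rightarrow> bool" where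
 "polygonal_loop \<tau> C c \<gamma> \<longleftrightarrow> (\<forall>t. \<gamma> (t + 1) = \<gamma> t) \<and> (\<forall>t. \<gamma> (- t) = \<tau> (\<gamma> t)) \<and> (\<forall>t. \<gamma> t \<in> C) \<and>
  (\<forall>t t'. t <= t' --> (\<forall>\<zeta>\<in>C. omega0 \<zeta> (\<gamma> t' - \<gamma> t) <= 2 * c * (t' - t))) \<and>
  (\<forall>t. \<exists>d>0. \<exists>v. omega0 (\<gamma> t) v = 2 * c \<and> (\<forall>\<zeta>\<in>C. omega0 \<zeta> v <= 2 * c) \<and> (\<forall>s\<in>{t..<t+d}. \<gamma> s = \<gamma> t + (s - t) *\<^sub>R v)) \<and>
  (\<forall>t. \<exists>d>0. \<exists>v. omega0 (\<gamma> t) v = 2 * c \<and> (\<forall>\<zeta>\<in>C. omega0 \<zeta> v <= 2 * c) \<and> (\<forall>s\<in>{t-d<..t}. \<gamma> s = \<gamma> t + (s - t) *\<^sub>R v))"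

context antisymp_involution
begin

text \<open>The polygon is continued by its image under \<tau>, run backwards. Both \<tau> and the
  reversal change the sign of \<open>omega0\<close>, so mirrored edges have the same symplectic
  length and obey the same maximality.\<close>

lemma polygonal_loop_exists:
 fixes z :: "nat \<Rightarrow> 'n phase"
 assumes C: "convex C" "0 < r" "cball 0 r \<subseteq> C" "!!\<zeta>. \<zeta> \<in> C ==> \<tau> \<zeta> \<in> C"
  and zF: "z 0 \<in> Fix \<tau>" "z m \<in> Fix \<tau>" and zC: "!!i. i <= m ==> z i \<in> C"
  and cone: "!!i \<zeta>. i < m ==> \<zeta> \<in> C ==> omega0 \<zeta> (z (Suc i) - z i) <= omega0 (z i) (z (Suc i) - z i)"
  and c: "(\<Sum>i<m. omega0 (z i) (z (Suc i) - z i)) = c" "0 < c"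
 shows "\<exists>\<gamma>. polygonal_loop \<tau> C c \<gamma>"
proof -
 define y where "y i = (if i <= m then z i else \<tau> (z (2 * m - i)))" for i
 define k where "k i = omega0 (y i) (y (Suc i) - y i)" for i
 have ysym: "y (2 * m - i) = \<tau> (y i)" if "i <= 2 * m" for i
 proof -
  consider "i < m" | "i = m" | "m < i" by linarith
  then show ?thesis
  proof cases
   case 1
   then have "\<not> 2 * m - i <= m" by simp
   then show ?thesis using 1 by (simp add: y_def)
  next
   case 2 then show ?thesis using zF(2) by (simp add: y_def Fix_def)
  next
   case 3
   then have "2 * m - i <= m" "\<not> i <= m" by auto
   then show ?thesis using that by (simp add: y_def)
  qed
 qed
 have ksym: "k (2 * m - Suc i) = k i" if i: "i < 2 * m" for i
 proof -
  have S: "Suc (2 * m - Suc i) = 2 * m - i" using i by simp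
  have "k (2 * m - Suc i) = omega0 (\<tau> (y (Suc i))) (\<tau> (y i) - \<tau> (y (Suc i)))"
   unfolding k_def S using ysym[of i] ysym[of "Suc i"] i by simp
  also have "\<dots> = k i" by (simp add: k_def omega0_linear anti) (simp add: omega0_def inner_commute)
  finally show ?thesis .
 qed
 have klow: "k i = omega0 (z i) (z (Suc i) - z i)" "y (Suc i) - y i = z (Suc i) - z i" if "i < m" for i
  using that by (auto simp: k_def y_def)
 have yC: "y i \<in> C" if "i <= 2 * m" for i using zC C(4) that by (simp add: y_def)
 have kcone: "omega0 \<zeta> (y (Suc i) - y i) <= k i" if i: "i < 2 * m" and \<zeta>: "\<zeta> \<in> C" for i \<zeta>
 proof (cases "i < m")
  case True
  then show ?thesis using cone[OF True \<zeta>] klow by simp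
 next
  case False
  define l where "l = 2 * m - Suc i"
  have l: "l < m" "Suc l = 2 * m - i" using False i by (auto simp: l_def)
  have "y (Suc i) = \<tau> (y l)" "y i = \<tau> (y (Suc l))"
   using ysym[of l] ysym[of "Suc l"] l i False by (auto simp: l_def)
  then have "omega0 \<zeta> (y (Suc i) - y i) = omega0 (\<tau> (\<tau> \<zeta>)) (\<tau> (y l) - \<tau> (y (Suc l)))" by simp
  also have "\<dots> = omega0 (\<tau> \<zeta>) (y (Suc l) - y l)" unfolding omega0_linear(4) anti by simp
  also have "\<dots> <= k l" using cone[OF l(1) C(4)[OF \<zeta>]] klow[OF l(1)] by simp
  also have "k l = k i" using ksym[OF i] by (simp add: l_def)
  finally show ?thesis .
 qed
 have split: "sum k {..<m + q} = sum k {..<m} + (\<Sum>i<q. k (m + i))" for q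
  by (induction q) (simp_all add: add.assoc)
 have "(\<Sum>i<m. k (m + i)) = (\<Sum>i<m. k (m - Suc i))"
 proof (rule sum.cong[OF refl])
  fix i assume "i \<in> {..<m}"
  then have i: "m + i < 2 * m" "2 * m - Suc (m + i) = m - Suc i" by auto
  show "k (m + i) = k (m - Suc i)" using ksym[OF i(1)] unfolding i(2) ..
 qed
 also have "\<dots> = sum k {..<m}" by (rule sum.nat_diff_reindex)
 finally have "sum k {..<2 * m} = sum k {..<m} + sum k {..<m}" using split[of m] unfolding mult_2 by simp
 moreover have "sum k {..<m} = c" unfolding c(1)[symmetric] by (rule sum.cong[OF refl]) (simp add: klow(1))
 ultimately have tot: "sum k {..<2 * m} = 2 * c" by simp
 have ssym: "sum k {..<2 * m - i} = 2 * c - sum k {..<i}" if "i <= 2 * m" for i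
  using that
 proof (induction i)
  case 0 then show ?case using tot by simp
 next
  case (Suc i)
  have "sum k {..<2 * m - i} = sum k {..<2 * m - Suc i} + k (2 * m - Suc i)"
   using Suc.prems by (metis Suc_diff_Suc Suc_le_lessD sum.lessThan_Suc)
  then show ?case using Suc ksym[of i] by simp
 qed
 have cl: "y (2 * m) = y 0" using ysym[of 0] zF(1) by (simp add: y_def Fix_def)
 have kd: "k i = omega0 (y i) (y (Suc i) - y i)" for i by (simp add: k_def)
 have c2: "0 < 2 * c" using c(2) by simp
 define g where "g = polygon_path (2 * m) y k"
 define \<gamma> where "\<gamma> t = g (2 * c * frac t)" for t
 have g: "g a = y i + ((a - sum k {..<i}) / k i) *\<^sub>R (y (Suc i) - y i)"
  if "i < 2 * m" "sum k {..<i} <= a" "a <= sum k {..<Suc i}" "0 < k i" for i a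
  unfolding g_def by (rule closed_polygon_loop(6)[where C = C and r = r and N = "2 * m" and z = y and k = k and K = "2 * c"])
   (rule C(1-3) yC cl kd kcone tot c2 that | assumption)+
 have gK: "g (2 * c) = g 0" unfolding g_def by (rule closed_polygon_loop(7)[where C = C and r = r and N = "2 * m" and z = y and k = k and K = "2 * c"])
   (rule C(1-3) yC cl kd kcone tot c2 | assumption)+
 have refl: "g (2 * c - a) = \<tau> (g a)" if a: "0 <= a" "a < 2 * c" for a
 proof -
  obtain i where i: "i < 2 * m" "sum k {..<i} <= a" "a < sum k {..<Suc i}"
   using partial_sum_index[of "%i. sum k {..<i}" a "2 * m"] a tot by auto
  have ki: "0 < k i" using i by simp
  define l where "l = 2 * m - Suc i"
  have l: "l < 2 * m" "Suc l = 2 * m - i" using i by (auto simp: l_def)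
  have kl: "k l = k i" using ksym[OF i(1)] by (simp add: l_def)
  have sl: "sum k {..<l} = 2 * c - sum k {..<Suc i}" "sum k {..<Suc l} = 2 * c - sum k {..<i}"
   unfolding l(2) using ssym[of "Suc i"] ssym[of i] i by (auto simp: l_def)
  have yl: "y l = \<tau> (y (Suc i))" "y (Suc l) = \<tau> (y i)"
   unfolding l(2) using ysym[of "Suc i"] ysym[of i] i by (auto simp: l_def)
  have "g (2 * c - a) = y l + ((2 * c - a - sum k {..<l}) / k l) *\<^sub>R (y (Suc l) - y l)"
   by (rule g) (use l i sl ki kl in auto)
  also have "\<dots> = \<tau> (y (Suc i) + ((sum k {..<Suc i} - a) / k i) *\<^sub>R (y i - y (Suc i)))"
   unfolding sl(1) yl kl by (simp add: linear_add[OF lin] linear_scale[OF lin] linear_diff[OF lin])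
  also have "y (Suc i) + ((sum k {..<Suc i} - a) / k i) *\<^sub>R (y i - y (Suc i)) = y i + (1 - (sum k {..<Suc i} - a) / k i) *\<^sub>R (y (Suc i) - y i)"
   by (simp add: algebra_simps)
  also have "1 - (sum k {..<Suc i} - a) / k i = (a - sum k {..<i}) / k i" using ki by (simp add: field_simps)
  also have "y i + ((a - sum k {..<i}) / k i) *\<^sub>R (y (Suc i) - y i) = g a" by (rule g[symmetric]) (use i ki in auto)
  finally show ?thesis .
 qed
 have "\<gamma> (- t) = \<tau> (\<gamma> t)" for t
 proof (cases "t \<in> \<int>")
  case True
  then have f0: "frac t = 0" "frac (- t) = 0" by (auto simp: frac_eq_0_iff)
  show ?thesis unfolding \<gamma>_def f0 using refl[of 0] gK c(2) by simp
 next
  case False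
  then have "\<gamma> (- t) = g (2 * c - 2 * c * frac t)" by (simp add: \<gamma>_def frac_neg right_diff_distrib)
  also have "\<dots> = \<tau> (g (2 * c * frac t))" by (rule refl) (use c(2) frac_lt_1[of t] in auto)
  finally show ?thesis by (simp add: \<gamma>_def)
 qed
 moreover have "\<gamma> (t + 1) = \<gamma> t" for t unfolding \<gamma>_def by (simp add: frac_1_eq)
 moreover have "\<gamma> t \<in> C" for t unfolding \<gamma>_def g_def by (rule closed_polygon_loop(3)[where C = C and r = r and N = "2 * m" and z = y and k = k and K = "2 * c"])
   (rule C(1-3) yC cl kd kcone tot c2 | assumption)+
 moreover have "omega0 \<zeta> (\<gamma> t' - \<gamma> t) <= 2 * c * (t' - t)" if "t <= t'" "\<zeta> \<in> C" for t t' \<zeta>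
  unfolding \<gamma>_def g_def by (rule closed_polygon_loop(2)[where C = C and r = r and N = "2 * m" and z = y and k = k and K = "2 * c"])
   (rule C(1-3) yC cl kd kcone tot c2 that | assumption)+
 moreover have "\<exists>d>0. \<exists>v. omega0 (\<gamma> t) v = 2 * c \<and> (\<forall>\<zeta>\<in>C. omega0 \<zeta> v <= 2 * c) \<and> (\<forall>s\<in>{t..<t+d}. \<gamma> s = \<gamma> t + (s - t) *\<^sub>R v)" for t
  unfolding \<gamma>_def g_def by (rule closed_polygon_loop(4)[where C = C and r = r and N = "2 * m" and z = y and k = k and K = "2 * c"])
   (rule C(1-3) yC cl kd kcone tot c2 | assumption)+
 moreover have "\<exists>d>0. \<exists>v. omega0 (\<gamma> t) v = 2 * c \<and> (\<forall>\<zeta>\<in>C. omega0 \<zeta> v <= 2 * c) \<and> (\<forall>s\<in>{t-d<..t}. \<gamma> s = \<gamma> t + (s - t) *\<^sub>R v)" for t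
  unfolding \<gamma>_def g_def by (rule closed_polygon_loop(5)[where C = C and r = r and N = "2 * m" and z = y and k = k and K = "2 * c"])
   (rule C(1-3) yC cl kd kcone tot c2 | assumption)+
 ultimately show ?thesis unfolding polygonal_loop_def by blast
qed

end

text \<open>D is the right-hand velocity. Around each point the loop is affine on either side;
  finitely many such neighbourhoods cover [a, b], and away from their centres the loop is locally
  affine, which gives finitely many corners.\<close>

lemma polygonal_loop_calculus:
 fixes \<gamma> :: "real \<Rightarrow> 'n::finite phase"
 assumes \<gamma>: "polygonal_loop \<tau> C c \<gamma>" and r: "0 < r" "cball 0 r \<subseteq> C"
 obtains D where "!!X. continuous_on X \<gamma>" "!!t. omega0 (\<gamma> t) (D t) = 2 * c" "!!t \<zeta>. \<zeta> \<in> C ==> omega0 \<zeta> (D t) <= 2 * c"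
  "!!a b. \<exists>S. finite S \<and> (\<forall>t\<in>{a..b} - S. (\<gamma> has_vector_derivative D t) (at t)) \<and> continuous_on ({a..b} - S) D"
proof -
 have "\<exists>d v. 0 < d \<and> omega0 (\<gamma> t) v = 2 * c \<and> (\<forall>\<zeta>\<in>C. omega0 \<zeta> v <= 2 * c) \<and> (\<forall>s\<in>{t..<t+d}. \<gamma> s = \<gamma> t + (s - t) *\<^sub>R v)" for t
  using \<gamma> unfolding polygonal_loop_def by blast
 then obtain dR D where R: "!!t. 0 < dR t" "!!t. omega0 (\<gamma> t) (D t) = 2 * c" "!!t \<zeta>. \<zeta> \<in> C ==> omega0 \<zeta> (D t) <= 2 * c"
  "!!t s. s \<in> {t..<t + dR t} ==> \<gamma> s = \<gamma> t + (s - t) *\<^sub>R D t" by metis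
 have "\<exists>d v. 0 < d \<and> (\<forall>s\<in>{t-d<..t}. \<gamma> s = \<gamma> t + (s - t) *\<^sub>R v)" for t
  using \<gamma> unfolding polygonal_loop_def by blast
 then obtain dL E where L: "!!t. 0 < dL t" "!!t s. s \<in> {t - dL t<..t} ==> \<gamma> s = \<gamma> t + (s - t) *\<^sub>R E t" by metis
 have cont: "continuous_on X \<gamma>" for X
 proof (rule lipschitz_on_continuous_on[of "2 * c / r"], rule lipschitz_onI)
  have sym: "norm (\<gamma> t' - \<gamma> t) <= 2 * c / r * (t' - t)" if "t <= t'" for t t'
  proof -
   have "r * norm (\<gamma> t' - \<gamma> t) <= 2 * c * (t' - t)"
    by (rule omega0_bound_norm[OF r]) (use \<gamma> that in \<open>auto simp: polygonal_loop_def\<close>)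
   then show ?thesis using r(1) by (simp add: field_simps)
  qed
  show "dist (\<gamma> x) (\<gamma> y) <= 2 * c / r * dist x y" for x y
   using sym[of x y] sym[of y x] by (cases "x <= y") (auto simp: dist_norm norm_minus_commute)
  have "0 <= 2 * c" using R(3)[OF subsetD[OF r(2)], of 0 0] r(1) by (simp add: omega0_linear)
  then show "0 <= 2 * c / r" using r(1) by simp
 qed
 have affine: "(\<gamma> has_vector_derivative D u) (at u)" "\<forall>s\<in>W. D s = D u"
  if W: "open W" "u \<in> W" and aff: "!!s. s \<in> W ==> \<gamma> s = p + (s - q) *\<^sub>R v" for W u p q v
 proof -
  have Dv: "D s = v" if s: "s \<in> W" for s
  proof -
   obtain e where e: "0 < e" "ball s e \<subseteq> W" using W(1) s open_contains_ball by blast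
   define h where "h = min (e / 2) (dR s / 2)"
   have h: "0 < h" "h < e" "h < dR s" using e R(1)[of s] by (auto simp: h_def min_def)
   have "s + h \<in> W" using e h by (auto simp: dist_real_def)
   have "h *\<^sub>R D s = \<gamma> (s + h) - \<gamma> s" using R(4)[of "s + h" s] h by simp
   also have "\<dots> = h *\<^sub>R v" unfolding aff[OF \<open>s + h \<in> W\<close>] aff[OF s] by (simp add: algebra_simps)
   finally have "h *\<^sub>R D s = h *\<^sub>R v" .
   then show ?thesis using h by simp
  qed
  have dv: "((%s. p + (s - q) *\<^sub>R v) has_vector_derivative v) (at u)"
   by (auto intro!: derivative_eq_intros)
  show "(\<gamma> has_vector_derivative D u) (at u)"
   unfolding Dv[OF W(2)] by (rule has_vector_derivative_transform_within_open[OF dv W]) (simp add: aff)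
  show "\<forall>s\<in>W. D s = D u" using Dv W(2) by simp
 qed
 have "\<exists>S. finite S \<and> (\<forall>t\<in>{a..b} - S. (\<gamma> has_vector_derivative D t) (at t)) \<and> continuous_on ({a..b} - S) D" for a b
 proof -
  define I where "I t = {t - dL t<..<t + dR t}" for t
  have op: "open (I t)" and tI: "t \<in> I t" for t using R(1)[of t] L(1)[of t] by (auto simp: I_def)
  have "{a..b} \<subseteq> (\<Union>t\<in>{a..b}. I t)" using tI by blast
  then obtain S where S: "S \<subseteq> {a..b}" "finite S" "{a..b} \<subseteq> (\<Union>t\<in>S. I t)"
   by (rule compactE_image[OF compact_Icc, of "{a..b}" I, rotated]) (use op in auto)
  have loc: "(\<gamma> has_vector_derivative D u) (at u) \<and> isCont D u" if u: "u \<in> {a..b} - S" for u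
  proof -
   obtain t where t: "t \<in> S" "u \<in> I t" using S(3) u by blast
   have "\<exists>W. open W \<and> u \<in> W \<and> (\<exists>p q v. \<forall>s\<in>W. \<gamma> s = p + (s - q) *\<^sub>R v)"
   proof (cases "t < u")
    case True
    then show ?thesis using t(2)
     by (intro exI[of _ "{t<..<t + dR t}"] conjI exI[of _ "\<gamma> t"] exI[of _ t] exI[of _ "D t"]) (auto simp: I_def intro!: R(4))
   next
    case False
    then have "u < t" using t(1) u by (cases "u = t") auto
    then show ?thesis using t(2)
     by (intro exI[of _ "{t - dL t<..<t}"] conjI exI[of _ "\<gamma> t"] exI[of _ t] exI[of _ "E t"]) (auto simp: I_def intro!: L(2))
   qed
   then obtain W p q v where W: "open W" "u \<in> W" "!!s. s \<in> W ==> \<gamma> s = p + (s - q) *\<^sub>R v" by blast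
   note A = affine[OF W]
   have "\<forall>\<^sub>F s in nhds u. D s = D u" using A(2) W(1,2) unfolding eventually_nhds by blast
   then have "isCont D u = isCont (%_. D u) u" by (rule isCont_cong)
   then show ?thesis using A(1) by simp
  qed
  then show ?thesis using S(2) by (intro exI[of _ S]) (auto intro: continuous_at_imp_continuous_on)
 qed
 then show thesis using that[of D] cont R(2,3) by blast
qed

section \<open>Billiard trajectories as characteristics of the product\<close>

lemma body_translate:
 fixes K :: "'a::euclidean_space set"
 assumes K: "smooth_convex_body K" and a: "a \<in> interior K"
 shows "compact ((%q. q - a) ` K)" "convex ((%q. q - a) ` K)" "0 \<in> interior ((%q. q - a) ` K)"
  "!!x. x \<in> frontier ((%q. q - a) ` K) ==> \<exists>n. has_tangent ((%q. q - a) ` K) x n"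
proof -
 have K': "compact K" "convex K" using K by (auto simp: smooth_convex_body_def convex_body_def)
 show c: "compact ((%q. q - a) ` K)" by (rule compact_translation_subtract[OF K'(1)])
 show "convex ((%q. q - a) ` K)" by (rule convex_translation_subtract[OF K'(2)])
 have int: "interior ((%q. q - a) ` K) = (%q. q - a) ` interior K" by (rule interior_translation_subtract)
 show "0 \<in> interior ((%q. q - a) ` K)" unfolding int using a by (auto intro: image_eqI[of _ _ a])
 fix x assume x: "x \<in> frontier ((%q. q - a) ` K)"
 have "x + a \<in> frontier K"
 proof -
  have "x \<in> (%q. q - a) ` K" "x \<notin> (%q. q - a) ` interior K"
   using x compact_imp_closed[OF c] unfolding frontier_def int[symmetric] by auto
  then have "x + a \<in> K" "x + a \<notin> interior K" by (auto intro: image_eqI[of _ _ "x + a"])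
  then show ?thesis using compact_imp_closed[OF K'(1)] by (simp add: frontier_def)
 qed
 then obtain n where "has_tangent K (x + a) n" using smooth_body_tangent[OF K] by blast
 then show "\<exists>n. has_tangent ((%q. q - a) ` K) x n" using tangent_translate by blast
qed

lemma interior_normal_zero:
 fixes w x :: "'a::euclidean_space"
 assumes x: "x \<in> interior K" and w: "!!y. y \<in> K ==> w \<bullet> y <= w \<bullet> x"
 shows "w = 0"
proof (rule ccontr)
 assume w0: "w ~= 0"
 obtain e where e: "0 < e" "cball x e \<subseteq> K" using x by (auto simp: mem_interior_cball)
 have "x + (e / norm w) *\<^sub>R w \<in> cball x e" using e w0 by (simp add: dist_norm)
 from w[OF subsetD[OF e(2) this]] have "(e / norm w) * (w \<bullet> w) <= 0" by (simp add: inner_add_right)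
 moreover have "0 < (e / norm w) * (w \<bullet> w)" using e w0 by simp
 ultimately show False by linarith
qed

locale smooth_pair =
 fixes \<Delta> \<Lambda> :: "(real^'n::finite) set"
 assumes D: "compact \<Delta>" "convex \<Delta>" "0 \<in> interior \<Delta>" "!!x. x \<in> frontier \<Delta> ==> \<exists>n. has_tangent \<Delta> x n"
  and Lam: "compact \<Lambda>" "convex \<Lambda>" "0 \<in> interior \<Lambda>" "!!x. x \<in> frontier \<Lambda> ==> \<exists>n. has_tangent \<Lambda> x n"
begin

abbreviation "nD q \<equiv> grad (minkowski \<Delta>) q"
abbreviation "nL p \<equiv> grad (minkowski \<Lambda>) p"

lemma normals:
 shows "x \<in> frontier \<Delta> ==> nD x \<bullet> x = 1" "x \<in> frontier \<Delta> ==> y \<in> \<Delta> ==> nD x \<bullet> y <= 1"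
  "x \<in> frontier \<Delta> ==> (!!y. y \<in> \<Delta> ==> w \<bullet> y <= w \<bullet> x) ==> w = (w \<bullet> x) *\<^sub>R nD x \<and> 0 <= w \<bullet> x"
  "x \<in> frontier \<Lambda> ==> nL x \<bullet> x = 1" "x \<in> frontier \<Lambda> ==> y \<in> \<Lambda> ==> nL x \<bullet> y <= 1"
  "x \<in> frontier \<Lambda> ==> (!!y. y \<in> \<Lambda> ==> w \<bullet> y <= w \<bullet> x) ==> w = (w \<bullet> x) *\<^sub>R nL x \<and> 0 <= w \<bullet> x"
 using gauge_gradient[OF D(1-3), of x] D(4)[of x] gauge_gradient[OF Lam(1-3), of x] Lam(4)[of x] by blast+

lemma front: "x \<in> \<Delta> ==> x \<notin> interior \<Delta> ==> x \<in> frontier \<Delta>" "x \<in> \<Lambda> ==> x \<notin> interior \<Lambda> ==> x \<in> frontier \<Lambda>"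
 using closure_subset by (auto simp: frontier_def)

lemma frontier_prod: "z \<in> frontier (\<Delta> \<times> \<Lambda>) \<longleftrightarrow> fst z \<in> \<Delta> \<and> snd z \<in> \<Lambda> \<and> (fst z \<notin> interior \<Delta> \<or> snd z \<notin> interior \<Lambda>)"
 using compact_imp_closed[OF compact_Times[OF D(1) Lam(1)]] by (cases z) (auto simp: frontier_def interior_Times)

text \<open>Maximality over a product splits: \<open>snd v\<close> is normal to \<Delta> at q and -
  \<open>fst v\<close> is normal to \<Lambda> at p. A normal at an interior point is 0 and at a
  boundary point a nonnegative multiple of the gauge gradient; the two multiples add up to K, so
  they are not both 0.\<close>

lemma characteristic_velocity:
 assumes z: "z \<in> \<Delta> \<times> \<Lambda>" and K: "0 < K" "omega0 z v = K" and max: "!!\<zeta>. \<zeta> \<in> \<Delta> \<times> \<Lambda> ==> omega0 \<zeta> v <= K"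
 shows "z \<in> frontier (\<Delta> \<times> \<Lambda>)"
  "z \<notin> frontier \<Delta> \<times> frontier \<Lambda> ==> v = K *\<^sub>R billiard_field \<Delta> \<Lambda> z"
  "z \<in> frontier \<Delta> \<times> frontier \<Lambda> ==> v \<in> billiard_cone \<Delta> \<Lambda> z"
proof -
 obtain q p where zq: "z = (q, p)" by fastforce
 have qp: "q \<in> \<Delta>" "p \<in> \<Lambda>" using z zq by auto
 define a b where "a = - fst v" and "b = snd v"
 have v: "v = (- a, b)" by (simp add: a_def b_def)
 have om: "omega0 (q', p') v = b \<bullet> q' + a \<bullet> p'" for q' p' by (simp add: omega0_def v inner_commute)
 have Kab: "K = b \<bullet> q + a \<bullet> p" using K(2) by (simp add: zq om)
 have bm: "b \<bullet> y <= b \<bullet> q" if "y \<in> \<Delta>" for y using max[of "(y, p)"] that qp by (simp add: om Kab)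
 have am: "a \<bullet> y <= a \<bullet> p" if "y \<in> \<Lambda>" for y using max[of "(q, y)"] that qp by (simp add: om Kab)
 have b0: "b = 0" if "q \<in> interior \<Delta>" by (rule interior_normal_zero[OF that bm])
 have a0: "a = 0" if "p \<in> interior \<Lambda>" by (rule interior_normal_zero[OF that am])
 have nb: "b = (b \<bullet> q) *\<^sub>R nD q" "0 <= b \<bullet> q" if "q \<in> frontier \<Delta>" using normals(3)[OF that bm] by auto
 have na: "a = (a \<bullet> p) *\<^sub>R nL p" "0 <= a \<bullet> p" if "p \<in> frontier \<Lambda>" using normals(6)[OF that am] by auto
 show "z \<in> frontier (\<Delta> \<times> \<Lambda>)" unfolding frontier_prod using qp a0 b0 Kab K(1) zq by auto
 show "v = K *\<^sub>R billiard_field \<Delta> \<Lambda> z" if nf: "z \<notin> frontier \<Delta> \<times> frontier \<Lambda>"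
 proof (cases "q \<in> interior \<Delta>")
  case True
  have "p \<notin> interior \<Lambda>" using a0 b0[OF True] Kab K(1) by auto
  then have "a = K *\<^sub>R nL p" using na(1) front(2) qp Kab b0[OF True] by simp
  then show ?thesis using True b0[OF True] by (simp add: v zq billiard_field_def)
 next
  case False
  then have qf: "q \<in> frontier \<Delta>" using front qp by blast
  then have "p \<in> interior \<Lambda>" using nf front(2) qp by (auto simp: zq)
  note a0 = a0[OF this]
  have "b = K *\<^sub>R nD q" using nb(1)[OF qf] Kab a0 by simp
  then show ?thesis using False a0 by (simp add: v zq billiard_field_def)
 qed
 show "v \<in> billiard_cone \<Delta> \<Lambda> z" if "z \<in> frontier \<Delta> \<times> frontier \<Lambda>"
 proof -
  have f: "q \<in> frontier \<Delta>" "p \<in> frontier \<Lambda>" using that by (auto simp: zq)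
  have "v = - ((a \<bullet> p) *\<^sub>R (nL (snd z), 0)) + (b \<bullet> q) *\<^sub>R (0, nD (fst z))"
   using nb(1)[OF f(1)] na(1)[OF f(2)] by (simp add: v zq)
  moreover have "(a \<bullet> p, b \<bullet> q) ~= (0, 0)" using Kab K(1) by auto
  ultimately show ?thesis unfolding billiard_cone_def using nb(2)[OF f(1)] na(2)[OF f(2)] by blast
 qed
qed

text \<open>The converse of \<open>characteristic_velocity\<close> for velocities of arbitrary
  billiard trajectories: they are made of outer normals, whatever their speed.\<close>

lemma cone_normal:
 assumes z: "z \<in> frontier (\<Delta> \<times> \<Lambda>)"
  and v: "(z \<notin> frontier \<Delta> \<times> frontier \<Lambda> \<and> v = \<kappa> *\<^sub>R billiard_field \<Delta> \<Lambda> z) \<or> (z \<in> frontier \<Delta> \<times> frontier \<Lambda> \<and> v \<in> billiard_cone \<Delta> \<Lambda> z)"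
  and \<kappa>: "0 < \<kappa>"
 shows "y \<in> \<Lambda> ==> - fst v \<bullet> y <= - fst v \<bullet> snd z" "x \<in> \<Delta> ==> snd v \<bullet> x <= snd v \<bullet> fst z"
proof -
 note zf = z[unfolded frontier_prod]
 have "\<exists>l \<mu>. 0 <= l \<and> 0 <= \<mu> \<and> - fst v = l *\<^sub>R nL (snd z) \<and> snd v = \<mu> *\<^sub>R nD (fst z) \<and> (l = 0 \<or> snd z \<in> frontier \<Lambda>) \<and> (\<mu> = 0 \<or> fst z \<in> frontier \<Delta>)"
  using v
 proof (elim disjE conjE)
  assume v: "v = \<kappa> *\<^sub>R billiard_field \<Delta> \<Lambda> z"
  show ?thesis
  proof (cases "fst z \<in> interior \<Delta>")
   case True
   then have "snd z \<in> frontier \<Lambda>" using zf front by blast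
   then show ?thesis using v True \<kappa> by (intro exI[of _ \<kappa>] exI[of _ 0]) (simp add: billiard_field_def)
  next
   case False
   then have "fst z \<in> frontier \<Delta>" using zf front by blast
   then show ?thesis using v False \<kappa> by (intro exI[of _ 0] exI[of _ \<kappa>]) (simp add: billiard_field_def)
  qed
 next
  assume zz: "z \<in> frontier \<Delta> \<times> frontier \<Lambda>" and "v \<in> billiard_cone \<Delta> \<Lambda> z"
  then obtain l \<mu> where "0 <= l" "0 <= \<mu>" "v = - (l *\<^sub>R (nL (snd z), 0)) + \<mu> *\<^sub>R (0, nD (fst z))"
   unfolding billiard_cone_def by blast
  then show ?thesis using zz by (intro exI[of _ l] exI[of _ \<mu>]) auto
 qed
 then obtain l \<mu> where l: "0 <= l" "0 <= \<mu>" "- fst v = l *\<^sub>R nL (snd z)" "snd v = \<mu> *\<^sub>R nD (fst z)"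
  "l = 0 \<or> snd z \<in> frontier \<Lambda>" "\<mu> = 0 \<or> fst z \<in> frontier \<Delta>" by blast
 show "- fst v \<bullet> y <= - fst v \<bullet> snd z" if "y \<in> \<Lambda>"
  unfolding l(3) using l(1,5) normals(4,5)[of "snd z"] that by (cases "l = 0") (auto intro: mult_left_le)
 show "snd v \<bullet> x <= snd v \<bullet> fst z" if "x \<in> \<Delta>"
  unfolding l(4) using l(2,6) normals(1,2)[of "fst z"] that by (cases "\<mu> = 0") (auto intro: mult_left_le)
qed

lemma polygonal_loop_billiard0:
 assumes c: "0 < c" and \<gamma>: "polygonal_loop \<tau> (\<Delta> \<times> \<Lambda>) c \<gamma>"
 shows "billiard0 \<Delta> \<Lambda> \<gamma> 1"
proof -
 have "0 \<in> interior (\<Delta> \<times> \<Lambda>)" using D(3) Lam(3) by (simp add: interior_Times zero_prod_def)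
 then obtain r where r: "0 < r" "cball 0 r \<subseteq> \<Delta> \<times> \<Lambda>" by (auto simp: mem_interior_cball)
 obtain V where V: "!!X. continuous_on X \<gamma>"
  "!!a b. \<exists>S. finite S \<and> (\<forall>t\<in>{a..b} - S. (\<gamma> has_vector_derivative V t) (at t)) \<and> continuous_on ({a..b} - S) V"
  by (rule polygonal_loop_calculus[OF \<gamma> r]) (rule that)
 have c2: "0 < 2 * c" using c by simp
 have gC: "\<gamma> t \<in> \<Delta> \<times> \<Lambda>" for t using \<gamma> unfolding polygonal_loop_def by blast
 have "\<exists>d v. 0 < d \<and> omega0 (\<gamma> t) v = 2 * c \<and> (\<forall>\<zeta>\<in>\<Delta> \<times> \<Lambda>. omega0 \<zeta> v <= 2 * c) \<and> (\<forall>s\<in>{t..<t+d}. \<gamma> s = \<gamma> t + (s - t) *\<^sub>R v)" for t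
  using \<gamma> unfolding polygonal_loop_def by blast
 then obtain dR R where R: "!!t. 0 < dR t" "!!t. omega0 (\<gamma> t) (R t) = 2 * c" "!!t \<zeta>. \<zeta> \<in> \<Delta> \<times> \<Lambda> ==> omega0 \<zeta> (R t) <= 2 * c"
  "!!t s. s \<in> {t..<t + dR t} ==> \<gamma> s = \<gamma> t + (s - t) *\<^sub>R R t" by metis
 have "\<exists>d v. 0 < d \<and> omega0 (\<gamma> t) v = 2 * c \<and> (\<forall>\<zeta>\<in>\<Delta> \<times> \<Lambda>. omega0 \<zeta> v <= 2 * c) \<and> (\<forall>s\<in>{t-d<..t}. \<gamma> s = \<gamma> t + (s - t) *\<^sub>R v)" for t
  using \<gamma> unfolding polygonal_loop_def by blast
 then obtain dL L where L: "!!t. 0 < dL t" "!!t. omega0 (\<gamma> t) (L t) = 2 * c" "!!t \<zeta>. \<zeta> \<in> \<Delta> \<times> \<Lambda> ==> omega0 \<zeta> (L t) <= 2 * c"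
  "!!t s. s \<in> {t - dL t<..t} ==> \<gamma> s = \<gamma> t + (s - t) *\<^sub>R L t" by metis
 note cR = characteristic_velocity[OF gC c2 R(2) R(3)]
 note cL = characteristic_velocity[OF gC c2 L(2) L(3)]
 have aff: "((%s. \<gamma> t + (s - t) *\<^sub>R v) has_vector_derivative v) (at t within X)" for t v X
  by (auto intro!: derivative_eq_intros)
 have dR: "(\<gamma> has_vector_derivative R t) (at_right t)" for t
 proof -
  have "(\<gamma> has_vector_derivative R t) (at t within {t..})"
   by (rule has_vector_derivative_transform_within[OF aff R(1)[of t]]) (auto simp: dist_real_def intro!: R(4)[symmetric])
  then show ?thesis by (rule has_vector_derivative_within_subset) auto
 qed
 have dL: "(\<gamma> has_vector_derivative L t) (at_left t)" for t
 proof -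
  have "(\<gamma> has_vector_derivative L t) (at t within {..t})"
   by (rule has_vector_derivative_transform_within[OF aff L(1)[of t]]) (auto simp: dist_real_def intro!: L(4)[symmetric])
  then show ?thesis by (rule has_vector_derivative_within_subset) auto
 qed
 show ?thesis
  unfolding billiard0_def
 proof (intro conjI allI impI)
  show "\<gamma> (t + 1) = \<gamma> t" for t using \<gamma> unfolding polygonal_loop_def by blast
  show "continuous_on UNIV \<gamma>" by (rule V(1))
  show "\<gamma> piecewise_C1_differentiable_on {a..b}" for a b
  proof -
   obtain S where S: "finite S" "\<forall>t\<in>{a..b} - S. (\<gamma> has_vector_derivative V t) (at t)" "continuous_on ({a..b} - S) V"
    using V(2)[of a b] by (elim exE conjE) (rule that)
   show ?thesis unfolding piecewise_C1_differentiable_on_def C1_differentiable_on_def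
    by (intro conjI exI[of _ S] exI[of _ V] V(1) S)
  qed
  show "\<gamma> t \<in> frontier (\<Delta> \<times> \<Lambda>)" for t by (rule cR(1))
  show "\<exists>\<kappa>>0. (\<forall>t. \<gamma> t \<notin> frontier \<Delta> \<times> frontier \<Lambda> --> (\<gamma> has_vector_derivative (\<kappa> *\<^sub>R billiard_field \<Delta> \<Lambda> (\<gamma> t))) (at t)) \<and>
   (\<forall>t. \<gamma> t \<in> frontier \<Delta> \<times> frontier \<Lambda> -->
      (\<exists>v. (\<gamma> has_vector_derivative v) (at_left t) \<and> v \<in> billiard_cone \<Delta> \<Lambda> (\<gamma> t)) \<and>
      (\<exists>v. (\<gamma> has_vector_derivative v) (at_right t) \<and> v \<in> billiard_cone \<Delta> \<Lambda> (\<gamma> t)))"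
  proof (intro exI[of _ "2 * c"] conjI allI impI c2)
   fix t
   { assume nf: "\<gamma> t \<notin> frontier \<Delta> \<times> frontier \<Lambda>"
    \<comment> \<open>Off the corners the point determines the velocity, so the left and right
      velocities agree and the two affine pieces join to a derivative.\<close>
    have RL: "L t = R t" using cR(2)[OF _ nf] cL(2)[OF _ nf] by simp
    have "(\<gamma> has_vector_derivative R t) (at t)"
    proof (rule has_vector_derivative_transform_within_open[OF aff])
     show "open {t - dL t<..<t + dR t}" "t \<in> {t - dL t<..<t + dR t}" using R(1)[of t] L(1)[of t] by auto
     show "\<gamma> t + (s - t) *\<^sub>R R t = \<gamma> s" if "s \<in> {t - dL t<..<t + dR t}" for s
      using R(4)[of s t] L(4)[of s t] that RL by (cases "t <= s") auto
    qed
    then show "(\<gamma> has_vector_derivative (2 * c) *\<^sub>R billiard_field \<Delta> \<Lambda> (\<gamma> t)) (at t)" using cR(2)[OF _ nf] by simp }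
   { assume f: "\<gamma> t \<in> frontier \<Delta> \<times> frontier \<Lambda>"
    show "\<exists>v. (\<gamma> has_vector_derivative v) (at_left t) \<and> v \<in> billiard_cone \<Delta> \<Lambda> (\<gamma> t)" using dL cL(3)[OF _ f] by blast
    show "\<exists>v. (\<gamma> has_vector_derivative v) (at_right t) \<and> v \<in> billiard_cone \<Delta> \<Lambda> (\<gamma> t)" using dR cR(3)[OF _ f] by blast }
  qed
 qed simp
qed

end

section \<open>Actions of polygonal loops and of arbitrary billiard trajectories\<close>

lemma neg_J0_inner: "(- J0 v) \<bullet> w = omega0 w v"
 by (simp add: J0_def omega0_def inner_prod_def inner_commute)

text \<open>The area density is constantly 2 * c, and the translation by z0 only adds an exact term,
  which vanishes over a closed loop.\<close>

lemma polygonal_loop_action: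
 fixes z0 :: "'n::finite phase"
 assumes \<gamma>: "polygonal_loop \<tau> C c \<gamma>" and r: "0 < r" "cball 0 r \<subseteq> C"
 shows "action (%t. \<gamma> t + z0) 1 = c"
proof -
 obtain D where D: "!!X. continuous_on X \<gamma>" "!!t. omega0 (\<gamma> t) (D t) = 2 * c"
  "!!a b. \<exists>S. finite S \<and> (\<forall>t\<in>{a..b} - S. (\<gamma> has_vector_derivative D t) (at t)) \<and> continuous_on ({a..b} - S) D"
  by (rule polygonal_loop_calculus[OF \<gamma> r]) (rule that)
 obtain S where S: "finite S" "!!t. t \<in> {0..1} - S ==> (\<gamma> has_vector_derivative D t) (at t)" using D(3)[of 0 1] by blast
 have "((%t. omega0 z0 (D t)) has_integral omega0 z0 (\<gamma> 1) - omega0 z0 (\<gamma> 0)) {0..1}"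
 proof (rule fundamental_theorem_of_calculus_interior_strong[OF S(1)])
  show "((%t. omega0 z0 (\<gamma> t)) has_vector_derivative omega0 z0 (D t)) (at t)" if "t \<in> {0<..<1} - S" for t
  proof -
   have "(\<gamma> has_vector_derivative D t) (at t)" using S(2) that by auto
   from bounded_linear.has_vector_derivative[OF bounded_linear_inner_right[of "- J0 z0"] this]
   have "((%t. - ((- J0 z0) \<bullet> \<gamma> t)) has_vector_derivative - ((- J0 z0) \<bullet> D t)) (at t)" by (rule has_vector_derivative_minus)
   moreover have "- ((- J0 z0) \<bullet> w) = omega0 z0 w" for w unfolding neg_J0_inner by (simp add: omega0_def inner_commute)
   ultimately show ?thesis by simp
  qed
  show "continuous_on {0..1} (%t. omega0 z0 (\<gamma> t))" unfolding omega0_def by (intro continuous_intros D(1))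
 qed simp
 moreover have "\<gamma> 1 = \<gamma> 0" using \<gamma> unfolding polygonal_loop_def by (metis add_0)
 ultimately have "((%t. omega0 z0 (D t)) has_integral 0) {0..1}" by simp
 from has_integral_add[OF has_integral_unit_const[of "2 * c"] this]
 have "((%t. 2 * c + omega0 z0 (D t)) has_integral 2 * c) {0..1}" by simp
 then have fin: "((%t. (- J0 (vector_derivative (%t. \<gamma> t + z0) (at t))) \<bullet> (\<gamma> t + z0)) has_integral 2 * c) {0..1}"
 proof (rule has_integral_spike_finite[OF S(1), rotated])
  fix t assume t: "t \<in> {0..1} - S"
  have "((%t. \<gamma> t + z0) has_vector_derivative D t) (at t)"
   using has_vector_derivative_add[OF S(2)[OF t] has_vector_derivative_const[of z0]] by simp
  then have "vector_derivative (%t. \<gamma> t + z0) (at t) = D t" by (rule vector_derivative_at)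
  then show "(- J0 (vector_derivative (%t. \<gamma> t + z0) (at t))) \<bullet> (\<gamma> t + z0) = 2 * c + omega0 z0 (D t)"
   unfolding neg_J0_inner by (simp add: omega0_linear D(2))
 qed
 show ?thesis unfolding action_def integral_unique[OF fin] by simp
qed

text \<open>Billiard velocities are outer normals, so along the first half of the trajectory the
  support length equals the area a. The isoperimetric inequality reads c * a <= a^2, and by symmetry
  a is the whole action. The trajectory may be normalised at a centre other than z0; normality does
  not depend on this choice.\<close>

lemma billiard_action_ge:
 fixes \<tau> :: "'n::finite phase \<Rightarrow> 'n phase"
 assumes inv: "lin_antisymp_inv \<tau>" and D: "smooth_convex_body \<Delta>" and Lam: "smooth_convex_body \<Lambda>"
  and z0: "\<tau> z0 = z0"
  and iso: "isoperimetric \<tau> ((%q. q - fst z0) ` \<Delta>) ((%p. p - snd z0) ` \<Lambda>) c"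
  and \<gamma>: "brake_billiard \<tau> \<Delta> \<Lambda> \<gamma> T" and A: "0 < action \<gamma> T"
 shows "c <= action \<gamma> T"
proof -
 interpret antisymp_involution \<tau> by unfold_locales (rule inv)
 obtain qb pb where b: "qb \<in> interior \<Delta>" "pb \<in> interior \<Lambda>"
  "billiard0 ((%q. q - qb) ` \<Delta>) ((%p. p - pb) ` \<Lambda>) (%t. \<gamma> t - (qb, pb)) T"
  using \<gamma> unfolding brake_billiard_def billiard_def by blast
 define Db Lb where "Db = (%q. q - qb) ` \<Delta>" and "Lb = (%p. p - pb) ` \<Lambda>"
 interpret smooth_pair Db Lb
  unfolding Db_def Lb_def by unfold_locales (use body_translate[OF D b(1)] body_translate[OF Lam b(2)] in auto)
 define \<gamma>b where "\<gamma>b t = \<gamma> t - (qb, pb)" for t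
 have B: "billiard0 Db Lb \<gamma>b T" using b(3) unfolding Db_def Lb_def \<gamma>b_def .
 have T: "0 < T" and per: "\<gamma>b (t + T) = \<gamma>b t" and cb: "continuous_on UNIV \<gamma>b" and fr: "\<gamma>b t \<in> frontier (Db \<times> Lb)" for t
  using B unfolding billiard0_def by blast+
 have sym: "\<gamma> (T - t) = \<tau> (\<gamma> t)" for t using \<gamma> unfolding brake_billiard_def by blast
 have "\<exists>\<kappa>>0. (\<forall>t. \<gamma>b t \<notin> frontier Db \<times> frontier Lb -->
      (\<gamma>b has_vector_derivative (\<kappa> *\<^sub>R billiard_field Db Lb (\<gamma>b t))) (at t)) \<and>
    (\<forall>t. \<gamma>b t \<in> frontier Db \<times> frontier Lb -->
      (\<exists>v. (\<gamma>b has_vector_derivative v) (at_left t) \<and> v \<in> billiard_cone Db Lb (\<gamma>b t)) \<and>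
      (\<exists>v. (\<gamma>b has_vector_derivative v) (at_right t) \<and> v \<in> billiard_cone Db Lb (\<gamma>b t)))"
  using B unfolding billiard0_def by (elim conjE)
 then obtain \<kappa> where k: "0 < \<kappa>" "\<forall>t. \<gamma>b t \<notin> frontier Db \<times> frontier Lb -->
      (\<gamma>b has_vector_derivative (\<kappa> *\<^sub>R billiard_field Db Lb (\<gamma>b t))) (at t)"
  "\<forall>t. \<gamma>b t \<in> frontier Db \<times> frontier Lb -->
      (\<exists>v. (\<gamma>b has_vector_derivative v) (at_left t) \<and> v \<in> billiard_cone Db Lb (\<gamma>b t)) \<and>
      (\<exists>v. (\<gamma>b has_vector_derivative v) (at_right t) \<and> v \<in> billiard_cone Db Lb (\<gamma>b t))"
  by (elim exE conjE) (rule that)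
 note \<kappa> = k(1) k(2)[THEN spec, THEN mp] k(3)[THEN spec, THEN mp, THEN conjunct2]
 have "\<gamma>b piecewise_C1_differentiable_on {0..T}" using B unfolding billiard0_def by blast
 then obtain S V where S: "finite S" "!!t. t \<in> {0..T} - S ==> (\<gamma>b has_vector_derivative V t) (at t)"
  unfolding piecewise_C1_differentiable_on_def C1_differentiable_on_def by blast
 define y where "y t = \<gamma> t - z0" for t
 have yb: "y t = \<gamma>b t + ((qb, pb) - z0)" "\<gamma> t = \<gamma>b t + (qb, pb)" for t by (simp_all add: y_def \<gamma>b_def)
 have dy: "(y has_vector_derivative V t) (at t)" and dg: "(\<gamma> has_vector_derivative V t) (at t)" if "t \<in> {0..T} - S" for t
  using has_vector_derivative_add[OF S(2)[OF that] has_vector_derivative_const[of "(qb, pb) - z0"]]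
   has_vector_derivative_add[OF S(2)[OF that] has_vector_derivative_const[of "(qb, pb)"]] by (simp_all add: yb[abs_def])
 have cy: "continuous_on X y" for X
  unfolding yb[abs_def] by (intro continuous_intros continuous_on_subset[OF cb]) auto
 have cg: "continuous_on X \<gamma>" for X
  unfolding yb(2)[abs_def] by (intro continuous_intros continuous_on_subset[OF cb]) auto
 have normal: "y' \<in> Lb ==> - fst (V t) \<bullet> y' <= - fst (V t) \<bullet> snd (\<gamma>b t)" "x \<in> Db ==> snd (V t) \<bullet> x <= snd (V t) \<bullet> fst (\<gamma>b t)"
  if t: "t \<in> {0..T} - S" for t y' x
 proof -
  have "(\<gamma>b t \<notin> frontier Db \<times> frontier Lb \<and> V t = \<kappa> *\<^sub>R billiard_field Db Lb (\<gamma>b t)) \<or> (\<gamma>b t \<in> frontier Db \<times> frontier Lb \<and> V t \<in> billiard_cone Db Lb (\<gamma>b t))"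
  proof (cases "\<gamma>b t \<in> frontier Db \<times> frontier Lb")
   case True
   from \<kappa>(3)[OF True] obtain v where v: "(\<gamma>b has_vector_derivative v) (at_right t)" "v \<in> billiard_cone Db Lb (\<gamma>b t)" by blast
   have "(\<gamma>b has_vector_derivative V t) (at_right t)" by (rule has_vector_derivative_at_within[OF S(2)[OF t]])
   from vector_derivative_unique_within[OF _ this v(1)] have "V t = v" by (simp add: trivial_limit_at_right_real)
   then show ?thesis using True v(2) by blast
  next
   case False
   then show ?thesis using vector_derivative_unique_at[OF S(2)[OF t] \<kappa>(2)[OF False]] by blast
  qed
  from cone_normal[OF fr this \<kappa>(1)] show "y' \<in> Lb ==> - fst (V t) \<bullet> y' <= - fst (V t) \<bullet> snd (\<gamma>b t)"
   "x \<in> Db ==> snd (V t) \<bullet> x <= snd (V t) \<bullet> fst (\<gamma>b t)" by blast+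
 qed
 \<comment> \<open>These are the support functions of the bodies centred at z0, because the velocity
   is normal at the current point; their sum is the area density.\<close>
 define ka kb where "ka t = - (snd (y t) \<bullet> fst (V t))" and "kb t = fst (y t) \<bullet> snd (V t)" for t
 have ka: "supp ((%p. p - snd z0) ` \<Lambda>) (- fst (V t)) <= ka t" if t: "t \<in> {0..T} - S" for t
 proof (rule supp_least)
  show "(%p. p - snd z0) ` \<Lambda> ~= {}" using b(2) interior_subset by auto
  fix x assume "x \<in> (%p. p - snd z0) ` \<Lambda>"
  then obtain l where l: "l \<in> \<Lambda>" "x = l - snd z0" by blast
  have "l - pb \<in> Lb" using l by (simp add: Lb_def)
  from normal(1)[OF t this] show "x \<bullet> - fst (V t) <= ka t"
   unfolding ka_def yb(1) l(2) by (simp add: inner_diff_left inner_diff_right inner_add_left inner_add_right inner_commute)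
 qed
 have kb: "supp ((%q. q - fst z0) ` \<Delta>) (snd (V t)) <= kb t" if t: "t \<in> {0..T} - S" for t
 proof (rule supp_least)
  show "(%q. q - fst z0) ` \<Delta> ~= {}" using b(1) interior_subset by auto
  fix x assume "x \<in> (%q. q - fst z0) ` \<Delta>"
  then obtain l where l: "l \<in> \<Delta>" "x = l - fst z0" by blast
  have "l - qb \<in> Db" using l by (simp add: Db_def)
  from normal(2)[OF t this] show "x \<bullet> snd (V t) <= kb t"
   unfolding kb_def yb(1) l(2) by (simp add: inner_diff_left inner_diff_right inner_add_left inner_add_right inner_commute)
 qed
 have gT: "\<gamma> T = \<gamma> 0" using per[of 0] by (simp add: \<gamma>b_def)
 have J: "((%t. (- J0 (vector_derivative \<gamma> (at t))) \<bullet> \<gamma> t) has_integral 2 * action \<gamma> T) {0..T}"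
 proof -
  \<comment> \<open>A non-integrable density would have the integral 0 by convention, contrary to
    the positive action.\<close>
  have "(%t. (- J0 (vector_derivative \<gamma> (at t))) \<bullet> \<gamma> t) integrable_on {0..T}"
  proof (rule ccontr)
   assume n: "\<not> ?thesis"
   have "action \<gamma> T = 0" unfolding action_def not_integrable_integral[OF n] by simp
   then show False using A by simp
  qed
  from integrable_integral[OF this] show ?thesis unfolding action_def by (simp only: mult.assoc[symmetric]) simp
 qed
 have oV: "((%t. omega0 z0 (V t)) has_integral omega0 z0 (\<gamma> T) - omega0 z0 (\<gamma> 0)) {0..T}"
 proof (rule fundamental_theorem_of_calculus_interior_strong[OF S(1)])
  show "0 <= T" using T by simp
  show "((%t. omega0 z0 (\<gamma> t)) has_vector_derivative omega0 z0 (V t)) (at t)" if "t \<in> {0<..<T} - S" for t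
  proof -
   have "(\<gamma> has_vector_derivative V t) (at t)" using dg that by auto
   from bounded_linear.has_vector_derivative[OF bounded_linear_inner_right[of "- J0 z0"] this]
   have "((%t. - ((- J0 z0) \<bullet> \<gamma> t)) has_vector_derivative - ((- J0 z0) \<bullet> V t)) (at t)" by (rule has_vector_derivative_minus)
   moreover have "- ((- J0 z0) \<bullet> w) = omega0 z0 w" for w unfolding neg_J0_inner by (simp add: omega0_def inner_commute)
   ultimately show ?thesis by simp
  qed
  show "continuous_on {0..T} (%t. omega0 z0 (\<gamma> t))" unfolding omega0_def by (intro continuous_intros cg)
 qed
 have W: "((%t. omega0 (y t) (V t)) has_integral 2 * action \<gamma> T) {0..T}"
 proof -
  have "((%t. (- J0 (vector_derivative \<gamma> (at t))) \<bullet> \<gamma> t - omega0 z0 (V t)) has_integral 2 * action \<gamma> T - 0) {0..T}"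
   using has_integral_diff[OF J oV] unfolding gT by simp
  then have "((%t. omega0 (y t) (V t)) has_integral 2 * action \<gamma> T - 0) {0..T}"
  proof (rule has_integral_spike_finite[OF S(1), rotated])
   fix t assume "t \<in> {0..T} - S"
   from vector_derivative_at[OF dg[OF this]] show "omega0 (y t) (V t) = (- J0 (vector_derivative \<gamma> (at t))) \<bullet> \<gamma> t - omega0 z0 (V t)"
    unfolding neg_J0_inner y_def by (simp add: omega0_linear)
  qed
  then show ?thesis by simp
 qed
 define h where "h = T / 2"
 have h: "0 < h" "h < T" "T - h = h" using T by (auto simp: h_def)
 define a where "a = integral {0..h} (%t. omega0 (y t) (V t))"
 have ia: "((%t. omega0 (y t) (V t)) has_integral a) {0..h}"
  unfolding a_def by (intro integrable_integral integrable_subinterval_real[OF has_integral_integrable[OF W]]) (use h in auto)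
 \<comment> \<open>The substitution of T - t for t and the involution turn the second half into the
   first: the velocity becomes minus its image, and this sign cancels that of \<tau>. Each half
   carries half of the integral 2 * action.\<close>
 have aA: "a = action \<gamma> T"
 proof -
  have i2: "(%t. omega0 (y t) (V t)) integrable_on {h..T}"
   by (rule integrable_subinterval_real[OF has_integral_integrable[OF W]]) (use h in auto)
  define b' where "b' = integral {h..T} (%t. omega0 (y t) (V t))"
  have i2': "((%t. omega0 (y t) (V t)) has_integral b') (cbox h T)" using integrable_integral[OF i2] by (simp add: b'_def)
  have "((%t. omega0 (y (T - t)) (V (T - t))) has_integral b') {0..h}"
  proof -
   have im: "(%x::real. (1 / - 1) *\<^sub>R x + - ((1 / - 1) *\<^sub>R T)) ` cbox h T = {0..h}"
   proof -
    have "(%x::real. T - x) ` {h..T} = {0..h}"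
     by (auto simp: image_iff intro!: bexI[of _ "T - _"]) (use h in auto)
    then show ?thesis by (simp add: add.commute)
   qed
   show ?thesis using has_integral_affinity[OF i2', of "- 1" T] unfolding im by (simp add: add.commute)
  qed
  then have "((%t. omega0 (y t) (V t)) has_integral b') {0..h}"
  proof (rule has_integral_spike_finite[of "insert 0 (S \<union> (%t. T - t) ` S)", rotated 2])
   show "finite (insert 0 (S \<union> (%t. T - t) ` S))" using S(1) by simp
   fix t assume t: "t \<in> {0..h} - insert 0 (S \<union> (%t. T - t) ` S)"
   have t1: "t \<in> {0..T} - S" "T - t \<in> {0..T} - S" using t h by (auto simp: image_iff)
   have "((%s. \<gamma> (T - s)) has_vector_derivative (- 1) *\<^sub>R V (T - t)) (at t)"
   proof -
    have "((%s. T - s) has_vector_derivative - 1) (at t)"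
     unfolding has_real_derivative_iff_has_vector_derivative[symmetric] by (auto intro!: derivative_eq_intros)
    from vector_diff_chain_at[OF this dg[OF t1(2)]] show ?thesis by (simp add: o_def)
   qed
   moreover have "((%s. \<gamma> (T - s)) has_vector_derivative \<tau> (V t)) (at t)"
    unfolding sym by (rule bounded_linear.has_vector_derivative[OF linear_conv_bounded_linear[THEN iffD1, OF lin] dg[OF t1(1)]])
   ultimately have "(- 1) *\<^sub>R V (T - t) = \<tau> (V t)" by (rule vector_derivative_unique_at)
   then have VT: "V (T - t) = - \<tau> (V t)" by (metis minus_minus scaleR_minus1_left)
   have "y (T - t) = \<tau> (y t)" unfolding y_def sym by (simp add: linear_diff[OF lin] z0)
   then show "omega0 (y t) (V t) = omega0 (y (T - t)) (V (T - t))" by (simp add: VT omega0_linear anti)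
  qed
  then have "b' = a" using ia by (rule has_integral_unique)
  moreover have "((%t. omega0 (y t) (V t)) has_integral a + b') {0..T}"
   by (rule has_integral_combine[OF _ _ ia]) (use h i2' in auto)
  then have "2 * action \<gamma> T = a + b'" using W has_integral_unique by blast
  ultimately show ?thesis by simp
 qed
 have bd: "((%t. fst (y t) \<bullet> snd (V t) + fst (V t) \<bullet> snd (y t)) has_integral (fst (y h) \<bullet> snd (y h) - fst (y 0) \<bullet> snd (y 0))) {0..h}"
 proof (rule fundamental_theorem_of_calculus_interior_strong[OF S(1)])
  fix t assume t: "t \<in> {0<..<h} - S"
  then have d: "(y has_vector_derivative V t) (at t)" using dy h by auto
  show "((%t. fst (y t) \<bullet> snd (y t)) has_vector_derivative fst (y t) \<bullet> snd (V t) + fst (V t) \<bullet> snd (y t)) (at t)"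
   using bounded_bilinear.has_vector_derivative[OF bounded_bilinear_inner
    bounded_linear.has_vector_derivative[OF bounded_linear_fst d] bounded_linear.has_vector_derivative[OF bounded_linear_snd d]] .
 qed (use h in \<open>auto intro!: continuous_intros cy\<close>)
 have ika: "ka integrable_on {0..h}"
  using has_integral_mult_right[OF has_integral_diff[OF ia bd], of "1/2"]
  by (rule has_integral_integrable[OF has_integral_eq[rotated]]) (simp add: ka_def omega0_def inner_commute)
 have ikb: "kb integrable_on {0..h}"
  using has_integral_mult_right[OF has_integral_add[OF ia bd], of "1/2"]
  by (rule has_integral_integrable[OF has_integral_eq[rotated]]) (simp add: kb_def omega0_def inner_commute)
 have sum: "integral {0..h} ka + integral {0..h} kb = a"
 proof -
  have "((%t. ka t + kb t) has_integral integral {0..h} ka + integral {0..h} kb) {0..h}"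
   by (intro has_integral_add integrable_integral ika ikb)
  moreover have "(%t. ka t + kb t) = (%t. omega0 (y t) (V t))" by (simp add: ka_def kb_def omega0_def fun_eq_iff)
  ultimately show ?thesis using ia has_integral_unique by metis
 qed
 have y0: "y 0 \<in> Fix \<tau>" "y h \<in> Fix \<tau>"
  using sym[of 0] sym[of h] h(3) gT by (auto simp: Fix_def y_def linear_diff[OF lin] z0)
 have "c * a <= (integral {0..h} ka + integral {0..h} kb)\<^sup>2"
 proof (rule isoperimetric_phase[OF iso _ S(1) cy _ _ _ ika ikb y0 ia])
  show "0 <= h" using h by simp
  fix t assume "t \<in> {0<..<h} - S"
  then have t: "t \<in> {0..T} - S" using h by auto
  show "(y has_vector_derivative V t) (at t)" by (rule dy[OF t])
  show "supp ((%p. p - snd z0) ` \<Lambda>) (- fst (V t)) <= ka t" by (rule ka[OF t])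
  show "supp ((%q. q - fst z0) ` \<Delta>) (snd (V t)) <= kb t" by (rule kb[OF t])
 qed
 then have "a * c <= a * a" unfolding sum by (simp add: power2_eq_square mult.commute)
 then show ?thesis using A aA by simp
qed

section \<open>Symplectic coordinates adapted to the involution\<close>

text \<open>As a Lagrangian space, the fixed space is the Euclidean orthogonal complement of its own
  image under \<open>J0\<close>, so its dimension is half of the total.\<close>

lemma (in antisymp_involution) dim_Fix: "dim (Fix \<tau>) = CARD('n)"
proof -
 have lJ: "linear (J0 :: 'n phase \<Rightarrow> _)" by (rule bounded_linear.linear[OF bounded_linear_J0])
 have iJ: "inj (J0 :: 'n phase \<Rightarrow> _)" by (rule injI) (simp add: J0_def prod_eq_iff)
 have "{y \<in> UNIV. \<forall>x \<in> J0 ` Fix \<tau>. orthogonal x y} = Fix \<tau>"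
 proof -
  have "orthogonal (J0 l) y \<longleftrightarrow> omega0 y l = 0" for l y :: "'n phase"
   using neg_J0_inner[of l y, symmetric] by (simp add: orthogonal_def)
  then show ?thesis using Fix_maximal Fix_isotropic by auto
 qed
 moreover have "dim {y \<in> UNIV. \<forall>x \<in> J0 ` Fix \<tau>. orthogonal x y} + dim (J0 ` Fix \<tau>) = dim (UNIV :: 'n phase set)"
  by (rule dim_subspace_orthogonal_to_vectors) (auto intro: linear_subspace_image[OF lJ] Fix_subspace)
 moreover have "dim (J0 ` Fix \<tau>) = dim (Fix \<tau>)"
  by (rule dim_image_eq[OF lJ]) (rule inj_on_subset[OF iJ], simp)
 ultimately show ?thesis by simp
qed

text \<open>The configuration part is an isometry P onto the fixed space. The momentum part R takes
  the anti-invariant component of \<open>J0 (P b)\<close>: its image is isotropic too, and it is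
  dual to P since averaging with \<tau> does not change the pairing with fixed vectors.\<close>

lemma (in antisymp_involution) symplectic_coordinates:
 obtains \<Psi> \<Phi> :: "'n phase \<Rightarrow> 'n phase" where "linear \<Psi>" "linear \<Phi>" "!!z. \<Phi> (\<Psi> z) = z" "!!z. \<Psi> (\<Phi> z) = z"
  "!!z w. omega0 (\<Psi> z) (\<Psi> w) = omega0 z w" "!!z. \<tau> (\<Psi> z) = \<Psi> (fst z, - snd z)"
proof -
 have d: "dim (UNIV :: (real^'n) set) = dim (Fix \<tau>)" by (simp add: dim_Fix)
 obtain P :: "real^'n \<Rightarrow> 'n phase" where P: "linear P" "P ` UNIV = Fix \<tau>" "!!x. x \<in> UNIV ==> norm (P x) = norm x"
  by (rule isometry_subspaces[OF subspace_UNIV Fix_subspace d]) (rule that)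
 have PF: "P a \<in> Fix \<tau>" for a using P(2) by blast
 have tP: "\<tau> (P a) = P a" for a using PF[of a] by (simp add: Fix_def)
 have iP: "P a \<bullet> P b = a \<bullet> b" for a b
  unfolding dot_norm linear_add[OF P(1), symmetric] using P(3) by simp
 have lJ: "linear (J0 :: 'n phase \<Rightarrow> _)" by (rule bounded_linear.linear[OF bounded_linear_J0])
 define R where "R b = (1/2) *\<^sub>R (J0 (P b) - \<tau> (J0 (P b)))" for b
 have tR: "\<tau> (R b) = - R b" for b
  by (simp add: R_def linear_scale[OF lin] linear_diff[OF lin] scaleR_diff_right)
 have lR: "linear R"
  by (rule linearI) (simp_all add: R_def linear_add[OF P(1)] linear_add[OF lJ] linear_add[OF lin] linear_scale[OF P(1)] linear_scale[OF lJ]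
    linear_scale[OF lin] scaleR_diff_right scaleR_add_right)
 have skew: "omega0 z w = - omega0 w z" for z w :: "'n phase" by (simp add: omega0_def inner_commute)
 have PP: "omega0 (P a) (P b) = 0" for a b by (rule Fix_isotropic[OF PF PF])
 have PR: "omega0 (P a) (R b) = a \<bullet> b" for a b
 proof -
  have "omega0 (P a) (\<tau> (J0 (P b))) = - omega0 (P a) (J0 (P b))" using anti[of "P a" "J0 (P b)"] by (simp add: tP)
  then show ?thesis by (simp add: R_def omega0_linear omega0_J0 iP)
 qed
 have RR: "omega0 (R a) (R b) = 0" for a b using anti[of "R a" "R b"] by (simp add: tR omega0_linear)
 define \<Psi> where "\<Psi> z = P (fst z) + R (snd z)" for z :: "'n phase"
 have l: "linear \<Psi>"
  by (rule linearI) (simp_all add: \<Psi>_def linear_add[OF P(1)] linear_add[OF lR] linear_scale[OF P(1)] linear_scale[OF lR] scaleR_add_right)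
 have om: "omega0 (\<Psi> z) (\<Psi> w) = omega0 z w" for z w
 proof -
  have "omega0 (R (snd z)) (P (fst w)) = - (snd z \<bullet> fst w)" using PR[of "fst w" "snd z"] skew[of "R (snd z)"] by (simp add: inner_commute)
  then show ?thesis by (simp add: \<Psi>_def omega0_linear PP RR PR) (simp add: omega0_def)
 qed
 have "inj \<Psi>"
 proof (rule injI)
  fix z w assume zw: "\<Psi> z = \<Psi> w"
  have "omega0 u z = omega0 u w" for u using om[of u z] om[of u w] zw by simp
  then show "z = w" by (rule omega0_nondegenerate)
 qed
 then obtain \<Phi> where "linear \<Phi>" "\<forall>x. \<Phi> (\<Psi> x) = x" "\<forall>x. \<Psi> (\<Phi> x) = x"
  using linear_injective_isomorphism[OF l] by blast
 moreover have "\<tau> (\<Psi> z) = \<Psi> (fst z, - snd z)" for z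
  by (simp add: \<Psi>_def linear_add[OF lin] tP tR linear_neg[OF lR])
 ultimately show thesis using that[of \<Psi> \<Phi>] l om by blast
qed

section \<open>The upper bound for the capacity\<close>

text \<open>Off K the extension is locally constant and on U it agrees with f. The second clause
  says that the partial derivatives have a plateau at 0, so the lemma applies to them again.\<close>

lemma constant_extension_derivative:
 fixes f :: "'a::euclidean_space \<Rightarrow> real"
 assumes U: "open U" and K: "compact K" "K \<subseteq> U"
  and f: "!!x. x \<in> U ==> (f has_derivative (%v. \<Sum>i\<in>Basis. (v \<bullet> i) * g i x)) (at x)"
  and m: "!!x. x \<in> U - K ==> f x = m"
 shows "((%x. if x \<in> U then f x else m) has_derivative (%v. \<Sum>i\<in>Basis. (v \<bullet> i) * (if x \<in> U then g i x else 0))) (at x)"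
  "x \<in> U - K ==> i \<in> Basis ==> g i x = 0"
proof -
 let ?F = "%x. if x \<in> U then f x else m"
 have out: "(?F has_derivative (%v. 0)) (at x)" if "x \<notin> K" for x
  by (rule has_derivative_transform_within_open[OF has_derivative_const[of m], of "- K"])
   (use that m compact_imp_closed[OF K(1)] in auto)
 have ins: "(?F has_derivative (%v. \<Sum>i\<in>Basis. (v \<bullet> i) * g i x)) (at x)" if "x \<in> U" for x
  by (rule has_derivative_transform_within_open[OF f[OF that] U that]) simp
 show z: "g i x = 0" if x: "x \<in> U - K" and i: "i \<in> Basis" for x i
 proof -
  have "(%v. 0) = (%v. \<Sum>i\<in>Basis. (v \<bullet> i) * g i x)"
   by (rule has_derivative_unique[OF out ins]) (use x in auto)
  from fun_cong[OF this, of i] have "0 = (\<Sum>l\<in>Basis. (i \<bullet> l) * g l x)" .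
  also have "\<dots> = (\<Sum>l\<in>Basis. if i = l then g l x else 0)" by (rule sum.cong[OF refl]) (simp add: inner_Basis i)
  also have "\<dots> = g i x" using i by simp
  finally show ?thesis by simp
 qed
 show "(?F has_derivative (%v. \<Sum>i\<in>Basis. (v \<bullet> i) * (if x \<in> U then g i x else 0))) (at x)"
 proof (cases "x \<in> U")
  case True then show ?thesis using ins by simp
 next
  case False
  then have "x \<notin> K" using K(2) by blast
  from out[OF this] show ?thesis using False by simp
 qed
qed

text \<open>The extension is made for H and then for its partial derivatives; the second derivatives
  vanish off the compact set K and are bounded on it, which gives a global Lipschitz constant for
  the gradient.\<close>

lemma plateau_lipschitz:
 fixes H :: "'a::euclidean_space \<Rightarrow> real"
 assumes U: "open U" and K: "compact K" "K \<subseteq> U" and H: "C_inf U H" and m: "!!z. z \<in> U - K ==> H z = m"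
 obtains gH L where "!!z. ((%z. if z \<in> U then H z else m) has_derivative (%v. v \<bullet> gH z)) (at z)"
  "!!z w. norm (gH z - gH w) <= L * norm (z - w)"
proof -
 obtain g where g: "!!x. x \<in> U ==> (H has_derivative (%v. \<Sum>i\<in>Basis. (v \<bullet> i) * g i x)) (at x)" "!!i. i \<in> Basis ==> C_inf U (g i)"
  by (rule C_infD[OF H]) (rule that)
 have "\<exists>h. (\<forall>x\<in>U. (g i has_derivative (%v. \<Sum>j\<in>Basis. (v \<bullet> j) * h j x)) (at x)) \<and> (\<forall>j\<in>Basis. C_inf U (h j))" if i: "i \<in> Basis" for i
 proof -
  obtain h where "!!x. x \<in> U ==> (g i has_derivative (%v. \<Sum>j\<in>Basis. (v \<bullet> j) * h j x)) (at x)" "!!j. j \<in> Basis ==> C_inf U (h j)"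
   by (rule C_infD[OF g(2)[OF i]]) (rule that)
  then show ?thesis by (intro exI[of _ h] conjI ballI)
 qed
 then have "\<exists>h. \<forall>i\<in>Basis. (\<forall>x\<in>U. (g i has_derivative (%v. \<Sum>j\<in>Basis. (v \<bullet> j) * h i j x)) (at x)) \<and> (\<forall>j\<in>Basis. C_inf U (h i j))"
  by (intro bchoice ballI)
 then obtain h where hh: "\<forall>i\<in>Basis. (\<forall>x\<in>U. (g i has_derivative (%v. \<Sum>j\<in>Basis. (v \<bullet> j) * h i j x)) (at x)) \<and> (\<forall>j\<in>Basis. C_inf U (h i j))"
  by (elim exE) (rule that)
 have h: "(g i has_derivative (%v. \<Sum>j\<in>Basis. (v \<bullet> j) * h i j x)) (at x)" if "i \<in> Basis" "x \<in> U" for i x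
  by (rule hh[THEN bspec, OF that(1), THEN conjunct1, THEN bspec, OF that(2)])
 have h2: "C_inf U (h i j)" if "i \<in> Basis" "j \<in> Basis" for i j
  by (rule hh[THEN bspec, OF that(1), THEN conjunct2, THEN bspec, OF that(2)])
 have E1: "((%x. if x \<in> U then H x else m) has_derivative (%v. \<Sum>i\<in>Basis. (v \<bullet> i) * (if x \<in> U then g i x else 0))) (at x)" for x
  by (rule constant_extension_derivative(1)[where K = K and g = g, OF U K g(1) m]) assumption+
 have E2: "g i x = 0" if "x \<in> U - K" "i \<in> Basis" for x i
  by (rule constant_extension_derivative(2)[where f = H and K = K and g = g and m = m, OF U K g(1) m that]) assumption+
 define G where "G i x = (if x \<in> U then g i x else 0)" for i x
 have EG: "(G i has_derivative (%v. \<Sum>j\<in>Basis. (v \<bullet> j) * (if x \<in> U then h i j x else 0))) (at x)"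
  "x \<in> U - K ==> j \<in> Basis ==> h i j x = 0" if i: "i \<in> Basis" for i j x
 proof -
  show "(G i has_derivative (%v. \<Sum>j\<in>Basis. (v \<bullet> j) * (if x \<in> U then h i j x else 0))) (at x)"
   unfolding G_def[abs_def]
   by (rule constant_extension_derivative(1)[where K = K and g = "h i" and f = "g i" and m = 0, OF U K h[OF i] E2[OF _ i]]) assumption+
  assume x: "x \<in> U - K" "j \<in> Basis"
  show "h i j x = 0"
   by (rule constant_extension_derivative(2)[where K = K and g = "h i" and f = "g i" and m = 0, OF U K h[OF i] E2[OF _ i] x]) assumption+
 qed
 have "\<exists>B. \<forall>z w. norm (G i z - G i w) <= B * norm (z - w)" if i: "i \<in> Basis" for i
 proof -
  have "\<exists>B. \<forall>x\<in>K. norm (h i j x) <= B" if j: "j \<in> Basis" for j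
  proof -
   obtain q where q: "!!x. x \<in> U ==> (h i j has_derivative (%v. \<Sum>l\<in>Basis. (v \<bullet> l) * q l x)) (at x)"
    by (rule C_infD[OF h2[OF i j]]) (rule that)
   have "continuous_on K (h i j)"
    by (rule continuous_at_imp_continuous_on) (use q K(2) has_derivative_continuous in blast)
   from compact_imp_bounded[OF compact_continuous_image[OF this K(1)]] show ?thesis
    unfolding bounded_iff by auto
  qed
  then obtain B where B: "!!j x. j \<in> Basis ==> x \<in> K ==> norm (h i j x) <= B j" by metis
  have hb: "norm (if x \<in> U then h i j x else 0) <= \<bar>B j\<bar>" if j: "j \<in> Basis" for j x
   using B[OF j, of x] EG(2)[OF i, of x j] j by (cases "x \<in> K") auto
  have "norm (G i z - G i w) <= (\<Sum>j\<in>Basis. \<bar>B j\<bar>) * norm (z - w)" for z w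
  proof (rule differentiable_bound[OF convex_UNIV, of "G i" "%x v. \<Sum>j\<in>Basis. (v \<bullet> j) * (if x \<in> U then h i j x else 0)"])
   show "(G i has_derivative (%v. \<Sum>j\<in>Basis. (v \<bullet> j) * (if x \<in> U then h i j x else 0))) (at x within UNIV)" for x
    using EG(1)[OF i] by simp
   show "onorm (%v. \<Sum>j\<in>Basis. (v \<bullet> j) * (if x \<in> U then h i j x else 0)) <= (\<Sum>j\<in>Basis. \<bar>B j\<bar>)" for x
   proof (rule onorm_le)
    fix v :: 'a
    have "norm (\<Sum>j\<in>Basis. (v \<bullet> j) * (if x \<in> U then h i j x else 0)) <= (\<Sum>j\<in>Basis. norm v * \<bar>B j\<bar>)"
    proof (rule sum_norm_le)
     fix j :: 'a assume j: "j \<in> Basis"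
     show "norm ((v \<bullet> j) * (if x \<in> U then h i j x else 0)) <= norm v * \<bar>B j\<bar>"
      unfolding norm_mult by (rule mult_mono) (use Basis_le_norm[OF j, of v] hb[OF j, of x] in auto)
    qed
    then show "norm (\<Sum>j\<in>Basis. (v \<bullet> j) * (if x \<in> U then h i j x else 0)) <= (\<Sum>j\<in>Basis. \<bar>B j\<bar>) * norm v"
     by (simp only: sum_distrib_left[symmetric] mult.commute)
   qed
  qed auto
  then show ?thesis by blast
 qed
 then obtain B where B: "!!i z w. i \<in> Basis ==> norm (G i z - G i w) <= B i * norm (z - w)" by metis
 define gH where "gH z = (\<Sum>i\<in>Basis. G i z *\<^sub>R i)" for z :: 'a
 show thesis
 proof (rule that[of gH "\<Sum>i\<in>Basis. B i"])
  fix z w :: 'a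
  have "v \<bullet> gH z = (\<Sum>i\<in>Basis. (v \<bullet> i) * (if z \<in> U then g i z else 0))" for v
   by (simp add: gH_def G_def inner_sum_right mult.commute)
  then show "((%z. if z \<in> U then H z else m) has_derivative (%v. v \<bullet> gH z)) (at z)" using E1[of z] by simp
  have "norm (gH z - gH w) = norm (\<Sum>i\<in>Basis. (G i z - G i w) *\<^sub>R i)"
   by (simp add: gH_def sum_subtractf scaleR_diff_left)
  also have "\<dots> <= (\<Sum>i\<in>Basis. B i * norm (z - w))"
  proof (rule sum_norm_le)
   fix i :: 'a assume "i \<in> Basis"
   then show "norm ((G i z - G i w) *\<^sub>R i) <= B i * norm (z - w)" using B[of i z w] by simp
  qed
  finally show "norm (gH z - gH w) <= (\<Sum>i\<in>Basis. B i) * norm (z - w)" by (simp only: sum_distrib_right)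
 qed
qed

lemma omega0_bounded_linear: "bounded_linear (omega0 z)"
proof -
 have "omega0 z = (%w. fst z \<bullet> snd w - snd z \<bullet> fst w)" by (simp add: omega0_def fun_eq_iff)
 then show ?thesis
  by (auto intro!: bounded_linear_sub bounded_linear_compose[OF bounded_linear_inner_right bounded_linear_fst]
    bounded_linear_compose[OF bounded_linear_inner_right bounded_linear_snd])
qed

text \<open>Fejer averaging has a positive kernel of mass one, so it preserves the increment
  inequality and hence the support bound on the velocity. The velocities need not converge; uniform
  convergence of the loops and bounded velocities suffice for the areas.\<close>

lemma loop_approximation:
 fixes f :: "real \<Rightarrow> 'n::finite phase"
 assumes f: "brake_loop f" and c: "0 < c" and K: "compact K" "convex K" "0 \<in> interior K"
  and inc: "!!t t' \<zeta>. t <= t' ==> \<zeta> \<in> K ==> omega0 \<zeta> (f t' - f t) <= 2 * c * (t' - t)"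
  and S: "finite S" and F: "!!t. t \<in> {0..1} - S ==> (f has_vector_derivative F t) (at t)"
  and F1: "!!t. omega0 (f t) (F t) = 2 * c" and F2: "!!t \<zeta>. \<zeta> \<in> K ==> omega0 \<zeta> (F t) <= 2 * c"
  and e: "0 < e"
 shows "\<exists>M d. c - e <= act M d \<and> (\<forall>z t. z \<bullet> trig M (%k::int. (2*pi*k) *\<^sub>R d k) t <= 2 * c * gauge_of K z)"
proof -
 have fc: "continuous_on UNIV f" and fp: "!!t. f (t + 1) = f t" using f by (auto simp: brake_loop_def)
 have fcX: "continuous_on X f" for X by (rule continuous_on_subset[OF fc]) simp
 obtain r where r: "0 < r" "cball 0 r \<subseteq> K" using K(3) by (auto simp: mem_interior_cball)
 \<comment> \<open>The sum of both velocities has norm at most 4 * c / r, so a loop error \<delta>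
   costs at most 2 * e in the integral, that is e in \<open>act\<close>.\<close>
 define \<delta> where "\<delta> = e * r / (2 * c)"
 have \<delta>: "0 < \<delta>" using e r c by (simp add: \<delta>_def)
 obtain M0 where M0: "!!M t. M > M0 ==> norm (fejer_mean M f t - f t) <= \<delta>" using fejer_mean_tendsto[OF fc fp \<delta>] by blast
 define M where "M = Suc M0"
 have M: "0 < M" "!!t. norm (fejer_mean M f t - f t) <= \<delta>" using M0[of M] by (auto simp: M_def)
 obtain d where d: "!!t. fejer_mean M f t = trig M d t" using fejer_mean_brake_loop[OF f] by blast
 define \<sigma> where "\<sigma> = trig M d"
 define w where "w = trig M (%k::int. (2*pi*k) *\<^sub>R d k)"
 have \<sigma>': "(\<sigma> has_vector_derivative J0 (w t)) (at t within X)" for t X unfolding \<sigma>_def w_def by (rule trig_has_vector_derivative)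
 have \<sigma>i: "((%s. fejer M s *\<^sub>R f (t - s)) has_integral \<sigma> t) {0..1}" for t
  unfolding \<sigma>_def d[symmetric] fejer_mean_def
  by (intro integrable_integral integrable_continuous_real continuous_intros continuous_on_compose2[OF fc]) auto
 have inc\<sigma>: "omega0 \<zeta> (\<sigma> t' - \<sigma> t) <= 2 * c * (t' - t)" if "t <= t'" "\<zeta> \<in> K" for t t' \<zeta>
 proof (rule has_integral_le)
  show "((%s. omega0 \<zeta> (fejer M s *\<^sub>R f (t' - s) - fejer M s *\<^sub>R f (t - s))) has_integral omega0 \<zeta> (\<sigma> t' - \<sigma> t)) {0..1}"
   using has_integral_linear[OF has_integral_diff[OF \<sigma>i[of t'] \<sigma>i[of t]] omega0_bounded_linear[of \<zeta>]] by (simp add: o_def)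
  show "((%s. (2 * c * (t' - t)) * fejer M s) has_integral 2 * c * (t' - t)) {0..1}"
   using has_integral_mult_right[OF fejer_integral[OF M(1)], of "2 * c * (t' - t)"] by simp
  fix s :: real
  have "omega0 \<zeta> (fejer M s *\<^sub>R f (t' - s) - fejer M s *\<^sub>R f (t - s)) = fejer M s * omega0 \<zeta> (f (t' - s) - f (t - s))"
   by (simp add: omega0_linear right_diff_distrib)
  also have "\<dots> <= fejer M s * (2 * c * (t' - t))"
   using inc[of "t - s" "t' - s" \<zeta>] that by (intro mult_left_mono fejer_nonneg) auto
  finally show "omega0 \<zeta> (fejer M s *\<^sub>R f (t' - s) - fejer M s *\<^sub>R f (t - s)) <= (2 * c * (t' - t)) * fejer M s" by (simp add: mult.commute)
 qed
 have dw: "omega0 \<zeta> (J0 (w t)) <= 2 * c" if \<zeta>: "\<zeta> \<in> K" for \<zeta> t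
 proof -
  have "0 <= 2 * c - omega0 \<zeta> (J0 (w t))"
  proof (rule mono_on_imp_deriv_nonneg[of UNIV "%s. 2 * c * s - omega0 \<zeta> (\<sigma> s)"])
   show "mono_on UNIV (%s. 2 * c * s - omega0 \<zeta> (\<sigma> s))"
   proof (rule mono_onI)
    fix s s' :: real assume "s <= s'"
    from inc\<sigma>[OF this \<zeta>] show "2 * c * s - omega0 \<zeta> (\<sigma> s) <= 2 * c * s' - omega0 \<zeta> (\<sigma> s')"
     by (simp add: omega0_linear algebra_simps)
   qed
   have "((%s. omega0 \<zeta> (\<sigma> s)) has_real_derivative omega0 \<zeta> (J0 (w t))) (at t)"
    using bounded_linear.has_vector_derivative[OF omega0_bounded_linear \<sigma>'[of t UNIV]] by (simp add: has_real_derivative_iff_has_vector_derivative)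
   then show "((%s. 2 * c * s - omega0 \<zeta> (\<sigma> s)) has_real_derivative 2 * c - omega0 \<zeta> (J0 (w t))) (at t)"
    by (auto intro!: derivative_eq_intros)
  qed simp
  then show ?thesis by simp
 qed
 obtain \<kappa> \<beta> where j: "sublinear_gauge (gauge_of K) \<kappa> \<beta>" using gauge_of_body(1)[OF K] by blast
 have loop: "z \<bullet> w t <= 2 * c * gauge_of K z" for z t
 proof -
  have "supp K (w t) <= 2 * c"
   by (rule supp_least) (use r(2) r(1) dw in \<open>auto simp: omega0_J0\<close>)
  then have "gauge_of K z * supp K (w t) <= gauge_of K z * (2 * c)" by (rule mult_left_mono[OF _ sublinear_gauge.nonneg[OF j]])
  then show ?thesis using gauge_of_body(3)[OF K, of z "w t"] by (simp add: mult.commute)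
 qed
 have \<sigma>c: "continuous_on X \<sigma>" for X by (rule continuous_on_vector_derivative[OF \<sigma>'])
 have ends: "f 1 = f 0" "\<sigma> 1 = \<sigma> 0" using fp[of 0] trig_periodic[of M d 0] by (auto simp: \<sigma>_def)
 \<comment> \<open>The mixed terms form an exact derivative and integrate to 0 over the closed
   loops. The difference of the two areas thus becomes the integral of omega0 (\<sigma> - f,
   \<sigma>' + f'), where only the first factor must be small.\<close>
 have parts: "((%t. omega0 (\<sigma> t) (F t) + omega0 (J0 (w t)) (f t)) has_integral omega0 (\<sigma> 1) (f 1) - omega0 (\<sigma> 0) (f 0)) {0..1}"
 proof (rule fundamental_theorem_of_calculus_interior_strong[OF S])
  fix t assume t: "t \<in> {0<..<1} - S"
  have df: "(f has_vector_derivative F t) (at t)" by (rule F) (use t in auto)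
  note d1 = bounded_linear.has_vector_derivative[OF bounded_linear_fst \<sigma>'[of t UNIV]] bounded_linear.has_vector_derivative[OF bounded_linear_snd \<sigma>'[of t UNIV]]
   bounded_linear.has_vector_derivative[OF bounded_linear_fst df] bounded_linear.has_vector_derivative[OF bounded_linear_snd df]
  have "((%t. fst (\<sigma> t) \<bullet> snd (f t) - snd (\<sigma> t) \<bullet> fst (f t)) has_vector_derivative
   (fst (\<sigma> t) \<bullet> snd (F t) + fst (J0 (w t)) \<bullet> snd (f t)) - (snd (\<sigma> t) \<bullet> fst (F t) + snd (J0 (w t)) \<bullet> fst (f t))) (at t)"
   by (intro has_vector_derivative_diff bounded_bilinear.has_vector_derivative[OF bounded_bilinear_inner] d1)
  moreover have "omega0 (\<sigma> t) (F t) + omega0 (J0 (w t)) (f t)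
   = (fst (\<sigma> t) \<bullet> snd (F t) + fst (J0 (w t)) \<bullet> snd (f t)) - (snd (\<sigma> t) \<bullet> fst (F t) + snd (J0 (w t)) \<bullet> fst (f t))"
   by (simp add: omega0_def)
  ultimately show "((%t. omega0 (\<sigma> t) (f t)) has_vector_derivative omega0 (\<sigma> t) (F t) + omega0 (J0 (w t)) (f t)) (at t)"
   unfolding omega0_def[of "\<sigma> _" "f _"] by simp
 next
  show "continuous_on {0..1} (%t. omega0 (\<sigma> t) (f t))" unfolding omega0_def by (intro continuous_intros \<sigma>c fcX)
 qed simp
 have "2 * c - 2 * e - 0 <= 2 * act M d"
 proof (rule has_integral_le_finite[OF _ _ S])
  show "((%t. (2 * c - 2 * e) - (omega0 (\<sigma> t) (F t) + omega0 (J0 (w t)) (f t))) has_integral 2 * c - 2 * e - 0) {0..1}"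
   using has_integral_diff[OF has_integral_unit_const parts] unfolding ends by simp
  show "((%t. omega0 (\<sigma> t) (J0 (w t))) has_integral 2 * act M d) {0..1}" unfolding \<sigma>_def w_def by (rule trig_act)
  fix t
  define a u where "a = \<sigma> t - f t" and "u = J0 (w t) + F t"
  have "r * norm (J0 (w t)) <= 2 * c" "r * norm (F t) <= 2 * c"
   by (rule omega0_bound_norm[OF r dw] omega0_bound_norm[OF r F2]; assumption)+
  moreover have "norm u <= norm (J0 (w t)) + norm (F t)" unfolding u_def by (rule norm_triangle_ineq)
  then have "r * norm u <= r * (norm (J0 (w t)) + norm (F t))" using r(1) by simp
  ultimately have ru: "r * norm u <= 4 * c" by (simp add: distrib_left)
  have na: "norm a <= \<delta>" using M(2)[of t] d by (simp add: a_def \<sigma>_def)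
  have "- omega0 a u = (- J0 u) \<bullet> (- a)" unfolding neg_J0_inner by (simp add: omega0_linear)
  also have "\<dots> <= norm (- J0 u) * norm (- a)" by (rule norm_cauchy_schwarz)
  also have "\<dots> = norm u * norm a" by (simp add: norm_J0)
  also have "\<dots> <= norm u * \<delta>" using na by (intro mult_left_mono) auto
  also have "\<dots> = (r * norm u) * e / (2 * c)" by (simp add: \<delta>_def)
  also have "\<dots> <= (4 * c) * e / (2 * c)" using ru e c by (intro divide_right_mono mult_right_mono) auto
  also have "\<dots> = 2 * e" using c by simp
  finally have "- 2 * e <= omega0 a u" by simp
  moreover have "omega0 (J0 (w t)) (f t) = - omega0 (f t) (J0 (w t))" by (simp add: omega0_def inner_commute)
  moreover have "omega0 a u = omega0 (\<sigma> t) (J0 (w t)) + omega0 (\<sigma> t) (F t) - omega0 (f t) (J0 (w t)) - omega0 (f t) (F t)"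
   by (simp add: a_def u_def omega0_linear)
  ultimately show "(2 * c - 2 * e) - (omega0 (\<sigma> t) (F t) + omega0 (J0 (w t)) (f t)) <= omega0 (\<sigma> t) (J0 (w t))"
   using F1[of t] by linarith
 qed
 then have "c - e <= act M d" by simp
 then show ?thesis using loop unfolding w_def by blast
qed

text \<open>Everything is centred at z1, a fixed point near which H vanishes: the linking sphere
  consists of small loops about the origin and needs this. After the change to adapted symplectic
  coordinates, \<open>brake_orbit_exists\<close> yields an orbit that stays inside the body and is
  carried back.\<close>

lemma admissible_upper_bound:
 fixes \<tau> :: "'n::finite phase \<Rightarrow> 'n phase"
 assumes inv: "lin_antisymp_inv \<tau>" and C: "compact C" "convex C" and CT: "!!\<zeta>. \<zeta> \<in> C ==> \<tau> \<zeta> \<in> C"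
  and z1: "\<tau> z1 = z1" "z1 \<in> V" and V: "open V" "V \<subseteq> interior C" "!!z. z \<in> V ==> H z = 0"
  and c: "0 < c" and \<gamma>: "polygonal_loop \<tau> ((%z. z - z1) ` C) c \<gamma>"
  and H: "admissible_sym \<tau> (interior C) H" and z: "z \<in> interior C"
 shows "H z <= c"
proof (rule ccontr)
 interpret antisymp_involution \<tau> by unfold_locales (rule inv)
 assume "\<not> H z <= c"
 define U where "U = interior C"
 have A: "!!z. z \<in> U ==> H (\<tau> z) = H z" "C_inf U H" "!!z. z \<in> U ==> 0 <= H z" "!!x. \<not> ham_brake_orbit \<tau> U H x 1"
  using H unfolding admissible_sym_def U_def by auto
 obtain m K where m: "!!z. z \<in> U ==> H z <= m" and K: "compact K" "K \<subseteq> U" "!!z. z \<in> U - K ==> H z = m"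
  using H unfolding admissible_sym_def U_def by blast
 have cm: "c < m" using m[of z] z \<open>\<not> H z <= c\<close> by (simp add: U_def)
 have Uop: "open U" by (simp add: U_def)
 obtain \<Psi> \<Phi> :: "'n phase \<Rightarrow> 'n phase" where \<Psi>: "linear \<Psi>" "linear \<Phi>" "!!z. \<Phi> (\<Psi> z) = z" "!!z. \<Psi> (\<Phi> z) = z"
  "!!z w. omega0 (\<Psi> z) (\<Psi> w) = omega0 z w" "!!z. \<tau> (\<Psi> z) = \<Psi> (fst z, - snd z)"
  by (rule symplectic_coordinates) (rule that)
 have bij: "bij \<Phi>" by (metis \<Psi>(3,4) bijI injI surjI)
 have bl: "bounded_linear \<Psi>" "bounded_linear \<Phi>" using \<Psi>(1,2) linear_conv_bounded_linear by blast+
 define C1 where "C1 = (%z. z - z1) ` C"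
 have iC1: "interior C1 = (%z. z - z1) ` U" unfolding C1_def U_def by (rule interior_translation_subtract)
 have z1U: "z1 \<in> U" using z1(2) V(2) by (auto simp: U_def)
 have C1: "compact C1" "convex C1" "0 \<in> interior C1"
  using C z1U unfolding iC1 by (auto simp: C1_def intro: compact_translation_subtract convex_translation_subtract image_eqI[of _ _ z1])
 have TC1: "\<tau> \<zeta> \<in> C1" if \<zeta>: "\<zeta> \<in> C1" for \<zeta>
 proof -
  obtain y where "y \<in> C" "\<zeta> = y - z1" using \<zeta> unfolding C1_def by blast
  then show ?thesis using CT[of y] by (auto simp: C1_def linear_diff[OF lin] z1(1))
 qed
 define C2 where "C2 = \<Phi> ` C1"
 have iC2: "interior C2 = \<Phi> ` interior C1" unfolding C2_def by (rule interior_bijective_linear_image[OF \<Psi>(2) bij])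
 have C2: "compact C2" "convex C2" "0 \<in> interior C2"
 proof -
  show "compact C2" unfolding C2_def by (rule compact_continuous_image[OF linear_continuous_on[OF bl(2)] C1(1)])
  show "convex C2" unfolding C2_def by (rule convex_linear_image[OF \<Psi>(2) C1(2)])
  show "0 \<in> interior C2" unfolding iC2 using C1(3) linear_0[OF \<Psi>(2)] by (metis image_eqI)
 qed
 have memC2: "\<Psi> \<zeta> \<in> C1" if "\<zeta> \<in> C2" for \<zeta> using that \<Psi>(4) by (auto simp: C2_def)
 have U2: "x \<in> interior C2 \<longleftrightarrow> z1 + \<Psi> x \<in> U" for x
 proof
  assume "x \<in> interior C2"
  then obtain u where "u \<in> U" "x = \<Phi> (u - z1)" unfolding iC2 iC1 by blast
  then show "z1 + \<Psi> x \<in> U" by (simp add: \<Psi>(4))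
 next
  assume u: "z1 + \<Psi> x \<in> U"
  have "x = \<Phi> ((z1 + \<Psi> x) - z1)" by (simp add: \<Psi>(3))
  then show "x \<in> interior C2" unfolding iC2 iC1 using u by blast
 qed
 define j where "j = gauge_of C2"
 obtain \<kappa> \<beta> where jg: "sublinear_gauge j \<kappa> \<beta>" unfolding j_def using gauge_of_body(1)[OF C2] by blast
 have jU: "j x < 1 \<longleftrightarrow> z1 + \<Psi> x \<in> U" for x unfolding j_def U2[symmetric] using gauge_of_body(2)[OF C2] by simp
 define \<rho> :: "'n phase \<Rightarrow> 'n phase" where "\<rho> z = (fst z, - snd z)" for z
 have t\<Psi>: "\<tau> (\<Psi> x) = \<Psi> (\<rho> x)" for x using \<Psi>(6) by (simp add: \<rho>_def)
 have jr: "j (\<rho> x) = j x" for x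
  unfolding j_def
 proof (rule gauge_invariant[OF C2])
  show "linear \<rho>" by (rule linearI) (simp_all add: \<rho>_def)
  show "\<rho> (\<rho> x) = x" for x by (simp add: \<rho>_def)
  show "\<rho> ` C2 \<subseteq> C2"
  proof (rule image_subsetI)
   fix x assume xC: "x \<in> C2"
   have "\<Phi> (\<tau> (\<Psi> x)) \<in> C2" unfolding C2_def by (rule imageI) (rule TC1[OF memC2[OF xC]])
   then show "\<rho> x \<in> C2" by (simp add: t\<Psi> \<Psi>(3))
  qed
 qed
 obtain gH L where g: "!!z. ((%z. if z \<in> U then H z else m) has_derivative (%v. v \<bullet> gH z)) (at z)"
  "!!z w. norm (gH z - gH w) <= L * norm (z - w)"
  by (rule plateau_lipschitz[OF Uop K(1,2) A(2) K(3)], assumption, rule that)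
 define Hx where "Hx z = (if z \<in> U then H z else m)" for z
 define H2 where "H2 x = Hx (z1 + \<Psi> x)" for x
 define g2 where "g2 x = adjoint \<Psi> (gH (z1 + \<Psi> x))" for x
 have adj: "v \<bullet> adjoint \<Psi> u = \<Psi> v \<bullet> u" for u v by (rule adjoint_works[OF \<Psi>(1)])
 obtain B1 where B1: "0 < B1" "!!x. norm (\<Psi> x) <= norm x * B1" using bounded_linear.pos_bounded[OF bl(1)] by blast
 have bla: "bounded_linear (adjoint \<Psi>)" using adjoint_linear[OF \<Psi>(1)] linear_conv_bounded_linear by blast
 obtain B2 where B2: "0 < B2" "!!x. norm (adjoint \<Psi> x) <= norm x * B2" using bounded_linear.pos_bounded[OF bla] by blast
 have lip: "lipschitz_hamiltonian H2 g2 (\<bar>L\<bar> * B1 * B2)"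
 proof
  fix x y :: "'n phase"
  have "((%x. z1 + \<Psi> x) has_derivative \<Psi>) (at x)"
   using has_derivative_add[OF has_derivative_const[of z1] linear_imp_has_derivative[OF \<Psi>(1)]] by simp
  from has_derivative_compose[OF this g(1)] show "(H2 has_derivative (%v. v \<bullet> g2 x)) (at x)"
   unfolding H2_def Hx_def g2_def adj .
  have "norm (g2 x - g2 y) = norm (adjoint \<Psi> (gH (z1 + \<Psi> x) - gH (z1 + \<Psi> y)))"
   by (simp add: g2_def linear_diff[OF adjoint_linear[OF \<Psi>(1)]])
  also have "\<dots> <= norm (gH (z1 + \<Psi> x) - gH (z1 + \<Psi> y)) * B2" by (rule B2(2))
  also have "\<dots> <= (\<bar>L\<bar> * (norm (x - y) * B1)) * B2"
  proof (rule mult_right_mono)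
   have "norm (gH (z1 + \<Psi> x) - gH (z1 + \<Psi> y)) <= L * norm (\<Psi> (x - y))"
    using g(2)[of "z1 + \<Psi> x" "z1 + \<Psi> y"] by (simp add: linear_diff[OF \<Psi>(1)])
   also have "\<dots> <= \<bar>L\<bar> * (norm (x - y) * B1)" by (rule mult_mono) (use B1(2)[of "x - y"] in auto)
   finally show "norm (gH (z1 + \<Psi> x) - gH (z1 + \<Psi> y)) <= \<bar>L\<bar> * (norm (x - y) * B1)" .
  qed (use B2 in simp)
  finally show "norm (g2 x - g2 y) <= \<bar>L\<bar> * B1 * B2 * norm (x - y)" by (simp add: ac_simps)
 qed
 have mm: "0 <= m" using A(3)[OF z1U] m[OF z1U] by linarith
 obtain r1 where r1: "0 < r1" "ball z1 r1 \<subseteq> V" using V(1) z1(2) open_contains_ball by blast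
 have H0: "H2 x = 0" if "norm x < r1 / B1" for x
 proof -
  have "norm x * B1 < r1" using that B1(1) by (simp add: field_simps)
  then have "norm (\<Psi> x) < r1" using B1(2)[of x] by linarith
  then have "z1 + \<Psi> x \<in> V" using r1(2) by (auto simp: dist_norm)
  then show ?thesis using V(2,3) by (auto simp: H2_def Hx_def U_def)
 qed
 define r where "r = (SOME r::real. 0 < r \<and> cball 0 r \<subseteq> C1)"
 have r: "0 < r" "cball 0 r \<subseteq> C1"
 proof -
  have "\<exists>r>0. cball 0 r \<subseteq> C1" using C1(3) by (simp add: mem_interior_cball)
  from someI_ex[OF this] show "0 < r" "cball 0 r \<subseteq> C1" unfolding r_def by auto
 qed
 have \<gamma>1: "polygonal_loop \<tau> C1 c \<gamma>" using \<gamma> unfolding C1_def .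
 obtain D where D: "!!X. continuous_on X \<gamma>" "!!t. omega0 (\<gamma> t) (D t) = 2 * c" "!!t \<zeta>. \<zeta> \<in> C1 ==> omega0 \<zeta> (D t) <= 2 * c"
  "!!a b. \<exists>S. finite S \<and> (\<forall>t\<in>{a..b} - S. (\<gamma> has_vector_derivative D t) (at t)) \<and> continuous_on ({a..b} - S) D"
  by (rule polygonal_loop_calculus[OF \<gamma>1 r]) (rule that)
 obtain S where S: "finite S" "!!t. t \<in> {0..1} - S ==> (\<gamma> has_vector_derivative D t) (at t)" using D(4)[of 0 1] by blast
 have om\<Phi>: "omega0 \<zeta> (\<Phi> v) = omega0 (\<Psi> \<zeta>) v" for \<zeta> v using \<Psi>(5)[of \<zeta> "\<Phi> v"] by (simp add: \<Psi>(4))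
 have fl: "brake_loop (%t. \<Phi> (\<gamma> t))"
  unfolding brake_loop_def
 proof (intro conjI allI)
  show "continuous_on UNIV (%t. \<Phi> (\<gamma> t))" by (rule bounded_linear.continuous_on[OF bl(2) D(1)])
  show "\<Phi> (\<gamma> (t + 1)) = \<Phi> (\<gamma> t)" for t using \<gamma> unfolding polygonal_loop_def by simp
  show "\<Phi> (\<gamma> (- t)) = (fst (\<Phi> (\<gamma> t)), - snd (\<Phi> (\<gamma> t)))" for t
  proof -
   have "\<gamma> (- t) = \<tau> (\<gamma> t)" by (rule \<gamma>[unfolded polygonal_loop_def, THEN conjunct2, THEN conjunct1, THEN spec])
   also have "\<dots> = \<Psi> (\<rho> (\<Phi> (\<gamma> t)))" using t\<Psi>[of "\<Phi> (\<gamma> t)"] by (simp add: \<Psi>(4))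
   finally show ?thesis by (simp add: \<Psi>(3) \<rho>_def)
  qed
 qed
 have loop: "\<exists>M d. c - e <= act M d \<and> (\<forall>z t. z \<bullet> trig M (%k::int. (2*pi*k) *\<^sub>R d k) t <= 2 * c * j z)" if e: "0 < e" for e
  unfolding j_def
 proof (rule loop_approximation[OF fl c C2 _ S(1) _ _ _ e, where F = "%t. \<Phi> (D t)"])
  show "omega0 \<zeta> (\<Phi> (\<gamma> t') - \<Phi> (\<gamma> t)) <= 2 * c * (t' - t)" if "t <= t'" "\<zeta> \<in> C2" for t t' \<zeta>
  proof -
   have "omega0 (\<Psi> \<zeta>) (\<gamma> t' - \<gamma> t) <= 2 * c * (t' - t)"
    using \<gamma>1 that memC2[OF that(2)] unfolding polygonal_loop_def by blast
   then show ?thesis by (simp add: linear_diff[OF \<Psi>(2), symmetric] om\<Phi>)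
  qed
  show "((%t. \<Phi> (\<gamma> t)) has_vector_derivative \<Phi> (D t)) (at t)" if "t \<in> {0..1} - S" for t
   by (rule bounded_linear.has_vector_derivative[OF bl(2) S(2)[OF that]])
  show "omega0 (\<Phi> (\<gamma> t)) (\<Phi> (D t)) = 2 * c" for t by (simp add: om\<Phi> \<Psi>(4) D(2))
  show "omega0 \<zeta> (\<Phi> (D t)) <= 2 * c" if "\<zeta> \<in> C2" for t \<zeta> using D(3)[OF memC2[OF that]] by (simp add: om\<Phi>)
 qed
 have "\<exists>x. brake_loop x \<and> (\<forall>t. (x has_vector_derivative J0 (g2 (x t))) (at t)) \<and> (\<forall>t. j (x t) < 1) \<and> (\<exists>s t. x s ~= x t)"
 proof (rule brake_orbit_exists[OF jg jr[unfolded \<rho>_def] lip _ _ _ _ _ H0 c cm loop])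
  show "H2 (fst x, - snd x) = H2 x" for x
  proof -
   have "z1 + \<Psi> (\<rho> x) = \<tau> (z1 + \<Psi> x)" by (simp add: linear_add[OF lin] z1(1) t\<Psi>)
   moreover have "z1 + \<Psi> (\<rho> x) \<in> U \<longleftrightarrow> z1 + \<Psi> x \<in> U" unfolding jU[symmetric] jr ..
   ultimately have "H2 (\<rho> x) = H2 x" using A(1)[of "z1 + \<Psi> x"] by (auto simp: H2_def Hx_def)
   then show ?thesis by (simp add: \<rho>_def)
  qed
  show "H2 x <= m" for x using m by (simp add: H2_def Hx_def)
  show "0 <= H2 x" for x using A(3) mm by (simp add: H2_def Hx_def)
  show "H2 x = m" if "1 <= j x" for x using jU[of x] that by (simp add: H2_def Hx_def)
  show "0 < r1 / B1" using r1(1) B1(1) by simp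
 qed assumption+
 then obtain x where x: "brake_loop x" "!!t. (x has_vector_derivative J0 (g2 (x t))) (at t)" "!!t. j (x t) < 1" "\<exists>s t. x s ~= x t" by blast
 define X where "X t = z1 + \<Psi> (x t)" for t
 have XU: "X t \<in> U" for t using x(3) jU by (simp add: X_def)
 \<comment> \<open>The orbit has period exactly 1, the closed end of the range of periods excluded
   by admissibility.\<close>
 have "ham_brake_orbit \<tau> U H X 1"
  unfolding ham_brake_orbit_def
 proof (intro conjI allI)
  show "X t \<in> U" for t by (rule XU)
  show "\<exists>x'. (X has_vector_derivative x') (at t) \<and> (\<forall>v. omega0 x' v = - frechet_derivative H (at (X t)) v)" for t
  proof (intro exI[of _ "\<Psi> (J0 (g2 (x t)))"] conjI allI)
   show "(X has_vector_derivative \<Psi> (J0 (g2 (x t)))) (at t)"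
    using has_vector_derivative_add[OF has_vector_derivative_const[of z1] bounded_linear.has_vector_derivative[OF bl(1) x(2)[of t]]]
    by (simp add: X_def[abs_def])
   fix v
   have "(H has_derivative (%v. v \<bullet> gH (X t))) (at (X t))"
    by (rule has_derivative_transform_within_open[OF g(1) Uop XU]) simp
   then have "frechet_derivative H (at (X t)) = (%v. v \<bullet> gH (X t))" by (rule frechet_derivative_at[symmetric])
   moreover have "omega0 (\<Psi> (J0 (g2 (x t)))) v = - omega0 v (\<Psi> (J0 (g2 (x t))))" by (simp add: omega0_def inner_commute)
   moreover have "omega0 v (\<Psi> (J0 (g2 (x t)))) = omega0 (\<Phi> v) (J0 (g2 (x t)))" using \<Psi>(5)[of "\<Phi> v" "J0 (g2 (x t))"] by (simp add: \<Psi>(4))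
   moreover have "omega0 (\<Phi> v) (J0 (g2 (x t))) = v \<bullet> gH (X t)" unfolding omega0_J0 g2_def adj by (simp add: \<Psi>(4) X_def)
   ultimately show "omega0 (\<Psi> (J0 (g2 (x t)))) v = - frechet_derivative H (at (X t)) v" by simp
  qed
  have xp: "x (t + 1) = x t" and xr: "x (- t) = \<rho> (x t)" for t using x(1) by (auto simp: brake_loop_def \<rho>_def)
  show "X (t + 1) = X t" for t by (simp add: X_def xp)
  show "\<exists>s t. X s ~= X t" using x(4) \<Psi>(3) unfolding X_def by (metis add_left_cancel)
  show "X (1 - t) = X (- t)" for t using xp[of "- t"] by (simp add: X_def)
  show "X (- t) = \<tau> (X t)" for t by (simp add: X_def xr linear_add[OF lin] z1(1) t\<Psi>)
 qed
 then show False using A(4) by blast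
qed

section \<open>Translations and the conclusion\<close>

lemma C_inf_translate:
 assumes "C_inf U f"
 shows "C_inf {z. z - a \<in> U} (%z. f (z - a))"
proof -
 have "C_inf {z. z - a \<in> U} F" if "\<exists>f. F = (%z. f (z - a)) \<and> C_inf U f" for F
  using that
 proof (coinduction arbitrary: F)
  case C_inf
  then obtain f where F: "F = (%z. f (z - a))" and f: "C_inf U f" by blast
  obtain g where g: "!!x. x \<in> U ==> (f has_derivative (%v. \<Sum>i\<in>Basis. (v \<bullet> i) * g i x)) (at x)" "!!i. i \<in> Basis ==> C_inf U (g i)"
   by (rule C_infD[OF f]) (rule that)
  have d: "\<forall>x\<in>{z. z - a \<in> U}. (F has_derivative (%v. \<Sum>i\<in>Basis. (v \<bullet> i) * g i (x - a))) (at x)"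
  proof
   fix x assume "x \<in> {z. z - a \<in> U}"
   then have x: "x - a \<in> U" by simp
   have "((%z. z - a) has_derivative (%v. v)) (at x)" by (auto intro!: derivative_eq_intros)
   from has_derivative_compose[OF this g(1)[OF x]] show "(F has_derivative (%v. \<Sum>i\<in>Basis. (v \<bullet> i) * g i (x - a))) (at x)"
    unfolding F .
  qed
  have q: "\<exists>F. (%z. g i (z - a)) = F \<and> (\<exists>f. F = (%z. f (z - a)) \<and> C_inf U f)" if "i \<in> Basis" for i
   by (rule exI[of _ "%z. g i (z - a)"], rule conjI[OF refl], rule exI[of _ "g i"], rule conjI[OF refl g(2)[OF that]])
  show ?case
   by (rule exI[of _ F], rule exI[of _ "%i z. g i (z - a)"], intro conjI refl d ballI disjI1 q)
 qed
 then show ?thesis using assms by blast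
qed

text \<open>The Hamiltonian of the lower bound is built on the body recentred at the origin. A fixed
  point a is a translation vector that commutes with \<tau>, so symmetry and brake orbits are
  carried along.\<close>

lemma admissible_translate:
 fixes \<tau> :: "'n::finite phase \<Rightarrow> 'n phase"
 assumes lin: "linear \<tau>" and a: "\<tau> a = a" and H: "admissible_sym \<tau> U H"
 shows "admissible_sym \<tau> {z. z - a \<in> U} (%z. H (z - a))"
proof -
 have ta: "\<tau> (z - a) = \<tau> z - a" for z by (simp add: linear_diff[OF lin] a)
 have A: "!!z. z \<in> U ==> H (\<tau> z) = H z" "C_inf U H" "!!z. z \<in> U ==> 0 <= H z"
  "!!x T. T \<in> {0<..1} ==> \<not> ham_brake_orbit \<tau> U H x T"
  using H unfolding admissible_sym_def by auto
 obtain V where V: "open V" "V ~= {}" "V \<subseteq> U" "V \<inter> Fix \<tau> ~= {}" "\<forall>z\<in>V. H z = 0"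
  using H unfolding admissible_sym_def by blast
 obtain m K where m: "\<forall>z\<in>U. H z <= m" "\<exists>z\<in>U. H z = m" and K: "compact K" "K \<subseteq> U" "\<forall>z\<in>U - K. H z = m"
  using H unfolding admissible_sym_def by blast
 have img: "{z. z - a \<in> X} = (%z. z + a) ` X" for X :: "'n phase set"
  by (force intro: image_eqI[of _ _ "_ - a"])
 show ?thesis
  unfolding admissible_sym_def
 proof (intro conjI ballI allI impI)
  show "H (\<tau> z - a) = H (z - a)" if "z \<in> {z. z - a \<in> U}" for z using A(1)[of "z - a"] that by (simp add: ta)
  show "C_inf {z. z - a \<in> U} (%z. H (z - a))" by (rule C_inf_translate[OF A(2)])
  show "0 <= H (z - a)" if "z \<in> {z. z - a \<in> U}" for z using A(3) that by simp
  show "\<exists>V. open V \<and> V ~= {} \<and> V \<subseteq> {z. z - a \<in> U} \<and> V \<inter> Fix \<tau> ~= {} \<and> (\<forall>z\<in>V. H (z - a) = 0)"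
  proof (intro exI[of _ "(%z. z - a) -` V"] conjI)
   show "open ((%z. z - a) -` V)" by (rule open_vimage[OF V(1)]) (intro continuous_intros)
   obtain u where u: "u \<in> V" "\<tau> u = u" using V(4) by (auto simp: Fix_def)
   then have "u + a \<in> (%z. z - a) -` V" "u + a \<in> Fix \<tau>" by (simp_all add: Fix_def linear_add[OF lin] a)
   then show "(%z. z - a) -` V ~= {}" "(%z. z - a) -` V \<inter> Fix \<tau> ~= {}" by blast+
  qed (use V(3,5) in auto)
  show "\<exists>m. (\<forall>z\<in>{z. z - a \<in> U}. H (z - a) <= m) \<and> (\<exists>z\<in>{z. z - a \<in> U}. H (z - a) = m) \<and>
    (\<exists>K. compact K \<and> K \<subseteq> {z. z - a \<in> U} \<and> (\<forall>z\<in>{z. z - a \<in> U} - K. H (z - a) = m))"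
  proof (intro exI[of _ m] conjI exI[of _ "{z. z - a \<in> K}"])
   obtain u where "u \<in> U" "H u = m" using m(2) by blast
   then show "\<exists>z\<in>{z. z - a \<in> U}. H (z - a) = m" by (intro bexI[of _ "u + a"]) auto
   show "compact {z. z - a \<in> K}" unfolding img by (rule compact_continuous_image[OF _ K(1)]) (intro continuous_intros)
  qed (use m(1) K(2,3) in auto)
  fix x and T :: real assume T: "T \<in> {0<..1}"
  show "\<not> ham_brake_orbit \<tau> {z. z - a \<in> U} (%z. H (z - a)) x T"
  proof
   assume o: "ham_brake_orbit \<tau> {z. z - a \<in> U} (%z. H (z - a)) x T"
   have "ham_brake_orbit \<tau> U H (%t. x t - a) T"
    unfolding ham_brake_orbit_def
   proof (intro conjI allI)
    have xU: "x t - a \<in> U" for t using o unfolding ham_brake_orbit_def by blast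
    show "x t - a \<in> U" for t by (rule xU)
    fix t
    obtain x' where x': "(x has_vector_derivative x') (at t)" "\<forall>v. omega0 x' v = - frechet_derivative (%z. H (z - a)) (at (x t)) v"
     using o unfolding ham_brake_orbit_def by blast
    obtain g where g: "!!x. x \<in> U ==> (H has_derivative (%v. \<Sum>i\<in>Basis. (v \<bullet> i) * g i x)) (at x)"
     by (rule C_infD[OF A(2)]) (rule that)
    have "((%z. z - a) has_derivative (%v. v)) (at (x t))" by (auto intro!: derivative_eq_intros)
    from has_derivative_compose[OF this g[OF xU]]
    have "frechet_derivative (%z. H (z - a)) (at (x t)) = frechet_derivative H (at (x t - a))"
     unfolding frechet_derivative_at[OF g[OF xU], symmetric] by (rule frechet_derivative_at[symmetric])
    moreover have "((%t. x t - a) has_vector_derivative x') (at t)"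
     using has_vector_derivative_diff[OF x'(1) has_vector_derivative_const[of a]] by simp
    ultimately show "\<exists>x'. ((%t. x t - a) has_vector_derivative x') (at t) \<and> (\<forall>v. omega0 x' v = - frechet_derivative H (at (x t - a)) v)"
     using x'(2) by (intro exI[of _ x']) simp
   next
    have o1: "x (t + T) = x t" "x (T - t) = x (- t)" "x (- t) = \<tau> (x t)" for t using o unfolding ham_brake_orbit_def by blast+
    have o2: "\<exists>s t. x s ~= x t" using o unfolding ham_brake_orbit_def by (elim conjE)
    show "x (t + T) - a = x t - a" for t by (simp only: o1(1))
    show "\<exists>s t. x s - a ~= x t - a" using o2 by simp
    show "x (T - t) - a = x (- t) - a" for t by (simp only: o1(2))
    show "x (- t) - a = \<tau> (x t - a)" for t unfolding ta o1(3) ..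
   qed
   then show False using A(4)[OF T] by blast
  qed
 qed
qed

theorem theorem1p32:
  fixes \<tau> :: "'n::finite phase \<Rightarrow> 'n phase"
    and \<Delta> \<Lambda> :: "(real^'n) set"
  assumes "lin_antisymp_inv \<tau>"
    and "smooth_convex_body \<Delta>" and "smooth_convex_body \<Lambda>"
    and "\<tau> ` (\<Delta> \<times> \<Lambda>) = \<Delta> \<times> \<Lambda>"
  shows "\<exists>\<gamma>s Ts. brake_billiard \<tau> \<Delta> \<Lambda> \<gamma>s Ts \<and> action \<gamma>s Ts > 0 \<and>
           c_EHZ_sym \<tau> (\<Delta> \<times> \<Lambda>) = ereal (action \<gamma>s Ts) \<and>
           (\<forall>\<gamma> T. brake_billiard \<tau> \<Delta> \<Lambda> \<gamma> T \<and> action \<gamma> T > 0 \<longrightarrow> action \<gamma>s Ts \<le> action \<gamma> T)"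
proof -
 interpret antisymp_involution \<tau> by unfold_locales (rule assms(1))
 define C where "C = \<Delta> \<times> \<Lambda>"
 have body: "compact \<Delta>" "convex \<Delta>" "interior \<Delta> ~= {}" "compact \<Lambda>" "convex \<Lambda>" "interior \<Lambda> ~= {}"
  using assms(2,3) by (auto simp: smooth_convex_body_def convex_body_def)
 have C: "compact C" "convex C" unfolding C_def using body by (auto intro: compact_Times convex_Times)
 have intC: "interior C = interior \<Delta> \<times> interior \<Lambda>" by (simp add: C_def interior_Times)
 have bij: "bij \<tau>" by (metis invol bijI injI surjI)
 have tC: "\<tau> \<zeta> \<in> C" if "\<zeta> \<in> C" for \<zeta> using assms(4) that unfolding C_def by blast
 have tint: "\<tau> ` interior C = interior C"
  using interior_bijective_linear_image[OF lin bij, of C] assms(4) by (simp add: C_def)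
 obtain b where b: "b \<in> interior C" using body(3,6) intC by auto
 \<comment> \<open>The average of an interior point and its image is fixed by \<tau> and interior by
   convexity; it becomes the origin.\<close>
 define z0 where "z0 = (1/2) *\<^sub>R b + (1/2) *\<^sub>R \<tau> b"
 have "\<tau> b \<in> interior C" using tint b by blast
 then have z0i: "z0 \<in> interior C"
  unfolding z0_def using convexD[OF convex_interior[OF C(2)] b, of "\<tau> b" "1/2" "1/2"] by simp
 have z0t: "\<tau> z0 = z0" by (simp add: z0_def linear_add[OF lin] linear_scale[OF lin] add.commute)
 define \<Delta>0 \<Lambda>0 where "\<Delta>0 = (%q. q - fst z0) ` \<Delta>" and "\<Lambda>0 = (%p. p - snd z0) ` \<Lambda>"
 have z0ii: "fst z0 \<in> interior \<Delta>" "snd z0 \<in> interior \<Lambda>" using z0i unfolding intC mem_Times_iff by blast+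
 note D0 = body_translate[OF assms(2) z0ii(1), folded \<Delta>0_def]
 note L0 = body_translate[OF assms(3) z0ii(2), folded \<Lambda>0_def]
 interpret smooth_pair \<Delta>0 \<Lambda>0 by unfold_locales (use D0 L0 in auto)
 have mem1: "x \<in> (%z. z - u) ` S \<longleftrightarrow> x + u \<in> S" for x u :: "'n phase" and S
 proof
  assume "x + u \<in> S"
  then show "x \<in> (%z. z - u) ` S" by (intro image_eqI[of _ _ "x + u"]) auto
 qed auto
 have mem2: "x \<in> (%z. z - u) ` S \<longleftrightarrow> x + u \<in> S" for x u :: "real^'n" and S
 proof
  assume "x + u \<in> S"
  then show "x \<in> (%z. z - u) ` S" by (intro image_eqI[of _ _ "x + u"]) auto
 qed auto
 have C0: "(%z. z - z0) ` C = \<Delta>0 \<times> \<Lambda>0"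
  unfolding set_eq_iff mem1 by (simp add: \<Delta>0_def \<Lambda>0_def C_def mem_Times_iff mem2)
 have mC0: "x \<in> \<Delta>0 \<times> \<Lambda>0 \<longleftrightarrow> x + z0 \<in> C" for x unfolding C0[symmetric] by (rule mem1)
 have tC0: "\<tau> x \<in> \<Delta>0 \<times> \<Lambda>0" if "x \<in> \<Delta>0 \<times> \<Lambda>0" for x
  using that tC[of "x + z0"] unfolding mC0 by (simp add: linear_add[OF lin] z0t)
 have sym0: "\<tau> ` (\<Delta>0 \<times> \<Lambda>0) = \<Delta>0 \<times> \<Lambda>0"
 proof
  show "\<tau> ` (\<Delta>0 \<times> \<Lambda>0) \<subseteq> \<Delta>0 \<times> \<Lambda>0" using tC0 by blast
  show "\<Delta>0 \<times> \<Lambda>0 \<subseteq> \<tau> ` (\<Delta>0 \<times> \<Lambda>0)"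
  proof
   fix x assume "x \<in> \<Delta>0 \<times> \<Lambda>0"
   then show "x \<in> \<tau> ` (\<Delta>0 \<times> \<Lambda>0)" using tC0[of x] invol[of x] by (metis image_eqI)
  qed
 qed
 have "\<exists>c z m. 0 < c \<and> z 0 \<in> Fix \<tau> \<and> z m \<in> Fix \<tau> \<and> (\<forall>i\<le>m. z i \<in> \<Delta>0 \<times> \<Lambda>0) \<and>
  (\<forall>i<m. \<forall>\<zeta>\<in>\<Delta>0 \<times> \<Lambda>0. omega0 \<zeta> (z (Suc i) - z i) <= omega0 (z i) (z (Suc i) - z i)) \<and>
  (\<Sum>i<m. omega0 (z i) (z (Suc i) - z i)) = c \<and> isoperimetric \<tau> \<Delta>0 \<Lambda>0 c"
 proof (rule staircase_minimizer[OF assms(1) D0(1-3) L0(1-3)], goal_cases)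
  case (1 c z m)
  note A = this
  have "isoperimetric \<tau> \<Delta>0 \<Lambda>0 c"
   unfolding isoperimetric_def
  proof (intro allI impI, goal_cases)
   case (1 h S x p x' p' ka kb)
   show ?case
    by (rule A(7)[where h = h and S = S and x = x and p = p and x' = x' and p' = p' and ka = ka and kb = kb]) (rule 1(1-4) 1(5)[THEN bspec] 1(6)[THEN bspec] 1(7)[THEN bspec] 1(8)[THEN bspec] 1(9-13) | assumption)+
  qed
  then show ?case using A(1-6) by (intro exI[of _ c] exI[of _ z] exI[of _ m]) blast
 qed
 then obtain c z m where c: "0 < c" and zF: "z 0 \<in> Fix \<tau>" "z m \<in> Fix \<tau>" and zC: "!!i. i <= m ==> z i \<in> \<Delta>0 \<times> \<Lambda>0"
  and cone: "!!i \<zeta>. i < m ==> \<zeta> \<in> \<Delta>0 \<times> \<Lambda>0 ==> omega0 \<zeta> (z (Suc i) - z i) <= omega0 (z i) (z (Suc i) - z i)"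
  and tot: "(\<Sum>i<m. omega0 (z i) (z (Suc i) - z i)) = c" and iso: "isoperimetric \<tau> \<Delta>0 \<Lambda>0 c" by blast
 \<comment> \<open>The polygon is available relative to every fixed interior point: the shift a and
   the displacement of the end points lie in the isotropic space \<open>Fix \<tau>\<close>, so the
   total area c does not change. The upper bound uses this at a zero of H, the trajectory at
   z0.\<close>
 have loop: "\<exists>\<gamma>. polygonal_loop \<tau> ((%z. z - z1) ` C) c \<gamma>" if z1: "\<tau> z1 = z1" "z1 \<in> interior C" for z1
 proof -
  define a where "a = z0 - z1"
  have aF: "a \<in> Fix \<tau>" by (simp add: a_def Fix_def linear_diff[OF lin] z0t z1(1))
  have "0 \<in> interior ((%z. z - z1) ` C)"
   unfolding interior_translation_subtract using z1(2) by (auto intro: image_eqI[of _ _ z1])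
  then obtain r where r: "0 < r" "cball 0 r \<subseteq> (%z. z - z1) ` C" by (auto simp: mem_interior_cball)
  show ?thesis
  proof (rule polygonal_loop_exists[where z = "%i. z i + a" and m = m, OF convex_translation_subtract[OF C(2)] r])
   show "\<tau> \<zeta> \<in> (%z. z - z1) ` C" if "\<zeta> \<in> (%z. z - z1) ` C" for \<zeta>
    using that tC[of "\<zeta> + z1"] unfolding mem1 by (simp add: linear_add[OF lin] z1(1))
   show "z 0 + a \<in> Fix \<tau>" "z m + a \<in> Fix \<tau>" using subspace_add[OF Fix_subspace] zF aF by blast+
   show "z i + a \<in> (%z. z - z1) ` C" if "i <= m" for i
    using zC[OF that] unfolding mem1 mC0 by (simp add: a_def)
   show "omega0 \<zeta> (z (Suc i) + a - (z i + a)) <= omega0 (z i + a) (z (Suc i) + a - (z i + a))" if i: "i < m" and "\<zeta> \<in> (%z. z - z1) ` C" for i \<zeta>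
   proof -
    have "\<zeta> - a \<in> \<Delta>0 \<times> \<Lambda>0" using that(2) unfolding mem1 mC0 by (simp add: a_def)
    from cone[OF i this] show ?thesis by (simp add: omega0_linear(1,3))
   qed
   have "(\<Sum>i<m. omega0 a (z (Suc i) - z i)) = omega0 a (z m - z 0)"
    unfolding omega0_sum[symmetric] sum_lessThan_telescope ..
   also have "\<dots> = 0" using Fix_isotropic[OF aF] zF by (simp add: omega0_linear)
   finally show "(\<Sum>i<m. omega0 (z i + a) (z (Suc i) + a - (z i + a))) = c"
    using tot by (simp add: omega0_linear(1) sum.distrib)
  qed (rule c)
 qed
 obtain \<gamma> where \<gamma>: "polygonal_loop \<tau> (\<Delta>0 \<times> \<Lambda>0) c \<gamma>" using loop[OF z0t z0i] unfolding C0 by blast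
 define \<gamma>s where "\<gamma>s t = \<gamma> t + z0" for t
 have "billiard \<Delta> \<Lambda> \<gamma>s 1"
  unfolding billiard_def
 proof (rule bexI[OF _ z0ii(1)], rule bexI[OF _ z0ii(2)])
  have "(%t. \<gamma>s t - (fst z0, snd z0)) = \<gamma>" by (simp add: \<gamma>s_def fun_eq_iff)
  then show "billiard0 ((%q. q - fst z0) ` \<Delta>) ((%p. p - snd z0) ` \<Lambda>) (%t. \<gamma>s t - (fst z0, snd z0)) 1"
   using polygonal_loop_billiard0[OF c \<gamma>] unfolding \<Delta>0_def \<Lambda>0_def by simp
 qed
 moreover have "\<gamma>s (1 - t) = \<tau> (\<gamma>s t)" for t
 proof -
  have "\<gamma> (- t + 1) = \<gamma> (- t)" using \<gamma> unfolding polygonal_loop_def by (elim conjE) (rule spec)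
  then have "\<gamma> (1 - t) = \<gamma> (- t)" by (simp only: uminus_add_conv_diff)
  also have "\<dots> = \<tau> (\<gamma> t)" using \<gamma> unfolding polygonal_loop_def by blast
  finally show ?thesis by (simp add: \<gamma>s_def linear_add[OF lin] z0t)
 qed
 ultimately have br: "brake_billiard \<tau> \<Delta> \<Lambda> \<gamma>s 1" unfolding brake_billiard_def by blast
 have "0 \<in> interior (\<Delta>0 \<times> \<Lambda>0)" using D0(3) L0(3) by (simp add: interior_Times zero_prod_def)
 then obtain r where r: "0 < r" "cball 0 r \<subseteq> \<Delta>0 \<times> \<Lambda>0" by (auto simp: mem_interior_cball)
 have act: "action \<gamma>s 1 = c" using polygonal_loop_action[OF \<gamma> r, of z0] unfolding \<gamma>s_def[abs_def] .
 have min: "c <= action \<gamma>' T" if "brake_billiard \<tau> \<Delta> \<Lambda> \<gamma>' T" "0 < action \<gamma>' T" for \<gamma>' T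
  by (rule billiard_action_ge[OF assms(1-3) z0t iso[unfolded \<Delta>0_def \<Lambda>0_def] that])
 have "c_EHZ_sym \<tau> C <= ereal c"
  unfolding c_EHZ_sym_def c_HZ_sym_def
 proof (rule SUP_least)
  fix H assume "H \<in> {H. admissible_sym \<tau> (interior C) H}"
  then have H: "admissible_sym \<tau> (interior C) H" by simp
  then have "\<exists>V. open V \<and> V ~= {} \<and> V \<subseteq> interior C \<and> V \<inter> Fix \<tau> ~= {} \<and> (\<forall>z\<in>V. H z = 0)"
   unfolding admissible_sym_def by (elim conjE)
  then obtain V where V': "open V" "V \<subseteq> interior C" "V \<inter> Fix \<tau> ~= {}" "\<forall>z\<in>V. H z = 0"
   by (elim exE conjE) (rule that)
  note V = V'(1-3) V'(4)[THEN bspec]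
  obtain z1 where z1: "\<tau> z1 = z1" "z1 \<in> V" using V(3) by (auto simp: Fix_def)
  obtain \<gamma>1 where \<gamma>1: "polygonal_loop \<tau> ((%z. z - z1) ` C) c \<gamma>1" using loop[OF z1(1)] z1(2) V(2) by blast
  have "Sup (H ` interior C) <= c"
  proof (rule cSup_least)
   show "H ` interior C ~= {}" using z0i by blast
   fix y assume "y \<in> H ` interior C"
   then show "y <= c" using admissible_upper_bound[OF assms(1) C tC z1 V(1,2,4) c \<gamma>1 H] by blast
  qed
  then show "ereal (Sup (H ` interior C)) <= ereal c" by simp
 qed
 moreover have "ereal c <= c_EHZ_sym \<tau> C"
 proof (rule tendsto_upperbound)
  have "((%e. c * (1 - e) * (1 - e) * (1 - 4 * e)) \<longlongrightarrow> c * (1 - 0) * (1 - 0) * (1 - 4 * 0)) (at_right (0::real))"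
   by (intro tendsto_intros)
  then show "((%e. ereal (c * (1 - e) * (1 - e) * (1 - 4 * e))) \<longlongrightarrow> ereal c) (at_right 0)" by simp
  have "ereal (c * (1 - e) * (1 - e) * (1 - 4 * e)) <= c_EHZ_sym \<tau> C" if e: "0 < e" "e < 1/4" for e
  proof -
   obtain H where H: "admissible_sym \<tau> (interior (\<Delta>0 \<times> \<Lambda>0)) H"
    "c * (1 - e) * (1 - e) * (1 - 4 * e) <= Sup (H ` interior (\<Delta>0 \<times> \<Lambda>0))"
    using lower_bound_admissible[OF assms(1) D0(1-3) L0(1-3) sym0 iso c e] by blast
   have iC: "interior C = {z. z - z0 \<in> interior (\<Delta>0 \<times> \<Lambda>0)}"
    unfolding C0[symmetric] interior_translation_subtract by (auto simp: mem1)
   have adm: "admissible_sym \<tau> (interior C) (%z. H (z - z0))"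
    unfolding iC by (rule admissible_translate[OF lin z0t H(1)])
   have "(%z. H (z - z0)) ` interior C = H ` interior (\<Delta>0 \<times> \<Lambda>0)"
    unfolding C0[symmetric] interior_translation_subtract by (simp add: image_image)
   then have "ereal (c * (1 - e) * (1 - e) * (1 - 4 * e)) <= ereal (Sup ((%z. H (z - z0)) ` interior C))" using H(2) by simp
   also have "\<dots> <= c_EHZ_sym \<tau> C" unfolding c_EHZ_sym_def c_HZ_sym_def by (rule SUP_upper) (use adm in simp)
   finally show ?thesis .
  qed
  then show "\<forall>\<^sub>F e in at_right 0. ereal (c * (1 - e) * (1 - e) * (1 - 4 * e)) <= c_EHZ_sym \<tau> C"
   unfolding eventually_at_right_field by (intro exI[of _ "1/4"]) auto
  show "at_right (0::real) ~= bot" by (simp add: trivial_limit_at_right_real)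
 qed
 ultimately have "c_EHZ_sym \<tau> C = ereal c" by (rule antisym)
 then have cap: "c_EHZ_sym \<tau> (\<Delta> \<times> \<Lambda>) = ereal (action \<gamma>s 1)" unfolding C_def act .
 show ?thesis
 proof (rule exI[of _ \<gamma>s], rule exI[of _ 1], intro conjI allI impI)
  show "0 < action \<gamma>s 1" unfolding act by (rule c)
  show "action \<gamma>s 1 <= action \<gamma>' T" if "brake_billiard \<tau> \<Delta> \<Lambda> \<gamma>' T \<and> 0 < action \<gamma>' T" for \<gamma>' T
   unfolding act by (rule min[OF that[THEN conjunct1] that[THEN conjunct2]])
 qed (rule br cap)+
qed

end
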